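(* Assume $\alpha'(0)=\alpha''(0)=0$. Let $u_0,\bar u_0\in\check H^2(\Omega)$ and $f\in W^{1,1}(0,T;L^2(\Omega))$ be such that the solution $u$ of the variable-exponent fractional diffusion-wave problem $$\int_0^t k(t-s)\,\partial_s^2u(\boldsymbol x,s)\,ds-\kappa A u(\boldsymbol x,t)=f(\boldsymbol x,t)\ \text{ in }\Omega\times(0,T],\qquad k(t)=\frac{t^{1-\alpha(t)}}{\Gamma(2-\alpha(t))},$$ $$u(\cdot,0)=u_0,\quad \partial_tu(\cdot,0)=\bar u_0,\qquad u=0\text{ on }\partial\Omega\times[0,T],$$ satisfies, for some constant $Q_0$, $\|\partial_t^{n+1}u(t)\|_{\check H^{2m}}\le Q_0t^{\alpha_0-(n+1)}$ for $t\in(0,T]$, $n=1,2$, $m=0,1$. Let $U_h^0=\Lambda_hu_0$ and let $U_h^n\in S_h$, $1\le n\le N$, satisfy, for all $\chi\in S_h$, $$(\delta_tU_h^n,\chi)+\frac1\tau\Big[w_0(U_h^{n-\frac12},\chi)-\sum_{k=1}^{n-1}(w_{k-1}-w_k)(U_h^{n-k-\frac12},\chi)-(w_{n-1}U_h^0,\chi)\Big]+\kappa\big(I_{\bar\alpha}^{n-1/2}(\nabla U_h),\nabla\chi\big)=(\bar F^n,\chi).$$ Then there is a constant $Q>0$, independent of $h$, $\tau$, $N$ and $m$, such that $$\|u(t_m)-U_h^m\|\le Q\big(h^2+\tau^2\big),\qquad 1\le m\le N.$$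
   Context: Standing setting: $T>0$, $\kappa>0$, $1\le d\le 3$; $\Omega\subset\mathbb R^d$ is a simply-connected bounded domain with piecewise smooth boundary with convex corners; $A$ is the Laplacian with zero Dirichlet boundary condition, with eigenpairs $-A\phi_i=\lambda_i\phi_i$; $\check H^s(\Omega):=\{q\in L^2(\Omega):\|q\|_{\check H^s}^2:=\sum_i\lambda_i^s(q,\phi_i)^2<\infty\}$, so $\check H^0=L^2(\Omega)$ and $\check H^2(\Omega)=H^2(\Omega)\cap H_0^1(\Omega)$; $(\cdot,\cdot)$ and $\|\cdot\|$ are the $L^2(\Omega)$ inner product and norm. $\alpha:[0,T]\to(1,2)$ is three times differentiable with $|\alpha'(t)|+|\alpha''(t)|+|\alpha'''(t)|\le L$ for some $L>0$; $\alpha_0:=\alpha(0)$, $\bar\alpha:=\alpha_0-1\in(0,1)$. $\beta_\mu(t):=t^{\mu-1}/\Gamma(\mu)$. The solution $u$ is the unique one in $W^{2,p}(0,T;L^2(\Omega))\cap L^p(0,T;\check H^2(\Omega))$ with $1<p<\frac1{2-\alpha_0}$. Define $$g(t):=\int_0^1\frac{(tz)^{\alpha(0)-\alpha(tz)}}{\Gamma(\alpha(0)-1)\Gamma(2-\alpha(tz))}(1-z)^{\alpha(0)-2}z^{1-\alpha(0)}\,dz,\qquad g(0)=1$$ (so $g$ is the time convolution of $\beta_{\alpha_0-1}$ and $k$), and $$\bar f(t):=\int_0^t\beta_{\bar\alpha}(t-s)f(s)\,ds+g(t)\bar u_0,\qquad \bar F^n:=\frac1\tau\int_{t_{n-1}}^{t_n}\bar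 f(t)\,dt.$$ Time grid: $N$ is a positive integer, $\tau=T/N$, $t_n=n\tau$; $\delta_tv^n=(v^n-v^{n-1})/\tau$ and $v^{n-1/2}=(v^n+v^{n-1})/2$ for $1\le n\le N$. Weights: $w_k=g(t_{k+1})-g(t_k)$ for $k\ge0$. The averaged product-integration rule is $$I_{\bar\alpha}^{n-1/2}(\varphi)=\omega_{n,1}\varphi^1+\sum_{j=2}^n\omega_{n,j}\varphi^{j-1/2},\qquad \omega_{n,j}=\frac1\tau\int_{t_{n-1}}^{t_n}\int_{t_{j-1}}^{\min(t,t_j)}\beta_{\bar\alpha}(t-s)\,ds\,dt,\quad 1\le j\le n,$$ and $I_{\bar\alpha}^{n-1/2}(\nabla U_h)$ means this with $\varphi^j=\nabla U_h^j$. Space discretization: $S_h\subset H_0^1(\Omega)$ is the space of continuous piecewise linear functions with respect to a quasi-uniform partition of $\Omega$ with mesh diameter $h$. The Ritz projection $\Lambda_h:H_0^1(\Omega)\to S_h$ is defined by $(\nabla(\varphi-\Lambda_h\varphi),\nabla\chi)=0$ for all $\chi\in S_h$, and has the approximation property $\|\varphi-\Lambda_h\varphi\|\le Qh^2\|\varphi\|_{H^2}$ and $\|\partial_t(\varphi-\Lambda_h\varphi)\|\le Qh^2\|\partial_t\varphi\|_{H^2}$ for $\varphi$ (respectively $\partial_t\varphi$) in $H^2(\Omega)\cap H_0^1(\Omega)$, with $Q$ independent of $h$. *)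

theory Defs
  imports "HOL-Analysis.Analysis"
begin

section \<open>The Hilbert space of square integrable functions\<close>

text \<open>
  The type \<open>'a L2\<close> is the space of square integrable functions on the whole space \<open>'a\<close>
  modulo equality almost everywhere. It is shown to be a separable Hilbert space, so that the
  Bochner integral of the library applies to functions of time with values in it. For an open set
  \<open>\<Omega>\<close>, the space of square integrable functions on \<open>\<Omega>\<close> is identified below with
  the closed subspace of the elements that vanish outside \<open>\<Omega>\<close>.
\<close>

definition square_integrable :: "('a::euclidean_space \<Rightarrow> real) \<Rightarrow> bool"
  where "square_integrable f \<longleftrightarrow> f \<in> borel_measurable lborel \<and> integrable lborel (\<lambda>x. (f x)\<^sup>2)"

lemma square_integrable_mult:
  assumes "square_integrable f" "square_integrable g"
  shows "integrable lborel (\<lambda>x. f x * g x)"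
proof (rule Bochner_Integration.integrable_bound)
  show "integrable lborel (\<lambda>x. (f x)\<^sup>2 + (g x)\<^sup>2)"
    using assms by (auto simp: square_integrable_def)
  have "\<bar>a * b\<bar> \<le> a\<^sup>2 + b\<^sup>2" for a b :: real
  proof -
    have "2 * (\<bar>a\<bar> * \<bar>b\<bar>) \<le> a\<^sup>2 + b\<^sup>2"
      using sum_squares_bound[of "\<bar>a\<bar>" "\<bar>b\<bar>"] by simp
    moreover have "0 \<le> \<bar>a\<bar> * \<bar>b\<bar>" by simp
    ultimately have "\<bar>a\<bar> * \<bar>b\<bar> \<le> a\<^sup>2 + b\<^sup>2" by linarith
    then show ?thesis by (simp add: abs_mult)
  qed
  then show "AE x in lborel. norm (f x * g x) \<le> norm ((f x)\<^sup>2 + (g x)\<^sup>2)"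
    by (intro AE_I2) (metis abs_ge_self order_trans real_norm_def)
qed (use assms in \<open>auto simp: square_integrable_def\<close>)

lemma square_integrable_0: "square_integrable (\<lambda>_. 0)"
  by (auto simp: square_integrable_def)

lemma square_integrable_add:
  assumes "square_integrable f" "square_integrable g"
  shows "square_integrable (\<lambda>x. f x + g x)"
  using assms square_integrable_mult[OF assms]
  by (auto simp: square_integrable_def power2_sum mult.assoc)

lemma square_integrable_scale: "square_integrable f \<Longrightarrow> square_integrable (\<lambda>x. c * f x)"
  by (auto simp: square_integrable_def power_mult_distrib)

lemma square_integrable_diff:
  assumes "square_integrable f" "square_integrable g"
  shows "square_integrable (\<lambda>x. f x - g x)"
  using square_integrable_add[OF assms(1) square_integrable_scale[OF assms(2), of "-1"]] by simp

quotient_type (overloaded) 'a L2 = "'a::euclidean_space \<Rightarrow> real" / partial: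
  "\<lambda>f g. square_integrable f \<and> square_integrable g \<and> (AE x in lborel. f x = g x)"
  morphisms rep_L2 abs_L2
proof (rule part_equivpI)
  show "\<exists>f::'a \<Rightarrow> real. square_integrable f \<and> square_integrable f \<and> (AE x in lborel. f x = f x)"
    using square_integrable_0 by blast
  show "symp (\<lambda>f g::'a \<Rightarrow> real. square_integrable f \<and> square_integrable g \<and> (AE x in lborel. f x = g x))"
    by (auto simp: symp_def eq_commute)
  show "transp (\<lambda>f g::'a \<Rightarrow> real. square_integrable f \<and> square_integrable g \<and> (AE x in lborel. f x = g x))"
    by (auto simp: transp_def elim: AE_mp)
qed

lemma AE_cong2:
  assumes "AE x in M. f x = f' x" "AE x in M. g x = g' x"
  shows "AE x in M. h (f x) (g x) = h (f' x) (g' x)"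
  using assms by eventually_elim simp

instantiation L2 :: (euclidean_space) real_vector
begin

lift_definition zero_L2 :: "'a L2" is "\<lambda>_. 0"
  by (simp add: square_integrable_0)

lift_definition plus_L2 :: "'a L2 \<Rightarrow> 'a L2 \<Rightarrow> 'a L2" is "\<lambda>f g x. f x + g x"
  by (auto simp: square_integrable_add)

lift_definition minus_L2 :: "'a L2 \<Rightarrow> 'a L2 \<Rightarrow> 'a L2" is "\<lambda>f g x. f x - g x"
  by (auto simp: square_integrable_diff)

lift_definition uminus_L2 :: "'a L2 \<Rightarrow> 'a L2" is "\<lambda>f x. - f x"
  using square_integrable_scale[of _ "-1"] by auto

lift_definition scaleR_L2 :: "real \<Rightarrow> 'a L2 \<Rightarrow> 'a L2" is "\<lambda>c f x. c * f x"
  by (auto simp: square_integrable_scale)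

instance
proof
  fix a b c :: "'a L2" and r s :: real
  show "a + b + c = a + (b + c)"
    by transfer (auto simp: square_integrable_add add.assoc)
  show "a + b = b + a"
    by transfer (auto simp: square_integrable_add add.commute)
  show "0 + a = a"
    by transfer auto
  show "- a + a = 0"
    by transfer (auto simp: square_integrable_0)
  show "a - b = a + - b"
    by transfer (auto simp: square_integrable_diff)
  show "r *\<^sub>R (a + b) = r *\<^sub>R a + r *\<^sub>R b"
    by transfer (auto simp: square_integrable_add square_integrable_scale distrib_left)
  show "(r + s) *\<^sub>R a = r *\<^sub>R a + s *\<^sub>R a"
    by transfer (auto simp: square_integrable_add square_integrable_scale distrib_right)
  show "r *\<^sub>R s *\<^sub>R a = (r * s) *\<^sub>R a"
    by transfer (auto simp: square_integrable_scale mult.assoc)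
  show "1 *\<^sub>R a = a"
    by transfer auto
qed

end

instantiation L2 :: (euclidean_space) real_inner
begin

lift_definition inner_L2 :: "'a L2 \<Rightarrow> 'a L2 \<Rightarrow> real" is "\<lambda>f g. LINT x|lborel. f x * g x"
  by (intro integral_cong_AE AE_cong2[where h="(*)"]) (auto simp: square_integrable_def)

definition norm_L2 :: "'a L2 \<Rightarrow> real" where "norm_L2 v = sqrt (inner v v)"
definition sgn_L2 :: "'a L2 \<Rightarrow> 'a L2" where "sgn_L2 v = v /\<^sub>R norm v"
definition dist_L2 :: "'a L2 \<Rightarrow> 'a L2 \<Rightarrow> real" where "dist_L2 v w = norm (v - w)"
definition uniformity_L2 :: "('a L2 \<times> 'a L2) filter"
  where "uniformity_L2 = (INF e\<in>{0<..}. principal {(x, y). dist x y < e})"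
definition open_L2 :: "'a L2 set \<Rightarrow> bool"
  where "open_L2 U = (\<forall>x\<in>U. \<forall>\<^sub>F (x', y) in uniformity. x' = x \<longrightarrow> y \<in> U)"

instance
proof
  fix a b c :: "'a L2" and r :: real
  show "inner a b = inner b a"
    by transfer (simp add: mult.commute)
  show "inner (a + b) c = inner a c + inner b c"
    by transfer (simp add: distrib_right square_integrable_mult)
  show "inner (r *\<^sub>R a) b = r * inner a b"
    by transfer (simp add: mult.assoc)
  show "0 \<le> inner a a"
    by transfer simp
  show "inner a a = 0 \<longleftrightarrow> a = 0"
  proof (transfer, goal_cases)
    case (1 f)
    then show ?case
      using integral_nonneg_eq_0_iff_AE[OF square_integrable_mult[of f f]]
      by (auto simp: square_integrable_0)
  qed
qed (rule norm_L2_def sgn_L2_def dist_L2_def uniformity_L2_def open_L2_def)+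

end

lemma rep_L2_square_integrable: "square_integrable (rep_L2 v)"
  using Quotient_rep_reflp[OF Quotient_L2] by blast

lemma abs_rep_L2: "abs_L2 (rep_L2 v) = v"
  by (rule Quotient_abs_rep[OF Quotient_L2])

lemma rep_abs_L2: "square_integrable f \<Longrightarrow> AE x in lborel. rep_L2 (abs_L2 f) x = f x"
  using Quotient_rep_abs[OF Quotient_L2, of f] by blast

lemma abs_L2_eq_iff:
  "square_integrable f \<Longrightarrow> square_integrable g \<Longrightarrow> abs_L2 f = abs_L2 g \<longleftrightarrow> (AE x in lborel. f x = g x)"
  using Quotient_rel[OF Quotient_L2, of f g] by blast

lemma L2_eqI: "(AE x in lborel. rep_L2 v x = rep_L2 w x) \<Longrightarrow> v = w"
  by (metis abs_rep_L2 abs_L2_eq_iff rep_L2_square_integrable)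

lemma inner_abs_L2:
  "square_integrable f \<Longrightarrow> square_integrable g \<Longrightarrow> inner (abs_L2 f) (abs_L2 g) = (LINT x|lborel. f x * g x)"
  by (simp add: inner_L2.abs_eq)

lemma inner_L2_rep: "inner v w = (LINT x|lborel. rep_L2 v x * rep_L2 w x)"
  by (metis abs_rep_L2 inner_abs_L2 rep_L2_square_integrable)

lemma norm_abs_L2: "square_integrable f \<Longrightarrow> (norm (abs_L2 f))\<^sup>2 = (LINT x|lborel. (f x)\<^sup>2)"
  using inner_abs_L2[of f f] unfolding power2_norm_eq_inner by (simp add: power2_eq_square)

lemma abs_L2_add: "square_integrable f \<Longrightarrow> square_integrable g \<Longrightarrow> abs_L2 f + abs_L2 g = abs_L2 (\<lambda>x. f x + g x)"
  by (simp add: plus_L2.abs_eq)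

lemma abs_L2_diff: "square_integrable f \<Longrightarrow> square_integrable g \<Longrightarrow> abs_L2 f - abs_L2 g = abs_L2 (\<lambda>x. f x - g x)"
  by (simp add: minus_L2.abs_eq)

lemma abs_L2_scale: "square_integrable f \<Longrightarrow> c *\<^sub>R abs_L2 f = abs_L2 (\<lambda>x. c * f x)"
  by (simp add: scaleR_L2.abs_eq)

lemma norm_le_imp_nn_integral:
  assumes f: "square_integrable f" and n: "norm (abs_L2 f) \<le> c" and c: "0 \<le> c"
  shows "(\<integral>\<^sup>+x. ennreal ((f x)\<^sup>2) \<partial>lborel) \<le> ennreal (c\<^sup>2)"
proof -
  have "(\<integral>\<^sup>+x. ennreal ((f x)\<^sup>2) \<partial>lborel) = ennreal (LINT x|lborel. (f x)\<^sup>2)"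
    using f by (intro nn_integral_eq_integral) (auto simp: square_integrable_def)
  also have "(LINT x|lborel. (f x)\<^sup>2) \<le> c\<^sup>2"
    using norm_abs_L2[OF f] n by (metis norm_ge_zero power_mono)
  finally show ?thesis by (simp add: ennreal_leI)
qed

lemma nn_integral_imp_norm_le:
  fixes f :: "'a::euclidean_space \<Rightarrow> real"
  assumes f[measurable]: "f \<in> borel_measurable lborel"
    and n: "(\<integral>\<^sup>+x. ennreal ((f x)\<^sup>2) \<partial>lborel) \<le> ennreal (c\<^sup>2)" and c: "0 \<le> c"
  shows "square_integrable f" "norm (abs_L2 f) \<le> c"
proof -
  have "(\<integral>\<^sup>+x. ennreal ((f x)\<^sup>2) \<partial>lborel) < \<infinity>"
    using le_less_trans[OF n ennreal_less_top] by simp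
  then have "integrable lborel (\<lambda>x. (f x)\<^sup>2)"
    by (intro integrableI_bounded) simp_all
  then show sq: "square_integrable f" by (simp add: square_integrable_def f)
  have "(\<integral>\<^sup>+x. ennreal ((f x)\<^sup>2) \<partial>lborel) = ennreal (LINT x|lborel. (f x)\<^sup>2)"
    using sq by (intro nn_integral_eq_integral) (auto simp: square_integrable_def)
  then have "(LINT x|lborel. (f x)\<^sup>2) \<le> c\<^sup>2" using n by (simp add: ennreal_le_iff)
  then have "(norm (abs_L2 f))\<^sup>2 \<le> c\<^sup>2"
    by (simp only: norm_abs_L2[OF sq])
  then show "norm (abs_L2 f) \<le> c"
    using c by (rule power2_le_imp_le)
qed

instance L2 :: (euclidean_space) banach
proof
  fix X :: "nat \<Rightarrow> 'a L2"
  assume cau: "Cauchy X"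
  define f where "f n = rep_L2 (X n)" for n
  have f: "square_integrable (f n)" and X: "X n = abs_L2 (f n)" for n
    by (simp_all add: f_def rep_L2_square_integrable abs_rep_L2)
  have [measurable]: "f n \<in> borel_measurable lborel" for n
    using f[of n] by (simp add: square_integrable_def)
  have "\<forall>k. \<exists>M. \<forall>m\<ge>M. \<forall>n\<ge>M. dist (X m) (X n) < (1/4)^k"
    using cau by (auto simp: Cauchy_def)
  then obtain M where M: "\<And>k m n. m \<ge> M k \<Longrightarrow> n \<ge> M k \<Longrightarrow> dist (X m) (X n) < (1/4)^k"
    by metis
  define r where "r k = (\<Sum>i\<le>k. M i)" for k
  have rM: "M k \<le> r j" if "k \<le> j" for k j
    unfolding r_def using that by (intro member_le_sum) auto
  define A where "A k = {x\<in>space lborel. (1/4)^k \<le> (f (r (Suc k)) x - f (r k) x)\<^sup>2}" for k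
  have A[measurable]: "A k \<in> sets lborel" for k
    unfolding A_def by (intro borel_measurable_le borel_measurable_const borel_measurable_power borel_measurable_diff) simp_all
  have em: "emeasure lborel (A k) \<le> ennreal ((1/4)^k)" for k
  proof -
    let ?d = "\<lambda>x. f (r (Suc k)) x - f (r k) x"
    have sq: "square_integrable ?d" by (rule square_integrable_diff[OF f f])
    have "norm (abs_L2 ?d) \<le> (1/4)^k"
      using M[OF rM[of k "Suc k"] rM[of k k]] by (simp add: X dist_norm abs_L2_diff f)
    then have "(LINT x|lborel. (?d x)\<^sup>2) \<le> ((1/4)^k)\<^sup>2"
      using norm_abs_L2[OF sq] by (metis norm_ge_zero power_mono)
    then have "1 / (1/4)^k * (LINT x|lborel. (?d x)\<^sup>2) \<le> (1/4)^k"
      by (simp add: power2_eq_square field_simps)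
    moreover have "emeasure lborel (A k) \<le> ennreal (1 / (1/4)^k * (LINT x|lborel. (?d x)\<^sup>2))"
      unfolding A_def
      using sq by (intro integral_Markov_inequality) (auto simp: square_integrable_def)
    ultimately show ?thesis by (meson ennreal_leI order_trans)
  qed
  have AE: "AE x in lborel. eventually (\<lambda>k. x \<in> space lborel - A k) sequentially"
  proof (rule borel_cantelli_AE1)
    show "emeasure lborel (A k) < \<infinity>" for k
      using em[of k] by (simp add: le_less_trans)
    show "summable (\<lambda>k. measure lborel (A k))"
    proof (rule summable_comparison_test')
      show "summable (\<lambda>k. (1/4::real)^k)" by (simp add: summable_geometric)
      show "norm (measure lborel (A k)) \<le> (1/4)^k" for k
        using em[of k] by (simp add: measure_def enn2real_leI)
    qed
  qed (rule A)
  define F where "F x = lim (\<lambda>k. f (r k) x)" for x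
  have Fm[measurable]: "F \<in> borel_measurable lborel"
    unfolding F_def by (rule borel_measurable_lim_metric) simp
  have lim: "AE x in lborel. (\<lambda>k. f (r k) x) \<longlonglongrightarrow> F x"
    using AE
  proof eventually_elim
    case (elim x)
    have "summable (\<lambda>k. f (r (Suc k)) x - f (r k) x)"
    proof (rule summable_comparison_test_ev)
      show "summable (\<lambda>k. (1/2::real)^k)" by (simp add: summable_geometric)
      show "\<forall>\<^sub>F k in sequentially. norm (f (r (Suc k)) x - f (r k) x) \<le> (1/2)^k"
        using elim
      proof eventually_elim
        case (elim k)
        then have "(f (r (Suc k)) x - f (r k) x)\<^sup>2 \<le> (1/4)^k" by (auto simp: A_def)
        also have "(1/4::real)^k = ((1/2)^k)\<^sup>2"
          by (simp add: power2_eq_square flip: power_mult_distrib)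
        finally show ?case by (simp add: abs_le_square_iff[symmetric])
      qed
    qed
    then have "convergent (\<lambda>n. \<Sum>k<n. f (r (Suc k)) x - f (r k) x)"
      by (simp add: summable_iff_convergent)
    then have "convergent (\<lambda>n. (f (r n) x - f (r 0) x) + f (r 0) x)"
      unfolding sum_lessThan_telescope[of "\<lambda>k. f (r k) x"] by (intro convergent_add convergent_const)
    then show ?case by (simp add: F_def convergent_LIMSEQ_iff)
  qed
  have key: "square_integrable (\<lambda>x. F x - f n x) \<and> norm (abs_L2 (\<lambda>x. F x - f n x)) \<le> (1/4)^K"
    if n: "n \<ge> M K" for n K
  proof -
    have "(\<integral>\<^sup>+x. ennreal ((F x - f n x)\<^sup>2) \<partial>lborel)
        = (\<integral>\<^sup>+x. liminf (\<lambda>k. ennreal ((f (r k) x - f n x)\<^sup>2)) \<partial>lborel)"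
    proof (rule nn_integral_cong_AE)
      show "AE x in lborel. ennreal ((F x - f n x)\<^sup>2) = liminf (\<lambda>k. ennreal ((f (r k) x - f n x)\<^sup>2))"
        using lim
      proof eventually_elim
        case (elim x)
        then have "(\<lambda>k. ennreal ((f (r k) x - f n x)\<^sup>2)) \<longlonglongrightarrow> ennreal ((F x - f n x)\<^sup>2)"
          by (intro tendsto_intros)
        then show ?case by (rule sym[OF lim_imp_Liminf[OF sequentially_bot]])
      qed
    qed
    also have "\<dots> \<le> liminf (\<lambda>k. \<integral>\<^sup>+x. ennreal ((f (r k) x - f n x)\<^sup>2) \<partial>lborel)"
      by (rule nn_integral_liminf) simp
    also have "\<dots> \<le> ennreal (((1/4)^K)\<^sup>2)"
    proof (rule Liminf_le)
      show "\<forall>\<^sub>F k in sequentially. (\<integral>\<^sup>+x. ennreal ((f (r k) x - f n x)\<^sup>2) \<partial>lborel) \<le> ennreal (((1/4)^K)\<^sup>2)"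
        using eventually_ge_at_top[of K]
      proof eventually_elim
        case (elim k)
        have "norm (abs_L2 (\<lambda>x. f (r k) x - f n x)) \<le> (1/4)^K"
          using M[OF rM[OF elim] n] by (simp add: X dist_norm abs_L2_diff f)
        then show ?case
          by (intro norm_le_imp_nn_integral square_integrable_diff f) auto
      qed
    qed simp
    finally show ?thesis
      by (intro conjI nn_integral_imp_norm_le[of _ "(1/4)^K"]) auto
  qed
  have "square_integrable (\<lambda>x. (F x - f (M 0) x) + f (M 0) x)"
    using key[of 0 "M 0"] by (intro square_integrable_add f) auto
  then have F: "square_integrable F" by simp
  have "X \<longlonglongrightarrow> abs_L2 F"
  proof (rule metric_LIMSEQ_I)
    fix e :: real assume "0 < e"
    then obtain K where K: "(1/4)^K < e"
      using real_arch_pow_inv[of e "1/4"] by auto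
    show "\<exists>no. \<forall>n\<ge>no. dist (X n) (abs_L2 F) < e"
    proof (intro exI allI impI)
      fix n assume "n \<ge> M K"
      from key[OF this] have "norm (abs_L2 F - X n) \<le> (1/4)^K"
        by (simp add: X abs_L2_diff f F)
      then show "dist (X n) (abs_L2 F) < e" using K by (simp add: dist_norm norm_minus_commute)
    qed
  qed
  then show "convergent X" by (auto simp: convergent_def)
qed

lemma square_integrable_indicator:
  "A \<in> sets lborel \<Longrightarrow> emeasure lborel A < \<infinity> \<Longrightarrow> square_integrable (indicat_real A)"
  by (auto simp: square_integrable_def power2_eq_square simp flip: indicator_inter_arith)

lemma norm_indicator_L2_diff:
  assumes A: "A \<in> sets lborel" and U: "U \<in> sets lborel" "emeasure lborel U < \<infinity>" and sub: "A \<subseteq> U"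
  shows "(norm (abs_L2 (indicat_real A) - abs_L2 (indicat_real U)))\<^sup>2 = measure lborel (U - A)"
proof -
  have finA: "emeasure lborel A < \<infinity>"
    using emeasure_mono[OF sub U(1)] U(2) by (rule le_less_trans)
  have sq: "square_integrable (\<lambda>x. indicat_real A x - indicat_real U x)"
    by (intro square_integrable_diff square_integrable_indicator A U finA)
  have "(norm (abs_L2 (indicat_real A) - abs_L2 (indicat_real U)))\<^sup>2
      = (LINT x|lborel. (indicat_real A x - indicat_real U x)\<^sup>2)"
    by (simp add: abs_L2_diff[OF square_integrable_indicator[OF A finA] square_integrable_indicator[OF U]]
        norm_abs_L2[OF sq])
  also have "\<dots> = (LINT x|lborel. indicat_real (U - A) x)"
    using sub by (intro Bochner_Integration.integral_cong) (auto simp: indicator_def)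
  finally show ?thesis by simp
qed

lemma ex_countable_dense_L2: "\<exists>D :: 'a::euclidean_space L2 set. countable D \<and> closure D = UNIV"
proof -
  obtain B :: "'a set set" where B: "countable B" "topological_basis B"
    using ex_countable_basis by auto
  define R where "R = {X\<in>insert {} B. emeasure lborel X < \<infinity>}"
  define \<F> where "\<F> = {F. finite F \<and> F \<subseteq> R}"
  have cR: "countable R"
    using B by (auto simp: R_def intro: countable_subset[of _ "insert {} B"])
  have openR: "open X" if "X \<in> R" for X
    using that B by (auto simp: R_def topological_basis_open)
  define ind where "ind A = abs_L2 (indicat_real A)" for A :: "'a set"
  define D where "D = (\<lambda>xs. \<Sum>(q, F)\<leftarrow>xs. q *\<^sub>R ind (\<Union>F)) ` lists (\<rat> \<times> \<F>)"
  define C where "C = closure D"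
  have cD: "countable D"
    unfolding D_def \<F>_def
    by (intro countable_image countable_lists countable_SIGMA countable_rat countable_Collect_finite_subset cR)
  have clC: "closed C" by (simp add: C_def)
  have D_add: "x + y \<in> D" if xy: "x \<in> D" "y \<in> D" for x y
  proof -
    obtain xs ys where "xs \<in> lists (\<rat> \<times> \<F>)" "ys \<in> lists (\<rat> \<times> \<F>)"
      "x = (\<Sum>(q, F)\<leftarrow>xs. q *\<^sub>R ind (\<Union>F))" "y = (\<Sum>(q, F)\<leftarrow>ys. q *\<^sub>R ind (\<Union>F))"
      using xy unfolding D_def by (elim imageE) blast
    then show ?thesis
      unfolding D_def by (intro image_eqI[of _ _ "xs @ ys"]) auto
  qed
  have C_add: "x + y \<in> C" if xy: "x \<in> C" "y \<in> C" for x y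
  proof -
    obtain X Y where "\<And>n. X n \<in> D" "X \<longlonglongrightarrow> x" "\<And>n. Y n \<in> D" "Y \<longlonglongrightarrow> y"
      using xy unfolding C_def closure_sequential by blast
    then show ?thesis
      unfolding C_def closure_sequential
      by (intro exI[of _ "\<lambda>n. X n + Y n"]) (auto intro: D_add tendsto_add)
  qed
  have "(\<Sum>(q, F)\<leftarrow>[]. q *\<^sub>R ind (\<Union>F)) \<in> D"
    unfolding D_def by (rule imageI) simp
  then have C_0: "0 \<in> C" unfolding C_def by (auto intro: closure_subset[THEN subsetD])
  have C_sum: "(\<Sum>i\<in>I. f i) \<in> C" if "\<And>i. i \<in> I \<Longrightarrow> f i \<in> C" for I :: "real set" and f
    using that by (induction I rule: infinite_finite_induct) (auto intro: C_add C_0)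
  have step1: "c *\<^sub>R ind (\<Union>F) \<in> C" if F: "F \<in> \<F>" for c F
  proof -
    have "q *\<^sub>R ind (\<Union>F) \<in> D" if "q \<in> \<rat>" for q
      unfolding D_def using that F by (intro image_eqI[of _ _ "[(q, F)]"]) auto
    then have "(\<lambda>q. q *\<^sub>R ind (\<Union>F)) ` \<rat> \<subseteq> C"
      unfolding C_def using closure_subset by blast
    then have "(\<lambda>q. q *\<^sub>R ind (\<Union>F)) ` closure \<rat> \<subseteq> C"
      by (intro image_closure_subset continuous_intros clC)
    then show ?thesis by (auto simp: Rats_closure_real)
  qed
  have lim: "c *\<^sub>R y \<in> C" if "X \<longlonglongrightarrow> y" "\<And>n. c *\<^sub>R X n \<in> C" for X :: "nat \<Rightarrow> 'a L2" and y c
    using clC that(2) tendsto_scaleR[OF tendsto_const that(1)] by (rule closed_sequentially)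
  have step2: "c *\<^sub>R ind U \<in> C" if U: "open U" and fin: "emeasure lborel U < \<infinity>" for c U
  proof -
    obtain B' where B': "B' \<subseteq> B" "\<Union>B' = U"
      using B(2) U unfolding topological_basis_def by blast
    define E where "E = insert {} B'"
    have E: "countable E" "E \<noteq> {}" "\<Union>E = U"
      using B' B(1) by (auto simp: E_def intro: countable_subset)
    have ER: "E \<subseteq> R"
    proof
      fix X assume X: "X \<in> E"
      then have "emeasure lborel X \<le> emeasure lborel U"
        using E(3) U by (intro emeasure_mono) auto
      then show "X \<in> R" using X B' fin by (auto simp: R_def E_def intro: le_less_trans)
    qed
    define V where "V n = \<Union>(from_nat_into E ` {..<n})" for n :: nat
    have F: "from_nat_into E ` {..<n} \<in> \<F>" for n
      using ER from_nat_into[OF E(2)] by (auto simp: \<F>_def)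
    have V[measurable]: "V n \<in> sets lborel" for n
      using ER from_nat_into[OF E(2)] openR by (auto simp: V_def intro!: borel_open open_UN)
    have "(\<Union>n. V n) = \<Union>(range (from_nat_into E))"
      by (auto simp: V_def)
    then have UV: "(\<Union>n. V n) = U"
      using E by simp
    have "(\<lambda>n. measure lborel (V n)) \<longlonglongrightarrow> measure lborel (\<Union>n. V n)"
    proof (rule Lim_measure_incseq)
      show "incseq V" unfolding incseq_def V_def by (meson Union_mono image_mono lessThan_subset_iff)
      show "emeasure lborel (\<Union>n. V n) \<noteq> \<infinity>" unfolding UV using fin by auto
    qed (use V in blast)
    then have lm: "(\<lambda>n. measure lborel U - measure lborel (V n)) \<longlonglongrightarrow> 0"
      unfolding UV using tendsto_diff[OF tendsto_const[of "measure lborel U"]] by fastforce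
    have nrm: "(norm (ind (V n) - ind U))\<^sup>2 = measure lborel U - measure lborel (V n)" for n
    proof -
      have sub: "V n \<subseteq> U" using UV by blast
      have "(norm (ind (V n) - ind U))\<^sup>2 = measure lborel (U - V n)"
        unfolding ind_def using V U fin sub by (intro norm_indicator_L2_diff) auto
      also have "\<dots> = measure lborel U - measure lborel (V n)"
        using V[of n] U fin sub by (intro measure_Diff) auto
      finally show ?thesis .
    qed
    have "(\<lambda>n. sqrt ((norm (ind (V n) - ind U))\<^sup>2)) \<longlonglongrightarrow> sqrt 0"
      unfolding nrm by (intro tendsto_real_sqrt lm)
    then have "(\<lambda>n. ind (V n)) \<longlonglongrightarrow> ind U"
      by (simp add: tendsto_norm_zero_iff LIM_zero_iff)
    then show ?thesis
      by (rule lim) (simp add: V_def step1[OF F])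
  qed
  have step3: "c *\<^sub>R ind A \<in> C" if A: "A \<in> sets borel" and fin: "emeasure lborel A < \<infinity>" for c A
  proof -
    have "\<exists>U. open U \<and> A \<subseteq> U \<and> emeasure lborel (U - A) < ennreal (1 / real (Suc n))" for n
      using outer_regular_lborel[OF A, of "1 / real (Suc n)"] by auto
    then obtain U where U: "\<And>n. open (U n)" "\<And>n. A \<subseteq> U n"
        "\<And>n. emeasure lborel (U n - A) < ennreal (1 / real (Suc n))"
      by metis
    have finU: "emeasure lborel (U n) < \<infinity>" for n
    proof -
      have "U n = A \<union> (U n - A)" using U(2) by blast
      then have "emeasure lborel (U n) \<le> emeasure lborel A + emeasure lborel (U n - A)"
        using emeasure_subadditive[of A lborel "U n - A"] A U(1)[of n] by auto
      also have "\<dots> < \<infinity>"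
        using fin U(3)[of n] by (auto simp: less_top intro: less_trans)
      finally show ?thesis .
    qed
    have nrm: "(norm (ind (U n) - ind A))\<^sup>2 \<le> 1 / real (Suc n)" for n
    proof -
      have "(norm (ind (U n) - ind A))\<^sup>2 = measure lborel (U n - A)"
        unfolding ind_def
        using norm_indicator_L2_diff[of A "U n"] A U(1)[of n] U(2)[of n] finU[of n]
        by (simp add: norm_minus_commute)
      also have "\<dots> \<le> 1 / real (Suc n)"
        unfolding measure_def using U(3)[of n] by (intro enn2real_leI) auto
      finally show ?thesis .
    qed
    have "(\<lambda>n. (norm (ind (U n) - ind A))\<^sup>2) \<longlonglongrightarrow> 0"
      by (rule tendsto_sandwich[OF _ _ tendsto_const LIMSEQ_inverse_real_of_nat])
        (use nrm in \<open>auto simp: inverse_eq_divide\<close>)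
    then have "(\<lambda>n. sqrt ((norm (ind (U n) - ind A))\<^sup>2)) \<longlonglongrightarrow> sqrt 0"
      by (rule tendsto_real_sqrt)
    then have "(\<lambda>n. ind (U n)) \<longlonglongrightarrow> ind A"
      by (simp add: tendsto_norm_zero_iff LIM_zero_iff)
    then show ?thesis
      by (rule lim) (rule step2[OF U(1) finU])
  qed
  have step4: "abs_L2 s \<in> C" if s: "simple_function lborel s" and sq: "square_integrable s" for s :: "'a \<Rightarrow> real"
  proof -
    let ?A = "\<lambda>y. s -` {y}"
    have mA[measurable]: "?A y \<in> sets borel" for y
      using s simple_functionD(2)[OF s, of "{y}"] by simp
    have finA: "emeasure lborel (?A y) < \<infinity>" if "y \<noteq> 0" for y
    proof -
      have "emeasure lborel {x\<in>space lborel. y\<^sup>2 \<le> (s x)\<^sup>2} \<le> ennreal (1 / y\<^sup>2 * (LINT x|lborel. (s x)\<^sup>2))"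
        using sq that by (intro integral_Markov_inequality) (auto simp: square_integrable_def)
      moreover have "emeasure lborel (?A y) \<le> emeasure lborel {x\<in>space lborel. y\<^sup>2 \<le> (s x)\<^sup>2}"
        using borel_measurable_simple_function[OF s]
        by (intro emeasure_mono borel_measurable_le borel_measurable_const borel_measurable_power) auto
      ultimately have "emeasure lborel (?A y) \<le> ennreal (1 / y\<^sup>2 * (LINT x|lborel. (s x)\<^sup>2))"
        by (rule order_trans[rotated])
      then show ?thesis by (rule le_less_trans) simp
    qed
    define I where "I = range s - {0}"
    have finI: "finite I" using s by (simp add: I_def simple_function_def)
    define g where "g y = indicat_real (?A y)" for y
    have g: "square_integrable (g y)" "ind (?A y) = abs_L2 (g y)" if "y \<in> I" for y
      using finA[of y] that mA by (auto simp: I_def g_def ind_def intro: square_integrable_indicator)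
    have sum: "square_integrable (\<lambda>x. \<Sum>y\<in>J. y * g y x) \<and>
        (\<Sum>y\<in>J. y *\<^sub>R ind (?A y)) = abs_L2 (\<lambda>x. \<Sum>y\<in>J. y * g y x)" if "finite J" "J \<subseteq> I" for J
      using that
    proof (induction J)
      case empty
      then show ?case by (simp add: square_integrable_0 zero_L2_def)
    next
      case (insert y J)
      then show ?case
        by (simp add: g abs_L2_scale abs_L2_add square_integrable_add square_integrable_scale)
    qed
    have "s x = (\<Sum>y\<in>I. y * indicat_real (?A y) x)" for x
    proof -
      have "(\<Sum>y\<in>I. y * indicat_real (?A y) x) = (\<Sum>y\<in>I. if y = s x then s x else 0)"
        by (intro sum.cong) (auto simp: indicator_def)
      then show ?thesis using finI by (auto simp: I_def)
    qed
    then have "s = (\<lambda>x. \<Sum>y\<in>I. y * g y x)" unfolding g_def by blast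
    then have "abs_L2 s = (\<Sum>y\<in>I. y *\<^sub>R ind (?A y))"
      using sum[OF finI order_refl] by metis
    also have "\<dots> \<in> C"
      by (intro C_sum step3 mA finA) (auto simp: I_def)
    finally show ?thesis .
  qed
  have "v \<in> C" for v
  proof -
    define f where "f = rep_L2 v"
    have f: "square_integrable f" "abs_L2 f = v"
      by (auto simp: f_def rep_L2_square_integrable abs_rep_L2)
    have fm[measurable]: "f \<in> borel_measurable lborel" and fi: "integrable lborel (\<lambda>x. (f x)\<^sup>2)"
      using f(1) by (auto simp: square_integrable_def)
    obtain s where s: "\<And>i. simple_function lborel (s i)" "\<And>x. (\<lambda>i. s i x) \<longlonglongrightarrow> f x"
        "\<And>i x. dist (s i x) 0 \<le> 2 * dist (f x) 0"
      using borel_measurable_implies_sequence_metric[OF fm, of 0] by auto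
    have sm[measurable]: "s i \<in> borel_measurable lborel" for i
      using s(1) by (rule borel_measurable_simple_function)
    have bd: "\<bar>s i x\<bar> \<le> 2 * \<bar>f x\<bar>" for i x using s(3)[of i x] by simp
    have sq: "square_integrable (s i)" for i
    proof -
      have "integrable lborel (\<lambda>x. (s i x)\<^sup>2)"
      proof (rule Bochner_Integration.integrable_bound)
        show "integrable lborel (\<lambda>x. 4 * (f x)\<^sup>2)" using fi by simp
        have "(s i x)\<^sup>2 \<le> 4 * (f x)\<^sup>2" for x
          using power_mono[OF bd[of i x], of 2] by (simp add: power_mult_distrib)
        then show "AE x in lborel. norm ((s i x)\<^sup>2) \<le> norm (4 * (f x)\<^sup>2)" by simp
      qed simp
      then show ?thesis by (simp add: square_integrable_def)
    qed
    have "(\<lambda>i. LINT x|lborel. (s i x - f x)\<^sup>2) \<longlonglongrightarrow> (LINT x|(lborel :: 'a measure). (0::real))"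
    proof (rule integral_dominated_convergence[where w = "\<lambda>x. 9 * (f x)\<^sup>2"])
      show "integrable lborel (\<lambda>x. 9 * (f x)\<^sup>2)" using fi by simp
      show "AE x in lborel. (\<lambda>i. (s i x - f x)\<^sup>2) \<longlonglongrightarrow> 0"
      proof (rule AE_I2)
        fix x
        have "(\<lambda>i. (s i x - f x)\<^sup>2) \<longlonglongrightarrow> (f x - f x)\<^sup>2"
          by (intro tendsto_intros s(2))
        then show "(\<lambda>i. (s i x - f x)\<^sup>2) \<longlonglongrightarrow> 0" by simp
      qed
      show "AE x in lborel. norm ((s i x - f x)\<^sup>2) \<le> 9 * (f x)\<^sup>2" for i
      proof (rule AE_I2)
        fix x
        have "\<bar>s i x - f x\<bar> \<le> 3 * \<bar>f x\<bar>" using bd[of i x] by linarith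
        from power_mono[OF this, of 2] show "norm ((s i x - f x)\<^sup>2) \<le> 9 * (f x)\<^sup>2"
          by (simp add: power_mult_distrib)
      qed
    qed auto
    moreover have "(norm (abs_L2 (s i) - v))\<^sup>2 = (LINT x|lborel. (s i x - f x)\<^sup>2)" for i
      using norm_abs_L2[OF square_integrable_diff[OF sq f(1)]] abs_L2_diff[OF sq f(1)] f(2) by metis
    ultimately have "(\<lambda>i. (norm (abs_L2 (s i) - v))\<^sup>2) \<longlonglongrightarrow> 0" by simp
    then have "(\<lambda>i. sqrt ((norm (abs_L2 (s i) - v))\<^sup>2)) \<longlonglongrightarrow> sqrt 0"
      by (rule tendsto_real_sqrt)
    then have "(\<lambda>i. abs_L2 (s i)) \<longlonglongrightarrow> v"
      by (simp add: tendsto_norm_zero_iff LIM_zero_iff)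
    with clC step4[OF s(1) sq] show ?thesis by (rule closed_sequentially)
  qed
  then show ?thesis using cD by (auto simp: C_def)
qed

instance L2 :: (euclidean_space) second_countable_topology
proof
  obtain D :: "'a L2 set" where D: "countable D" "closure D = UNIV"
    using ex_countable_dense_L2 by auto
  define B where "B = (\<lambda>(x, q). ball x q) ` (D \<times> \<rat>)"
  have "countable B"
    unfolding B_def by (intro countable_image countable_SIGMA D countable_rat)
  moreover have "topological_basis B"
  proof (rule topological_basisI)
    show "open U" if "U \<in> B" for U using that by (auto simp: B_def)
    fix U :: "'a L2 set" and x assume "open U" "x \<in> U"
    then obtain e where e: "0 < e" "ball x e \<subseteq> U" by (auto elim: openE)
    obtain q where q: "q \<in> \<rat>" "0 < q" "q < e / 2" using Rats_dense_in_real[of 0 "e/2"] e by auto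
    obtain d where d: "d \<in> D" "dist d x < q"
      using D(2) q(2) closure_approachable[of x D] by auto
    have "ball d q \<subseteq> U"
    proof -
      have "ball d q \<subseteq> ball x e"
      proof
        fix y assume "y \<in> ball d q"
        then have "dist x y < q + q" using d(2) dist_triangle[of x y d] by (auto simp: dist_commute)
        then show "y \<in> ball x e" using q(3) by simp
      qed
      then show ?thesis using e(2) by blast
    qed
    then show "\<exists>V\<in>B. x \<in> V \<and> V \<subseteq> U"
      using d q by (intro bexI[of _ "ball d q"]) (auto simp: B_def)
  qed
  ultimately show "\<exists>B::'a L2 set set. countable B \<and> open = generate_topology B"
    by (blast intro: topological_basis_imp_subbasis)
qed

lemma square_integrable_compact_support:
  assumes "continuous_on UNIV f" "compact K" "\<And>x. x \<notin> K \<Longrightarrow> f x = 0"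
  shows "square_integrable f"
proof -
  have "integrable lborel (\<lambda>x. indicator K x *\<^sub>R (f x)\<^sup>2)"
    using assms(1,2) by (intro borel_integrable_compact continuous_intros) (auto intro: continuous_on_subset)
  also have "(\<lambda>x. indicator K x *\<^sub>R (f x)\<^sup>2) = (\<lambda>x. (f x)\<^sup>2)"
  proof
    show "indicator K x *\<^sub>R (f x)\<^sup>2 = (f x)\<^sup>2" for x
      using assms(3)[of x] by (cases "x \<in> K") auto
  qed
  finally show ?thesis
    using borel_measurable_continuous_onI[OF assms(1)] by (simp add: square_integrable_def)
qed


section \<open>Sobolev spaces on an open set\<close>

primrec Ck_on :: "nat \<Rightarrow> 'a::euclidean_space set \<Rightarrow> ('a \<Rightarrow> real) \<Rightarrow> bool" where
  "Ck_on 0 S f \<longleftrightarrow> continuous_on S f"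
| "Ck_on (Suc k) S f \<longleftrightarrow> (\<forall>x\<in>S. f differentiable at x) \<and>
     (\<forall>b\<in>Basis. Ck_on k S (\<lambda>x. frechet_derivative f (at x) b))"

definition smooth_on :: "'a::euclidean_space set \<Rightarrow> ('a \<Rightarrow> real) \<Rightarrow> bool"
  where "smooth_on S f \<longleftrightarrow> (\<forall>k. Ck_on k S f)"

definition test_functions :: "'a::euclidean_space set \<Rightarrow> ('a \<Rightarrow> real) set"
  where "test_functions \<Omega> = {\<psi>. smooth_on UNIV \<psi> \<and>
    compact (closure {x. \<psi> x \<noteq> 0}) \<and> closure {x. \<psi> x \<noteq> 0} \<subseteq> \<Omega>}"

lemma test_functions_square_integrable: "\<psi> \<in> test_functions \<Omega> \<Longrightarrow> square_integrable \<psi>"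
proof (rule square_integrable_compact_support[where K = "closure {x. \<psi> x \<noteq> 0}"])
  assume \<psi>: "\<psi> \<in> test_functions \<Omega>"
  then show "compact (closure {x. \<psi> x \<noteq> 0})" by (simp add: test_functions_def)
  show "\<psi> x = 0" if "x \<notin> closure {x. \<psi> x \<noteq> 0}" for x
    using that closure_subset[of "{x. \<psi> x \<noteq> 0}"] by blast
  from \<psi> have "Ck_on 0 UNIV \<psi>" by (auto simp: test_functions_def smooth_on_def)
  then show "continuous_on UNIV \<psi>" by simp
qed

definition L2_on :: "'a::euclidean_space set \<Rightarrow> 'a L2 set"
  where "L2_on \<Omega> = {v. AE x in lborel. x \<notin> \<Omega> \<longrightarrow> rep_L2 v x = 0}"

definition has_weak_deriv :: "'a::euclidean_space set \<Rightarrow> 'a \<Rightarrow> 'a L2 \<Rightarrow> 'a L2 \<Rightarrow> bool"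
  where "has_weak_deriv \<Omega> b v w \<longleftrightarrow> v \<in> L2_on \<Omega> \<and> w \<in> L2_on \<Omega> \<and>
    (\<forall>\<psi>\<in>test_functions \<Omega>.
      (LINT x|lborel. rep_L2 v x * frechet_derivative \<psi> (at x) b) = - (LINT x|lborel. rep_L2 w x * \<psi> x))"

text \<open>The weak derivative is unique, so the choice below is determined whenever one exists.\<close>

definition weak_deriv :: "'a::euclidean_space set \<Rightarrow> 'a \<Rightarrow> 'a L2 \<Rightarrow> 'a L2"
  where "weak_deriv \<Omega> b v = (SOME w. has_weak_deriv \<Omega> b v w)"

definition H1 :: "'a::euclidean_space set \<Rightarrow> 'a L2 set"
  where "H1 \<Omega> = {v \<in> L2_on \<Omega>. \<forall>b\<in>Basis. \<exists>w. has_weak_deriv \<Omega> b v w}"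

definition norm_H1 :: "'a::euclidean_space set \<Rightarrow> 'a L2 \<Rightarrow> real"
  where "norm_H1 \<Omega> v = sqrt ((norm v)\<^sup>2 + (\<Sum>b\<in>Basis. (norm (weak_deriv \<Omega> b v))\<^sup>2))"

definition H10 :: "'a::euclidean_space set \<Rightarrow> 'a L2 set"
  where "H10 \<Omega> = {v \<in> H1 \<Omega>. \<forall>\<epsilon>>0. \<exists>\<psi>\<in>test_functions \<Omega>. norm_H1 \<Omega> (v - abs_L2 \<psi>) < \<epsilon>}"

definition H2 :: "'a::euclidean_space set \<Rightarrow> 'a L2 set"
  where "H2 \<Omega> = {v \<in> H1 \<Omega>. \<forall>b\<in>Basis. weak_deriv \<Omega> b v \<in> H1 \<Omega>}"

definition norm_H2 :: "'a::euclidean_space set \<Rightarrow> 'a L2 \<Rightarrow> real"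
  where "norm_H2 \<Omega> v = sqrt ((norm v)\<^sup>2 + (\<Sum>b\<in>Basis. (norm (weak_deriv \<Omega> b v))\<^sup>2)
    + (\<Sum>b\<in>Basis. \<Sum>c\<in>Basis. (norm (weak_deriv \<Omega> c (weak_deriv \<Omega> b v)))\<^sup>2))"

definition grad_inner :: "'a::euclidean_space set \<Rightarrow> 'a L2 \<Rightarrow> 'a L2 \<Rightarrow> real"
  where "grad_inner \<Omega> v w = (\<Sum>b\<in>Basis. inner (weak_deriv \<Omega> b v) (weak_deriv \<Omega> b w))"

definition laplacian :: "'a::euclidean_space set \<Rightarrow> 'a L2 \<Rightarrow> 'a L2"
  where "laplacian \<Omega> v = (\<Sum>b\<in>Basis. weak_deriv \<Omega> b (weak_deriv \<Omega> b v))"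


section \<open>The spatial domain and the Dirichlet Laplacian\<close>

text \<open>
  Near each boundary point the domain is the intersection of finitely many smooth regions
  \<open>{y. \<psi> y > 0}\<close> whose boundaries pass through the point, and some direction \<open>e\<close> points
  strictly into all of them. One region gives a smooth boundary point; several of them give an
  edge or a corner, which is convex because the regions are intersected, and which is not a cusp
  because of \<open>e\<close>.
\<close>

definition piecewise_smooth_convex_corners :: "'a::euclidean_space set \<Rightarrow> bool"
  where "piecewise_smooth_convex_corners \<Omega> \<longleftrightarrow>
    (\<forall>x\<in>frontier \<Omega>. \<exists>V \<Psi> e. open V \<and> x \<in> V \<and> finite \<Psi> \<and>
      (\<forall>\<psi>\<in>\<Psi>. smooth_on V \<psi> \<and> \<psi> x = 0 \<and> frechet_derivative \<psi> (at x) e > 0) \<and>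
      \<Omega> \<inter> V = {y \<in> V. \<forall>\<psi>\<in>\<Psi>. \<psi> y > 0})"

definition admissible_domain :: "'a::euclidean_space set \<Rightarrow> bool"
  where "admissible_domain \<Omega> \<longleftrightarrow> open \<Omega> \<and> connected \<Omega> \<and> \<Omega> \<noteq> {} \<and> bounded \<Omega> \<and>
    simply_connected \<Omega> \<and> piecewise_smooth_convex_corners \<Omega>"

definition dirichlet_eigensystem :: "'a::euclidean_space set \<Rightarrow> (nat \<Rightarrow> real) \<Rightarrow> (nat \<Rightarrow> 'a L2) \<Rightarrow> bool"
  where "dirichlet_eigensystem \<Omega> lam \<phi> \<longleftrightarrow>
    (\<forall>i. 0 < lam i) \<and> mono lam \<and>
    (\<forall>i. \<phi> i \<in> H2 \<Omega> \<inter> H10 \<Omega> \<and> - laplacian \<Omega> (\<phi> i) = lam i *\<^sub>R \<phi> i) \<and>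
    (\<forall>i j. inner (\<phi> i) (\<phi> j) = (if i = j then 1 else 0)) \<and>
    (\<forall>v\<in>L2_on \<Omega>. (\<forall>i. inner v (\<phi> i) = 0) \<longrightarrow> v = 0)"

definition H_check :: "'a::euclidean_space set \<Rightarrow> (nat \<Rightarrow> real) \<Rightarrow> (nat \<Rightarrow> 'a L2) \<Rightarrow> real \<Rightarrow> 'a L2 set"
  where "H_check \<Omega> lam \<phi> s = {q \<in> L2_on \<Omega>. summable (\<lambda>i. lam i powr s * (inner q (\<phi> i))\<^sup>2)}"

definition norm_H_check :: "(nat \<Rightarrow> real) \<Rightarrow> (nat \<Rightarrow> 'a::euclidean_space L2) \<Rightarrow> real \<Rightarrow> 'a L2 \<Rightarrow> real"
  where "norm_H_check lam \<phi> s q = sqrt (\<Sum>i. lam i powr s * (inner q (\<phi> i))\<^sup>2)"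


section \<open>Functions of time\<close>

definition Lp_time :: "'b::{banach, second_countable_topology} set \<Rightarrow> real \<Rightarrow> real \<Rightarrow> (real \<Rightarrow> 'b) \<Rightarrow> bool"
  where "Lp_time X p T v \<longleftrightarrow> (AE t in lborel. t \<in> {0<..<T} \<longrightarrow> v t \<in> X) \<and>
    set_borel_measurable lborel {0<..<T} v \<and>
    set_integrable lborel {0<..<T} (\<lambda>t. norm (v t) powr p)"

definition has_weak_time_deriv ::
    "real \<Rightarrow> (real \<Rightarrow> 'b::{banach, second_countable_topology}) \<Rightarrow> (real \<Rightarrow> 'b) \<Rightarrow> bool"
  where "has_weak_time_deriv T v w \<longleftrightarrow>
    (\<forall>a b. 0 < a \<and> b < T \<longrightarrow> set_integrable lborel {a..b} v \<and> set_integrable lborel {a..b} w) \<and>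
    (\<forall>\<eta>\<in>test_functions {0<..<T}.
      (LBINT t:{0<..<T}. deriv \<eta> t *\<^sub>R v t) = - (LBINT t:{0<..<T}. \<eta> t *\<^sub>R w t))"

definition W11_time :: "'b::{banach, second_countable_topology} set \<Rightarrow> real \<Rightarrow> (real \<Rightarrow> 'b) \<Rightarrow> bool"
  where "W11_time X T v \<longleftrightarrow>
    (\<exists>w. Lp_time X 1 T v \<and> Lp_time X 1 T w \<and> has_weak_time_deriv T v w)"


section \<open>The variable-exponent diffusion-wave problem\<close>

definition beta_kernel :: "real \<Rightarrow> real \<Rightarrow> real"
  where "beta_kernel \<mu> t = t powr (\<mu> - 1) / Gamma \<mu>"

definition k_kernel :: "(real \<Rightarrow> real) \<Rightarrow> real \<Rightarrow> real"
  where "k_kernel \<alpha> t = t powr (1 - \<alpha> t) / Gamma (2 - \<alpha> t)"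

definition g_kernel :: "(real \<Rightarrow> real) \<Rightarrow> real \<Rightarrow> real"
  where "g_kernel \<alpha> t = (if t = 0 then 1 else
    (LBINT z:{0<..<1}. (t * z) powr (\<alpha> 0 - \<alpha> (t * z)) / (Gamma (\<alpha> 0 - 1) * Gamma (2 - \<alpha> (t * z)))
      * (1 - z) powr (\<alpha> 0 - 2) * z powr (1 - \<alpha> 0)))"

text \<open>
  The solution enters through \<open>du 0\<close>, \<open>du 1\<close>, \<open>du 2\<close>: the function itself and its first two weak
  time derivatives, the first two in their continuous representatives, which is what gives the
  initial conditions a meaning. The space \<open>H_check\<close> of order two is contained in \<open>H10\<close>,
  which is the boundary condition.
\<close>

definition diffusion_wave_solution ::
    "'a::euclidean_space set \<Rightarrow> (nat \<Rightarrow> real) \<Rightarrow> (nat \<Rightarrow> 'a L2) \<Rightarrow> real \<Rightarrow> real \<Rightarrow> (real \<Rightarrow> real) \<Rightarrow> real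
      \<Rightarrow> (real \<Rightarrow> 'a L2) \<Rightarrow> 'a L2 \<Rightarrow> 'a L2 \<Rightarrow> (nat \<Rightarrow> real \<Rightarrow> 'a L2) \<Rightarrow> bool"
  where "diffusion_wave_solution \<Omega> lam \<phi> T \<kappa> \<alpha> p f u0 ub0 du \<longleftrightarrow>
    continuous_on {0..T} (du 0) \<and> continuous_on {0..T} (du 1) \<and>
    (\<forall>i\<le>2. Lp_time (L2_on \<Omega>) p T (du i)) \<and>
    has_weak_time_deriv T (du 0) (du 1) \<and> has_weak_time_deriv T (du 1) (du 2) \<and>
    (AE t in lborel. t \<in> {0<..<T} \<longrightarrow> du 0 t \<in> H_check \<Omega> lam \<phi> 2) \<and>
    set_integrable lborel {0<..<T} (\<lambda>t. norm_H_check lam \<phi> 2 (du 0 t) powr p) \<and>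
    (AE t in lborel. t \<in> {0<..T} \<longrightarrow>
      (LBINT s:{0..t}. k_kernel \<alpha> (t - s) *\<^sub>R du 2 s) - \<kappa> *\<^sub>R laplacian \<Omega> (du 0 t) = f t) \<and>
    du 0 0 = u0 \<and> du 1 0 = ub0"

definition f_bar :: "(real \<Rightarrow> real) \<Rightarrow> (real \<Rightarrow> 'a::euclidean_space L2) \<Rightarrow> 'a L2 \<Rightarrow> real \<Rightarrow> 'a L2"
  where "f_bar \<alpha> f ub0 t =
    (LBINT s:{0..t}. beta_kernel (\<alpha> 0 - 1) (t - s) *\<^sub>R f s) + g_kernel \<alpha> t *\<^sub>R ub0"


section \<open>Finite elements\<close>

definition mesh_size :: "'a::euclidean_space set set \<Rightarrow> real"
  where "mesh_size \<T> = Max (diameter ` \<T>)"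

text \<open>
  Straight simplices cover a domain with curved boundary only approximately. For such a domain the
  triangulated region is inscribed, with its boundary vertices on the boundary of the domain and
  the uncovered part within one mesh size of that boundary. A triangulation of the closure of the
  domain is the special case where nothing is left uncovered.
\<close>

definition partition_of :: "'a::euclidean_space set \<Rightarrow> 'a set set \<Rightarrow> bool"
  where "partition_of \<Omega> \<T> \<longleftrightarrow> triangulation \<T> \<and> \<T> \<noteq> {} \<and> (\<forall>K\<in>\<T>. int DIM('a) simplex K) \<and>
    \<Union>\<T> \<subseteq> closure \<Omega> \<and>
    (\<forall>K\<in>\<T>. \<forall>v. v extreme_point_of K \<and> v \<in> frontier (\<Union>\<T>) \<longrightarrow> v \<in> frontier \<Omega>) \<and>
    (\<forall>x\<in>\<Omega> - \<Union>\<T>. infdist x (frontier \<Omega>) \<le> mesh_size \<T>)"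

text \<open>
  Every simplex contains a ball whose radius is comparable to the largest diameter in the mesh:
  the simplices are shape regular and of comparable size.
\<close>

definition quasi_uniform :: "real \<Rightarrow> 'a::euclidean_space set set \<Rightarrow> bool"
  where "quasi_uniform \<sigma> \<T> \<longleftrightarrow> (\<forall>K\<in>\<T>. \<exists>x. cball x (\<sigma> * mesh_size \<T>) \<subseteq> K)"

definition fe_space :: "'a::euclidean_space set \<Rightarrow> 'a set set \<Rightarrow> 'a L2 set"
  where "fe_space \<Omega> \<T> = {v \<in> H10 \<Omega>. \<exists>\<eta>. continuous_on UNIV \<eta> \<and> (\<forall>x. x \<notin> \<Union>\<T> \<longrightarrow> \<eta> x = 0) \<and>
    (\<forall>K\<in>\<T>. \<exists>a c. \<forall>x\<in>K. \<eta> x = inner a x + c) \<and> v = abs_L2 \<eta>}"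

definition ritz_projection :: "'a::euclidean_space set \<Rightarrow> 'a L2 set \<Rightarrow> ('a L2 \<Rightarrow> 'a L2) \<Rightarrow> bool"
  where "ritz_projection \<Omega> S R \<longleftrightarrow>
    (\<forall>v\<in>H10 \<Omega>. R v \<in> S \<and> (\<forall>\<eta>\<in>S. grad_inner \<Omega> (v - R v) \<eta> = 0))"


section \<open>The fully discrete scheme\<close>

definition bdiff :: "real \<Rightarrow> (nat \<Rightarrow> 'b::real_vector) \<Rightarrow> nat \<Rightarrow> 'b"
  where "bdiff \<tau> v n = (1 / \<tau>) *\<^sub>R (v n - v (n - 1))"

definition midval :: "(nat \<Rightarrow> 'b::real_vector) \<Rightarrow> nat \<Rightarrow> 'b"
  where "midval v n = (1 / 2) *\<^sub>R (v n + v (n - 1))"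

definition F_bar ::
    "(real \<Rightarrow> real) \<Rightarrow> (real \<Rightarrow> 'a::euclidean_space L2) \<Rightarrow> 'a L2 \<Rightarrow> real \<Rightarrow> nat \<Rightarrow> 'a L2"
  where "F_bar \<alpha> f ub0 \<tau> n =
    (1 / \<tau>) *\<^sub>R (LBINT t:{real (n - 1) * \<tau>..real n * \<tau>}. f_bar \<alpha> f ub0 t)"

definition w_weight :: "(real \<Rightarrow> real) \<Rightarrow> real \<Rightarrow> nat \<Rightarrow> real"
  where "w_weight \<alpha> \<tau> k = g_kernel \<alpha> (real (k + 1) * \<tau>) - g_kernel \<alpha> (real k * \<tau>)"

definition omega_weight :: "real \<Rightarrow> real \<Rightarrow> nat \<Rightarrow> nat \<Rightarrow> real"
  where "omega_weight \<mu> \<tau> n j = 1 / \<tau> *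
    (LBINT t:{real (n - 1) * \<tau>..real n * \<tau>}.
      LBINT s:{real (j - 1) * \<tau>..min t (real j * \<tau>)}. beta_kernel \<mu> (t - s))"

definition avg_rule :: "real \<Rightarrow> real \<Rightarrow> nat \<Rightarrow> (nat \<Rightarrow> 'b::real_vector) \<Rightarrow> 'b"
  where "avg_rule \<mu> \<tau> n v =
    omega_weight \<mu> \<tau> n 1 *\<^sub>R v 1 + (\<Sum>j=2..n. omega_weight \<mu> \<tau> n j *\<^sub>R midval v j)"

definition fully_discrete_solution ::
    "'a::euclidean_space set \<Rightarrow> 'a L2 set \<Rightarrow> real \<Rightarrow> (real \<Rightarrow> real) \<Rightarrow> (real \<Rightarrow> 'a L2) \<Rightarrow> 'a L2 \<Rightarrow> 'a L2
      \<Rightarrow> real \<Rightarrow> nat \<Rightarrow> (nat \<Rightarrow> 'a L2) \<Rightarrow> bool"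
  where "fully_discrete_solution \<Omega> S \<kappa> \<alpha> f u0h ub0 \<tau> N U \<longleftrightarrow> U 0 = u0h \<and>
    (\<forall>n\<in>{1..N}. U n \<in> S \<and>
      (\<forall>\<eta>\<in>S. inner (bdiff \<tau> U n) \<eta>
        + 1 / \<tau> * (w_weight \<alpha> \<tau> 0 * inner (midval U n) \<eta>
            - (\<Sum>k=1..n-1. (w_weight \<alpha> \<tau> (k - 1) - w_weight \<alpha> \<tau> k) * inner (midval U (n - k)) \<eta>)
            - w_weight \<alpha> \<tau> (n - 1) * inner (U 0) \<eta>)
        + \<kappa> * (\<Sum>b\<in>Basis. inner (avg_rule (\<alpha> 0 - 1) \<tau> n (\<lambda>j. weak_deriv \<Omega> b (U j))) (weak_deriv \<Omega> b \<eta>))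
        = inner (F_bar \<alpha> f ub0 \<tau> n) \<eta>))"

end

theory Submission
  imports Defs
begin

text \<open>
  Convolving the equation with \<open>beta_kernel (\<alpha> 0 - 1)\<close> turns the memory term into \<open>g * \<partial>\<^sub>t\<^sup>2 u\<close>, and a
  further integration in time gives, with \<open>B = beta_kernel (\<alpha> 0)\<close>,
  \<open>u - g u\<^sub>0 + g' * u - \<kappa> B * laplacian u = \<integral> f_bar\<close>. Because \<open>\<alpha>\<close> is flat at \<open>0\<close>, the function \<open>g\<close> is
  twice continuously differentiable. The scheme is the increment of this identity over one step, with
  \<open>u\<close> and \<open>laplacian u\<close> replaced by step functions of averages; so the error of the Ritz projection
  satisfies the scheme with a residual made of projection errors and of increments of
  \<open>g' * e\<close> and \<open>B * e\<close>, where \<open>e\<close> is the interpolation error. The primitive of \<open>e\<close> is a sawtooth up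
  to \<open>O(\<tau>\<^sup>2)\<close> variation, because \<open>\<partial>\<^sub>t\<^sup>2 u\<close> is integrable; hence the residuals sum up to \<open>O(h\<^sup>2 + \<tau>\<^sup>2)\<close>.

  The quadrature weights are second differences of \<open>t powr (\<alpha> 0)\<close>, the covariances of fractional
  Gaussian noise, so they define a positive semidefinite form. The energy method, with an exponential
  weight absorbing the history term with kernel \<open>g'\<close>, then bounds the error by the sum of the residuals.
\<close>

section \<open>Convolution\<close>

text \<open>The obstacle is the singularity at \<open>t = 0\<close>: the second time derivative is
  only bounded by \<open>t powr (\<alpha> 0 - 2)\<close>, integrable but unbounded, so no pointwise
  second order estimate of the interpolation error is available near \<open>0\<close>. Everything is
  therefore measured in total variation over the grid, with the primitive \<open>\<Phi>\<close> of
  that bound as the only modulus. The integration in time has three effects: the averaged load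
  \<open>F_bar\<close> is reproduced without error; the kernels become \<open>g1\<close> and
  \<open>beta_kernel (\<alpha> 0)\<close>, themselves primitives vanishing at \<open>0\<close>, so
  one integration can be moved from the kernel onto the error; and each re-associated convolution
  has a bounded scalar factor, so identities hold at every grid point and not just almost
  everywhere. The first cell, where an end point value may replace the average, costs only
  \<open>O(\<tau>\<^sup>2)\<close>: an error of size \<open>O(\<tau>)\<close> on a cell of length
  \<tau>. The Laplacian is moved through time integrals by truncating it to finitely many
  eigenfunctions.\<close>

definition conv :: "(real \<Rightarrow> real) \<Rightarrow> (real \<Rightarrow> 'b::{banach, second_countable_topology}) \<Rightarrow> real \<Rightarrow> 'b"
  where "conv a b t = (LBINT s:{0..t}. a (t - s) *\<^sub>R b s)"

lemma set_integrable_real_borel: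
  fixes f :: "real \<Rightarrow> 'b::{banach, second_countable_topology}"
  assumes "set_integrable lborel A f"
  shows "(\<lambda>x. indicator A x *\<^sub>R f x) \<in> borel_measurable borel"
  using assms unfolding set_integrable_def by (simp add: borel_measurable_integrable)

lemma integral_reflect_shift:
  fixes f :: "real \<Rightarrow> 'b::{banach, second_countable_topology}"
  shows "(LBINT s. f (t - s)) = (LBINT s. f s)"
  using lborel_integral_real_affine[of "-1" f t] by simp

lemma integral_shift:
  fixes f :: "real \<Rightarrow> 'b::{banach, second_countable_topology}"
  shows "(LBINT s. f (s - t)) = (LBINT s. f s)"
  using lborel_integral_real_affine[of 1 f "-t"] by simp

lemma integrable_reflect_shift:
  fixes f :: "real \<Rightarrow> 'b::{banach, second_countable_topology}"
  shows "integrable lborel (\<lambda>s. f (t - s)) \<longleftrightarrow> integrable lborel f"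
  using lborel_integrable_real_affine_iff[of "-1" f t] by simp

lemma integrable_shift:
  fixes f :: "real \<Rightarrow> 'b::{banach, second_countable_topology}"
  shows "integrable lborel (\<lambda>s. f (s - t)) \<longleftrightarrow> integrable lborel f"
  using lborel_integrable_real_affine_iff[of 1 f "-t"] by simp

text \<open>The factors are only known to be measurable on an interval. Cutting both off outside
  \<open>[0, t]\<close> gives functions on the whole line, and the same pair serves every
  \<open>s \<le> t\<close>, so Fubini and translation invariance apply.\<close>

lemma conv_eq_truncated:
  assumes "s \<le> t"
  shows "conv b c s = (LBINT r. (indicator {0..t} (s - r) * b (s - r)) *\<^sub>R (indicator {0..t} r *\<^sub>R c r))"
  unfolding conv_def set_lebesgue_integral_def
  by (intro Bochner_Integration.integral_cong) (use assms in \<open>auto simp: indicator_def\<close>)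

text \<open>Fubini. A bound on one of the two scalar kernels makes the integral of
  \<open>a' (t - s) * b' (s - r)\<close> over \<open>s\<close> finite for every \<open>r\<close>,
  uniformly; so the identity holds at the given \<open>t\<close> and not just for almost every
  \<open>t\<close>.\<close>

lemma conv_assoc:
  fixes a b :: "real \<Rightarrow> real" and c :: "real \<Rightarrow> 'b::{banach, second_countable_topology}"
  assumes a: "set_integrable lborel {0..t} a" and b: "set_integrable lborel {0..t} b"
    and c: "set_integrable lborel {0..t} c"
    and bd: "(\<forall>s\<in>{0..t}. \<bar>a s\<bar> \<le> M) \<or> (\<forall>s\<in>{0..t}. \<bar>b s\<bar> \<le> M)"
  shows "conv a (conv b c) t = conv (conv a b) c t"
proof -
  define a' where "a' = (\<lambda>x. indicator {0..t} x * a x)"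
  define b' where "b' = (\<lambda>x. indicator {0..t} x * b x)"
  define c' where "c' = (\<lambda>x. indicator {0..t} x *\<^sub>R c x)"
  have ai: "integrable lborel a'" and bi: "integrable lborel b'" and ci: "integrable lborel c'"
    using a b c by (simp_all add: set_integrable_def a'_def b'_def c'_def)
  note [measurable] = borel_measurable_integrable[OF ai, simplified] borel_measurable_integrable[OF bi, simplified]
    borel_measurable_integrable[OF ci, simplified]
  have bd': "(\<forall>s. \<bar>a' s\<bar> \<le> \<bar>M\<bar>) \<or> (\<forall>s. \<bar>b' s\<bar> \<le> \<bar>M\<bar>)"
  proof -
    have "\<bar>a' s\<bar> \<le> \<bar>M\<bar>" if "\<forall>s\<in>{0..t}. \<bar>a s\<bar> \<le> M" for s
      using that by (cases "s \<in> {0..t}") (fastforce simp: a'_def)+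
    moreover have "\<bar>b' s\<bar> \<le> \<bar>M\<bar>" if "\<forall>s\<in>{0..t}. \<bar>b s\<bar> \<le> M" for s
      using that by (cases "s \<in> {0..t}") (fastforce simp: b'_def)+
    ultimately show ?thesis using bd by blast
  qed
  define f where "f = (\<lambda>(r, s). (a' (t - s) * b' (s - r)) *\<^sub>R c' r)"
  have ai': "integrable lborel (\<lambda>s. a' (t - s))" for t
    using ai by (simp add: integrable_reflect_shift)
  have bi': "integrable lborel (\<lambda>s. b' (s - r))" for r
    using bi by (simp add: integrable_shift)
  \<comment> \<open>One constant for both alternatives of \<open>bd\<close>: the bounded kernel
    contributes \<open>M\<close>, the other one its integral.\<close>
  define K where "K = \<bar>M\<bar> * ((LBINT s. \<bar>a' s\<bar>) + (LBINT s. \<bar>b' s\<bar>))"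
  have nn: "0 \<le> (LBINT s. \<bar>a' s\<bar>)" "0 \<le> (LBINT s. \<bar>b' s\<bar>)" by simp_all
  have ab: "integrable lborel (\<lambda>s. a' (t - s) * b' (s - r)) \<and> (LBINT s. \<bar>a' (t - s) * b' (s - r)\<bar>) \<le> K" for r
    using bd'
  proof
    assume M: "\<forall>s. \<bar>a' s\<bar> \<le> \<bar>M\<bar>"
    have i: "integrable lborel (\<lambda>s. a' (t - s) * b' (s - r))"
      by (rule Bochner_Integration.integrable_bound[where f = "\<lambda>s. \<bar>M\<bar> * \<bar>b' (s - r)\<bar>"])
        (use M bi' in \<open>auto simp: abs_mult intro!: mult_right_mono\<close>)
    have "(LBINT s. \<bar>a' (t - s) * b' (s - r)\<bar>) \<le> (LBINT s. \<bar>M\<bar> * \<bar>b' (s - r)\<bar>)"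
      by (intro integral_mono integrable_abs integrable_mult_right i bi')
        (use M in \<open>auto simp: abs_mult intro!: mult_right_mono\<close>)
    also have "\<dots> = \<bar>M\<bar> * (LBINT s. \<bar>b' s\<bar>)"
      using integral_shift[of "\<lambda>s. \<bar>b' s\<bar>" r] by simp
    also have "\<dots> \<le> K" using nn by (simp add: K_def distrib_left)
    finally show ?thesis using i by simp
  next
    assume M: "\<forall>s. \<bar>b' s\<bar> \<le> \<bar>M\<bar>"
    have i: "integrable lborel (\<lambda>s. a' (t - s) * b' (s - r))"
      by (rule Bochner_Integration.integrable_bound[where f = "\<lambda>s. \<bar>a' (t - s)\<bar> * \<bar>M\<bar>"])
        (use M ai' in \<open>auto simp: abs_mult intro!: mult_left_mono\<close>)
    have "(LBINT s. \<bar>a' (t - s) * b' (s - r)\<bar>) \<le> (LBINT s. \<bar>a' (t - s)\<bar> * \<bar>M\<bar>)"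
      by (intro integral_mono integrable_abs integrable_mult_left i ai')
        (use M in \<open>auto simp: abs_mult intro!: mult_left_mono\<close>)
    also have "\<dots> = \<bar>M\<bar> * (LBINT s. \<bar>a' s\<bar>)"
      using integral_reflect_shift[of "\<lambda>s. \<bar>a' s\<bar>" t] by simp
    also have "\<dots> \<le> K" using nn by (simp add: K_def distrib_left)
    finally show ?thesis using i by simp
  qed
  have fm[measurable]: "f \<in> borel_measurable (lborel \<Otimes>\<^sub>M lborel)"
    unfolding f_def by measurable
  have fi: "integrable (lborel \<Otimes>\<^sub>M lborel) f"
  proof (rule lborel_pair.Fubini_integrable)
    show "AE r in lborel. integrable lborel (\<lambda>s. f (r, s))"
      using ab by (auto simp: f_def)
    show "integrable lborel (\<lambda>r. LBINT s. norm (f (r, s)))"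
    proof (rule Bochner_Integration.integrable_bound[where f = "\<lambda>r. K * norm (c' r)"])
      show "integrable lborel (\<lambda>r. K * norm (c' r))" using ci by simp
      show "AE r in lborel. norm (LBINT s. norm (f (r, s))) \<le> norm (K * norm (c' r))"
      proof (rule AE_I2)
        fix r
        have "(LBINT s. norm (f (r, s))) = (LBINT s. \<bar>a' (t - s) * b' (s - r)\<bar>) * norm (c' r)"
          by (simp add: f_def)
        also have "\<dots> \<le> K * norm (c' r)" using ab by (intro mult_right_mono) auto
        finally show "norm (LBINT s. norm (f (r, s))) \<le> norm (K * norm (c' r))"
          using Bochner_Integration.integral_nonneg[of lborel "\<lambda>s. norm (f (r, s))"] by simp
      qed
    qed measurable
  qed measurable
  have "(LBINT r. LBINT s. f (r, s)) = (LBINT s. LBINT r. f (r, s))"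
    using lborel_pair.Fubini_integral[of "\<lambda>r s. f (r, s)"] fi by simp
  also have "(LBINT s. LBINT r. f (r, s)) = conv a (conv b c) t"
    unfolding conv_def[of a] set_lebesgue_integral_def
  proof (rule Bochner_Integration.integral_cong[OF refl])
    fix s
    show "(LBINT r. f (r, s)) = indicator {0..t} s *\<^sub>R a (t - s) *\<^sub>R conv b c s"
    proof (cases "s \<in> {0..t}")
      case True
      have "(LBINT r. f (r, s)) = (LBINT r. a' (t - s) *\<^sub>R (b' (s - r) *\<^sub>R c' r))"
        by (simp add: f_def)
      also have "\<dots> = a' (t - s) *\<^sub>R conv b c s"
        using True by (subst integral_scaleR_right) (auto simp: conv_eq_truncated[of s t] b'_def c'_def)
      finally show ?thesis using True by (simp add: a'_def)
    next
      case False
      \<comment> \<open>For \<open>s > t\<close> the first factor is cut off; for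
        \<open>s < 0\<close> no \<open>r \<ge> 0\<close> leaves
        \<open>s - r \<ge> 0\<close>.\<close>
      then have "a' (t - s) = 0 \<or> (\<forall>r. b' (s - r) *\<^sub>R c' r = 0)"
        by (auto simp: a'_def b'_def c'_def indicator_def)
      then have "f (r, s) = 0" for r by (auto simp: f_def)
      then show ?thesis using False by simp
    qed
  qed
  also have "(LBINT r. LBINT s. f (r, s)) = conv (conv a b) c t"
    unfolding conv_def[of "conv a b"] set_lebesgue_integral_def
  proof (rule Bochner_Integration.integral_cong[OF refl])
    fix r
    show "(LBINT s. f (r, s)) = indicator {0..t} r *\<^sub>R conv a b (t - r) *\<^sub>R c r"
    proof (cases "r \<in> {0..t}")
      case True
      have "(LBINT s. f (r, s)) = (LBINT s. a' (t - s) * b' (s - r)) *\<^sub>R c' r"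
        using ab[of r] by (simp add: f_def)
      also have "(LBINT s. a' (t - s) * b' (s - r)) = (LBINT s. a' (t - r - s) * b' s)"
        using integral_shift[of "\<lambda>s. a' (t - r - s) * b' s" r] by simp
      also have "\<dots> = conv a b (t - r)"
        using True by (subst conv_eq_truncated[of _ t]) (auto simp: a'_def b'_def)
      finally show ?thesis using True by (simp add: c'_def)
    qed (simp add: f_def c'_def)
  qed
  finally show ?thesis by simp
qed

text \<open>Young's inequality for integrable functions: by translation invariance the inner
  integral of the norm depends on \<open>r\<close> only through \<open>norm (c' r)\<close>.\<close>

lemma conv_integrable:
  fixes b :: "real \<Rightarrow> real" and c :: "real \<Rightarrow> 'b::{banach, second_countable_topology}"
  assumes b: "set_integrable lborel {0..t} b" and c: "set_integrable lborel {0..t} c"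
  shows "set_integrable lborel {0..t} (conv b c)"
proof -
  define b' where "b' = (\<lambda>x. indicator {0..t} x * b x)"
  define c' where "c' = (\<lambda>x. indicator {0..t} x *\<^sub>R c x)"
  have bi: "integrable lborel b'" and ci: "integrable lborel c'"
    using b c by (simp_all add: set_integrable_def b'_def c'_def)
  note [measurable] = borel_measurable_integrable[OF bi, simplified] borel_measurable_integrable[OF ci, simplified]
  have bi': "integrable lborel (\<lambda>s. b' (s - r))" for r
    using bi by (simp add: integrable_shift)
  define f where "f = (\<lambda>(r, s). b' (s - r) *\<^sub>R c' r)"
  have fi: "integrable (lborel \<Otimes>\<^sub>M lborel) f"
  proof (rule lborel_pair.Fubini_integrable)
    show "AE r in lborel. integrable lborel (\<lambda>s. f (r, s))"
      using bi' by (auto simp: f_def)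
    have "(LBINT s. norm (f (r, s))) = (LBINT s. \<bar>b' s\<bar>) * norm (c' r)" for r
      using integral_shift[of "\<lambda>s. \<bar>b' s\<bar>" r] by (simp add: f_def)
    then show "integrable lborel (\<lambda>r. LBINT s. norm (f (r, s)))" using ci by simp
  qed (unfold f_def, measurable)
  have "integrable lborel (\<lambda>s. LBINT r. f (r, s))"
    using lborel_pair.integrable_snd[of "\<lambda>r s. f (r, s)"] fi by simp
  then have "set_integrable lborel {0..t} (\<lambda>s. LBINT r. f (r, s))"
    unfolding set_integrable_def by (intro integrable_mult_indicator) auto
  moreover have "set_integrable lborel {0..t} (conv b c) = set_integrable lborel {0..t} (\<lambda>s. LBINT r. f (r, s))"
    by (intro set_integrable_cong) (auto simp: conv_eq_truncated[of _ t] f_def b'_def c'_def)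
  ultimately show ?thesis by simp
qed

text \<open>Two merely integrable functions have a convolution at almost every point only. A bound
  on one factor gives it at every point, as evaluation at grid times requires; the next lemma bounds
  the other factor.\<close>

lemma conv_integrand_bounded_left:
  fixes b :: "real \<Rightarrow> 'b::{banach, second_countable_topology}"
  assumes a: "set_integrable lborel {0..t} a" and b: "set_integrable lborel {0..t} b"
    and M: "\<And>s. s \<in> {0..t} \<Longrightarrow> \<bar>a s\<bar> \<le> M"
  shows "set_integrable lborel {0..t} (\<lambda>s. a (t - s) *\<^sub>R b s)"
proof -
  define a' where "a' = (\<lambda>x. indicator {0..t} x * a x)"
  define b' where "b' = (\<lambda>x. indicator {0..t} x *\<^sub>R b x)"
  have ai: "integrable lborel a'" and bi: "integrable lborel b'"
    using a b by (simp_all add: set_integrable_def b'_def a'_def)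
  note [measurable] = borel_measurable_integrable[OF bi, simplified] borel_measurable_integrable[OF ai, simplified]
  have "\<bar>a' s\<bar> \<le> \<bar>M\<bar>" for s
    using M[of s] abs_ge_self[of M] by (cases "s \<in> {0..t}") (simp_all add: a'_def)
  then have le: "norm (a' (t - s) *\<^sub>R b' s) \<le> norm (\<bar>M\<bar> * norm (b' s))" for s
    unfolding norm_scaleR real_norm_def abs_mult abs_norm_cancel abs_abs by (intro mult_right_mono) auto
  have "integrable lborel (\<lambda>s. a' (t - s) *\<^sub>R b' s)"
    by (rule Bochner_Integration.integrable_bound[OF _ _ AE_I2[OF le]]) (use bi in simp_all)
  moreover have "a' (t - s) *\<^sub>R b' s = indicator {0..t} s *\<^sub>R a (t - s) *\<^sub>R b s" for s
    by (auto simp: a'_def b'_def indicator_def)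
  ultimately show ?thesis by (simp add: set_integrable_def)
qed

lemma conv_integrand_bounded_right:
  fixes b :: "real \<Rightarrow> 'b::{banach, second_countable_topology}"
  assumes a: "set_integrable lborel {0..t} a" and b: "set_integrable lborel {0..t} b"
    and M: "\<And>s. s \<in> {0..t} \<Longrightarrow> norm (b s) \<le> M"
  shows "set_integrable lborel {0..t} (\<lambda>s. a (t - s) *\<^sub>R b s)"
proof -
  define a' where "a' = (\<lambda>x. indicator {0..t} x * a x)"
  define b' where "b' = (\<lambda>x. indicator {0..t} x *\<^sub>R b x)"
  have ai: "integrable lborel a'" and bi: "integrable lborel b'"
    using a b by (simp_all add: set_integrable_def b'_def a'_def)
  note [measurable] = borel_measurable_integrable[OF bi, simplified] borel_measurable_integrable[OF ai, simplified]
  have "norm (b' s) \<le> \<bar>M\<bar>" for s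
    using M[of s] abs_ge_self[of M] by (cases "s \<in> {0..t}") (simp_all add: b'_def)
  then have le: "norm (a' (t - s) *\<^sub>R b' s) \<le> norm (a' (t - s) * \<bar>M\<bar>)" for s
    unfolding norm_scaleR real_norm_def abs_mult abs_abs by (intro mult_left_mono) auto
  have ai': "integrable lborel (\<lambda>s. a' (t - s))" using ai by (simp add: integrable_reflect_shift)
  have "integrable lborel (\<lambda>s. a' (t - s) *\<^sub>R b' s)"
    by (rule Bochner_Integration.integrable_bound[OF _ _ AE_I2[OF le]]) (use ai' in simp_all)
  moreover have "a' (t - s) *\<^sub>R b' s = indicator {0..t} s *\<^sub>R a (t - s) *\<^sub>R b s" for s
    by (auto simp: a'_def b'_def indicator_def)
  ultimately show ?thesis by (simp add: set_integrable_def)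
qed

lemma conv_commute:
  fixes a b :: "real \<Rightarrow> real"
  shows "conv a b t = conv b a t"
proof -
  have "conv a b t = (LBINT s. indicator {0..t} s * (a (t - s) * b s))"
    by (simp add: conv_def set_lebesgue_integral_def)
  also have "\<dots> = (LBINT s. indicator {0..t} (t - s) * (a s * b (t - s)))"
    using integral_reflect_shift[of "\<lambda>s. indicator {0..t} s * (a (t - s) * b s)" t] by simp
  also have "\<dots> = conv b a t"
    unfolding conv_def set_lebesgue_integral_def
    by (intro Bochner_Integration.integral_cong) (auto simp: indicator_def)
  finally show ?thesis .
qed

lemma conv_cong_AE:
  fixes b :: "real \<Rightarrow> 'b::{banach, second_countable_topology}"
  assumes b: "set_integrable lborel {0..T} b" "set_integrable lborel {0..T} b'"
    and a: "set_integrable lborel {0..T} a"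
    and AE: "AE s in lborel. s \<in> {0..T} \<longrightarrow> b s = b' s" and t: "t \<le> T"
  shows "conv a b t = conv a b' t"
proof -
  define a1 where "a1 = (\<lambda>x. indicator {0..T} x * a x)"
  define b1 where "b1 = (\<lambda>x. indicator {0..T} x *\<^sub>R b x)"
  define b2 where "b2 = (\<lambda>x. indicator {0..T} x *\<^sub>R b' x)"
  have [measurable]: "a1 \<in> borel_measurable borel" "b1 \<in> borel_measurable borel" "b2 \<in> borel_measurable borel"
    using set_integrable_real_borel[OF a] set_integrable_real_borel[OF b(1)] set_integrable_real_borel[OF b(2)]
    by (simp_all add: a1_def b1_def b2_def)
  have "AE r in lborel. a1 (t - r) *\<^sub>R b1 r = a1 (t - r) *\<^sub>R b2 r"
    using AE by eventually_elim (auto simp: indicator_def b1_def b2_def)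
  then have "(LBINT r. a1 (t - r) *\<^sub>R b1 r) = (LBINT r. a1 (t - r) *\<^sub>R b2 r)"
    by (intro integral_cong_AE) auto
  then show ?thesis using t by (simp add: conv_eq_truncated[of _ T] a1_def b1_def b2_def)
qed

section \<open>Second differences of powers\<close>

lemma one_minus_cos_le: "1 - cos x \<le> x\<^sup>2 / 2" for x :: real
proof -
  have "1 - cos x = 2 * (sin (x / 2))\<^sup>2"
    using cos_double_sin[of "x / 2"] by simp
  also have "(sin (x / 2))\<^sup>2 \<le> (x / 2)\<^sup>2"
    by (rule abs_le_square_iff[THEN iffD1, OF abs_sin_x_le_abs_x])
  also have "2 * (x / 2)\<^sup>2 = x\<^sup>2 / 2" by (simp add: power2_eq_square)
  finally show ?thesis by simp
qed

lemma set_integrable_powr_0: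
  fixes a :: real
  assumes "-1 < a" "0 \<le> b"
  shows "set_integrable lborel {0..b} (\<lambda>x. x powr a)"
proof -
  have "(\<lambda>x. x powr a) absolutely_integrable_on {0..b}"
    using integrable_on_powr_from_0[OF assms] by (intro nonnegative_absolutely_integrable_1) auto
  then show ?thesis
    by (auto simp: set_integrable_def integrable_completion)
qed

lemma set_integrable_powr_at_top:
  fixes a :: real
  assumes "a < -1" "0 < b"
  shows "set_integrable lborel {b..} (\<lambda>x. x powr a)"
proof -
  have "(\<lambda>x. x powr a) absolutely_integrable_on {b..}"
    using has_integral_powr_to_inf[OF assms] by (intro nonnegative_absolutely_integrable_1) (auto simp: integrable_on_def)
  then show ?thesis
    by (auto simp: set_integrable_def integrable_completion)
qed

text \<open>Near \<open>0\<close> the quadratic zero of \<open>1 - cos x\<close> compensates the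
  singularity because \<open>p < 2\<close>; at infinity the power decays fast enough because
  \<open>0 < p\<close>.\<close>

lemma integrable_one_minus_cos_powr:
  fixes p :: real
  assumes "0 < p" "p < 2"
  shows "set_integrable lborel {0<..} (\<lambda>x. (1 - cos x) * x powr (- 1 - p))"
proof -
  have "set_integrable lborel {0<..1} (\<lambda>x. (1 - cos x) * x powr (- 1 - p))"
  proof (rule set_integrable_bound[where f = "\<lambda>x. x powr (1 - p)"])
    show "set_integrable lborel {0<..1} (\<lambda>x. x powr (1 - p))"
      by (rule set_integrable_subset[OF set_integrable_powr_0[of "1 - p" 1]]) (use assms in auto)
    show "AE x in lborel. x \<in> {0<..1} \<longrightarrow> norm ((1 - cos x) * x powr (- 1 - p)) \<le> norm (x powr (1 - p))"
    proof (intro AE_I2 impI)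
      fix x :: real assume x: "x \<in> {0<..1}"
      have "(1 - cos x) * x powr (- 1 - p) \<le> x\<^sup>2 * x powr (- 1 - p)"
        by (intro mult_right_mono order_trans[OF one_minus_cos_le]) auto
      also have "\<dots> = x powr (1 - p)"
        using x by (simp add: powr_numeral[symmetric] powr_add[symmetric] del: powr_numeral)
      finally show "norm ((1 - cos x) * x powr (- 1 - p)) \<le> norm (x powr (1 - p))" by simp
    qed
  qed (auto simp: set_borel_measurable_def)
  moreover have "set_integrable lborel {1..} (\<lambda>x. (1 - cos x) * x powr (- 1 - p))"
  proof (rule set_integrable_bound[where f = "\<lambda>x. 2 * x powr (- 1 - p)"])
    show "set_integrable lborel {1..} (\<lambda>x. 2 * x powr (- 1 - p))"
      using set_integrable_powr_at_top[of "- 1 - p" 1] assms by simp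
    have "1 - cos x \<le> 2" for x :: real using cos_ge_minus_one[of x] by linarith
    then show "AE x in lborel. x \<in> {1..} \<longrightarrow> norm ((1 - cos x) * x powr (- 1 - p)) \<le> norm (2 * x powr (- 1 - p))"
      by (auto simp: abs_mult intro!: mult_right_mono)
  qed (auto simp: set_borel_measurable_def)
  ultimately have "set_integrable lborel ({0<..1} \<union> {1..}) (\<lambda>x. (1 - cos x) * x powr (- 1 - p))"
    by (rule set_integrable_Un) auto
  moreover have "{0<..1} \<union> {1..} = {0::real<..}" by auto
  ultimately show ?thesis by simp
qed

text \<open>The normalising constant in the Levy-Khintchine formula for \<open>|x| powr p\<close>,
  the characteristic exponent of a symmetric stable law.\<close>

definition levy_const :: "real \<Rightarrow> real"
  where "levy_const p = (LBINT x:{0<..}. (1 - cos x) * x powr (- 1 - p))"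

text \<open>The integrand is nonnegative, and positive on the interval from \<open>0\<close> to
  \<open>1\<close>; a zero integral would make that interval a null set.\<close>

lemma levy_const_pos:
  assumes "0 < p" "p < 2"
  shows "0 < levy_const p"
proof -
  let ?f = "\<lambda>x. indicator {0<..} x * ((1 - cos x) * x powr (- 1 - p))"
  have i: "integrable lborel ?f"
    using integrable_one_minus_cos_powr[OF assms] by (simp add: set_integrable_def)
  have nn: "0 \<le> ?f x" for x by (auto simp: indicator_def)
  have "levy_const p \<noteq> 0"
  proof
    assume "levy_const p = 0"
    then have "integral\<^sup>L lborel ?f = 0"
      by (simp add: levy_const_def set_lebesgue_integral_def)
    then have "AE x in lborel. ?f x = 0"
      using integral_nonneg_eq_0_iff_AE[OF i] nn by auto
    then have "AE x in lborel. x \<notin> {0<..<1::real}"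
    proof eventually_elim
      case (elim x)
      have "cos x < 1" if "0 < x" "x < 1"
        using cos_monotone_0_pi[of 0 x] that pi_gt3 unfolding cos_zero by linarith
      then show ?case using elim by (auto simp: indicator_def)
    qed
    then have "emeasure lborel {0<..<1::real} = 0"
      by (subst (asm) AE_iff_measurable[where N = "{0<..<1}"]) auto
    then show False by simp
  qed
  moreover have "0 \<le> levy_const p"
    unfolding levy_const_def set_lebesgue_integral_def using nn
    by (intro Bochner_Integration.integral_nonneg) simp
  ultimately show ?thesis by simp
qed

lemma set_integral_sum2:
  fixes h :: "'i \<Rightarrow> 'j \<Rightarrow> 'a \<Rightarrow> real"
  assumes "\<And>i j. set_integrable M A (h i j)"
  shows "(\<Sum>i\<in>I. \<Sum>j\<in>J. LINT x:A|M. h i j x) = (LINT x:A|M. (\<Sum>i\<in>I. \<Sum>j\<in>J. h i j x))"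
  using assms unfolding set_integrable_def set_lebesgue_integral_def
  by (simp add: sum_distrib_left)

text \<open>Scaling the variable in the integral \<open>levy_const p\<close> by \<open>|x|\<close>
  produces the factor \<open>|x| powr p\<close>.\<close>

lemma abs_powr_representation:
  assumes p: "0 < p" "p < 2"
  shows "set_integrable lborel {0<..} (\<lambda>l. (1 - cos (x * l)) * l powr (- 1 - p))"
    and "(LBINT l:{0<..}. (1 - cos (x * l)) * l powr (- 1 - p)) = levy_const p * \<bar>x\<bar> powr p"
proof -
  let ?f = "\<lambda>x. indicator {0<..} x * ((1 - cos x) * x powr (- 1 - p))"
  let ?g = "\<lambda>x l. indicator {0<..} l * ((1 - cos (x * l)) * l powr (- 1 - p))"
  have i: "integrable lborel ?f"
    using integrable_one_minus_cos_powr[OF p] by (simp add: set_integrable_def)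
  have *: "integrable lborel (?g x) \<and> integral\<^sup>L lborel (?g x) = levy_const p * \<bar>x\<bar> powr p"
  proof (cases "x = 0")
    case False
    define c where "c = \<bar>x\<bar>"
    have c: "c > 0" using False by (simp add: c_def)
    have "cos (c * l) = cos (x * l)" for l
      by (cases "x \<ge> 0") (auto simp: c_def)
    then have gx: "?g x = ?g c" by simp
    have eq: "?f (0 + c * l) = c powr (- 1 - p) * ?g c l" for l
      using c by (auto simp: indicator_def powr_mult zero_less_mult_iff)
    have "integrable lborel (\<lambda>l. ?f (0 + c * l))"
      using lborel_integrable_real_affine_iff[of c ?f 0] i c by blast
    then have "integrable lborel (\<lambda>l. c powr (- 1 - p) * ?g c l)" unfolding eq .
    then have 1: "integrable lborel (?g c)" using c by simp
    have "levy_const p = integral\<^sup>L lborel ?f"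
      by (simp add: levy_const_def set_lebesgue_integral_def)
    also have "\<dots> = \<bar>c\<bar> *\<^sub>R (LBINT l. ?f (0 + c * l))"
      by (rule lborel_integral_real_affine) (use c in auto)
    also have "\<dots> = c * (c powr (- 1 - p) * integral\<^sup>L lborel (?g c))"
      unfolding eq using c by simp
    also have "c * (c powr (- 1 - p) * integral\<^sup>L lborel (?g c)) = integral\<^sup>L lborel (?g c) / c powr p"
      using c by (simp add: powr_diff powr_minus field_simps)
    finally have "integral\<^sup>L lborel (?g c) = levy_const p * c powr p"
      using c by (simp add: field_simps)
    with 1 show ?thesis unfolding gx by (simp add: c_def)
  qed (use p in simp)
  then show "set_integrable lborel {0<..} (\<lambda>l. (1 - cos (x * l)) * l powr (- 1 - p))"
    and "(LBINT l:{0<..}. (1 - cos (x * l)) * l powr (- 1 - p)) = levy_const p * \<bar>x\<bar> powr p"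
    by (simp_all add: set_integrable_def set_lebesgue_integral_def)
qed

text \<open>In a second difference the constants \<open>1\<close> of \<open>1 - cos\<close> cancel,
  and the sum formula for cosines leaves \<open>2 * cos (x * l) * (1 - cos l)\<close>. So the second
  difference is a cosine transform of a nonnegative density.\<close>

lemma second_difference_representation:
  assumes p: "0 < p" "p < 2"
  shows "set_integrable lborel {0<..} (\<lambda>l. 2 * cos (x * l) * (1 - cos l) * l powr (- 1 - p))"
    and "(LBINT l:{0<..}. 2 * cos (x * l) * (1 - cos l) * l powr (- 1 - p))
      = levy_const p * (\<bar>x + 1\<bar> powr p - 2 * \<bar>x\<bar> powr p + \<bar>x - 1\<bar> powr p)"
proof -
  note r = abs_powr_representation[OF p]
  have gen: "(1 - A) * w - 2 * ((1 - C) * w) + (1 - B) * w = (2 * C - (A + B)) * w"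
      "(2 * C - 2 * C * E) * w = 2 * C * (1 - E) * w" for A B C E w :: real
    by (simp_all add: algebra_simps)
  have "cos ((x + 1) * l) + cos ((x - 1) * l) = 2 * cos (x * l) * cos l" for l
    by (simp add: cos_add cos_diff distrib_right left_diff_distrib)
  then have eq: "2 * cos (x * l) * (1 - cos l) * l powr (- 1 - p) =
      (1 - cos ((x + 1) * l)) * l powr (- 1 - p) - 2 * ((1 - cos (x * l)) * l powr (- 1 - p))
      + (1 - cos ((x - 1) * l)) * l powr (- 1 - p)" for l
    unfolding gen(1) by (simp only: gen(2))
  show "set_integrable lborel {0<..} (\<lambda>l. 2 * cos (x * l) * (1 - cos l) * l powr (- 1 - p))"
    unfolding eq by (intro set_integral_add set_integral_diff set_integrable_mult_right r)
  show "(LBINT l:{0<..}. 2 * cos (x * l) * (1 - cos l) * l powr (- 1 - p))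
      = levy_const p * (\<bar>x + 1\<bar> powr p - 2 * \<bar>x\<bar> powr p + \<bar>x - 1\<bar> powr p)"
    unfolding eq
    by (simp only: set_integral_add(2)[OF set_integral_diff(1)[OF r(1) set_integrable_mult_right[OF r(1)]] r(1)]
        set_integral_diff(2)[OF r(1) set_integrable_mult_right[OF r(1)]] set_integral_mult_right r(2))
      (simp add: right_diff_distrib distrib_left)
qed

text \<open>The second differences of \<open>|x| powr p\<close> are the covariances of fractional Gaussian noise.\<close>

lemma second_difference_psd:
  fixes V :: "nat \<Rightarrow> 'b::real_inner"
  assumes p: "0 < p" "p < 2" and F: "finite F"
  shows "0 \<le> (\<Sum>n\<in>F. \<Sum>j\<in>F. (let x = real n - real j in
      \<bar>x + 1\<bar> powr p - 2 * \<bar>x\<bar> powr p + \<bar>x - 1\<bar> powr p) * inner (V n) (V j))"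
proof -
  define D where "D x = \<bar>x + 1\<bar> powr p - 2 * \<bar>x\<bar> powr p + \<bar>x - 1\<bar> powr p" for x :: real
  define K where "K l = (1 - cos l) * l powr (- 1 - p)" for l :: real
  have i: "set_integrable lborel {0<..} (\<lambda>l. (2 * cos (x * l) * K l) * c)"
    and e: "(LBINT l:{0<..}. (2 * cos (x * l) * K l) * c) = levy_const p * D x * c" for x c
    using second_difference_representation[OF p, of x] unfolding K_def D_def mult.assoc[symmetric]
    by (auto simp only: set_integral_mult_left intro!: set_integrable_mult_left)
  have "levy_const p * (\<Sum>n\<in>F. \<Sum>j\<in>F. D (real n - real j) * inner (V n) (V j))
      = (\<Sum>n\<in>F. \<Sum>j\<in>F. LBINT l:{0<..}. (2 * cos ((real n - real j) * l) * K l) * inner (V n) (V j))"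
    unfolding e by (simp add: sum_distrib_left mult.assoc)
  also have "\<dots> = (LBINT l:{0<..}. (\<Sum>n\<in>F. \<Sum>j\<in>F. (2 * cos ((real n - real j) * l) * K l) * inner (V n) (V j)))"
    by (rule set_integral_sum2[OF i])
  also have "0 \<le> \<dots>"
    unfolding set_lebesgue_integral_def
  proof (rule Bochner_Integration.integral_nonneg)
    fix l :: real
    have q: "inner (\<Sum>n\<in>F. a n *\<^sub>R V n) (\<Sum>n\<in>F. a n *\<^sub>R V n)
        = (\<Sum>n\<in>F. \<Sum>j\<in>F. (a n * a j) * inner (V n) (V j))" for a
      by (subst inner_sum_left, intro sum.cong refl, subst inner_sum_right, intro sum.cong refl) simp
    \<comment> \<open>The addition formula splits the cosine matrix into two Gram matrices, one of
      cosines and one of sines, so the form is a sum of two squared norms for every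
      frequency.\<close>
    have "cos ((real n - real j) * l) = cos (real n * l) * cos (real j * l) + sin (real n * l) * sin (real j * l)" for n j
      by (simp add: left_diff_distrib cos_diff)
    then have "(\<Sum>n\<in>F. \<Sum>j\<in>F. cos ((real n - real j) * l) * inner (V n) (V j))
        = inner (\<Sum>n\<in>F. cos (real n * l) *\<^sub>R V n) (\<Sum>n\<in>F. cos (real n * l) *\<^sub>R V n)
          + inner (\<Sum>n\<in>F. sin (real n * l) *\<^sub>R V n) (\<Sum>n\<in>F. sin (real n * l) *\<^sub>R V n)"
      unfolding q by (simp only: distrib_right sum.distrib)
    then have nn: "0 \<le> (\<Sum>n\<in>F. \<Sum>j\<in>F. cos ((real n - real j) * l) * inner (V n) (V j))"
      by simp
    have "0 \<le> 2 * K l" unfolding K_def by (intro mult_nonneg_nonneg) auto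
    from mult_nonneg_nonneg[OF this nn]
    have "0 \<le> (\<Sum>n\<in>F. \<Sum>j\<in>F. 2 * K l * (cos ((real n - real j) * l) * inner (V n) (V j)))"
      by (simp only: sum_distrib_left)
    also have "\<dots> = (\<Sum>n\<in>F. \<Sum>j\<in>F. (2 * cos ((real n - real j) * l) * K l) * inner (V n) (V j))"
      by (intro sum.cong refl) (simp only: ac_simps)
    finally have *: "0 \<le> (\<Sum>n\<in>F. \<Sum>j\<in>F. (2 * cos ((real n - real j) * l) * K l) * inner (V n) (V j))" .
    show "0 \<le> indicator {0<..} l *\<^sub>R (\<Sum>n\<in>F. \<Sum>j\<in>F. (2 * cos ((real n - real j) * l) * K l) * inner (V n) (V j))"
      by (intro scaleR_nonneg_nonneg *) simp
  qed
  finally have "0 \<le> (\<Sum>n\<in>F. \<Sum>j\<in>F. D (real n - real j) * inner (V n) (V j))"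
    using levy_const_pos[OF p] by (simp add: zero_le_mult_iff)
  then show ?thesis by (simp add: Let_def D_def)
qed

section \<open>Weak derivatives in time\<close>

text \<open>On the real line \<open>Basis\<close> is \<open>{1}\<close>, so the directional
  derivative in \<open>Ck_on\<close> is the ordinary one and the usual rules of calculus can be
  carried over to \<open>Ck_on\<close> by induction.\<close>

lemma Ck_on_Suc_real:
  fixes f :: "real \<Rightarrow> real"
  assumes "\<And>x. (f has_real_derivative f' x) (at x)" "Ck_on k UNIV f'"
  shows "Ck_on (Suc k) UNIV f"
proof -
  have "frechet_derivative f (at x) 1 = f' x" for x
    using frechet_derivative_at[OF has_field_derivative_imp_has_derivative[OF assms(1)[of x]]] by (metis mult.right_neutral)
  moreover have "f differentiable at x" for x
    using assms(1) real_differentiable_def by blast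
  ultimately show ?thesis using assms(2) by (simp add: Basis_real_def)
qed

lemma Ck_on_SucD_real:
  fixes f :: "real \<Rightarrow> real"
  assumes "Ck_on (Suc k) UNIV f"
  shows "(f has_real_derivative deriv f x) (at x)" "Ck_on k UNIV (deriv f)"
proof -
  have d: "f differentiable at x" for x using assms by simp
  then show D: "(f has_real_derivative deriv f x) (at x)" for x
    using DERIV_deriv_iff_real_differentiable by blast
  have "frechet_derivative f (at x) 1 = deriv f x" for x
    using frechet_derivative_at[OF has_field_derivative_imp_has_derivative[OF D[of x]]] by (metis mult.right_neutral)
  then show "Ck_on k UNIV (deriv f)"
    using assms by (simp add: Basis_real_def)
qed

lemma Ck_on_continuous_real:
  fixes f :: "real \<Rightarrow> real"
  assumes "Ck_on k UNIV f"
  shows "continuous_on UNIV f"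
proof (cases k)
  case (Suc k')
  then show ?thesis using Ck_on_SucD_real(1)[of k' f] assms
    by (meson DERIV_isCont continuous_at_imp_continuous_on)
qed (use assms in simp)

lemma Ck_on_Suc_imp_real:
  fixes f :: "real \<Rightarrow> real"
  shows "Ck_on (Suc k) UNIV f \<Longrightarrow> Ck_on k UNIV f"
proof (induction k arbitrary: f)
  case 0
  then show ?case using Ck_on_continuous_real by (simp only: Ck_on.simps(1))
next
  case (Suc k)
  note D = Ck_on_SucD_real[OF Suc.prems]
  show ?case by (rule Ck_on_Suc_real[OF D(1) Suc.IH[OF D(2)]])
qed

lemma Ck_on_const_real: "Ck_on k UNIV (\<lambda>x::real. c :: real)"
proof (induction k arbitrary: c)
  case (Suc k)
  show ?case by (rule Ck_on_Suc_real[OF DERIV_const Suc])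
qed simp

lemma Ck_on_diff_real:
  fixes f g :: "real \<Rightarrow> real"
  shows "Ck_on k UNIV f \<Longrightarrow> Ck_on k UNIV g \<Longrightarrow> Ck_on k UNIV (\<lambda>x. f x - g x)"
proof (induction k arbitrary: f g)
  case 0
  then show ?case by (auto intro: continuous_intros)
next
  case (Suc k)
  note F = Ck_on_SucD_real[OF Suc.prems(1)] and G = Ck_on_SucD_real[OF Suc.prems(2)]
  show ?case by (rule Ck_on_Suc_real[OF DERIV_diff[OF F(1) G(1)] Suc.IH[OF F(2) G(2)]])
qed

lemma Ck_on_add_real:
  fixes f g :: "real \<Rightarrow> real"
  shows "Ck_on k UNIV f \<Longrightarrow> Ck_on k UNIV g \<Longrightarrow> Ck_on k UNIV (\<lambda>x. f x + g x)"
proof (induction k arbitrary: f g)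
  case 0
  then show ?case by (auto intro: continuous_intros)
next
  case (Suc k)
  note F = Ck_on_SucD_real[OF Suc.prems(1)] and G = Ck_on_SucD_real[OF Suc.prems(2)]
  show ?case by (rule Ck_on_Suc_real[OF DERIV_add[OF F(1) G(1)] Suc.IH[OF F(2) G(2)]])
qed

lemma Ck_on_mult_real:
  fixes f g :: "real \<Rightarrow> real"
  shows "Ck_on k UNIV f \<Longrightarrow> Ck_on k UNIV g \<Longrightarrow> Ck_on k UNIV (\<lambda>x. f x * g x)"
proof (induction k arbitrary: f g)
  case 0
  then show ?case by (auto intro: continuous_intros)
next
  case (Suc k)
  note F = Ck_on_SucD_real[OF Suc.prems(1)] and G = Ck_on_SucD_real[OF Suc.prems(2)]
  note F0 = Ck_on_Suc_imp_real[OF Suc.prems(1)] and G0 = Ck_on_Suc_imp_real[OF Suc.prems(2)]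
  show ?case
    by (rule Ck_on_Suc_real[OF DERIV_mult[OF F(1) G(1)] Ck_on_add_real[OF Suc.IH[OF F(2) G0] Suc.IH[OF G(2) F0]]])
qed

lemma Ck_on_affine_real:
  fixes f :: "real \<Rightarrow> real"
  shows "Ck_on k UNIV f \<Longrightarrow> Ck_on k UNIV (\<lambda>x. f (c * x + d))"
proof (induction k arbitrary: f)
  case 0
  then show ?case by (auto intro!: continuous_intros continuous_on_compose2[of UNIV f])
next
  case (Suc k)
  note F = Ck_on_SucD_real[OF Suc.prems(1)]
  have "((\<lambda>x. f (c * x + d)) has_real_derivative deriv f (c * x + d) * c) (at x)" for x
    by (rule DERIV_chain2[OF F(1)]) (auto intro!: derivative_eq_intros)
  then show ?case
    by (rule Ck_on_Suc_real) (intro Ck_on_mult_real Ck_on_const_real Suc.IH F(2))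
qed

section \<open>A smooth step function built from \<open>exp (- (1 / x))\<close>\<close>

definition exp_inverse_poly :: "real poly \<Rightarrow> real \<Rightarrow> real"
  where "exp_inverse_poly P x = (if 0 < x then poly P (1 / x) * exp (- (1 / x)) else 0)"

lemma poly_times_exp_minus_tendsto_0: "((\<lambda>y. poly P y * exp (- y)) \<longlongrightarrow> (0::real)) at_top"
proof -
  have "((\<lambda>y. \<Sum>i\<le>degree P. coeff P i * (y ^ i / exp y)) \<longlongrightarrow> (\<Sum>i\<le>degree P. coeff P i * 0)) at_top"
    by (intro tendsto_intros tendsto_power_div_exp_0)
  moreover have "(\<Sum>i\<le>degree P. coeff P i * (y ^ i / exp y)) = poly P y * exp (- y)" for y
    unfolding poly_altdef exp_minus by (simp add: sum_distrib_right divide_inverse mult.assoc)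
  ultimately show ?thesis by simp
qed

text \<open>The class is closed under differentiation, so smoothness follows by induction over all
  polynomials at once. With \<open>y = 1 / x\<close> the inner derivative is \<open>- y ^ 2\<close>,
  whence \<open>[:0, 0, 1:]\<close>, and the exponential replaces the derivative of \<open>P\<close>
  by its difference with \<open>P\<close>. At \<open>0\<close> the difference quotient belongs to
  the polynomial \<open>y * P y\<close>, and the exponential wins.\<close>

lemma exp_inverse_poly_DERIV:
  "(exp_inverse_poly P has_real_derivative exp_inverse_poly ([:0, 0, 1:] * (P - pderiv P)) x) (at x)"
proof -
  let ?Q = "[:0, 0, 1:] * (P - pderiv P)"
  consider "x < 0" | "x = 0" | "0 < x" by linarith
  then show ?thesis
  proof cases
    case 1
    have "((\<lambda>_. 0) has_real_derivative 0) (at x)" by simp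
    then have "(exp_inverse_poly P has_real_derivative 0) (at x)"
      by (rule DERIV_cong_ev[THEN iffD1, rotated -1])
        (use 1 eventually_nhds_in_open[of "{..<0}" x] in \<open>auto simp: exp_inverse_poly_def elim!: eventually_mono\<close>)
    then show ?thesis using 1 by (simp add: exp_inverse_poly_def)
  next
    case 3
    have "((\<lambda>x. poly P (1 / x) * exp (- (1 / x))) has_real_derivative
        poly (pderiv P) (1 / x) * (- (1 / x\<^sup>2)) * exp (- (1 / x)) + exp (- (1 / x)) * (1 / x\<^sup>2) * poly P (1 / x)) (at x)"
      using 3 by (auto intro!: derivative_eq_intros DERIV_chain2[OF poly_DERIV] simp: power2_eq_square)
    also have "poly (pderiv P) (1 / x) * (- (1 / x\<^sup>2)) * exp (- (1 / x)) + exp (- (1 / x)) * (1 / x\<^sup>2) * poly P (1 / x)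
        = exp_inverse_poly ?Q x"
      using 3 by (simp add: exp_inverse_poly_def power2_eq_square algebra_simps)
    finally show ?thesis
      by (rule DERIV_cong_ev[THEN iffD1, rotated -1])
        (use 3 eventually_nhds_in_open[of "{0<..}" x] in \<open>auto simp: exp_inverse_poly_def elim!: eventually_mono\<close>)
  next
    case 2
    have lim: "((\<lambda>h. exp_inverse_poly P h / h) \<longlongrightarrow> 0) (at_right 0)"
    proof -
      have "((\<lambda>h::real. poly ([:0, 1:] * P) (1 / h) * exp (- (1 / h))) \<longlongrightarrow> 0) (at_right 0)"
        using filterlim_compose[OF poly_times_exp_minus_tendsto_0[of "[:0, 1:] * P"] filterlim_inverse_at_top_right]
        by (simp add: inverse_eq_divide)
      moreover have "\<forall>\<^sub>F h in at_right 0. poly ([:0, 1:] * P) (1 / h) * exp (- (1 / h)) = exp_inverse_poly P h / h"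
        by (auto simp: eventually_at_right_less exp_inverse_poly_def eventually_at_filter field_simps)
      ultimately show ?thesis using tendsto_cong by fast
    qed
    have "((\<lambda>h. exp_inverse_poly P h / h) \<longlongrightarrow> 0) (at_left 0)"
      by (rule tendsto_eventually) (auto simp: exp_inverse_poly_def eventually_at_filter)
    with lim have "((\<lambda>h. exp_inverse_poly P h / h) \<longlongrightarrow> 0) (at 0)"
      by (simp add: filterlim_at_split)
    then show ?thesis
      using 2 by (simp add: DERIV_def exp_inverse_poly_def)
  qed
qed

lemma Ck_on_exp_inverse_poly: "Ck_on k UNIV (exp_inverse_poly P)"
proof (induction k arbitrary: P)
  case 0
  have "continuous_on UNIV (exp_inverse_poly P)"
    using exp_inverse_poly_DERIV by (meson DERIV_isCont continuous_at_imp_continuous_on)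
  then show ?case by simp
next
  case (Suc k)
  show ?case by (rule Ck_on_Suc_real[OF exp_inverse_poly_DERIV Suc])
qed

text \<open>The second argument is written \<open>- 1 * x + 1\<close> to match the affine form in
  \<open>Ck_on_affine_real\<close>.\<close>

definition bump :: "real \<Rightarrow> real"
  where "bump x = exp_inverse_poly 1 x * exp_inverse_poly 1 (- 1 * x + 1)"

lemma Ck_on_bump: "Ck_on k UNIV bump"
  unfolding bump_def by (intro Ck_on_mult_real Ck_on_affine_real Ck_on_exp_inverse_poly)

lemma bump_nonneg: "0 \<le> bump x" and bump_pos: "0 < x \<Longrightarrow> x < 1 \<Longrightarrow> 0 < bump x"
  and bump_outside: "x \<notin> {0<..<1} \<Longrightarrow> bump x = 0"
  by (auto simp: bump_def exp_inverse_poly_def)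

lemma continuous_bump: "continuous_on S bump"
  using Ck_on_bump[of 0] continuous_on_subset by auto

definition smooth_step :: "real \<Rightarrow> real"
  where "smooth_step x = integral {0..x} bump / integral {0..1} bump"

lemma bump_integral_pos: "0 < integral {0..1} bump"
proof -
  have "integral {0..1} bump \<noteq> 0"
  proof
    assume "integral {0..1} bump = 0"
    then have "(bump has_integral 0) (cbox 0 1)"
      using integrable_continuous_interval[OF continuous_bump] by (metis cbox_interval integrable_integral)
    then have "bump (1/2) = 0"
      by (intro has_integral_0_cbox_imp_0[OF continuous_bump, of 0 1]) (auto simp: bump_nonneg)
    then show False using bump_pos[of "1/2"] by simp
  qed
  moreover have "0 \<le> integral {0..1} bump"
    by (intro integral_nonneg integrable_continuous_interval continuous_bump bump_nonneg)
  ultimately show ?thesis by simp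
qed

definition bump1 :: "real \<Rightarrow> real" where "bump1 x = bump x / integral {0..1} bump"

lemma bump1_nonneg: "0 \<le> bump1 x" and bump1_outside: "x \<notin> {0<..<1} \<Longrightarrow> bump1 x = 0"
  and continuous_bump1: "continuous_on S bump1"
  using bump_integral_pos bump_nonneg bump_outside continuous_bump[of S]
  by (auto simp: bump1_def intro!: continuous_intros)

lemma smooth_step_le_0: "x \<le> 0 \<Longrightarrow> smooth_step x = 0"
  by (cases "x = 0") (auto simp: smooth_step_def)

lemma smooth_step_ge_1: "1 \<le> x \<Longrightarrow> smooth_step x = 1"
proof -
  assume x: "1 \<le> x"
  have "integral {0..1} bump + integral {1..x} bump = integral {0..x} bump"
    by (rule Henstock_Kurzweil_Integration.integral_combine)
      (use x in \<open>auto intro!: integrable_continuous_interval continuous_bump\<close>)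
  moreover have "integral {1..x} bump = integral {1..x} (\<lambda>_. 0)"
    by (intro Henstock_Kurzweil_Integration.integral_cong) (auto simp: bump_outside)
  ultimately show ?thesis using bump_integral_pos by (simp add: smooth_step_def)
qed

lemma smooth_step_DERIV: "(smooth_step has_real_derivative bump1 x) (at x)"
proof (cases "x < 0")
  case True
  have "((\<lambda>_. 0) has_real_derivative 0) (at x)" by simp
  then have "(smooth_step has_real_derivative 0) (at x)"
    by (rule DERIV_cong_ev[THEN iffD1, rotated -1])
      (use True eventually_nhds_in_open[of "{..<0}" x] in \<open>auto simp: smooth_step_le_0 elim!: eventually_mono\<close>)
  then show ?thesis using True by (simp add: bump1_outside)
next
  case False
  \<comment> \<open>Starting the integral at \<open>-1\<close>, where \<open>bump\<close> vanishes,
    makes \<open>x = 0\<close> an interior point, so the two-sided derivative exists there as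
    well.\<close>
  define F where "F y = integral {-1..y} bump / integral {0..1} bump" for y
  have "((\<lambda>y. integral {-1..y} bump) has_vector_derivative bump x) (at x within {-1..x + 1})"
    by (rule integral_has_vector_derivative) (use False in \<open>auto intro: continuous_bump\<close>)
  then have "((\<lambda>y. integral {-1..y} bump) has_vector_derivative bump x) (at x)"
    using False by (simp add: at_within_Icc_at)
  then have F: "(F has_real_derivative bump1 x) (at x)"
    unfolding F_def bump1_def by (intro DERIV_cdivide) (simp add: has_real_derivative_iff_has_vector_derivative)
  have eq: "F y = smooth_step y" if "-1 < y" for y
  proof (cases "0 \<le> y")
    case True
    have "integral {-1..0} bump + integral {0..y} bump = integral {-1..y} bump"
      by (rule Henstock_Kurzweil_Integration.integral_combine)
        (use True in \<open>auto intro!: integrable_continuous_interval continuous_bump\<close>)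
    moreover have "integral {-1..0} bump = integral {-1..0::real} (\<lambda>_. 0)"
      by (rule Henstock_Kurzweil_Integration.integral_cong) (auto simp: bump_outside)
    ultimately show ?thesis by (simp add: smooth_step_def F_def)
  next
    case False
    have "integral {-1..y} bump = integral {-1..y} (\<lambda>_. 0)"
      using False by (intro Henstock_Kurzweil_Integration.integral_cong) (auto simp: bump_outside)
    then show ?thesis using False by (simp add: smooth_step_le_0 F_def)
  qed
  have "\<forall>\<^sub>F y in nhds x. F y = smooth_step y"
    using eventually_nhds_in_open[of "{-1<..}" x] False by (auto simp: eq elim!: eventually_mono)
  then show ?thesis using F DERIV_cong_ev[of x x F smooth_step] by simp
qed

lemma Ck_on_bump1: "Ck_on k UNIV bump1"
  unfolding bump1_def divide_inverse by (intro Ck_on_mult_real Ck_on_bump Ck_on_const_real)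

lemma Ck_on_smooth_step: "Ck_on k UNIV smooth_step"
  by (rule Ck_on_Suc_imp_real, rule Ck_on_Suc_real[OF smooth_step_DERIV Ck_on_bump1])

lemma smooth_step_bounds: "0 \<le> smooth_step x" "smooth_step x \<le> 1"
proof -
  have mono: "smooth_step x \<le> smooth_step y" if "x \<le> y" for x y
    using that by (rule DERIV_nonneg_imp_nondecreasing) (use smooth_step_DERIV bump1_nonneg in blast)
  show "0 \<le> smooth_step x"
    using mono[of "min x 0" x] by (simp add: smooth_step_le_0)
  show "smooth_step x \<le> 1"
    using mono[of x "max x 1"] by (simp add: smooth_step_ge_1)
qed

lemma bump1_integral: "integrable lborel bump1" "integral\<^sup>L lborel bump1 = 1"
proof -
  have eq: "bump1 = (\<lambda>x. indicator {0..1} x *\<^sub>R bump1 x)"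
  proof
    show "bump1 x = indicator {0..1} x *\<^sub>R bump1 x" for x
      using bump1_outside[of x] by (cases "x \<in> {0..1}") auto
  qed
  have "set_integrable lborel {0..1} bump1"
    unfolding set_integrable_def by (rule borel_integrable_compact) (auto intro: continuous_bump1)
  then show i: "integrable lborel bump1" unfolding set_integrable_def eq[symmetric] .
  have "(LBINT x:{0..1}. bump1 x) = integral {0..1} bump1"
    using \<open>set_integrable lborel {0..1} bump1\<close> by (rule set_borel_integral_eq_integral)
  also have "\<dots> = 1"
    using bump_integral_pos by (simp add: bump1_def[abs_def])
  finally show "integral\<^sup>L lborel bump1 = 1"
    unfolding set_lebesgue_integral_def eq[symmetric] .
qed

text \<open>A smoothed indicator of the interval from \<open>s\<close> to \<open>t\<close>. Each
  ramp starts at its base point and has length \<open>1 / m \<le> d\<close>, so the support stays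
  between \<open>s\<close> and \<open>t + d\<close>, inside the open time interval.\<close>

lemma test_function_step_difference:
  assumes "0 < s" "s < t" "t + d < T" "0 < d" "1 / d \<le> m"
  shows "(\<lambda>x. smooth_step (m * (x - s)) - smooth_step (m * (x - t))) \<in> test_functions {0<..<T}" (is "?\<eta> \<in> _")
proof -
  have m: "0 < m" using assms by (meson less_le_trans zero_less_divide_1_iff)
  have "smooth_on UNIV ?\<eta>"
    unfolding smooth_on_def using Ck_on_diff_real[OF Ck_on_affine_real[OF Ck_on_smooth_step, of _ m "- (m * s)"]
        Ck_on_affine_real[OF Ck_on_smooth_step, of _ m "- (m * t)"]]
    by (simp add: right_diff_distrib)
  moreover have sub: "closure {x. ?\<eta> x \<noteq> 0} \<subseteq> {s..t + d}"
  proof (rule closure_minimal)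
    show "{x. ?\<eta> x \<noteq> 0} \<subseteq> {s..t + d}"
    proof (rule subsetI, rule ccontr)
      fix x assume x: "x \<in> {x. ?\<eta> x \<noteq> 0}" "x \<notin> {s..t + d}"
      show False
      proof (cases "x < s")
        case True
        then have "m * (x - s) \<le> 0" "m * (x - t) \<le> 0" using m assms by (auto intro!: mult_nonneg_nonpos)
        then show False using x by (simp add: smooth_step_le_0)
      next
        case False
        then have d: "d \<le> x - t" using x by auto
        then have "d \<le> x - s" using assms by linarith
        have "1 \<le> m * d" using assms by (simp add: field_simps)
        then have "1 \<le> m * (x - s)" "1 \<le> m * (x - t)"
          using m d \<open>d \<le> x - s\<close> by (meson mult_left_mono less_imp_le order_trans)+
        then show False using x by (simp add: smooth_step_ge_1)
      qed
    qed
  qed simp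
  moreover have "compact (closure {x. ?\<eta> x \<noteq> 0})"
    using sub by (meson bounded_closed_interval bounded_subset closed_closure compact_eq_bounded_closed)
  ultimately show ?thesis using assms by (force simp: test_functions_def)
qed

text \<open>The substitution \<open>x = a + y / m\<close> moves the parameter from the kernel into
  the argument of \<open>v\<close>. Then dominated convergence applies, with continuity of
  \<open>v\<close> at \<open>a\<close> and the mass one of \<open>bump1\<close>.\<close>

lemma bump1_approximate_identity:
  fixes v :: "real \<Rightarrow> 'b::{banach, second_countable_topology}"
  assumes v: "continuous_on {0..T} v" and a: "0 < a" "a < T" and m: "filterlim m at_top sequentially" "\<And>n. 0 < m n"
  shows "(\<lambda>n. LBINT x:{0<..<T}. (m n * bump1 (m n * (x - a))) *\<^sub>R v x) \<longlonglongrightarrow> v a"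
    and "set_integrable lborel {0<..<T} (\<lambda>x. (m n * bump1 (m n * (x - a))) *\<^sub>R v x)"
proof -
  define vv where "vv = (\<lambda>x. indicator {0<..<T} x *\<^sub>R v x)"
  have vvm[measurable]: "vv \<in> borel_measurable borel"
    unfolding vv_def by (rule borel_measurable_continuous_on_indicator) (auto intro: continuous_on_subset[OF v])
  have [measurable]: "bump1 \<in> borel_measurable borel"
    by (rule borel_measurable_continuous_onI[OF continuous_bump1])
  obtain M where M: "\<And>x. x \<in> {0..T} \<Longrightarrow> norm (v x) \<le> M"
    using compact_imp_bounded[OF compact_continuous_image[OF v compact_Icc]] unfolding bounded_iff by (metis imageI)
  have Mv: "norm (vv x) \<le> \<bar>M\<bar>" for x
    using M[of x] abs_ge_self[of M] by (cases "x \<in> {0<..<T}") (simp_all add: vv_def)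
  let ?h = "\<lambda>n x. (m n * bump1 (m n * (x - a))) *\<^sub>R vv x"
  have b: "norm (bump1 y *\<^sub>R vv x) \<le> norm (bump1 y * \<bar>M\<bar>)" for x y
    unfolding norm_scaleR real_norm_def abs_mult abs_abs by (intro mult_left_mono Mv) simp
  have int: "integrable lborel (\<lambda>y. bump1 y *\<^sub>R vv (f y))" if "f \<in> borel_measurable borel" for f
    by (rule Bochner_Integration.integrable_bound[OF _ _ AE_I2[OF b]]) (use bump1_integral that in simp_all)
  have aff: "?h n (a + 1 / m n * y) = m n *\<^sub>R (bump1 y *\<^sub>R vv (a + 1 / m n * y))" for n y
    using m(2)[of n] by simp
  have "integrable lborel (\<lambda>y. ?h n (a + 1 / m n * y))" for n
    unfolding aff by (intro integrable_scaleR_right int) simp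
  then have hi: "integrable lborel (?h n)" for n
    using lborel_integrable_real_affine_iff[of "1 / m n" "?h n" a] m(2)[of n] by (metis less_irrefl zero_less_divide_1_iff)
  have seq: "indicator {0<..<T} x *\<^sub>R (m n * bump1 (m n * (x - a))) *\<^sub>R v x = ?h n x" for n x
    by (simp add: vv_def)
  show "set_integrable lborel {0<..<T} (\<lambda>x. (m n * bump1 (m n * (x - a))) *\<^sub>R v x)"
    unfolding set_integrable_def seq by (rule hi)
  have eq: "(LBINT x:{0<..<T}. (m n * bump1 (m n * (x - a))) *\<^sub>R v x) = (LBINT y. bump1 y *\<^sub>R vv (a + 1 / m n * y))" for n
  proof -
    have "integral\<^sup>L lborel (?h n) = \<bar>1 / m n\<bar> *\<^sub>R (LBINT y. ?h n (a + 1 / m n * y))"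
      by (rule lborel_integral_real_affine) (use m(2)[of n] in auto)
    also have "\<dots> = (LBINT y. bump1 y *\<^sub>R vv (a + 1 / m n * y))"
      unfolding aff integral_scaleR_right using m(2)[of n] by simp
    finally show ?thesis unfolding set_lebesgue_integral_def seq .
  qed
  have "(\<lambda>n. LBINT y. bump1 y *\<^sub>R vv (a + 1 / m n * y)) \<longlonglongrightarrow> (LBINT y. bump1 y *\<^sub>R vv a)"
  proof (rule integral_dominated_convergence[where w = "\<lambda>y. norm (bump1 y * \<bar>M\<bar>)"])
    show "AE y in lborel. (\<lambda>n. bump1 y *\<^sub>R vv (a + 1 / m n * y)) \<longlonglongrightarrow> bump1 y *\<^sub>R vv a"
    proof (rule AE_I2)
      fix y
      have "(\<lambda>n. inverse (m n)) \<longlonglongrightarrow> 0"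
        using m(1) by (rule tendsto_inverse_0_at_top)
      then have l: "(\<lambda>n. a + 1 / m n * y) \<longlonglongrightarrow> a + 0 * y"
        unfolding inverse_eq_divide by (intro tendsto_intros)
      have "continuous_on {0<..<T} vv"
        using continuous_on_subset[OF v, of "{0<..<T}"] by (rule continuous_on_cong[THEN iffD1, rotated -1]) (auto simp: vv_def)
      then have "isCont vv a" using a by (simp add: continuous_on_eq_continuous_at)
      from isCont_tendsto_compose[OF this, of "\<lambda>n. a + 1 / m n * y" sequentially] l
      show "(\<lambda>n. bump1 y *\<^sub>R vv (a + 1 / m n * y)) \<longlonglongrightarrow> bump1 y *\<^sub>R vv a"
        by (intro tendsto_scaleR tendsto_const) simp
    qed
  qed (use bump1_integral b in \<open>auto\<close>)
  also have "(LBINT y. bump1 y *\<^sub>R vv a) = v a"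
    using bump1_integral a by (simp add: vv_def)
  finally show "(\<lambda>n. LBINT x:{0<..<T}. (m n * bump1 (m n * (x - a))) *\<^sub>R v x) \<longlonglongrightarrow> v a"
    unfolding eq .
qed

text \<open>The du Bois-Reymond lemma: a continuous function is a primitive of its weak derivative.\<close>

lemma weak_time_deriv_increment:
  fixes v w :: "real \<Rightarrow> 'b::{banach, second_countable_topology}"
  assumes vw: "has_weak_time_deriv T v w" and v: "continuous_on {0..T} v" and st: "0 < s" "s < t" "t < T"
  shows "v t - v s = (LBINT r:{s..t}. w r)"
proof -
  define d where "d = (T - t) / 2"
  \<comment> \<open>The slopes tend to infinity but are never below \<open>1 / d\<close>, so that
    every ramp fits into the margin \<open>d\<close> to the right of \<open>t\<close>.\<close>
  define m where "m n = (1 + real n) / d" for n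
  define \<eta> where "\<eta> n x = smooth_step (m n * (x - s)) - smooth_step (m n * (x - t))" for n x
  have d: "0 < d" "t + d < T" using st by (auto simp: d_def field_simps)
  have mpos: "0 < m n" "1 / d \<le> m n" for n using d by (auto simp: m_def divide_right_mono)
  have "filterlim (\<lambda>n. (1 + real n) * (1 / d)) at_top sequentially"
    by (intro filterlim_at_top_mult_tendsto_pos[OF tendsto_const] filterlim_tendsto_add_at_top[OF tendsto_const]
        filterlim_real_sequentially) (use d in auto)
  then have mlim: "filterlim m at_top sequentially" by (simp add: m_def[abs_def])
  have test: "\<eta> n \<in> test_functions {0<..<T}" for n
    unfolding \<eta>_def using st d mpos by (intro test_function_step_difference[of s t d])
  have der: "deriv (\<eta> n) x = m n * bump1 (m n * (x - s)) - m n * bump1 (m n * (x - t))" for n x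
  proof (rule DERIV_imp_deriv)
    show "(\<eta> n has_real_derivative m n * bump1 (m n * (x - s)) - m n * bump1 (m n * (x - t))) (at x)"
      unfolding \<eta>_def
      by (auto intro!: derivative_eq_intros DERIV_chain2[OF smooth_step_DERIV])
  qed
  have ss: "s < T" "0 < t" using st by auto
  note A = bump1_approximate_identity[OF v _ _ mlim mpos(1)]
  \<comment> \<open>The derivative of the test function is a difference of two approximate point
    masses, at \<open>s\<close> and at \<open>t\<close>.\<close>
  have "(\<lambda>n. LBINT x:{0<..<T}. deriv (\<eta> n) x *\<^sub>R v x) \<longlonglongrightarrow> v s - v t"
    unfolding der scaleR_diff_left
    by (subst set_integral_diff(2)) (intro A tendsto_diff st ss)+
  then have L: "(\<lambda>n. - (LBINT x:{0<..<T}. \<eta> n x *\<^sub>R w x)) \<longlonglongrightarrow> v s - v t"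
    using vw test by (simp add: has_weak_time_deriv_def)
  have wi: "set_integrable lborel {s..t + d} w"
    using vw st d unfolding has_weak_time_deriv_def by auto
  define ww where "ww = (\<lambda>x. indicator {s..t + d} x *\<^sub>R w x)"
  have wwi: "integrable lborel ww" using wi by (simp add: ww_def set_integrable_def)
  note [measurable] = borel_measurable_integrable[OF wwi, simplified]
  have \<eta>m[measurable]: "\<eta> n \<in> borel_measurable borel" for n
  proof (rule borel_measurable_continuous_onI)
    show "continuous_on UNIV (\<eta> n)"
      using test[of n] unfolding test_functions_def smooth_on_def
      by (metis (no_types, lifting) Ck_on.simps(1) mem_Collect_eq)
  qed
  have \<eta>0: "\<eta> n x = 0" if "x \<notin> {s..t + d}" for n x
  proof (cases "x < s")
    case True
    then have "m n * (x - s) \<le> 0" "m n * (x - t) \<le> 0" using mpos(1)[of n] st by (auto intro!: mult_nonneg_nonpos)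
    then show ?thesis by (simp add: \<eta>_def smooth_step_le_0)
  next
    case False
    then have xd: "d \<le> x - t" "d \<le> x - s" using that st by auto
    have "1 \<le> m n * d" using mpos(2)[of n] d by (simp add: field_simps)
    then have "1 \<le> m n * (x - s)" "1 \<le> m n * (x - t)"
      using mpos(1)[of n] xd by (meson mult_left_mono less_imp_le order_trans)+
    then show ?thesis by (simp add: \<eta>_def smooth_step_ge_1)
  qed
  have eq: "(LBINT x:{0<..<T}. \<eta> n x *\<^sub>R w x) = (LBINT x. \<eta> n x *\<^sub>R ww x)" for n
    unfolding set_lebesgue_integral_def
  proof (intro Bochner_Integration.integral_cong refl)
    fix x
    show "indicator {0<..<T} x *\<^sub>R \<eta> n x *\<^sub>R w x = \<eta> n x *\<^sub>R ww x"
      using \<eta>0[of x n] st d by (cases "x \<in> {s..t + d}") (auto simp: ww_def)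
  qed
  \<comment> \<open>The ramps lie to the right of their base points, so the pointwise limit is the
    indicator of an interval open at \<open>s\<close> and closed at \<open>t\<close>.\<close>
  have "(\<lambda>n. LBINT x. \<eta> n x *\<^sub>R ww x) \<longlonglongrightarrow> (LBINT x. indicator {s<..t} x *\<^sub>R ww x)"
  proof (rule integral_dominated_convergence[where w = "\<lambda>x. norm (ww x)"])
    show "AE x in lborel. norm (\<eta> n x *\<^sub>R ww x) \<le> norm (ww x)" for n
    proof (rule AE_I2)
      fix x
      have "\<bar>\<eta> n x\<bar> \<le> 1"
        using smooth_step_bounds[of "m n * (x - s)"] smooth_step_bounds[of "m n * (x - t)"] by (simp add: \<eta>_def)
      then show "norm (\<eta> n x *\<^sub>R ww x) \<le> norm (ww x)"
        by (simp add: mult_left_le_one_le)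
    qed
    show "AE x in lborel. (\<lambda>n. \<eta> n x *\<^sub>R ww x) \<longlonglongrightarrow> indicator {s<..t} x *\<^sub>R ww x"
    proof (rule AE_I2)
      fix x
      have step: "\<forall>\<^sub>F n in sequentially. smooth_step (m n * (x - a)) = (if a < x then 1 else 0)" for a
      proof (cases "a < x")
        case True
        have "\<forall>\<^sub>F n in sequentially. 1 / (x - a) \<le> m n"
          using mlim by (simp add: filterlim_at_top)
        then show ?thesis
          by eventually_elim (use True in \<open>simp add: field_simps smooth_step_ge_1\<close>)
      next
        case False
        then have "m n * (x - a) \<le> 0" for n using mpos(1)[of n] by (intro mult_nonneg_nonpos) auto
        then show ?thesis using False by (simp add: smooth_step_le_0)
      qed
      have "\<forall>\<^sub>F n in sequentially. \<eta> n x *\<^sub>R ww x = indicator {s<..t} x *\<^sub>R ww x"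
        using step[of s] step[of t]
      proof eventually_elim
        case (elim n)
        then have "\<eta> n x = indicator {s<..t} x" using st by (auto simp: \<eta>_def indicator_def)
        then show ?case by simp
      qed
      then show "(\<lambda>n. \<eta> n x *\<^sub>R ww x) \<longlonglongrightarrow> indicator {s<..t} x *\<^sub>R ww x"
        by (rule tendsto_eventually)
    qed
  qed (use wwi in simp_all)
  then have "(\<lambda>n. - (LBINT x:{0<..<T}. \<eta> n x *\<^sub>R w x)) \<longlonglongrightarrow> - (LBINT x. indicator {s<..t} x *\<^sub>R ww x)"
    unfolding eq by (rule tendsto_minus)
  then have "v s - v t = - (LBINT x. indicator {s<..t} x *\<^sub>R ww x)"
    by (rule LIMSEQ_unique[OF L])
  also have "(LBINT x. indicator {s<..t} x *\<^sub>R ww x) = (LBINT x:{s..t}. w x)"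
    unfolding set_lebesgue_integral_def
  proof (rule integral_cong_AE)
    have i: "integrable lborel (\<lambda>x. indicator {s..t} x *\<^sub>R w x)"
      using set_integrable_subset[OF wi, of "{s..t}"] d by (auto simp: set_integrable_def)
    then show "(\<lambda>x. indicator {s..t} x *\<^sub>R w x) \<in> borel_measurable lborel" by (rule borel_measurable_integrable)
    show "AE x in lborel. indicator {s<..t} x *\<^sub>R ww x = indicator {s..t} x *\<^sub>R w x"
      using AE_lborel_singleton[of s] by eventually_elim (use d in \<open>auto simp: ww_def indicator_def\<close>)
  qed simp
  finally show ?thesis by (metis minus_diff_eq minus_minus)
qed

section \<open>Weak derivatives in space\<close>

lemma inner_abs_L2_right:
  "square_integrable f \<Longrightarrow> inner v (abs_L2 f) = (LINT x|lborel. rep_L2 v x * f x)"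
  using inner_abs_L2[OF rep_L2_square_integrable[of v], of f] by (simp add: abs_rep_L2)

lemma rep_L2_measurable[measurable]: "rep_L2 v \<in> borel_measurable borel"
  using rep_L2_square_integrable[of v] by (simp add: square_integrable_def)

text \<open>As an orthogonal complement, \<open>L2_on \<Omega>\<close> is visibly a closed subspace,
  and membership passes through Bochner integrals without a choice of representatives.\<close>

lemma L2_on_iff_orthogonal:
  fixes \<Omega> :: "'a::euclidean_space set"
  assumes "open \<Omega>"
  shows "v \<in> L2_on \<Omega> \<longleftrightarrow> (\<forall>z\<in>L2_on (- \<Omega>). inner v z = 0)"
proof
  assume v: "v \<in> L2_on \<Omega>"
  show "\<forall>z\<in>L2_on (- \<Omega>). inner v z = 0"
  proof
    fix z assume z: "z \<in> L2_on (- \<Omega>)"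
    have "AE x in lborel. rep_L2 v x * rep_L2 z x = 0"
      using v[unfolded L2_on_def, simplified] z[unfolded L2_on_def, simplified]
      by eventually_elim auto
    then show "inner v z = 0"
      unfolding inner_L2_rep by (rule integral_eq_zero_AE)
  qed
next
  assume orth: "\<forall>z\<in>L2_on (- \<Omega>). inner v z = 0"
  have [measurable]: "\<Omega> \<in> sets borel" using assms by simp
  define f where "f x = indicator (- \<Omega>) x * rep_L2 v x" for x
  have f2: "(f x)\<^sup>2 = indicator (- \<Omega>) x *\<^sub>R (rep_L2 v x)\<^sup>2" "rep_L2 v x * f x = (f x)\<^sup>2" for x
    by (auto simp: f_def indicator_def power2_eq_square)
  have "integrable lborel (\<lambda>x. (f x)\<^sup>2)"
    unfolding f2 using rep_L2_square_integrable[of v]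
    by (intro integrable_mult_indicator) (auto simp: square_integrable_def)
  then have sq: "square_integrable f"
    by (simp add: square_integrable_def f_def[abs_def])
  have "abs_L2 f \<in> L2_on (- \<Omega>)"
    unfolding L2_on_def mem_Collect_eq using rep_abs_L2[OF sq] by eventually_elim (auto simp: f_def)
  then have "inner v (abs_L2 f) = 0" using orth by blast
  then have "(LINT x|lborel. (f x)\<^sup>2) = 0"
    unfolding inner_abs_L2_right[OF sq] f2(2) .
  then have "AE x in lborel. (f x)\<^sup>2 = 0"
    using integral_nonneg_eq_0_iff_AE[of lborel "\<lambda>x. (f x)\<^sup>2"] sq by (auto simp: square_integrable_def)
  then show "v \<in> L2_on \<Omega>"
    unfolding L2_on_def mem_Collect_eq by eventually_elim (auto simp: f_def indicator_def)
qed

lemma subspace_L2_on: "open \<Omega> \<Longrightarrow> subspace (L2_on \<Omega>)"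
  unfolding subspace_def by (auto simp: L2_on_iff_orthogonal inner_add_left)

lemma closed_L2_on:
  fixes \<Omega> :: "'a::euclidean_space set"
  assumes "open \<Omega>"
  shows "closed (L2_on \<Omega>)"
proof -
  have "L2_on \<Omega> = (\<Inter>z\<in>L2_on (- \<Omega>). {v. inner v z = 0})"
    using L2_on_iff_orthogonal[OF assms] by auto
  also have "closed \<dots>"
    by (intro closed_INT ballI closed_Collect_eq continuous_intros)
  finally show ?thesis .
qed

lemma set_integral_inner_left:
  fixes f :: "'c \<Rightarrow> 'b::{real_inner, banach, second_countable_topology}"
  assumes "set_integrable M A f"
  shows "inner (LINT x:A|M. f x) z = (LINT x:A|M. inner (f x) z)"
  using assms integral_inner_left[where f = "\<lambda>x. indicator A x *\<^sub>R f x" and c = z]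
  by (cases "z = 0") (simp_all add: set_integrable_def set_lebesgue_integral_def)

lemma L2_on_set_integral:
  assumes "open \<Omega>" and f: "set_integrable M A f" and "AE x in M. x \<in> A \<longrightarrow> f x \<in> L2_on \<Omega>"
  shows "(LINT x:A|M. f x) \<in> L2_on \<Omega>"
  unfolding L2_on_iff_orthogonal[OF assms(1)]
proof
  fix z assume z: "z \<in> L2_on (- \<Omega>)"
  have "inner (LINT x:A|M. f x) z = (LINT x:A|M. inner (f x) z)"
    by (rule set_integral_inner_left[OF f])
  also have "\<dots> = 0"
    unfolding set_lebesgue_integral_def
  proof (rule integral_eq_zero_AE)
    show "AE x in M. indicator A x *\<^sub>R inner (f x) z = 0"
      using assms(3) by eventually_elim (use z assms(1) in \<open>auto simp: L2_on_iff_orthogonal indicator_def\<close>)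
  qed
  finally show "inner (LINT x:A|M. f x) z = 0" .
qed

section \<open>Calculus of test functions\<close>

abbreviation dir_deriv :: "'a::euclidean_space \<Rightarrow> ('a \<Rightarrow> real) \<Rightarrow> 'a \<Rightarrow> real"
  where "dir_deriv b \<psi> \<equiv> \<lambda>x. frechet_derivative \<psi> (at x) b"

lemma dir_deriv_eqI: "(\<psi> has_derivative D) (at x) \<Longrightarrow> dir_deriv b \<psi> x = D b"
  by (drule frechet_derivative_at) simp

lemma Ck_on_linear_comb:
  "Ck_on k UNIV f \<Longrightarrow> Ck_on k UNIV g \<Longrightarrow> Ck_on k UNIV (\<lambda>x. c * f x + d * g x)"
proof (induction k arbitrary: f g)
  case 0
  then show ?case by (auto intro!: continuous_intros)
next
  case (Suc k)
  have D: "((\<lambda>x. c * f x + d * g x) has_derivative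
      (\<lambda>b. c * frechet_derivative f (at x) b + d * frechet_derivative g (at x) b)) (at x)" for x
    using Suc.prems frechet_derivative_works by (auto intro!: derivative_intros)
  have "dir_deriv b (\<lambda>x. c * f x + d * g x) = (\<lambda>x. c * dir_deriv b f x + d * dir_deriv b g x)" for b
    using dir_deriv_eqI[OF D] by blast
  moreover have "(\<lambda>x. c * f x + d * g x) differentiable at x" for x
    using D by (auto simp: differentiable_def)
  ultimately show ?case using Suc by simp
qed

lemma test_functions_derivative:
  assumes "\<psi> \<in> test_functions \<Omega>"
  shows "(\<psi> has_derivative frechet_derivative \<psi> (at x)) (at x)"
    and "continuous_on UNIV \<psi>"
    and "b \<in> Basis \<Longrightarrow> continuous_on UNIV (dir_deriv b \<psi>)"
    and "x \<notin> closure {x. \<psi> x \<noteq> 0} \<Longrightarrow> \<psi> x = 0"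
    and "x \<notin> closure {x. \<psi> x \<noteq> 0} \<Longrightarrow> dir_deriv b \<psi> x = 0"
    and "compact (closure {x. \<psi> x \<noteq> 0})" "closure {x. \<psi> x \<noteq> 0} \<subseteq> \<Omega>"
proof -
  have "Ck_on 1 UNIV \<psi>" "Ck_on 0 UNIV \<psi>" using assms by (auto simp: test_functions_def smooth_on_def)
  then show "(\<psi> has_derivative frechet_derivative \<psi> (at x)) (at x)"
    and "continuous_on UNIV \<psi>"
    and "b \<in> Basis \<Longrightarrow> continuous_on UNIV (dir_deriv b \<psi>)"
    by (simp_all flip: frechet_derivative_works)
  show *: "x \<notin> closure {x. \<psi> x \<noteq> 0} \<Longrightarrow> \<psi> x = 0" for x
    using closure_subset[of "{x. \<psi> x \<noteq> 0}"] by blast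
  show "dir_deriv b \<psi> x = 0" if "x \<notin> closure {x. \<psi> x \<noteq> 0}"
  proof -
    have "((\<lambda>_. 0) has_derivative (\<lambda>_. 0)) (at x)" by simp
    moreover have "open (- closure {x. \<psi> x \<noteq> 0})" "x \<in> - closure {x. \<psi> x \<noteq> 0}" using that by auto
    ultimately have "(\<psi> has_derivative (\<lambda>_. 0)) (at x)"
      by (rule has_derivative_transform_within_open) (metis * ComplD)
    then show ?thesis by (rule dir_deriv_eqI)
  qed
qed (use assms in \<open>auto simp: test_functions_def\<close>)

lemma test_functions_linear_comb:
  assumes f: "f \<in> test_functions \<Omega>" and g: "g \<in> test_functions \<Omega>"
  shows "(\<lambda>x. c * f x + d * g x) \<in> test_functions \<Omega>"
    and "dir_deriv b (\<lambda>x. c * f x + d * g x) x = c * dir_deriv b f x + d * dir_deriv b g x"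
proof -
  let ?K = "closure {x. f x \<noteq> 0} \<union> closure {x. g x \<noteq> 0}"
  have sub: "closure {x. c * f x + d * g x \<noteq> 0} \<subseteq> ?K"
  proof (rule closure_minimal)
    have "{x. c * f x + d * g x \<noteq> 0} \<subseteq> {x. f x \<noteq> 0} \<union> {x. g x \<noteq> 0}" by auto
    also have "\<dots> \<subseteq> ?K" by (intro Un_mono closure_subset)
    finally show "{x. c * f x + d * g x \<noteq> 0} \<subseteq> ?K" .
  qed auto
  have "compact ?K" "?K \<subseteq> \<Omega>"
    using test_functions_derivative(6,7)[OF f] test_functions_derivative(6,7)[OF g] by auto
  with sub have "compact (closure {x. c * f x + d * g x \<noteq> 0})" "closure {x. c * f x + d * g x \<noteq> 0} \<subseteq> \<Omega>"
    by (meson closed_closure closed_subset compact_eq_bounded_closed bounded_subset subset_trans)+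
  then show "(\<lambda>x. c * f x + d * g x) \<in> test_functions \<Omega>"
    using f g by (simp add: test_functions_def smooth_on_def Ck_on_linear_comb)
  show "dir_deriv b (\<lambda>x. c * f x + d * g x) x = c * dir_deriv b f x + d * dir_deriv b g x"
    by (rule dir_deriv_eqI) (auto intro!: derivative_intros test_functions_derivative(1)[OF f] test_functions_derivative(1)[OF g])
qed

lemma square_integrable_dir_deriv:
  assumes "\<psi> \<in> test_functions \<Omega>" "b \<in> Basis"
  shows "square_integrable (dir_deriv b \<psi>)"
  by (rule square_integrable_compact_support[OF test_functions_derivative(3)[OF assms]
        test_functions_derivative(6,5)[OF assms(1)]])

lemma test_functions_L2_on:
  assumes "\<psi> \<in> test_functions \<Omega>"
  shows "abs_L2 \<psi> \<in> L2_on \<Omega>" "b \<in> Basis \<Longrightarrow> abs_L2 (dir_deriv b \<psi>) \<in> L2_on \<Omega>"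
proof -
  note t = test_functions_derivative[OF assms]
  have z: "\<psi> x = 0" "dir_deriv b \<psi> x = 0" if "x \<notin> \<Omega>" for x b
    using t(4,5,7) that by blast+
  show "abs_L2 \<psi> \<in> L2_on \<Omega>"
    unfolding L2_on_def mem_Collect_eq using rep_abs_L2[OF test_functions_square_integrable[OF assms]]
    by eventually_elim (simp add: z)
  show "abs_L2 (dir_deriv b \<psi>) \<in> L2_on \<Omega>" if "b \<in> Basis"
    unfolding L2_on_def mem_Collect_eq using rep_abs_L2[OF square_integrable_dir_deriv[OF assms that]]
    by eventually_elim (simp add: z)
qed

lemma integrable_compact_support:
  fixes f :: "'a::euclidean_space \<Rightarrow> real"
  assumes "continuous_on UNIV f" "compact K" "\<And>x. x \<notin> K \<Longrightarrow> f x = 0"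
  shows "integrable lborel f"
proof -
  have "integrable lborel (\<lambda>x. indicator K x *\<^sub>R f x)"
    using assms(1,2) by (intro borel_integrable_compact) (auto intro: continuous_on_subset)
  also have "(\<lambda>x. indicator K x *\<^sub>R f x) = f"
  proof
    show "indicator K x *\<^sub>R f x = f x" for x
      using assms(3)[of x] by (cases "x \<in> K") auto
  qed
  finally show ?thesis .
qed

text \<open>The integral of the difference quotient of a function vanishes by translation invariance.\<close>

lemma integral_directional_derivative_eq_0:
  fixes F :: "'a::euclidean_space \<Rightarrow> real"
  assumes D: "\<And>x. (F has_derivative F' x) (at x)" and c: "continuous_on UNIV (\<lambda>x. F' x b)"
    and K: "compact K" "\<And>x. x \<notin> K \<Longrightarrow> F x = 0"  "\<And>x. x \<notin> K \<Longrightarrow> F' x b = 0"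
  shows "(LINT x|lborel. F' x b) = 0"
proof -
  have cF: "continuous_on UNIV F"
    using D has_derivative_continuous continuous_at_imp_continuous_on by blast
  have iF: "integrable lborel F" by (rule integrable_compact_support[OF cF K(1,2)])
  have [measurable]: "F \<in> borel_measurable borel" by (rule borel_measurable_continuous_onI[OF cF])
  obtain M where M: "\<And>x. x \<in> K \<Longrightarrow> \<bar>F' x b\<bar> \<le> M"
    using compact_imp_bounded[OF compact_continuous_image[OF continuous_on_subset[OF c, of K] K(1)]]
    unfolding bounded_iff by auto
  have M': "\<bar>F' x b\<bar> \<le> \<bar>M\<bar>" for x
    using M[of x] K(3)[of x] by (cases "x \<in> K") auto
  \<comment> \<open>A difference quotient with step at most \<open>1\<close> vanishes outside the
    set swept by \<open>K\<close> along \<open>- b\<close>; this compact set carries an integrable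
    majorant for all of them.\<close>
  define K' where "K' = (\<lambda>(x, t). x - t *\<^sub>R b) ` (K \<times> {0..1})"
  have K': "compact K'"
    unfolding K'_def by (intro compact_continuous_image compact_Times K(1) compact_Icc)
      (auto simp: case_prod_beta' intro!: continuous_intros)
  define h where "h n = 1 / (1 + real n)" for n
  have h: "0 < h n" "h n \<le> 1" for n by (auto simp: h_def)
  define q where "q n x = (F (x + h n *\<^sub>R b) - F x) / h n" for n x
  have q0: "integral\<^sup>L lborel (q n) = 0" for n
  proof -
    have t: "integrable lborel (\<lambda>x. F (x + h n *\<^sub>R b))" "(LINT x|lborel. F (x + h n *\<^sub>R b)) = integral\<^sup>L lborel F"
      using integrable_distr_eq[of "(+) (h n *\<^sub>R b)" lborel borel F] integral_distr[of "(+) (h n *\<^sub>R b)" lborel borel F]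
        iF unfolding lborel_distr_plus by (simp_all add: add.commute[of _ "h n *\<^sub>R b"])
    show ?thesis unfolding q_def by (simp add: t iF)
  qed
  have der: "((\<lambda>t. F (x + t *\<^sub>R b)) has_real_derivative F' (x + t *\<^sub>R b) b) (at t)" for x t
  proof -
    have "((\<lambda>t. x + t *\<^sub>R b) has_derivative (\<lambda>t. t *\<^sub>R b)) (at t)"
      by (auto intro!: derivative_eq_intros)
    from has_derivative_compose[OF this D]
    have "((\<lambda>t. F (x + t *\<^sub>R b)) has_derivative (\<lambda>s. F' (x + t *\<^sub>R b) (s *\<^sub>R b))) (at t)" .
    moreover have "F' (x + t *\<^sub>R b) (s *\<^sub>R b) = F' (x + t *\<^sub>R b) b * s" for s
      using linear_scale[OF has_derivative_linear[OF D[of "x + t *\<^sub>R b"]], of s b] by simp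
    ultimately show ?thesis unfolding has_field_derivative_def by (simp add: fun_eq_iff)
  qed
  have "(\<lambda>n. integral\<^sup>L lborel (q n)) \<longlonglongrightarrow> (LINT x|lborel. F' x b)"
  proof (rule integral_dominated_convergence[where w = "\<lambda>x. \<bar>M\<bar> * indicator K' x"])
    show "AE x in lborel. (\<lambda>n. q n x) \<longlonglongrightarrow> F' x b"
    proof (rule AE_I2)
      fix x
      have "((\<lambda>t. F (x + t *\<^sub>R b)) has_real_derivative F' x b) (at 0)"
        using der[of x 0] by simp
      then have l: "((\<lambda>t. (F (x + t *\<^sub>R b) - F x) / t) \<longlongrightarrow> F' x b) (at 0)"
        by (simp add: DERIV_def)
      have "h \<longlonglongrightarrow> 0"
        using LIMSEQ_inverse_real_of_nat by (simp add: h_def[abs_def] inverse_eq_divide add.commute)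
      then have "filterlim h (at 0) sequentially"
        using h(1) by (auto simp: filterlim_at less_imp_neq[symmetric])
      from filterlim_compose[OF l this] show "(\<lambda>n. q n x) \<longlonglongrightarrow> F' x b"
        by (simp add: q_def)
    qed
    show "AE x in lborel. norm (q n x) \<le> \<bar>M\<bar> * indicator K' x" for n
    proof (rule AE_I2)
      fix x
      obtain z where z: "0 < z" "z < h n" "F (x + h n *\<^sub>R b) - F (x + 0 *\<^sub>R b) = (h n - 0) * F' (x + z *\<^sub>R b) b"
        using MVT2[OF h(1)[of n], of "\<lambda>t. F (x + t *\<^sub>R b)" "\<lambda>t. F' (x + t *\<^sub>R b) b"] der by blast
      then have qz: "q n x = F' (x + z *\<^sub>R b) b" using h(1)[of n] by (simp add: q_def field_simps)
      show "norm (q n x) \<le> \<bar>M\<bar> * indicator K' x"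
      proof (cases "x + z *\<^sub>R b \<in> K")
        case True
        then have "x \<in> K'"
          unfolding K'_def using z h(2)[of n] by (intro image_eqI[of _ _ "(x + z *\<^sub>R b, z)"]) auto
        then show ?thesis using M' qz by simp
      next
        case False
        then show ?thesis using K(3) qz by simp
      qed
    qed
    show "integrable lborel (\<lambda>x. \<bar>M\<bar> * indicator K' x)"
      using K' emeasure_bounded_finite[OF compact_imp_bounded[OF K']]
      by (intro integrable_mult_right integrable_real_indicator) (auto simp: borel_compact)
    show "(\<lambda>x. F' x b) \<in> borel_measurable lborel"
      using borel_measurable_continuous_onI[OF c] by simp
    show "q n \<in> borel_measurable lborel" for n
    proof -
      have "continuous_on UNIV (\<lambda>x. F (x + h n *\<^sub>R b))"
        by (rule continuous_on_compose2[OF cF]) (auto intro!: continuous_intros)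
      then have "continuous_on UNIV (q n)"
        unfolding q_def[abs_def] using h(1)[of n] by (intro continuous_on_divide continuous_on_diff cF continuous_on_const) auto
      then show ?thesis by (simp add: borel_measurable_continuous_onI)
    qed
  qed
  then show ?thesis by (simp add: q0 LIMSEQ_const_iff)
qed

lemma test_functions_integration_by_parts:
  assumes f: "f \<in> test_functions \<Omega>" and g: "g \<in> test_functions \<Omega>" and b: "b \<in> Basis"
  shows "(LINT x|lborel. f x * dir_deriv b g x) = - (LINT x|lborel. dir_deriv b f x * g x)"
proof -
  note F = test_functions_derivative[OF f] and G = test_functions_derivative[OF g]
  have "(LINT x|lborel. f x * dir_deriv b g x + dir_deriv b f x * g x) = 0"
  proof (rule integral_directional_derivative_eq_0)
    show "((\<lambda>x. f x * g x) has_derivative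
        (\<lambda>b. f x * frechet_derivative g (at x) b + frechet_derivative f (at x) b * g x)) (at x)" for x
      by (rule has_derivative_mult[OF F(1) G(1)])
    show "compact (closure {x. f x \<noteq> 0})" by (rule F(6))
    show "continuous_on UNIV (\<lambda>x. f x * dir_deriv b g x + dir_deriv b f x * g x)"
      by (intro continuous_on_add continuous_on_mult F(2) G(2) F(3) G(3) b)
    fix x assume "x \<notin> closure {x. f x \<noteq> 0}"
    then show "f x * g x = 0" "f x * dir_deriv b g x + dir_deriv b f x * g x = 0"
      using F(4)[of x] F(5)[of x b] by simp_all
  qed
  moreover have i1: "integrable lborel (\<lambda>x. f x * dir_deriv b g x)"
    by (rule square_integrable_mult[OF test_functions_square_integrable[OF f] square_integrable_dir_deriv[OF g b]])
  moreover have i2: "integrable lborel (\<lambda>x. dir_deriv b f x * g x)"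
    by (rule square_integrable_mult[OF square_integrable_dir_deriv[OF f b] test_functions_square_integrable[OF g]])
  ultimately have "(LINT x|lborel. f x * dir_deriv b g x) + (LINT x|lborel. dir_deriv b f x * g x) = 0"
    unfolding Bochner_Integration.integral_add[OF i1 i2] by simp
  then show ?thesis by linarith
qed

lemma has_weak_deriv_iff:
  assumes "b \<in> Basis"
  shows "has_weak_deriv \<Omega> b v w \<longleftrightarrow> v \<in> L2_on \<Omega> \<and> w \<in> L2_on \<Omega> \<and>
    (\<forall>\<psi>\<in>test_functions \<Omega>. inner v (abs_L2 (dir_deriv b \<psi>)) = - inner w (abs_L2 \<psi>))"
proof -
  have "(LINT x|lborel. rep_L2 v x * dir_deriv b \<psi> x) = inner v (abs_L2 (dir_deriv b \<psi>))"
    "(LINT x|lborel. rep_L2 w x * \<psi> x) = inner w (abs_L2 \<psi>)" if "\<psi> \<in> test_functions \<Omega>" for \<psi>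
    using square_integrable_dir_deriv[OF that assms] test_functions_square_integrable[OF that]
    by (simp_all add: inner_abs_L2_right)
  then show ?thesis unfolding has_weak_deriv_def by simp
qed

lemma has_weak_deriv_test_function:
  assumes f: "f \<in> test_functions \<Omega>" and b: "b \<in> Basis"
  shows "has_weak_deriv \<Omega> b (abs_L2 f) (abs_L2 (dir_deriv b f))"
  unfolding has_weak_deriv_iff[OF b]
proof (intro conjI ballI test_functions_L2_on[OF f] b)
  fix \<psi> assume t: "\<psi> \<in> test_functions \<Omega>"
  show "inner (abs_L2 f) (abs_L2 (dir_deriv b \<psi>)) = - inner (abs_L2 (dir_deriv b f)) (abs_L2 \<psi>)"
    unfolding inner_abs_L2[OF test_functions_square_integrable[OF f] square_integrable_dir_deriv[OF t b]]
      inner_abs_L2[OF square_integrable_dir_deriv[OF f b] test_functions_square_integrable[OF t]]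
    by (rule test_functions_integration_by_parts[OF f t b])
qed

lemma eps_le_imp_eq_0:
  fixes x C :: real
  assumes "\<And>e. 0 < e \<Longrightarrow> \<bar>x\<bar> \<le> C * e" "0 \<le> C"
  shows "x = 0"
proof -
  have "\<bar>x\<bar> \<le> 0 + e" if "0 < e" for e
  proof -
    have "\<bar>x\<bar> \<le> C * (e / (C + 1))" using assms that by (intro assms) auto
    also have "\<dots> \<le> e" using assms(2) that by (simp add: field_simps)
    finally show ?thesis by simp
  qed
  then have "\<bar>x\<bar> \<le> 0" by (rule field_le_epsilon)
  then show ?thesis by simp
qed

section \<open>Weak derivatives, the space \<open>H10\<close> and the Dirichlet form\<close>

locale dirichlet_problem =
  fixes \<Omega> :: "'a::euclidean_space set" and lam :: "nat \<Rightarrow> real" and \<phi> :: "nat \<Rightarrow> 'a L2"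
  assumes open_domain: "open \<Omega>" and eigensystem: "dirichlet_eigensystem \<Omega> lam \<phi>"
begin

lemma lam_pos: "0 < lam i"
  and \<phi>_H2: "\<phi> i \<in> H2 \<Omega>" and \<phi>_H10: "\<phi> i \<in> H10 \<Omega>"
  and laplacian_\<phi>: "- laplacian \<Omega> (\<phi> i) = lam i *\<^sub>R \<phi> i"
  and inner_\<phi>: "inner (\<phi> i) (\<phi> j) = (if i = j then 1 else 0)"
  and complete: "v \<in> L2_on \<Omega> \<Longrightarrow> (\<And>i. inner v (\<phi> i) = 0) \<Longrightarrow> v = 0"
  using eigensystem by (auto simp: dirichlet_eigensystem_def)

lemma \<phi>_L2_on: "\<phi> i \<in> L2_on \<Omega>"
  using \<phi>_H2 by (auto simp: H2_def H1_def)

text \<open>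
  The eigenfunctions lie in the closure of the test functions and form a complete system, so that
  the density of the test functions needs no mollifiers.
\<close>

lemma test_functions_dense:
  assumes w: "w \<in> L2_on \<Omega>" and orth: "\<And>\<psi>. \<psi> \<in> test_functions \<Omega> \<Longrightarrow> inner w (abs_L2 \<psi>) = 0"
  shows "w = 0"
proof (rule complete[OF w])
  fix i
  show "inner w (\<phi> i) = 0"
  proof (rule eps_le_imp_eq_0)
    fix e :: real assume "0 < e"
    then obtain \<psi> where \<psi>: "\<psi> \<in> test_functions \<Omega>" "norm_H1 \<Omega> (\<phi> i - abs_L2 \<psi>) < e"
      using \<phi>_H10[of i] by (auto simp: H10_def)
    have "norm (\<phi> i - abs_L2 \<psi>) \<le> norm_H1 \<Omega> (\<phi> i - abs_L2 \<psi>)"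
      unfolding norm_H1_def by (rule real_le_rsqrt) (simp add: sum_nonneg)
    then have n: "norm (\<phi> i - abs_L2 \<psi>) \<le> e" using \<psi>(2) by simp
    have "inner w (\<phi> i) = inner w (\<phi> i - abs_L2 \<psi>)"
      using orth[OF \<psi>(1)] by (simp add: inner_diff_right)
    also have "\<bar>\<dots>\<bar> \<le> norm w * norm (\<phi> i - abs_L2 \<psi>)" by (rule Cauchy_Schwarz_ineq2)
    also have "\<dots> \<le> norm w * e" using n by (intro mult_left_mono) auto
    finally show "\<bar>inner w (\<phi> i)\<bar> \<le> norm w * e" .
  qed simp
qed

text \<open>Two weak derivatives of the same element differ by something orthogonal to all test
  functions, hence by zero. This is what makes the choice in \<open>weak_deriv\<close>
  computable.\<close>

lemma weak_deriv_eqI: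
  assumes b: "b \<in> Basis" and w: "has_weak_deriv \<Omega> b v w"
  shows "weak_deriv \<Omega> b v = w"
proof -
  have w': "has_weak_deriv \<Omega> b v (weak_deriv \<Omega> b v)"
    unfolding weak_deriv_def using w by (rule someI)
  have "weak_deriv \<Omega> b v - w = 0"
  proof (rule test_functions_dense)
    show "weak_deriv \<Omega> b v - w \<in> L2_on \<Omega>"
      using w w' subspace_L2_on[OF open_domain] unfolding has_weak_deriv_iff[OF b] by (auto intro: subspace_diff)
    show "inner (weak_deriv \<Omega> b v - w) (abs_L2 \<psi>) = 0" if "\<psi> \<in> test_functions \<Omega>" for \<psi>
    proof -
      have "inner v (abs_L2 (dir_deriv b \<psi>)) = - inner w (abs_L2 \<psi>)"
        "inner v (abs_L2 (dir_deriv b \<psi>)) = - inner (weak_deriv \<Omega> b v) (abs_L2 \<psi>)"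
        using w w' that unfolding has_weak_deriv_iff[OF b] by blast+
      then show ?thesis by (simp add: inner_diff_left)
    qed
  qed
  then show ?thesis by simp
qed

lemma H1_has_weak_deriv:
  assumes "v \<in> H1 \<Omega>" "b \<in> Basis"
  shows "has_weak_deriv \<Omega> b v (weak_deriv \<Omega> b v)"
  using assms weak_deriv_eqI by (auto simp: H1_def)

lemma has_weak_deriv_linear_comb:
  assumes b: "b \<in> Basis" and v: "has_weak_deriv \<Omega> b v v'" and w: "has_weak_deriv \<Omega> b w w'"
  shows "has_weak_deriv \<Omega> b (c *\<^sub>R v + d *\<^sub>R w) (c *\<^sub>R v' + d *\<^sub>R w')"
  unfolding has_weak_deriv_iff[OF b]
proof (intro conjI ballI)
  note V = v[unfolded has_weak_deriv_iff[OF b]] and W = w[unfolded has_weak_deriv_iff[OF b]]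
  show "c *\<^sub>R v + d *\<^sub>R w \<in> L2_on \<Omega>" "c *\<^sub>R v' + d *\<^sub>R w' \<in> L2_on \<Omega>"
    using V W subspace_L2_on[OF open_domain] by (auto intro: subspace_add subspace_scale)
  fix \<psi> assume "\<psi> \<in> test_functions \<Omega>"
  then have "inner v (abs_L2 (dir_deriv b \<psi>)) = - inner v' (abs_L2 \<psi>)" "inner w (abs_L2 (dir_deriv b \<psi>)) = - inner w' (abs_L2 \<psi>)"
    using V W by blast+
  then show "inner (c *\<^sub>R v + d *\<^sub>R w) (abs_L2 (dir_deriv b \<psi>)) = - inner (c *\<^sub>R v' + d *\<^sub>R w') (abs_L2 \<psi>)"
    by (simp add: inner_add_left)
qed

lemma H1_linear_comb:
  assumes "v \<in> H1 \<Omega>" "w \<in> H1 \<Omega>"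
  shows "c *\<^sub>R v + d *\<^sub>R w \<in> H1 \<Omega>"
    and "b \<in> Basis \<Longrightarrow> weak_deriv \<Omega> b (c *\<^sub>R v + d *\<^sub>R w) = c *\<^sub>R weak_deriv \<Omega> b v + d *\<^sub>R weak_deriv \<Omega> b w"
proof -
  note D = has_weak_deriv_linear_comb[OF _ H1_has_weak_deriv[OF assms(1)] H1_has_weak_deriv[OF assms(2)]]
  have "c *\<^sub>R v + d *\<^sub>R w \<in> L2_on \<Omega>"
    using assms subspace_L2_on[OF open_domain] by (auto simp: H1_def intro: subspace_add subspace_scale)
  then show "c *\<^sub>R v + d *\<^sub>R w \<in> H1 \<Omega>"
    unfolding H1_def using D[of _ c d] by blast
  show "b \<in> Basis \<Longrightarrow> weak_deriv \<Omega> b (c *\<^sub>R v + d *\<^sub>R w) = c *\<^sub>R weak_deriv \<Omega> b v + d *\<^sub>R weak_deriv \<Omega> b w"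
    by (rule weak_deriv_eqI[OF _ D])
qed

lemma test_function_H1:
  assumes "\<psi> \<in> test_functions \<Omega>"
  shows "abs_L2 \<psi> \<in> H1 \<Omega>" and "b \<in> Basis \<Longrightarrow> weak_deriv \<Omega> b (abs_L2 \<psi>) = abs_L2 (dir_deriv b \<psi>)"
  using has_weak_deriv_test_function[OF assms] test_functions_L2_on(1)[OF assms] weak_deriv_eqI
  by (auto simp: H1_def)

text \<open>Trades the H1 norm for one L2 estimate per component with a common \<open>e\<close>, the
  form used in linear combinations and in integration by parts. For the converse, \<open>e\<close>
  is divided by the number \<open>1 + DIM('a)\<close> of components.\<close>

lemma H10_iff:
  "v \<in> H10 \<Omega> \<longleftrightarrow> v \<in> H1 \<Omega> \<and> (\<forall>e>0. \<exists>\<psi>\<in>test_functions \<Omega>. norm (v - abs_L2 \<psi>) < e \<and>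
    (\<forall>b\<in>Basis. norm (weak_deriv \<Omega> b v - abs_L2 (dir_deriv b \<psi>)) < e))" (is "_ \<longleftrightarrow> _ \<and> ?R")
proof (cases "v \<in> H1 \<Omega>")
  case True
  have wd: "weak_deriv \<Omega> b (v - abs_L2 \<psi>) = weak_deriv \<Omega> b v - abs_L2 (dir_deriv b \<psi>)"
    if "\<psi> \<in> test_functions \<Omega>" "b \<in> Basis" for b \<psi>
    using H1_linear_comb(2)[OF True test_function_H1(1)[OF that(1)] that(2), of 1 "-1"] test_function_H1(2)[OF that]
    by simp
  have le: "norm w \<le> norm_H1 \<Omega> w" "b \<in> Basis \<Longrightarrow> norm (weak_deriv \<Omega> b w) \<le> norm_H1 \<Omega> w" for w b
  proof -
    show "norm w \<le> norm_H1 \<Omega> w"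
      unfolding norm_H1_def by (rule real_le_rsqrt) (simp add: sum_nonneg)
    assume b: "b \<in> Basis"
    have "(norm (weak_deriv \<Omega> b w))\<^sup>2 \<le> (\<Sum>b\<in>Basis. (norm (weak_deriv \<Omega> b w))\<^sup>2)"
      using b by (intro member_le_sum) auto
    then show "norm (weak_deriv \<Omega> b w) \<le> norm_H1 \<Omega> w"
      unfolding norm_H1_def by (intro real_le_rsqrt) (simp add: add_increasing)
  qed
  have ge: "norm_H1 \<Omega> w \<le> norm w + (\<Sum>b\<in>Basis. norm (weak_deriv \<Omega> b w))" for w
  proof -
    have "norm_H1 \<Omega> w \<le> sqrt ((norm w)\<^sup>2) + sqrt (\<Sum>b\<in>Basis. (norm (weak_deriv \<Omega> b w))\<^sup>2)"
      unfolding norm_H1_def by (rule sqrt_add_le_add_sqrt) (simp_all add: sum_nonneg)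
    also have "sqrt (\<Sum>b\<in>Basis. (norm (weak_deriv \<Omega> b w))\<^sup>2) \<le> (\<Sum>b\<in>Basis. norm (weak_deriv \<Omega> b w))"
      using L2_set_le_sum[of Basis "\<lambda>b. norm (weak_deriv \<Omega> b w)"] by (simp add: L2_set_def)
    finally show ?thesis by simp
  qed
  have "(\<forall>e>0. \<exists>\<psi>\<in>test_functions \<Omega>. norm_H1 \<Omega> (v - abs_L2 \<psi>) < e) \<longleftrightarrow> ?R"
  proof (intro iffI allI impI)
    fix e :: real assume "0 < e" and "\<forall>e>0. \<exists>\<psi>\<in>test_functions \<Omega>. norm_H1 \<Omega> (v - abs_L2 \<psi>) < e"
    then obtain \<psi> where \<psi>: "\<psi> \<in> test_functions \<Omega>" "norm_H1 \<Omega> (v - abs_L2 \<psi>) < e" by blast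
    show "\<exists>\<psi>\<in>test_functions \<Omega>. norm (v - abs_L2 \<psi>) < e \<and>
        (\<forall>b\<in>Basis. norm (weak_deriv \<Omega> b v - abs_L2 (dir_deriv b \<psi>)) < e)"
      using \<psi> le(1)[of "v - abs_L2 \<psi>"] le(2)[of _ "v - abs_L2 \<psi>"] wd[OF \<psi>(1)] by (intro bexI[of _ \<psi>] conjI ballI) (auto intro: le_less_trans)
  next
    fix e :: real assume e: "0 < e" and R: ?R
    define e' where "e' = e / (1 + real DIM('a))"
    have e': "0 < e'" "(1 + real DIM('a)) * e' = e" using e by (auto simp: e'_def add_pos_pos)
    then obtain \<psi> where \<psi>: "\<psi> \<in> test_functions \<Omega>" "norm (v - abs_L2 \<psi>) < e'"
      "\<And>b. b \<in> Basis \<Longrightarrow> norm (weak_deriv \<Omega> b v - abs_L2 (dir_deriv b \<psi>)) < e'" using R by blast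
    have "norm_H1 \<Omega> (v - abs_L2 \<psi>) \<le> norm (v - abs_L2 \<psi>) + (\<Sum>b\<in>Basis. norm (weak_deriv \<Omega> b (v - abs_L2 \<psi>)))"
      by (rule ge)
    also have "(\<Sum>b\<in>Basis. norm (weak_deriv \<Omega> b (v - abs_L2 \<psi>))) \<le> (\<Sum>b\<in>(Basis::'a set). e')"
      using \<psi> by (intro sum_mono) (simp add: wd less_imp_le)
    also have "norm (v - abs_L2 \<psi>) + (\<Sum>b\<in>(Basis::'a set). e') < e' + real DIM('a) * e'"
      using \<psi>(2) by simp
    also have "\<dots> = e" using e'(2) by (simp add: distrib_right)
    finally show "\<exists>\<psi>\<in>test_functions \<Omega>. norm_H1 \<Omega> (v - abs_L2 \<psi>) < e" using \<psi>(1) by auto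
  qed
  then show ?thesis using True by (simp add: H10_def)
qed (simp add: H10_def)

lemma H10_H1: "v \<in> H10 \<Omega> \<Longrightarrow> v \<in> H1 \<Omega>" and H2_H1: "v \<in> H2 \<Omega> \<Longrightarrow> v \<in> H1 \<Omega>"
  and H1_L2_on: "v \<in> H1 \<Omega> \<Longrightarrow> v \<in> L2_on \<Omega>"
  by (simp_all add: H10_def H2_def H1_def)

lemma H10_linear_comb:
  assumes v: "v \<in> H10 \<Omega>" and w: "w \<in> H10 \<Omega>"
  shows "c *\<^sub>R v + d *\<^sub>R w \<in> H10 \<Omega>"
  unfolding H10_iff
proof (intro conjI allI impI)
  note vw = v[unfolded H10_iff] w[unfolded H10_iff]
  show "c *\<^sub>R v + d *\<^sub>R w \<in> H1 \<Omega>" using vw by (simp add: H1_linear_comb)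
  fix e :: real assume e: "0 < e"
  define e' where "e' = e / (\<bar>c\<bar> + \<bar>d\<bar> + 1)"
  have p: "0 < \<bar>c\<bar> + \<bar>d\<bar> + 1" by linarith
  have e': "0 < e'" "(\<bar>c\<bar> + \<bar>d\<bar> + 1) * e' = e" using e p by (simp_all add: e'_def)
  obtain f where f: "f \<in> test_functions \<Omega>" "norm (v - abs_L2 f) < e'"
      "\<And>b. b \<in> Basis \<Longrightarrow> norm (weak_deriv \<Omega> b v - abs_L2 (dir_deriv b f)) < e'"
    using vw(1) e'(1) by blast
  obtain g where g: "g \<in> test_functions \<Omega>" "norm (w - abs_L2 g) < e'"
      "\<And>b. b \<in> Basis \<Longrightarrow> norm (weak_deriv \<Omega> b w - abs_L2 (dir_deriv b g)) < e'"
    using vw(2) e'(1) by blast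
  have est: "norm (c *\<^sub>R x + d *\<^sub>R y - (c *\<^sub>R x' + d *\<^sub>R y')) < e" if "norm (x - x') < e'" "norm (y - y') < e'" for x y x' y' :: "'a L2"
  proof -
    have "norm (c *\<^sub>R x + d *\<^sub>R y - (c *\<^sub>R x' + d *\<^sub>R y')) = norm (c *\<^sub>R (x - x') + d *\<^sub>R (y - y'))"
      by (simp add: algebra_simps)
    also have "\<dots> \<le> \<bar>c\<bar> * norm (x - x') + \<bar>d\<bar> * norm (y - y')"
      using norm_triangle_ineq[of "c *\<^sub>R (x - x')" "d *\<^sub>R (y - y')"] by simp
    also have "\<dots> \<le> \<bar>c\<bar> * e' + \<bar>d\<bar> * e'"
      using that by (intro add_mono mult_left_mono) auto
    also have "\<dots> < (\<bar>c\<bar> + \<bar>d\<bar> + 1) * e'" using e'(1) by (simp add: distrib_right)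
    finally show ?thesis using e'(2) by simp
  qed
  let ?h = "\<lambda>x. c * f x + d * g x"
  have ab: "abs_L2 (\<lambda>x. c * u x + d * z x) = c *\<^sub>R abs_L2 u + d *\<^sub>R abs_L2 z"
    if "square_integrable u" "square_integrable z" for u z :: "'a \<Rightarrow> real"
    using that by (simp add: abs_L2_scale abs_L2_add square_integrable_scale)
  show "\<exists>\<psi>\<in>test_functions \<Omega>. norm (c *\<^sub>R v + d *\<^sub>R w - abs_L2 \<psi>) < e \<and>
      (\<forall>b\<in>Basis. norm (weak_deriv \<Omega> b (c *\<^sub>R v + d *\<^sub>R w) - abs_L2 (dir_deriv b \<psi>)) < e)"
  proof (intro bexI[of _ ?h] conjI ballI)
    show h: "?h \<in> test_functions \<Omega>" by (rule test_functions_linear_comb(1)[OF f(1) g(1)])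
    show "norm (c *\<^sub>R v + d *\<^sub>R w - abs_L2 ?h) < e"
      unfolding ab[OF test_functions_square_integrable[OF f(1)] test_functions_square_integrable[OF g(1)]]
      by (rule est[OF f(2) g(2)])
    fix b :: 'a assume b: "b \<in> Basis"
    have "dir_deriv b ?h = (\<lambda>x. c * dir_deriv b f x + d * dir_deriv b g x)"
      using test_functions_linear_comb(2)[OF f(1) g(1)] by blast
    then have "abs_L2 (dir_deriv b ?h) = c *\<^sub>R abs_L2 (dir_deriv b f) + d *\<^sub>R abs_L2 (dir_deriv b g)"
      using ab[OF square_integrable_dir_deriv[OF f(1) b] square_integrable_dir_deriv[OF g(1) b]] by simp
    then show "norm (weak_deriv \<Omega> b (c *\<^sub>R v + d *\<^sub>R w) - abs_L2 (dir_deriv b ?h)) < e"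
      using est[OF f(3)[OF b] g(3)[OF b]] vw b by (simp add: H1_linear_comb(2))
  qed
qed

lemma subspace_H10: "subspace (H10 \<Omega>)"
proof (rule subspaceI)
  note l = H10_linear_comb
  show "0 \<in> H10 \<Omega>" using l[OF \<phi>_H10[of 0] \<phi>_H10[of 0], of 0 0] by simp
  show "x + y \<in> H10 \<Omega>" if "x \<in> H10 \<Omega>" "y \<in> H10 \<Omega>" for x y using l[OF that, of 1 1] by simp
  show "c *\<^sub>R x \<in> H10 \<Omega>" if "x \<in> H10 \<Omega>" for c x using l[OF that that, of c 0] by simp
qed

text \<open>The boundary term vanishes because one factor is a limit of test functions.\<close>

lemma integration_by_parts_H10:
  assumes b: "b \<in> Basis" and g: "has_weak_deriv \<Omega> b g w" and \<xi>: "\<xi> \<in> H10 \<Omega>"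
  shows "inner g (weak_deriv \<Omega> b \<xi>) = - inner w \<xi>"
proof -
  have "inner g (weak_deriv \<Omega> b \<xi>) + inner w \<xi> = 0"
  proof (rule eps_le_imp_eq_0)
    fix e :: real assume "0 < e"
    then obtain \<psi> where \<psi>: "\<psi> \<in> test_functions \<Omega>" "norm (\<xi> - abs_L2 \<psi>) < e"
      "norm (weak_deriv \<Omega> b \<xi> - abs_L2 (dir_deriv b \<psi>)) < e" using \<xi> b unfolding H10_iff by blast
    have "inner g (abs_L2 (dir_deriv b \<psi>)) = - inner w (abs_L2 \<psi>)"
      using g \<psi>(1) unfolding has_weak_deriv_iff[OF b] by blast
    then have "inner g (weak_deriv \<Omega> b \<xi>) + inner w \<xi>
        = inner g (weak_deriv \<Omega> b \<xi> - abs_L2 (dir_deriv b \<psi>)) + inner w (\<xi> - abs_L2 \<psi>)"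
      by (simp add: inner_diff_right)
    also have "\<bar>\<dots>\<bar> \<le> norm g * norm (weak_deriv \<Omega> b \<xi> - abs_L2 (dir_deriv b \<psi>)) + norm w * norm (\<xi> - abs_L2 \<psi>)"
      by (intro order_trans[OF abs_triangle_ineq] add_mono Cauchy_Schwarz_ineq2)
    also have "\<dots> \<le> norm g * e + norm w * e"
      using \<psi> by (intro add_mono mult_left_mono) auto
    finally show "\<bar>inner g (weak_deriv \<Omega> b \<xi>) + inner w \<xi>\<bar> \<le> (norm g + norm w) * e"
      by (simp add: distrib_right)
  qed simp
  then show ?thesis by linarith
qed

lemma grad_inner_laplacian:
  assumes v: "v \<in> H2 \<Omega>" and \<xi>: "\<xi> \<in> H10 \<Omega>"
  shows "grad_inner \<Omega> v \<xi> = - inner (laplacian \<Omega> v) \<xi>"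
proof -
  have "inner (weak_deriv \<Omega> b v) (weak_deriv \<Omega> b \<xi>) = - inner (weak_deriv \<Omega> b (weak_deriv \<Omega> b v)) \<xi>" if "b \<in> Basis" for b
    by (rule integration_by_parts_H10[OF that H1_has_weak_deriv \<xi>]) (use v that in \<open>auto simp: H2_def\<close>)
  then show ?thesis by (simp add: grad_inner_def laplacian_def inner_sum_left sum_negf)
qed

lemma grad_inner_commute: "grad_inner \<Omega> v w = grad_inner \<Omega> w v"
  by (simp add: grad_inner_def inner_commute)

lemma grad_inner_linear_comb_left:
  "v \<in> H1 \<Omega> \<Longrightarrow> w \<in> H1 \<Omega> \<Longrightarrow> grad_inner \<Omega> (c *\<^sub>R v + d *\<^sub>R w) z = c * grad_inner \<Omega> v z + d * grad_inner \<Omega> w z"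
  by (simp add: grad_inner_def H1_linear_comb(2) inner_add_left sum.distrib sum_distrib_left)

text \<open>Replaces the Poincare inequality: if the gradient vanishes, Green's formula against each
  eigenfunction gives \<open>lam i * inner (\<phi> i) v = 0\<close>, and the system is complete with
  positive eigenvalues.\<close>

lemma grad_inner_self_eq_0:
  assumes v: "v \<in> H10 \<Omega>" and 0: "grad_inner \<Omega> v v = 0"
  shows "v = 0"
proof (rule complete)
  show "v \<in> L2_on \<Omega>" using v by (simp add: H1_L2_on H10_H1)
  fix i
  have "\<forall>b\<in>Basis. weak_deriv \<Omega> b v = 0"
    using 0 unfolding grad_inner_def by (subst (asm) sum_nonneg_eq_0_iff) auto
  then have "grad_inner \<Omega> (\<phi> i) v = 0" by (simp add: grad_inner_def)
  then have "lam i * inner (\<phi> i) v = 0"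
    using grad_inner_laplacian[OF \<phi>_H2 v, of i] laplacian_\<phi>[of i] by (metis inner_minus_left inner_scaleR_left)
  then show "inner v (\<phi> i) = 0" using lam_pos[of i] by (simp add: inner_commute)
qed

lemma laplacian_L2_on: "v \<in> H2 \<Omega> \<Longrightarrow> laplacian \<Omega> v \<in> L2_on \<Omega>"
  unfolding laplacian_def
  by (intro subspace_sum[OF subspace_L2_on[OF open_domain]])
    (use H1_has_weak_deriv in \<open>auto simp: H2_def has_weak_deriv_def\<close>)

text \<open>Symmetry of the Laplacian: Green's formula is used once for \<open>v\<close> and once
  for the eigenfunction.\<close>

lemma inner_laplacian_\<phi>:
  assumes "v \<in> H2 \<Omega>" "v \<in> H10 \<Omega>"
  shows "inner (- laplacian \<Omega> v) (\<phi> i) = lam i * inner v (\<phi> i)"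
proof -
  have "inner (- laplacian \<Omega> v) (\<phi> i) = grad_inner \<Omega> v (\<phi> i)"
    using grad_inner_laplacian[OF assms(1) \<phi>_H10] by simp
  also have "\<dots> = - inner (laplacian \<Omega> (\<phi> i)) v"
    using grad_inner_laplacian[OF \<phi>_H2 assms(2)] by (simp add: grad_inner_commute)
  also have "\<dots> = inner (lam i *\<^sub>R \<phi> i) v" by (simp flip: laplacian_\<phi>)
  finally show ?thesis by (simp add: inner_commute)
qed

end

section \<open>Spectral truncation and finite elements\<close>

context dirichlet_problem
begin

lemma norm_sum_\<phi>: "finite I \<Longrightarrow> (norm (\<Sum>i\<in>I. c i *\<^sub>R \<phi> i))\<^sup>2 = (\<Sum>i\<in>I. (c i)\<^sup>2)"
proof -
  assume I: "finite I"
  have "(norm (\<Sum>i\<in>I. c i *\<^sub>R \<phi> i))\<^sup>2 = (\<Sum>i\<in>I. \<Sum>j\<in>I. c i * c j * inner (\<phi> i) (\<phi> j))"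
    unfolding power2_norm_eq_inner
    by (subst inner_sum_left, intro sum.cong refl, subst inner_sum_right, intro sum.cong refl) simp
  also have "\<dots> = (\<Sum>i\<in>I. \<Sum>j\<in>I. if i = j then (c i)\<^sup>2 else 0)"
    by (intro sum.cong refl) (simp add: inner_\<phi> power2_eq_square)
  also have "\<dots> = (\<Sum>i\<in>I. (c i)\<^sup>2)" using I by simp
  finally show ?thesis .
qed

lemma inner_sum_\<phi>: "finite I \<Longrightarrow> inner (\<Sum>i\<in>I. c i *\<^sub>R \<phi> i) (\<phi> j) = (if j \<in> I then c j else 0)"
proof -
  assume I: "finite I"
  have "inner (\<Sum>i\<in>I. c i *\<^sub>R \<phi> i) (\<phi> j) = (\<Sum>i\<in>I. if i = j then c j else 0)"
    unfolding inner_sum_left by (intro sum.cong refl) (simp add: inner_\<phi>)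
  also have "\<dots> = (if j \<in> I then c j else 0)" using I by simp
  finally show ?thesis .
qed

lemma bessel: "(\<Sum>i<k. (inner v (\<phi> i))\<^sup>2) \<le> (norm v)\<^sup>2"
proof -
  let ?s = "\<Sum>i<k. inner v (\<phi> i) *\<^sub>R \<phi> i"
  have s: "inner v ?s = (\<Sum>i<k. (inner v (\<phi> i))\<^sup>2)"
    by (simp add: inner_sum_right power2_eq_square)
  have "0 \<le> inner (v - ?s) (v - ?s)" by simp
  also have "\<dots> = (norm v)\<^sup>2 - 2 * inner v ?s + (norm ?s)\<^sup>2"
    by (simp add: power2_norm_eq_inner inner_diff_left inner_diff_right inner_commute)
  also have "\<dots> = (norm v)\<^sup>2 - (\<Sum>i<k. (inner v (\<phi> i))\<^sup>2)"
    unfolding s norm_sum_\<phi>[OF finite_lessThan] by simp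
  finally show ?thesis by simp
qed

text \<open>Bessel's inequality makes the Fourier series converge. Its sum stays in the closed
  subspace \<open>L2_on \<Omega>\<close> and has the coefficients of \<open>v\<close>, so
  completeness identifies it with \<open>v\<close>.\<close>

lemma parseval:
  assumes v: "v \<in> L2_on \<Omega>"
  shows "(\<lambda>i. (inner v (\<phi> i))\<^sup>2) sums (norm v)\<^sup>2"
proof -
  define c where "c i = inner v (\<phi> i)" for i
  have sc: "summable (\<lambda>i. (c i)\<^sup>2)"
    using bessel[of v] by (intro summableI_nonneg_bounded[where x = "(norm v)\<^sup>2"]) (auto simp: c_def)
  have sm: "summable (\<lambda>i. c i *\<^sub>R \<phi> i)"
    unfolding summable_Cauchy
  proof (intro allI impI)
    fix e :: real assume e: "0 < e"
    then obtain N where N: "\<And>m n. m \<ge> N \<Longrightarrow> norm (\<Sum>i\<in>{m..<n}. (c i)\<^sup>2) < e\<^sup>2"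
      using sc unfolding summable_Cauchy by (meson zero_less_power)
    show "\<exists>N. \<forall>m\<ge>N. \<forall>n. norm (\<Sum>i\<in>{m..<n}. c i *\<^sub>R \<phi> i) < e"
    proof (intro exI allI impI)
      fix m n assume "N \<le> m"
      from N[OF this, of n] have "(norm (\<Sum>i\<in>{m..<n}. c i *\<^sub>R \<phi> i))\<^sup>2 < e\<^sup>2"
        unfolding norm_sum_\<phi>[OF finite_atLeastLessThan] by simp
      then show "norm (\<Sum>i\<in>{m..<n}. c i *\<^sub>R \<phi> i) < e" using e by (simp add: power_less_imp_less_base)
    qed
  qed
  define S where "S = (\<Sum>i. c i *\<^sub>R \<phi> i)"
  have lim: "(\<lambda>n. \<Sum>i<n. c i *\<^sub>R \<phi> i) \<longlonglongrightarrow> S"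
    using sm unfolding S_def by (rule summable_LIMSEQ)
  have "S \<in> L2_on \<Omega>"
  proof (rule closed_sequentially[OF closed_L2_on[OF open_domain] _ lim])
    show "(\<Sum>i<n. c i *\<^sub>R \<phi> i) \<in> L2_on \<Omega>" for n
      by (intro subspace_sum subspace_scale subspace_L2_on open_domain \<phi>_L2_on)
  qed
  moreover have "inner S (\<phi> j) = c j" for j
  proof -
    have "(\<lambda>n. inner (\<Sum>i<n. c i *\<^sub>R \<phi> i) (\<phi> j)) \<longlonglongrightarrow> inner S (\<phi> j)"
      by (intro tendsto_inner lim tendsto_const)
    moreover have "\<forall>\<^sub>F n in sequentially. inner (\<Sum>i<n. c i *\<^sub>R \<phi> i) (\<phi> j) = c j"
      using eventually_gt_at_top[of j] by eventually_elim (simp add: inner_sum_\<phi>)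
    ultimately show ?thesis
      using LIMSEQ_unique[OF _ tendsto_eventually] by fast
  qed
  ultimately have "v - S = 0"
    by (intro complete) (use v subspace_L2_on[OF open_domain] in \<open>auto simp: inner_diff_left c_def intro: subspace_diff\<close>)
  then have "(\<lambda>n. (norm (\<Sum>i<n. c i *\<^sub>R \<phi> i))\<^sup>2) \<longlonglongrightarrow> (norm v)\<^sup>2"
    using lim by (auto intro!: tendsto_power tendsto_norm)
  then show ?thesis unfolding norm_sum_\<phi>[OF finite_lessThan] sums_def c_def .
qed

text \<open>Minus the Laplacian on the first \<open>k\<close> modes. Unlike the Laplacian it is
  bounded, hence commutes with Bochner integrals in time; bounds uniform in \<open>k\<close> then
  recover the norm of order two.\<close>

definition trunc_laplacian :: "nat \<Rightarrow> 'a L2 \<Rightarrow> 'a L2"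
  where "trunc_laplacian k q = (\<Sum>i<k. (lam i * inner q (\<phi> i)) *\<^sub>R \<phi> i)"

lemma bounded_linear_trunc_laplacian: "bounded_linear (trunc_laplacian k)"
  unfolding trunc_laplacian_def
  by (intro bounded_linear_sum bounded_linear_compose[OF bounded_linear_scaleR_left]
      bounded_linear_const_mult bounded_linear_inner_left)

lemma lam_powr_2: "lam i powr 2 = (lam i)\<^sup>2"
  using lam_pos[of i] by (simp add: powr_numeral)

lemma norm_trunc_laplacian: "(norm (trunc_laplacian k q))\<^sup>2 = (\<Sum>i<k. lam i powr 2 * (inner q (\<phi> i))\<^sup>2)"
  unfolding trunc_laplacian_def norm_sum_\<phi>[OF finite_lessThan]
  by (simp add: power_mult_distrib lam_powr_2)

text \<open>The squared norms of the truncations are the partial sums of a nonnegative series, so a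
  uniform bound yields both its convergence and the bound for its sum.\<close>

lemma H_check_2_iff:
  assumes "0 \<le> B"
  shows "q \<in> H_check \<Omega> lam \<phi> 2 \<and> norm_H_check lam \<phi> 2 q \<le> B
    \<longleftrightarrow> q \<in> L2_on \<Omega> \<and> (\<forall>k. norm (trunc_laplacian k q) \<le> B)"
proof -
  let ?a = "\<lambda>i. lam i powr 2 * (inner q (\<phi> i))\<^sup>2"
  have nn: "0 \<le> ?a i" for i by simp
  have le: "norm (trunc_laplacian k q) \<le> C \<longleftrightarrow> sum ?a {..<k} \<le> C\<^sup>2" if "0 \<le> C" for k C
    using that abs_le_square_iff[of "norm (trunc_laplacian k q)" C] by (simp add: norm_trunc_laplacian)
  show ?thesis
  proof
    assume L: "q \<in> H_check \<Omega> lam \<phi> 2 \<and> norm_H_check lam \<phi> 2 q \<le> B"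
    then have s: "summable ?a" and m: "q \<in> L2_on \<Omega>" by (auto simp: H_check_def)
    have "sqrt (suminf ?a) \<le> B" using L by (simp add: norm_H_check_def)
    then have "suminf ?a \<le> B\<^sup>2" using assms by (simp add: real_sqrt_le_iff' sqrt_le_D)
    then have "sum ?a {..<k} \<le> B\<^sup>2" for k
      using sum_le_suminf[OF s, of "{..<k}"] nn by (meson finite_lessThan order_trans)
    then show "q \<in> L2_on \<Omega> \<and> (\<forall>k. norm (trunc_laplacian k q) \<le> B)" using m le[OF assms] by simp
  next
    assume R: "q \<in> L2_on \<Omega> \<and> (\<forall>k. norm (trunc_laplacian k q) \<le> B)"
    then have b: "sum ?a {..<k} \<le> B\<^sup>2" for k using le[OF assms] by blast
    then have s: "summable ?a" using nn by (intro summableI_nonneg_bounded)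
    then have "suminf ?a \<le> B\<^sup>2" using b by (intro suminf_le_const)
    then show "q \<in> H_check \<Omega> lam \<phi> 2 \<and> norm_H_check lam \<phi> 2 q \<le> B"
      using R s assms by (auto simp: H_check_def norm_H_check_def intro: real_le_lsqrt)
  qed
qed

lemma norm_H_check_nonneg: "0 \<le> norm_H_check lam \<phi> s q"
  if "q \<in> H_check \<Omega> lam \<phi> s"
  using that unfolding norm_H_check_def H_check_def by (auto intro!: suminf_nonneg)

lemma norm_trunc_laplacian_le: "q \<in> H_check \<Omega> lam \<phi> 2 \<Longrightarrow> norm (trunc_laplacian k q) \<le> norm_H_check lam \<phi> 2 q"
  using H_check_2_iff[OF norm_H_check_nonneg, of q 2 q] norm_H_check_nonneg[of q 2] H_check_2_iff[of "norm_H_check lam \<phi> 2 q" q]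
  by blast

lemma norm_H_check_0:
  assumes "q \<in> L2_on \<Omega>"
  shows "norm_H_check lam \<phi> 0 q = norm q"
proof -
  have "lam i powr 0 = 1" for i using lam_pos[of i] by simp
  then have "norm_H_check lam \<phi> 0 q = sqrt ((norm q)\<^sup>2)"
    unfolding norm_H_check_def sums_unique[OF parseval[OF assms]] by simp
  then show ?thesis by simp
qed

lemma norm_laplacian:
  assumes "q \<in> H2 \<Omega>" "q \<in> H10 \<Omega>"
  shows "norm (laplacian \<Omega> q) = norm_H_check lam \<phi> 2 q"
proof -
  have "- laplacian \<Omega> q \<in> L2_on \<Omega>"
    using laplacian_L2_on[OF assms(1)] subspace_L2_on[OF open_domain] by (simp add: subspace_neg)
  from sums_unique[OF parseval[OF this]]
  have "(norm (laplacian \<Omega> q))\<^sup>2 = (\<Sum>i. lam i powr 2 * (inner q (\<phi> i))\<^sup>2)"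
    unfolding inner_laplacian_\<phi>[OF assms] norm_minus_cancel by (simp add: power_mult_distrib lam_powr_2)
  then have "norm_H_check lam \<phi> 2 q = sqrt ((norm (laplacian \<Omega> q))\<^sup>2)"
    by (simp add: norm_H_check_def)
  then show ?thesis by simp
qed

lemma laplacian_linear_comb:
  assumes "v \<in> H2 \<Omega>" "w \<in> H2 \<Omega>"
  shows "laplacian \<Omega> (c *\<^sub>R v + d *\<^sub>R w) = c *\<^sub>R laplacian \<Omega> v + d *\<^sub>R laplacian \<Omega> w"
  using assms by (simp add: laplacian_def H1_linear_comb(2) H2_def sum.distrib scaleR_sum_right)

section \<open>Finite element spaces and Ritz projections\<close>

lemma subspace_fe_space:
  assumes "partition_of \<Omega> \<T>"
  shows "subspace (fe_space \<Omega> \<T>)"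
proof -
  have "finite \<T>" using assms by (simp add: partition_of_def triangulation_def)
  moreover have "compact K" if "K \<in> \<T>" for K
    using assms that compact_simplex[of "int DIM('a)" K] by (simp add: partition_of_def)
  ultimately have "compact (\<Union>\<T>)" by (rule compact_Union)
  \<comment> \<open>A mesh is finite with compact simplices, so a continuous function supported on
    it is square integrable. Only then does \<open>abs_L2\<close> respect sums and multiples of the
    representatives.\<close>
  then have sq: "square_integrable \<eta>" if "continuous_on UNIV \<eta>" "\<forall>x. x \<notin> \<Union>\<T> \<longrightarrow> \<eta> x = 0" for \<eta>
    using that square_integrable_compact_support by blast
  show ?thesis
  proof (rule subspaceI)
    show "0 \<in> fe_space \<Omega> \<T>"
      unfolding fe_space_def mem_Collect_eq
      by (intro conjI subspace_0[OF subspace_H10] exI[of _ "\<lambda>_. 0"])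
        (auto simp: zero_L2_def intro: exI[of _ 0])
  next
    fix v w assume v: "v \<in> fe_space \<Omega> \<T>" and w: "w \<in> fe_space \<Omega> \<T>"
    obtain \<eta> where e: "continuous_on UNIV \<eta>" "\<forall>x. x \<notin> \<Union>\<T> \<longrightarrow> \<eta> x = 0"
        "\<forall>K\<in>\<T>. \<exists>a c. \<forall>x\<in>K. \<eta> x = inner a x + c" "v = abs_L2 \<eta>" using v unfolding fe_space_def by blast
    obtain \<zeta> where z: "continuous_on UNIV \<zeta>" "\<forall>x. x \<notin> \<Union>\<T> \<longrightarrow> \<zeta> x = 0"
        "\<forall>K\<in>\<T>. \<exists>a c. \<forall>x\<in>K. \<zeta> x = inner a x + c" "w = abs_L2 \<zeta>" using w unfolding fe_space_def by blast
    show "v + w \<in> fe_space \<Omega> \<T>"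
      unfolding fe_space_def mem_Collect_eq
    proof (intro conjI exI[of _ "\<lambda>x. \<eta> x + \<zeta> x"] ballI)
      show "v + w \<in> H10 \<Omega>" using v w subspace_add[OF subspace_H10] by (auto simp: fe_space_def)
      show "v + w = abs_L2 (\<lambda>x. \<eta> x + \<zeta> x)" using abs_L2_add[OF sq[OF e(1,2)] sq[OF z(1,2)]] e(4) z(4) by simp
      fix K assume "K \<in> \<T>"
      then obtain a c a' c' where "\<forall>x\<in>K. \<eta> x = inner a x + c" "\<forall>x\<in>K. \<zeta> x = inner a' x + c'" using e(3) z(3) by meson
      then have "\<forall>x\<in>K. \<eta> x + \<zeta> x = inner (a + a') x + (c + c')" by (simp add: inner_add_left)
      then show "\<exists>a c. \<forall>x\<in>K. \<eta> x + \<zeta> x = inner a x + c" by blast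
    qed (use e z in \<open>auto intro: continuous_on_add\<close>)
  next
    fix v and r :: real assume v: "v \<in> fe_space \<Omega> \<T>"
    obtain \<eta> where e: "continuous_on UNIV \<eta>" "\<forall>x. x \<notin> \<Union>\<T> \<longrightarrow> \<eta> x = 0"
        "\<forall>K\<in>\<T>. \<exists>a c. \<forall>x\<in>K. \<eta> x = inner a x + c" "v = abs_L2 \<eta>" using v unfolding fe_space_def by blast
    show "r *\<^sub>R v \<in> fe_space \<Omega> \<T>"
      unfolding fe_space_def mem_Collect_eq
    proof (intro conjI exI[of _ "\<lambda>x. r * \<eta> x"] ballI)
      show "r *\<^sub>R v \<in> H10 \<Omega>" using v subspace_scale[OF subspace_H10] by (auto simp: fe_space_def)
      show "r *\<^sub>R v = abs_L2 (\<lambda>x. r * \<eta> x)" using abs_L2_scale[OF sq[OF e(1,2)]] e(4) by simp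
      fix K assume "K \<in> \<T>"
      then obtain a c where "\<forall>x\<in>K. \<eta> x = inner a x + c" using e(3) by meson
      then have "\<forall>x\<in>K. r * \<eta> x = inner (r *\<^sub>R a) x + r * c" by (simp add: distrib_left)
      then show "\<exists>a c. \<forall>x\<in>K. r * \<eta> x = inner a x + c" by blast
    qed (use e in \<open>auto intro: continuous_on_mult_left\<close>)
  qed
qed

text \<open>The difference of two candidates lies in \<open>S\<close> and is orthogonal to itself in
  the Dirichlet form, which is definite on \<open>H10\<close>.\<close>

lemma ritz_projection_unique:
  assumes R: "ritz_projection \<Omega> S R" and S: "subspace S" "S \<subseteq> H10 \<Omega>" and v: "v \<in> H10 \<Omega>"
    and w: "w \<in> S" "\<And>\<eta>. \<eta> \<in> S \<Longrightarrow> grad_inner \<Omega> w \<eta> = grad_inner \<Omega> v \<eta>"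
  shows "R v = w"
proof -
  have Rv: "R v \<in> S" "\<And>\<eta>. \<eta> \<in> S \<Longrightarrow> grad_inner \<Omega> (v - R v) \<eta> = 0"
    using R v by (auto simp: ritz_projection_def)
  have H: "R v \<in> H1 \<Omega>" "v \<in> H1 \<Omega>" "w \<in> H1 \<Omega>" using Rv(1) v w(1) S(2) H10_H1 by auto
  have "w - R v = 0"
  proof (rule grad_inner_self_eq_0)
    have d: "w - R v \<in> S" using S(1) w(1) Rv(1) by (rule subspace_diff)
    then show "w - R v \<in> H10 \<Omega>" using S(2) by blast
    show "grad_inner \<Omega> (w - R v) (w - R v) = 0"
      using Rv(2)[OF d] w(2)[OF d] grad_inner_linear_comb_left[OF H(2,1), of 1 "-1"]
        grad_inner_linear_comb_left[OF H(3,1), of 1 "-1"] by simp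
  qed
  then show ?thesis by simp
qed

lemma grad_inner_ritz:
  assumes R: "ritz_projection \<Omega> S R" and S: "S \<subseteq> H10 \<Omega>" and v: "v \<in> H10 \<Omega>" and \<eta>: "\<eta> \<in> S"
  shows "grad_inner \<Omega> (R v) \<eta> = grad_inner \<Omega> v \<eta>"
proof -
  have "R v \<in> H1 \<Omega>" "v \<in> H1 \<Omega>" using R S v H10_H1 by (auto simp: ritz_projection_def)
  from grad_inner_linear_comb_left[OF this(2,1), of 1 "-1" \<eta>] show ?thesis
    using R v \<eta> by (auto simp: ritz_projection_def)
qed

text \<open>Linearity is not built into \<open>ritz_projection\<close> but follows from uniqueness.
  It lets the increment of the projection error be bounded by the approximation property applied to
  an increment of the solution.\<close>

lemma ritz_projection_diff:
  assumes R: "ritz_projection \<Omega> S R" and S: "subspace S" "S \<subseteq> H10 \<Omega>" and v: "v \<in> H10 \<Omega>" and w: "w \<in> H10 \<Omega>"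
  shows "R (v - w) = R v - R w"
proof (rule ritz_projection_unique[OF R S])
  have Rvw: "R v \<in> S" "R w \<in> S" using R v w by (auto simp: ritz_projection_def)
  then have H: "R v \<in> H1 \<Omega>" "R w \<in> H1 \<Omega>" "v \<in> H1 \<Omega>" "w \<in> H1 \<Omega>" using S v w H10_H1 by auto
  show "v - w \<in> H10 \<Omega>" using subspace_H10 v w by (rule subspace_diff)
  show "R v - R w \<in> S" using S(1) Rvw by (rule subspace_diff)
  show "grad_inner \<Omega> (R v - R w) \<eta> = grad_inner \<Omega> (v - w) \<eta>" if "\<eta> \<in> S" for \<eta>
    using grad_inner_linear_comb_left[OF H(1,2), of 1 "-1" \<eta>] grad_inner_linear_comb_left[OF H(3,4), of 1 "-1" \<eta>]
      grad_inner_ritz[OF R S(2) v that] grad_inner_ritz[OF R S(2) w that] by simp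
qed

end

section \<open>The kernel of the transformed equation\<close>

lemma continuous_on_Icc_bounded:
  fixes H :: "real \<Rightarrow> 'b::real_normed_vector"
  assumes "continuous_on {a..b} H"
  obtains M where "\<And>x. x \<in> {a..b} \<Longrightarrow> norm (H x) \<le> M"
  using compact_imp_bounded[OF compact_continuous_image[OF assms compact_Icc]] unfolding bounded_iff
  by (metis imageI)

lemma x_ln_x_tendsto_0: "((\<lambda>x::real. x * \<bar>ln x\<bar>) \<longlongrightarrow> 0) (at_right 0)"
proof -
  have "((\<lambda>x::real. \<bar>ln (inverse x) / inverse x\<bar>) \<longlongrightarrow> \<bar>0\<bar>) (at_right 0)"
    by (intro tendsto_rabs filterlim_compose[OF ln_x_over_x_tendsto_0 filterlim_inverse_at_top_right])
  moreover have "\<forall>\<^sub>F x::real in at_right 0. \<bar>ln (inverse x) / inverse x\<bar> = x * \<bar>ln x\<bar>"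
    by (auto simp: eventually_at_filter ln_inverse abs_mult divide_inverse)
  ultimately show ?thesis
    using tendsto_cong by fastforce
qed

lemma has_derivative_at_0_zeroI:
  fixes F :: "real \<Rightarrow> real"
  assumes "0 < T" "F 0 = 0" "\<And>x. 0 < x \<Longrightarrow> x \<le> T \<Longrightarrow> x \<le> 1 \<Longrightarrow> \<bar>F x\<bar> \<le> C * x * (x * \<bar>ln x\<bar> + x)"
  shows "(F has_real_derivative 0) (at 0 within {0..T})"
proof -
  have m: "((\<lambda>x::real. C * (x * \<bar>ln x\<bar> + x)) \<longlongrightarrow> C * (0 + 0)) (at_right 0)"
    by (intro tendsto_intros x_ln_x_tendsto_0)
  have "((\<lambda>x. F x / x) \<longlongrightarrow> 0) (at_right 0)"
  proof (rule tendsto_rabs_zero_cancel, rule tendsto_sandwich[OF _ _ tendsto_const])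
    show "((\<lambda>x::real. C * (x * \<bar>ln x\<bar> + x)) \<longlongrightarrow> 0) (at_right 0)" using m by simp
    have "\<bar>F x / x\<bar> \<le> C * (x * \<bar>ln x\<bar> + x)" if "0 < x" "x < min T 1" for x
      using assms(3)[of x] that by (simp add: abs_divide field_simps)
    then show "\<forall>\<^sub>F x in at_right 0. \<bar>F x / x\<bar> \<le> C * (x * \<bar>ln x\<bar> + x)"
      using assms(1) unfolding eventually_at_right_field by (intro exI[of _ "min T 1"]) auto
  qed simp
  then have "((\<lambda>x. (F x - F 0) / (x - 0)) \<longlongrightarrow> 0) (at 0 within {0..T})"
    using assms(1,2) by (simp add: at_within_Icc_at_right)
  then show ?thesis by (simp only: has_field_derivative_iff)
qed

section \<open>Parameter integrals with a singular weight and a regular factor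
  \<open>H (t * z)\<close>\<close>

lemma parametric_integrand_integrable:
  fixes s :: "real \<Rightarrow> real"
  assumes s: "set_integrable lborel {0<..<1} s" and H: "continuous_on {0..T} H" and t: "t \<in> {0..T}"
  shows "set_integrable lborel {0<..<1} (\<lambda>z. s z * H (t * z))"
proof -
  obtain M where M: "\<And>x. x \<in> {0..T} \<Longrightarrow> norm (H x) \<le> M"
    using continuous_on_Icc_bounded[OF H] by blast
  have r: "t * z \<in> {0..T}" if "z \<in> {0<..<1}" for z
    using t that mult_left_le[of z t] by auto
  have c: "continuous_on {0<..<1} (\<lambda>z. H (t * z))"
    by (intro continuous_on_compose2[OF H] continuous_intros) (use r in auto)
  define s' where "s' = (\<lambda>z. indicator {0<..<1} z *\<^sub>R s z)"
  define H' where "H' = (\<lambda>z. indicator {0<..<1} z *\<^sub>R H (t * z))"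
  have [measurable]: "H' \<in> borel_measurable borel"
    unfolding H'_def using borel_measurable_continuous_on_indicator[OF _ c] by simp
  have [measurable]: "s' \<in> borel_measurable borel"
    using borel_measurable_integrable[OF s[unfolded set_integrable_def]] by (simp add: s'_def)
  have "indicator {0<..<1} z *\<^sub>R (s z * H (t * z)) = s' z * H' z" for z
    by (simp add: s'_def H'_def indicator_def)
  then have "set_borel_measurable lborel {0<..<1} (\<lambda>z. s z * H (t * z))"
    by (simp add: set_borel_measurable_def)
  moreover have "AE z in lborel. z \<in> {0<..<1} \<longrightarrow> norm (s z * H (t * z)) \<le> norm (\<bar>s z\<bar> * M)"
  proof (intro AE_I2 impI)
    fix z :: real assume "z \<in> {0<..<1}"
    from M[OF r[OF this]] have "\<bar>s z\<bar> * \<bar>H (t * z)\<bar> \<le> \<bar>s z\<bar> * M" by (intro mult_left_mono) auto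
    then show "norm (s z * H (t * z)) \<le> norm (\<bar>s z\<bar> * M)"
      unfolding real_norm_def abs_mult abs_abs using abs_ge_self[of M] by (meson abs_ge_zero mult_left_mono order_trans)
  qed
  moreover have "set_integrable lborel {0<..<1} (\<lambda>z. \<bar>s z\<bar> * M)"
    using set_integrable_abs[OF s] by simp
  ultimately show ?thesis using set_integrable_bound by blast
qed

lemma parametric_integral_close:
  fixes s :: "real \<Rightarrow> real"
  assumes s: "set_integrable lborel {0<..<1} s" and f: "set_integrable lborel {0<..<1} (\<lambda>z. s z * f z)"
    and e: "\<And>z. z \<in> {0<..<1} \<Longrightarrow> \<bar>f z\<bar> \<le> e"
  shows "\<bar>LBINT z:{0<..<1}. s z * f z\<bar> \<le> e * (LBINT z:{0<..<1}. \<bar>s z\<bar>)"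
proof -
  have "\<bar>LBINT z:{0<..<1}. s z * f z\<bar> \<le> (LBINT z:{0<..<1}. \<bar>s z * f z\<bar>)"
    using set_integral_norm_bound[OF f] by simp
  also have "\<dots> \<le> (LBINT z:{0<..<1}. e * \<bar>s z\<bar>)"
  proof (rule set_integral_mono)
    show "set_integrable lborel {0<..<1} (\<lambda>z. \<bar>s z * f z\<bar>)" using f by (rule set_integrable_abs)
    show "set_integrable lborel {0<..<1} (\<lambda>z. e * \<bar>s z\<bar>)" using set_integrable_abs[OF s] by simp
    fix z :: real assume "z \<in> {0<..<1}"
    from mult_left_mono[OF e[OF this], of "\<bar>s z\<bar>"] show "\<bar>s z * f z\<bar> \<le> e * \<bar>s z\<bar>"
      by (simp add: abs_mult mult.commute)
  qed
  finally show ?thesis by simp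
qed

lemma parametric_integral_continuous:
  fixes s :: "real \<Rightarrow> real"
  assumes s: "set_integrable lborel {0<..<1} s" and H: "continuous_on {0..T} H"
  shows "continuous_on {0..T} (\<lambda>t. LBINT z:{0<..<1}. s z * H (t * z))"
  unfolding continuous_on_iff
proof (intro ballI allI impI)
  fix x e :: real assume x: "x \<in> {0..T}" and e: "0 < e"
  define A where "A = (LBINT z:{0<..<1}. \<bar>s z\<bar>)"
  have A: "0 \<le> A" unfolding A_def set_lebesgue_integral_def by (intro Bochner_Integration.integral_nonneg) simp
  define e' where "e' = e / (A + 1)"
  have e': "0 < e'" "e' * A < e" using e A by (auto simp: e'_def field_simps)
  obtain d where d: "0 < d" "\<And>u v. u \<in> {0..T} \<Longrightarrow> v \<in> {0..T} \<Longrightarrow> dist v u < d \<Longrightarrow> dist (H v) (H u) < e'"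
    using compact_uniformly_continuous[OF H compact_Icc] e'(1) unfolding uniformly_continuous_on_def by blast
  show "\<exists>d>0. \<forall>y\<in>{0..T}. dist y x < d \<longrightarrow>
      dist (LBINT z:{0<..<1}. s z * H (y * z)) (LBINT z:{0<..<1}. s z * H (x * z)) < e"
  proof (intro exI conjI ballI impI)
    fix y assume y: "y \<in> {0..T}" and yx: "dist y x < d"
    note iy = parametric_integrand_integrable[OF s H y] and ix = parametric_integrand_integrable[OF s H x]
    have b: "\<bar>H (y * z) - H (x * z)\<bar> \<le> e'" if z: "z \<in> {0<..<1}" for z
    proof -
      have "y * z \<in> {0..T}" "x * z \<in> {0..T}" using x y z mult_left_le[of z y] mult_left_le[of z x] by auto
      moreover have "\<bar>y * z - x * z\<bar> \<le> \<bar>y - x\<bar>"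
        using z mult_left_le[of z "\<bar>y - x\<bar>"] by (simp add: abs_mult flip: left_diff_distrib)
      ultimately show ?thesis using d(2)[of "x * z" "y * z"] yx by (simp add: dist_real_def)
    qed
    have "(LBINT z:{0<..<1}. s z * H (y * z)) - (LBINT z:{0<..<1}. s z * H (x * z))
        = (LBINT z:{0<..<1}. s z * (H (y * z) - H (x * z)))"
      unfolding set_integral_diff(2)[OF iy ix, symmetric] by (simp add: right_diff_distrib)
    also have "\<bar>\<dots>\<bar> \<le> e' * A"
      unfolding A_def
      by (rule parametric_integral_close[OF s _ b]) (use set_integral_diff(1)[OF iy ix] in \<open>simp add: right_diff_distrib\<close>)
    finally show "dist (LBINT z:{0<..<1}. s z * H (y * z)) (LBINT z:{0<..<1}. s z * H (x * z)) < e"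
      using e'(2) by (simp add: dist_real_def)
  qed (rule d(1))
qed

text \<open>Since \<open>|y * z - x * z| \<le> |y - x|\<close>, uniform continuity of
  \<open>Hd\<close> bounds the first order remainder by \<open>e' * |y - x|\<close> for all
  \<open>z\<close> at once. The chain rule moves a factor \<open>z\<close> into the weight, which
  stays integrable, so the lemma can be applied again.\<close>

lemma parametric_integral_derivative:
  fixes s :: "real \<Rightarrow> real"
  assumes s: "set_integrable lborel {0<..<1} s"
    and D: "\<And>x. x \<in> {0..T} \<Longrightarrow> (H has_real_derivative Hd x) (at x within {0..T})"
    and Hd: "continuous_on {0..T} Hd" and x: "x \<in> {0..T}"
  shows "((\<lambda>t. LBINT z:{0<..<1}. s z * H (t * z)) has_real_derivative
      (LBINT z:{0<..<1}. (s z * z) * Hd (x * z))) (at x within {0..T})"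
    and "set_integrable lborel {0<..<1} (\<lambda>z. s z * z)"
proof -
  have H: "continuous_on {0..T} H" using D DERIV_continuous_on by blast
  show sz: "set_integrable lborel {0<..<1} (\<lambda>z. s z * z)"
    using parametric_integrand_integrable[OF s, of 1 "\<lambda>z. z" 1] by (simp add: continuous_on_id)
  define A where "A = (LBINT z:{0<..<1}. \<bar>s z\<bar>)"
  have A: "0 \<le> A" unfolding A_def set_lebesgue_integral_def by (intro Bochner_Integration.integral_nonneg) simp
  show "((\<lambda>t. LBINT z:{0<..<1}. s z * H (t * z)) has_real_derivative
      (LBINT z:{0<..<1}. (s z * z) * Hd (x * z))) (at x within {0..T})"
    unfolding has_field_derivative_def has_derivative_within_alt
  proof (intro conjI allI impI)
    fix e :: real assume e: "0 < e"
    define e' where "e' = e / (A + 1)"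
    have e': "0 < e'" "e' * A \<le> e" using e A by (auto simp: e'_def field_simps)
    obtain d where d: "0 < d" "\<And>u v. u \<in> {0..T} \<Longrightarrow> v \<in> {0..T} \<Longrightarrow> dist v u < d \<Longrightarrow> dist (Hd v) (Hd u) < e'"
      using compact_uniformly_continuous[OF Hd compact_Icc] e'(1) unfolding uniformly_continuous_on_def by blast
    show "\<exists>d>0. \<forall>y\<in>{0..T}. norm (y - x) < d \<longrightarrow>
      norm ((LBINT z:{0<..<1}. s z * H (y * z)) - (LBINT z:{0<..<1}. s z * H (x * z))
        - (LBINT z:{0<..<1}. (s z * z) * Hd (x * z)) * (y - x)) \<le> e * norm (y - x)"
    proof (intro exI conjI ballI impI)
      fix y assume y: "y \<in> {0..T}" and yx: "norm (y - x) < d"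
      note iy = parametric_integrand_integrable[OF s H y] and ix = parametric_integrand_integrable[OF s H x]
        and i1 = parametric_integrand_integrable[OF sz Hd x]
      let ?R = "\<lambda>z. H (y * z) - H (x * z) - Hd (x * z) * (y * z - x * z)"
      have b: "\<bar>?R z\<bar> \<le> e' * \<bar>y - x\<bar>" if z: "z \<in> {0<..<1}" for z
      proof -
        have r: "y * z \<in> {0..T}" "x * z \<in> {0..T}" using x y z mult_left_le[of z y] mult_left_le[of z x] by auto
        have le: "\<bar>y * z - x * z\<bar> \<le> \<bar>y - x\<bar>"
          using z mult_left_le[of z "\<bar>y - x\<bar>"] by (simp add: abs_mult flip: left_diff_distrib)
        let ?S = "closed_segment (x * z) (y * z)"
        have S: "?S \<subseteq> {0..T}" using r by (intro closed_segment_subset) auto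
        have "norm ((H (y * z) - Hd (x * z) * (y * z)) - (H (x * z) - Hd (x * z) * (x * z))) \<le> e' * norm (y * z - x * z)"
        proof (rule field_differentiable_bound[where S = ?S and f' = "\<lambda>u. Hd u - Hd (x * z)"])
          fix u assume u: "u \<in> ?S"
          have "(H has_real_derivative Hd u) (at u within ?S)"
            using D[of u] u S DERIV_subset by blast
          then show "((\<lambda>u. H u - Hd (x * z) * u) has_real_derivative Hd u - Hd (x * z)) (at u within ?S)"
            by (auto intro!: derivative_eq_intros)
          have "\<bar>u - x * z\<bar> \<le> \<bar>y * z - x * z\<bar>"
            using u segment_bound1[of u "x * z" "y * z"] by simp
          then have "dist u (x * z) < d" using le yx by (simp add: dist_real_def)
          then show "norm (Hd u - Hd (x * z)) \<le> e'"
            using d(2)[of "x * z" u] r(2) u S by (auto simp: dist_real_def)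
        qed auto
        also have "\<dots> \<le> e' * \<bar>y - x\<bar>" using le e'(1) by simp
        finally show ?thesis by (simp add: algebra_simps)
      qed
      have i: "set_integrable lborel {0<..<1} (\<lambda>z. s z * H (y * z) - s z * H (x * z) - ((s z * z) * Hd (x * z)) * (y - x))"
        by (intro set_integral_diff(1) iy ix set_integrable_mult_left i1)
      have eq: "s z * H (y * z) - s z * H (x * z) - ((s z * z) * Hd (x * z)) * (y - x) = s z * ?R z" for z
        by (simp add: algebra_simps)
      have "(LBINT z:{0<..<1}. s z * H (y * z)) - (LBINT z:{0<..<1}. s z * H (x * z))
          - (LBINT z:{0<..<1}. (s z * z) * Hd (x * z)) * (y - x) = (LBINT z:{0<..<1}. s z * ?R z)"
        unfolding eq[symmetric] set_integral_mult_left[symmetric]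
        by (simp only: set_integral_diff(2)[OF iy ix] set_integral_diff(1)[OF iy ix] set_integrable_mult_left[OF i1]
            set_integral_diff(2)[OF set_integral_diff(1)[OF iy ix] set_integrable_mult_left[OF i1]])
      also have "\<bar>\<dots>\<bar> \<le> (e' * \<bar>y - x\<bar>) * A"
        unfolding A_def by (rule parametric_integral_close[OF s _ b]) (use i in \<open>simp only: eq\<close>)
      also have "\<dots> = (e' * A) * \<bar>y - x\<bar>" by simp
      also have "\<dots> \<le> e * \<bar>y - x\<bar>" using e'(2) by (intro mult_right_mono) auto
      finally show "norm ((LBINT z:{0<..<1}. s z * H (y * z)) - (LBINT z:{0<..<1}. s z * H (x * z))
        - (LBINT z:{0<..<1}. (s z * z) * Hd (x * z)) * (y - x)) \<le> e * norm (y - x)" by simp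
    qed (rule d(1))
  qed (rule bounded_linear_mult_right)
qed

section \<open>The exponent \<alpha> and the smoothness of \<open>g_kernel\<close>\<close>

locale variable_exponent =
  fixes T L :: real and \<alpha> \<alpha>1 \<alpha>2 \<alpha>3 :: "real \<Rightarrow> real"
  assumes T_pos: "0 < T"
    and \<alpha>_bounds: "\<And>t. t \<in> {0..T} \<Longrightarrow> 1 < \<alpha> t \<and> \<alpha> t < 2"
    and D0: "\<And>t. t \<in> {0..T} \<Longrightarrow> (\<alpha> has_real_derivative \<alpha>1 t) (at t within {0..T})"
    and D1: "\<And>t. t \<in> {0..T} \<Longrightarrow> (\<alpha>1 has_real_derivative \<alpha>2 t) (at t within {0..T})"
    and D2: "\<And>t. t \<in> {0..T} \<Longrightarrow> (\<alpha>2 has_real_derivative \<alpha>3 t) (at t within {0..T})"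
    and L_pos: "0 < L" and \<alpha>_deriv_bound: "\<And>t. t \<in> {0..T} \<Longrightarrow> \<bar>\<alpha>1 t\<bar> + \<bar>\<alpha>2 t\<bar> + \<bar>\<alpha>3 t\<bar> \<le> L"
    and \<alpha>1_0: "\<alpha>1 0 = 0" and \<alpha>2_0: "\<alpha>2 0 = 0"
begin

text \<open>Applied three times, starting from the bound on \<open>\<alpha>3\<close>, it gives
  linear, quadratic and cubic decay at \<open>0\<close>. The mean value form keeps the constant
  \<open>L\<close> throughout.\<close>

lemma deriv_growth:
  fixes f f' :: "real \<Rightarrow> real"
  assumes D: "\<And>t. t \<in> {0..T} \<Longrightarrow> (f has_real_derivative f' t) (at t within {0..T})"
    and b: "\<And>t. t \<in> {0..T} \<Longrightarrow> \<bar>f' t\<bar> \<le> L * t ^ k" and x: "x \<in> {0..T}"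
  shows "\<bar>f x - f 0\<bar> \<le> L * x ^ (k + 1)"
proof -
  have "norm (f x - f 0) \<le> (L * x ^ k) * norm (x - 0)"
  proof (rule field_differentiable_bound[where S = "{0..x}"])
    fix z assume z: "z \<in> {0..x}"
    show "(f has_real_derivative f' z) (at z within {0..x})"
      by (rule DERIV_subset[OF D]) (use x z in auto)
    have "\<bar>f' z\<bar> \<le> L * z ^ k" using b[of z] x z by auto
    also have "\<dots> \<le> L * x ^ k" using z L_pos by (intro mult_left_mono power_mono) auto
    finally show "norm (f' z) \<le> L * x ^ k" by simp
  qed (use x in auto)
  then show ?thesis using x by (simp add: ac_simps)
qed

lemma \<alpha>2_growth: "x \<in> {0..T} \<Longrightarrow> \<bar>\<alpha>2 x\<bar> \<le> L * x"
  using deriv_growth[OF D2, of 0 x] \<alpha>_deriv_bound \<alpha>2_0 by force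

lemma \<alpha>1_growth: "x \<in> {0..T} \<Longrightarrow> \<bar>\<alpha>1 x\<bar> \<le> L * x ^ 2"
  using deriv_growth[OF D1, of 1 x] \<alpha>2_growth \<alpha>1_0 by (simp add: numeral_2_eq_2)

lemma \<alpha>_growth: "x \<in> {0..T} \<Longrightarrow> \<bar>\<alpha> 0 - \<alpha> x\<bar> \<le> L * x ^ 3"
  using deriv_growth[OF D0, of 2 x] \<alpha>1_growth by (simp add: numeral_3_eq_3 numeral_2_eq_2 abs_minus_commute)

lemma \<alpha>0: "1 < \<alpha> 0" "\<alpha> 0 < 2"
  using \<alpha>_bounds[of 0] T_pos by auto

lemma continuous_\<alpha>: "continuous_on {0..T} \<alpha>" "continuous_on {0..T} \<alpha>1" "continuous_on {0..T} \<alpha>2"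
  using D0 D1 D2 DERIV_continuous_on by blast+

text \<open>
  Writing \<open>h\<close> for \<open>hfun\<close>, the kernels are \<open>k t = t powr (1 - \<alpha> 0) * h t\<close> and, after substitution,
  \<open>g t = \<integral> rho z * h (t * z) dz\<close>, so \<open>g\<close> is as smooth as \<open>h = exp lexp * rG\<close>. The logarithms in the
  first two derivatives of \<open>lexp\<close> are compensated by \<open>\<alpha>1 0 = \<alpha>2 0 = 0\<close>.
\<close>

definition lexp :: "real \<Rightarrow> real"
  where "lexp x = (if x = 0 then 0 else (\<alpha> 0 - \<alpha> x) * ln x)"
definition lexp1 :: "real \<Rightarrow> real"
  where "lexp1 x = (if x = 0 then 0 else - \<alpha>1 x * ln x + (\<alpha> 0 - \<alpha> x) / x)"
definition lexp2 :: "real \<Rightarrow> real"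
  where "lexp2 x = (if x = 0 then 0 else - \<alpha>2 x * ln x - 2 * (\<alpha>1 x / x) - (\<alpha> 0 - \<alpha> x) / x\<^sup>2)"

text \<open>Each derivative of \<open>ln\<close> costs one power of \<open>x\<close>, and the decay
  of the matching derivative of \<alpha> pays for it. For \<open>lexp\<close> the assumption
  \<open>x \<le> 1\<close> gives away one power, so that it shares the form expected by
  \<open>has_derivative_at_0_zeroI\<close> with \<open>lexp1\<close>.\<close>

lemma lexp_bounds:
  assumes "0 < x" "x \<le> T" "x \<le> 1"
  shows "\<bar>lexp x\<bar> \<le> L * x * (x * \<bar>ln x\<bar> + x)" "\<bar>lexp1 x\<bar> \<le> L * x * (x * \<bar>ln x\<bar> + x)"
    "\<bar>lexp2 x\<bar> \<le> 3 * L * (x * \<bar>ln x\<bar> + x)"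
proof -
  have x: "x \<in> {0..T}" using assms by auto
  have A: "\<bar>\<alpha> 0 - \<alpha> x\<bar> \<le> L * x ^ 3" "\<bar>\<alpha>1 x\<bar> \<le> L * x ^ 2" "\<bar>\<alpha>2 x\<bar> \<le> L * x"
    using \<alpha>_growth[OF x] \<alpha>1_growth[OF x] \<alpha>2_growth[OF x] by auto
  have "\<bar>lexp x\<bar> = \<bar>\<alpha> 0 - \<alpha> x\<bar> * \<bar>ln x\<bar>" using assms by (simp add: lexp_def abs_mult)
  also have "\<dots> \<le> (L * x ^ 3) * \<bar>ln x\<bar>" using A by (intro mult_right_mono) auto
  also have "\<dots> = (L * x * (x * \<bar>ln x\<bar>)) * x" by (simp add: power3_eq_cube)
  also have "\<dots> \<le> L * x * (x * \<bar>ln x\<bar>)" using assms L_pos by (intro mult_left_le mult_nonneg_nonneg) auto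
  also have "\<dots> \<le> L * x * (x * \<bar>ln x\<bar> + x)" using assms L_pos by (intro mult_left_mono) auto
  finally show "\<bar>lexp x\<bar> \<le> L * x * (x * \<bar>ln x\<bar> + x)" .
  have d: "\<bar>\<alpha> 0 - \<alpha> x\<bar> / x \<le> L * x * x" "\<bar>\<alpha>1 x\<bar> / x \<le> L * x" "\<bar>\<alpha> 0 - \<alpha> x\<bar> / x\<^sup>2 \<le> L * x"
    using A assms(1) by (simp_all add: divide_le_eq power2_eq_square power3_eq_cube mult.assoc)
  have l: "\<bar>\<alpha>1 x\<bar> * \<bar>ln x\<bar> \<le> L * x ^ 2 * \<bar>ln x\<bar>" "\<bar>\<alpha>2 x\<bar> * \<bar>ln x\<bar> \<le> L * x * \<bar>ln x\<bar>"
    using A by (intro mult_right_mono; simp)+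
  have "\<bar>lexp1 x\<bar> \<le> \<bar>\<alpha>1 x\<bar> * \<bar>ln x\<bar> + \<bar>\<alpha> 0 - \<alpha> x\<bar> / x"
    using assms(1) abs_triangle_ineq[of "- \<alpha>1 x * ln x" "(\<alpha> 0 - \<alpha> x) / x"] by (simp add: lexp1_def abs_mult abs_divide)
  also have "\<dots> \<le> L * x ^ 2 * \<bar>ln x\<bar> + L * x * x" using d l by linarith
  finally show "\<bar>lexp1 x\<bar> \<le> L * x * (x * \<bar>ln x\<bar> + x)" by (simp add: power2_eq_square algebra_simps)
  have "\<bar>lexp2 x\<bar> = \<bar>- \<alpha>2 x * ln x - 2 * (\<alpha>1 x / x) - (\<alpha> 0 - \<alpha> x) / x\<^sup>2\<bar>" using assms(1) by (simp add: lexp2_def)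
  also have "\<dots> \<le> \<bar>- \<alpha>2 x * ln x\<bar> + \<bar>2 * (\<alpha>1 x / x)\<bar> + \<bar>(\<alpha> 0 - \<alpha> x) / x\<^sup>2\<bar>" by linarith
  also have "\<dots> = \<bar>\<alpha>2 x\<bar> * \<bar>ln x\<bar> + 2 * (\<bar>\<alpha>1 x\<bar> / x) + \<bar>\<alpha> 0 - \<alpha> x\<bar> / x\<^sup>2"
    using assms(1) by (simp add: abs_mult abs_divide)
  also have "\<dots> \<le> L * x * \<bar>ln x\<bar> + 2 * (L * x) + L * x" using d l by linarith
  also have "\<dots> \<le> 3 * L * (x * \<bar>ln x\<bar> + x)" using L_pos assms(1) by (simp add: algebra_simps)
  finally show "\<bar>lexp2 x\<bar> \<le> 3 * L * (x * \<bar>ln x\<bar> + x)" .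
qed

lemma lexp_derivs:
  assumes x: "x \<in> {0..T}"
  shows "(lexp has_real_derivative lexp1 x) (at x within {0..T})"
    and "(lexp1 has_real_derivative lexp2 x) (at x within {0..T})"
proof -
  have "(lexp has_real_derivative lexp1 x) (at x within {0..T}) \<and> (lexp1 has_real_derivative lexp2 x) (at x within {0..T})"
  proof (cases "x = 0")
    case True
    have "(lexp has_real_derivative 0) (at 0 within {0..T})"
      by (rule has_derivative_at_0_zeroI[OF T_pos _ lexp_bounds(1)]) (simp_all add: lexp_def)
    moreover have "(lexp1 has_real_derivative 0) (at 0 within {0..T})"
      by (rule has_derivative_at_0_zeroI[OF T_pos _ lexp_bounds(2)]) (simp_all add: lexp1_def)
    ultimately show ?thesis using True by (simp add: lexp1_def lexp2_def)
  next
    case False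
    then have xp: "0 < x" using x by auto
    have "((\<lambda>x. (\<alpha> 0 - \<alpha> x) * ln x) has_real_derivative lexp1 x) (at x within {0..T})"
      using xp by (auto intro!: derivative_eq_intros D0[OF x] simp: lexp1_def)
    then have 1: "(lexp has_real_derivative lexp1 x) (at x within {0..T})"
      by (rule has_field_derivative_transform_within[OF _ xp x]) (auto simp: lexp_def dist_real_def)
    have "((\<lambda>x. - \<alpha>1 x * ln x + (\<alpha> 0 - \<alpha> x) / x) has_real_derivative lexp2 x) (at x within {0..T})"
      using xp by (auto intro!: derivative_eq_intros D0[OF x] D1[OF x] simp: lexp2_def power2_eq_square field_simps)
    then have 2: "(lexp1 has_real_derivative lexp2 x) (at x within {0..T})"
      by (rule has_field_derivative_transform_within[OF _ xp x]) (auto simp: lexp1_def dist_real_def)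
    from 1 2 show ?thesis ..
  qed
  then show "(lexp has_real_derivative lexp1 x) (at x within {0..T})"
    and "(lexp1 has_real_derivative lexp2 x) (at x within {0..T})" by auto
qed

text \<open>The critical point is \<open>0\<close>, where \<open>\<alpha>2 x * ln x\<close> tends to
  zero because \<open>\<alpha>2\<close> decays linearly there.\<close>

lemma continuous_lexp2: "continuous_on {0..T} lexp2"
  unfolding continuous_on_eq_continuous_within
proof
  fix x assume x: "x \<in> {0..T}"
  show "continuous (at x within {0..T}) lexp2"
  proof (cases "x = 0")
    case True
    have m: "((\<lambda>x::real. 3 * L * (x * \<bar>ln x\<bar> + x)) \<longlongrightarrow> 3 * L * (0 + 0)) (at_right 0)"
      by (intro tendsto_intros x_ln_x_tendsto_0)
    have "(lexp2 \<longlongrightarrow> 0) (at_right 0)"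
    proof (rule tendsto_rabs_zero_cancel, rule tendsto_sandwich[OF _ _ tendsto_const])
      show "((\<lambda>x::real. 3 * L * (x * \<bar>ln x\<bar> + x)) \<longlongrightarrow> 0) (at_right 0)" using m by simp
      show "\<forall>\<^sub>F x in at_right 0. \<bar>lexp2 x\<bar> \<le> 3 * L * (x * \<bar>ln x\<bar> + x)"
        using T_pos lexp_bounds(3) unfolding eventually_at_right_field by (intro exI[of _ "min T 1"]) auto
    qed simp
    then show ?thesis using True T_pos by (simp add: continuous_within at_within_Icc_at_right lexp2_def)
  next
    case False
    then have xp: "0 < x" using x by auto
    have "continuous_on {0<..T} (\<lambda>x. - \<alpha>2 x * ln x - 2 * (\<alpha>1 x / x) - (\<alpha> 0 - \<alpha> x) / x\<^sup>2)"
      by (intro continuous_intros continuous_\<alpha>[THEN continuous_on_subset]) auto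
    then have "continuous_on {0<..T} lexp2"
      by (rule continuous_on_cong[THEN iffD1, rotated -1]) (auto simp: lexp2_def)
    then have "continuous (at x within {0<..T}) lexp2"
      using xp x by (auto simp: continuous_on_eq_continuous_within)
    moreover have "at x within {0<..T} = at x within {0..T}"
      by (rule at_within_nhd[of _ "{0<..}"]) (use xp in auto)
    ultimately show ?thesis by simp
  qed
qed

definition rG :: "real \<Rightarrow> real" where "rG x = rGamma (2 - \<alpha> x)"
definition rG1 :: "real \<Rightarrow> real" where "rG1 x = rG x * Digamma (2 - \<alpha> x) * \<alpha>1 x"
definition rG2 :: "real \<Rightarrow> real"
  where "rG2 x = rG1 x * Digamma (2 - \<alpha> x) * \<alpha>1 x + rG x * (- Polygamma 1 (2 - \<alpha> x) * \<alpha>1 x) * \<alpha>1 x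
    + rG x * Digamma (2 - \<alpha> x) * \<alpha>2 x"

lemma nonpos_int: "x \<in> {0..T} \<Longrightarrow> 2 - \<alpha> x \<notin> \<int>\<^sub>\<le>\<^sub>0"
  using \<alpha>_bounds[of x] by (auto elim!: nonpos_Ints_cases)

lemma rG_derivs:
  assumes x: "x \<in> {0..T}"
  shows "(rG has_real_derivative rG1 x) (at x within {0..T})"
    and "(rG1 has_real_derivative rG2 x) (at x within {0..T})"
proof -
  have d: "((\<lambda>x. 2 - \<alpha> x) has_real_derivative - \<alpha>1 x) (at x within {0..T})"
    by (auto intro!: derivative_eq_intros D0[OF x])
  have 1: "((\<lambda>x. rGamma (2 - \<alpha> x)) has_real_derivative (- rGamma (2 - \<alpha> x) * Digamma (2 - \<alpha> x)) * - \<alpha>1 x) (at x within {0..T})"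
    by (rule DERIV_chain2[OF has_field_derivative_rGamma_no_nonpos_int[OF nonpos_int[OF x]] d])
  have 2: "((\<lambda>x. Digamma (2 - \<alpha> x)) has_real_derivative Polygamma (Suc 0) (2 - \<alpha> x) * - \<alpha>1 x) (at x within {0..T})"
    by (rule DERIV_chain2[OF has_field_derivative_Polygamma[OF nonpos_int[OF x]] d])
  show rG: "(rG has_real_derivative rG1 x) (at x within {0..T})"
    using 1 unfolding rG_def[abs_def] rG1_def by simp
  show "(rG1 has_real_derivative rG2 x) (at x within {0..T})"
    unfolding rG1_def[abs_def]
    using DERIV_mult[OF DERIV_mult[OF rG 2] D1[OF x]] by (rule DERIV_cong) (simp add: rG2_def rG1_def algebra_simps)
qed

lemma continuous_rG2: "continuous_on {0..T} rG2"
proof -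
  have P: "continuous_on {0..T} (\<lambda>x. Polygamma n (2 - \<alpha> x))" for n
    by (rule continuous_on_compose2[OF continuous_on_Polygamma[of "{2 - \<alpha> x | x. x \<in> {0..T}}"]])
      (use nonpos_int in \<open>auto intro!: continuous_intros continuous_\<alpha>\<close>)
  have r: "continuous_on {0..T} rG" "continuous_on {0..T} rG1"
    using rG_derivs DERIV_continuous_on by blast+
  show ?thesis
    unfolding rG2_def[abs_def] by (intro continuous_intros r P continuous_\<alpha>)
qed

definition hfun :: "real \<Rightarrow> real" where "hfun x = exp (lexp x) * rG x"
definition hfun1 :: "real \<Rightarrow> real" where "hfun1 x = exp (lexp x) * (lexp1 x * rG x + rG1 x)"
definition hfun2 :: "real \<Rightarrow> real"
  where "hfun2 x = exp (lexp x) * (lexp1 x * (lexp1 x * rG x + rG1 x) + (lexp2 x * rG x + lexp1 x * rG1 x + rG2 x))"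

lemma hfun_derivs:
  assumes x: "x \<in> {0..T}"
  shows "(hfun has_real_derivative hfun1 x) (at x within {0..T})"
    and "(hfun1 has_real_derivative hfun2 x) (at x within {0..T})"
proof -
  note d = lexp_derivs[OF x] rG_derivs[OF x]
  have e: "((\<lambda>x. exp (lexp x)) has_real_derivative exp (lexp x) * lexp1 x) (at x within {0..T})"
    by (rule DERIV_chain2[OF DERIV_exp d(1)])
  show "(hfun has_real_derivative hfun1 x) (at x within {0..T})"
    unfolding hfun_def[abs_def] using DERIV_mult[OF e d(3)]
    by (rule DERIV_cong) (simp add: hfun1_def algebra_simps)
  show "(hfun1 has_real_derivative hfun2 x) (at x within {0..T})"
    unfolding hfun1_def[abs_def] using DERIV_mult[OF e DERIV_add[OF DERIV_mult[OF d(2,3)] d(4)]]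
    by (rule DERIV_cong) (simp add: hfun2_def algebra_simps)
qed

lemma continuous_hfun: "continuous_on {0..T} hfun" "continuous_on {0..T} hfun1" "continuous_on {0..T} hfun2"
proof -
  have r: "continuous_on {0..T} rG" "continuous_on {0..T} rG1" "continuous_on {0..T} lexp" "continuous_on {0..T} lexp1"
    using rG_derivs lexp_derivs DERIV_continuous_on by blast+
  show "continuous_on {0..T} hfun2"
    unfolding hfun2_def[abs_def] by (intro continuous_intros r continuous_lexp2 continuous_rG2)
  show "continuous_on {0..T} hfun" "continuous_on {0..T} hfun1"
    using hfun_derivs DERIV_continuous_on by blast+
qed

lemma hfun1_0: "hfun1 0 = 0"
  by (simp add: hfun1_def lexp1_def rG1_def \<alpha>1_0)

lemma hfun_pos: "x \<in> {0..T} \<Longrightarrow> 0 < hfun x"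
  using \<alpha>_bounds[of x] by (simp add: hfun_def rG_def rGamma_inverse_Gamma Gamma_real_pos)

lemma hfun_eq: "0 < x \<Longrightarrow> hfun x = x powr (\<alpha> 0 - \<alpha> x) / Gamma (2 - \<alpha> x)"
  by (simp add: hfun_def lexp_def rG_def powr_def rGamma_inverse_Gamma divide_inverse)

text \<open>Up to the factor \<open>Gamma (2 - \<alpha> 0)\<close>, the density of the Beta
  distribution with parameters \<open>2 - \<alpha> 0\<close> and \<open>\<alpha> 0 - 1\<close>. As
  \<open>hfun 0 = 1 / Gamma (2 - \<alpha> 0)\<close>, its total mass makes the integral formula for
  \<open>g\<close> agree with the prescribed value \<open>1\<close> at \<open>0\<close>.\<close>

definition rho :: "real \<Rightarrow> real"
  where "rho z = (1 - z) powr (\<alpha> 0 - 2) * z powr (1 - \<alpha> 0) / Gamma (\<alpha> 0 - 1)"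

lemma rho_nonneg: "0 \<le> rho z"
  using \<alpha>0 by (simp add: rho_def)

lemma rho_integral: "set_integrable lborel {0<..<1} rho" "(LBINT z:{0<..<1}. rho z) = Gamma (2 - \<alpha> 0)"
proof -
  let ?f = "\<lambda>z. z powr (1 - \<alpha> 0) * (1 - z) powr (\<alpha> 0 - 2)"
  have G: "Gamma (\<alpha> 0 - 1) > 0" using \<alpha>0 by (simp add: Gamma_real_pos)
  have "(?f has_integral Beta (2 - \<alpha> 0) (\<alpha> 0 - 1)) {0<..<1}"
    using has_integral_Beta_real[of "2 - \<alpha> 0" "\<alpha> 0 - 1"] \<alpha>0 by (simp add: has_integral_Icc_iff_Ioo)
  then have hi: "(?f has_integral Gamma (2 - \<alpha> 0) * Gamma (\<alpha> 0 - 1)) {0<..<1}"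
    using Gamma_fact[of 0, where 'a = real] by (simp add: Beta_def)
  then have "?f absolutely_integrable_on {0<..<1}"
    by (intro nonnegative_absolutely_integrable_1) (auto simp: integrable_on_def)
  then have i: "set_integrable lborel {0<..<1} ?f"
    by (simp add: set_integrable_def integrable_completion)
  have rf: "rho z = ?f z * (1 / Gamma (\<alpha> 0 - 1))" for z by (simp add: rho_def)
  show "set_integrable lborel {0<..<1} rho"
    unfolding rf using i by (intro set_integrable_mult_left)
  have "(LBINT z:{0<..<1}. ?f z) = integral {0<..<1} ?f" by (rule set_borel_integral_eq_integral(2)[OF i])
  also have "\<dots> = Gamma (2 - \<alpha> 0) * Gamma (\<alpha> 0 - 1)" by (rule integral_unique[OF hi])
  finally show "(LBINT z:{0<..<1}. rho z) = Gamma (2 - \<alpha> 0)"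
    unfolding rf set_integral_mult_left using G by simp
qed

definition g1 :: "real \<Rightarrow> real" where "g1 t = (LBINT z:{0<..<1}. (rho z * z) * hfun1 (t * z))"
definition g2 :: "real \<Rightarrow> real" where "g2 t = (LBINT z:{0<..<1}. (rho z * z * z) * hfun2 (t * z))"

lemma g_kernel_eq:
  assumes "t \<in> {0..T}"
  shows "g_kernel \<alpha> t = (LBINT z:{0<..<1}. rho z * hfun (t * z))"
proof (cases "t = 0")
  case True
  have "Gamma (2 - \<alpha> 0) \<noteq> 0" using Gamma_real_pos[of "2 - \<alpha> 0"] \<alpha>0 by linarith
  then have "(LBINT z:{0<..<1}. rho z * hfun 0) = 1"
    using rho_integral(2) by (simp add: hfun_def lexp_def rG_def rGamma_inverse_Gamma)
  then show ?thesis using True by (simp add: g_kernel_def)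
next
  case False
  then have t: "0 < t" using assms by auto
  have "(t * z) powr (\<alpha> 0 - \<alpha> (t * z)) / (Gamma (\<alpha> 0 - 1) * Gamma (2 - \<alpha> (t * z)))
      * (1 - z) powr (\<alpha> 0 - 2) * z powr (1 - \<alpha> 0) = rho z * hfun (t * z)" if "z \<in> {0<..<1}" for z
    using t that by (simp add: hfun_eq rho_def)
  then have "(LBINT z:{0<..<1}. (t * z) powr (\<alpha> 0 - \<alpha> (t * z)) / (Gamma (\<alpha> 0 - 1) * Gamma (2 - \<alpha> (t * z)))
      * (1 - z) powr (\<alpha> 0 - 2) * z powr (1 - \<alpha> 0)) = (LBINT z:{0<..<1}. rho z * hfun (t * z))"
    by (intro set_lebesgue_integral_cong) auto
  then show ?thesis using False by (simp only: g_kernel_def if_False)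
qed

lemma g_derivs:
  assumes t: "t \<in> {0..T}"
  shows "(g_kernel \<alpha> has_real_derivative g1 t) (at t within {0..T})"
    and "(g1 has_real_derivative g2 t) (at t within {0..T})"
proof -
  note p = parametric_integral_derivative[OF rho_integral(1) hfun_derivs(1) continuous_hfun(2) t]
  have "(g_kernel \<alpha> has_real_derivative (LBINT z:{0<..<1}. (rho z * z) * hfun1 (t * z))) (at t within {0..T})"
    by (rule has_field_derivative_transform_within[OF p(1), of 1]) (use t in \<open>auto simp: g_kernel_eq\<close>)
  then show "(g_kernel \<alpha> has_real_derivative g1 t) (at t within {0..T})"
    by (simp add: g1_def)
  show "(g1 has_real_derivative g2 t) (at t within {0..T})"
    unfolding g1_def[abs_def] g2_def
    by (rule parametric_integral_derivative(1)[OF p(2) hfun_derivs(2) continuous_hfun(3) t])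
qed

lemma continuous_g: "continuous_on {0..T} (g_kernel \<alpha>)" "continuous_on {0..T} g1" "continuous_on {0..T} g2"
proof -
  show "continuous_on {0..T} (g_kernel \<alpha>)" "continuous_on {0..T} g1"
    using g_derivs DERIV_continuous_on by blast+
  have z: "0 \<in> {0..T}" using T_pos by simp
  note p = parametric_integral_derivative(2)[OF rho_integral(1) hfun_derivs(1) continuous_hfun(2) z]
  note q = parametric_integral_derivative(2)[OF p hfun_derivs(2) continuous_hfun(3) z]
  show "continuous_on {0..T} g2"
    unfolding g2_def[abs_def] by (rule parametric_integral_continuous[OF q continuous_hfun(3)])
qed

text \<open>It makes \<open>g1\<close> the primitive of \<open>g2\<close> from \<open>0\<close>, the
  form of kernel that \<open>quadrature_error\<close> handles.\<close>

lemma g1_0: "g1 0 = 0"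
  by (simp add: g1_def hfun1_0)

lemma g_0: "g_kernel \<alpha> 0 = 1"
  by (simp add: g_kernel_def)

text \<open>Together with \<open>g_0\<close> this gives
  \<open>w_weight \<alpha> \<tau> 0 \<ge> - 1\<close> whatever the step size, so stability needs no
  smallness of \<tau>.\<close>

lemma g_nonneg: "t \<in> {0..T} \<Longrightarrow> 0 \<le> g_kernel \<alpha> t"
  unfolding g_kernel_eq set_lebesgue_integral_def
proof (rule Bochner_Integration.integral_nonneg)
  fix z assume t: "t \<in> {0..T}"
  have "z \<in> {0<..<1} \<Longrightarrow> t * z \<in> {0..T}" using t mult_left_le[of z t] by auto
  then show "0 \<le> indicator {0<..<1} z *\<^sub>R (rho z * hfun (t * z))"
    using mult_nonneg_nonneg[OF rho_nonneg[of z] less_imp_le[OF hfun_pos[of "t * z"]]] by (auto simp: indicator_def)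
qed

text \<open>It includes \<open>s = 0\<close>, where both sides are zero because
  \<open>0 powr x = 0\<close>.\<close>

lemma k_kernel_eq: "s \<in> {0..T} \<Longrightarrow> k_kernel \<alpha> s = hfun s * s powr (1 - \<alpha> 0)"
  by (cases "s = 0") (simp_all add: k_kernel_def hfun_eq flip: powr_add)

lemma k_kernel_integrable: "set_integrable lborel {0..T} (k_kernel \<alpha>)"
proof -
  obtain M where M: "\<And>x. x \<in> {0..T} \<Longrightarrow> norm (hfun x) \<le> M"
    using continuous_on_Icc_bounded[OF continuous_hfun(1)] by blast
  have p: "set_integrable lborel {0..T} (\<lambda>s. s powr (1 - \<alpha> 0))"
    using T_pos \<alpha>0 by (intro set_integrable_powr_0) auto
  have "set_integrable lborel {0..T} (\<lambda>s. hfun s * s powr (1 - \<alpha> 0))"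
  proof (rule set_integrable_bound[where f = "\<lambda>s. M * s powr (1 - \<alpha> 0)"])
    show "set_integrable lborel {0..T} (\<lambda>s. M * s powr (1 - \<alpha> 0))" using p by simp
    have [measurable]: "(\<lambda>s. indicator {0..T} s *\<^sub>R hfun s) \<in> borel_measurable borel"
      by (rule borel_measurable_continuous_on_indicator[OF _ continuous_hfun(1)]) simp
    have "(\<lambda>s. (indicator {0..T} s *\<^sub>R hfun s) * s powr (1 - \<alpha> 0)) \<in> borel_measurable borel"
      by measurable
    then show "set_borel_measurable lborel {0..T} (\<lambda>s. hfun s * s powr (1 - \<alpha> 0))"
      by (simp add: set_borel_measurable_def mult.assoc)
    show "AE s in lborel. s \<in> {0..T} \<longrightarrow> norm (hfun s * s powr (1 - \<alpha> 0)) \<le> norm (M * s powr (1 - \<alpha> 0))"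
      using M by (intro AE_I2 impI) (fastforce simp: abs_mult intro!: mult_right_mono)
  qed
  then show ?thesis
    by (subst set_integrable_cong[OF refl, where f' = "\<lambda>s. hfun s * s powr (1 - \<alpha> 0)"]) (auto simp: k_kernel_eq)
qed

text \<open>After the substitution \<open>s = t * z\<close> the powers of \<open>t\<close> cancel,
  since \<open>1 + (\<alpha> 0 - 2) + (1 - \<alpha> 0) = 0\<close>. The point \<open>t = 0\<close>
  is excluded: there the convolution is zero but \<open>g\<close> is one.\<close>

lemma conv_beta_k:
  assumes t: "0 < t" "t \<le> T"
  shows "conv (beta_kernel (\<alpha> 0 - 1)) (k_kernel \<alpha>) t = g_kernel \<alpha> t"
proof -
  define f where "f s = indicator {0..t} s * (beta_kernel (\<alpha> 0 - 1) (t - s) * k_kernel \<alpha> s)" for s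
  have eq: "t * f (0 + t * z) = indicator {0<..<1} z *\<^sub>R (rho z * hfun (t * z))" for z
  proof -
    consider "z = 0" | "z = 1" | "z \<notin> {0..1}" | "0 < z" "z < 1" by fastforce
    then show ?thesis
    proof cases
      case 1
      then show ?thesis by (simp add: f_def k_kernel_def)
    next
      case 2
      then show ?thesis by (simp add: f_def beta_kernel_def)
    next
      case 3
      then have "t * z \<notin> {0..t}" using t by (auto simp: zero_le_mult_iff)
      moreover have "indicator {0<..<1} z = (0::real)" using 3 by (auto simp: indicator_def)
      ultimately show ?thesis by (simp add: f_def)
    next
      case 4
      have "t * z \<le> t" using t 4 by (intro mult_left_le) auto
      moreover have "0 \<le> t * z" using t 4 by simp
      ultimately have tz: "t * z \<in> {0..t}" "t * z \<in> {0..T}"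
        using t(2) unfolding atLeastAtMost_iff by linarith+
      have "t - t * z = t * (1 - z)" by (simp add: right_diff_distrib)
      then have b: "beta_kernel (\<alpha> 0 - 1) (t - t * z) = t powr (\<alpha> 0 - 2) * (1 - z) powr (\<alpha> 0 - 2) / Gamma (\<alpha> 0 - 1)"
        using t 4 by (simp add: beta_kernel_def powr_mult)
      have k: "k_kernel \<alpha> (t * z) = hfun (t * z) * (t powr (1 - \<alpha> 0) * z powr (1 - \<alpha> 0))"
        using t 4 by (simp add: k_kernel_eq[OF tz(2)] powr_mult)
      have "t * (t powr (\<alpha> 0 - 2) * t powr (1 - \<alpha> 0)) = 1"
        using t by (simp add: powr_minus flip: powr_add)
      moreover have "t * f (0 + t * z) = (t * (t powr (\<alpha> 0 - 2) * t powr (1 - \<alpha> 0))) * (rho z * hfun (t * z))"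
        using tz(1) by (simp add: f_def b k rho_def)
      ultimately show ?thesis using 4 by simp
    qed
  qed
  have "conv (beta_kernel (\<alpha> 0 - 1)) (k_kernel \<alpha>) t = (LBINT s. f s)"
    by (simp add: conv_def set_lebesgue_integral_def f_def)
  also have "\<dots> = \<bar>t\<bar> *\<^sub>R (LBINT z. f (0 + t * z))"
    by (rule lborel_integral_real_affine) (use t in auto)
  also have "\<dots> = (LBINT z. t * f (0 + t * z))" using t by simp
  also have "\<dots> = g_kernel \<alpha> t"
    unfolding eq using t by (simp add: g_kernel_eq set_lebesgue_integral_def)
  finally show ?thesis .
qed

end

section \<open>The product-integration weights\<close>

lemma set_integral_reflect:
  fixes K :: "real \<Rightarrow> 'b::{banach, second_countable_topology}"
  shows "(LBINT s:{a..b}. K (t - s)) = (LBINT y:{t - b..t - a}. K y)"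
    and "set_integrable lborel {a..b} (\<lambda>s. K (t - s)) \<longleftrightarrow> set_integrable lborel {t - b..t - a} K"
proof -
  define F where "F = (\<lambda>y. indicator {t - b..t - a} y *\<^sub>R K y)"
  have F: "(\<lambda>s. indicator {a..b} s *\<^sub>R K (t - s)) = (\<lambda>s. F (t - s))"
    by (auto simp: indicator_def F_def)
  show "(LBINT s:{a..b}. K (t - s)) = (LBINT y:{t - b..t - a}. K y)"
    and "set_integrable lborel {a..b} (\<lambda>s. K (t - s)) \<longleftrightarrow> set_integrable lborel {t - b..t - a} K"
    unfolding set_lebesgue_integral_def set_integrable_def
    unfolding F F_def[symmetric] by (rule integral_reflect_shift integrable_reflect_shift)+
qed

lemma set_integral_Icc_split:
  fixes K :: "real \<Rightarrow> 'b::{banach, second_countable_topology}"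
  assumes K: "set_integrable lborel {a..c} K" and b: "a \<le> b" "b \<le> c"
  shows "(LBINT y:{a..c}. K y) = (LBINT y:{a..b}. K y) + (LBINT y:{b..c}. K y)"
proof -
  have s: "set_integrable lborel {a..b} K" "set_integrable lborel {b<..c} K" "set_integrable lborel {b..c} K"
    by (rule set_integrable_subset[OF K]; use b in auto)+
  have "{a..b} \<inter> {b<..c} = {}" by auto
  moreover have "{a..c} = {a..b} \<union> {b<..c}" using b by auto
  ultimately have "(LBINT y:{a..c}. K y) = (LBINT y:{a..b}. K y) + (LBINT y:{b<..c}. K y)"
    using set_integral_Un[OF _ s(1,2)] by simp
  also have "(LBINT y:{b<..c}. K y) = (LBINT y:{b..c}. K y)"
    unfolding set_lebesgue_integral_def
  proof (rule integral_cong_AE)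
    show "AE y in lborel. indicator {b<..c} y *\<^sub>R K y = indicator {b..c} y *\<^sub>R K y"
      using AE_lborel_singleton[of b] by eventually_elim (auto simp: indicator_def)
  qed (use s in \<open>simp_all add: set_integrable_def borel_measurable_integrable\<close>)
  finally show ?thesis .
qed

lemma set_integral_kernel_interval:
  fixes K :: "real \<Rightarrow> 'b::{banach, second_countable_topology}"
  assumes K: "set_integrable lborel {0..t} K" and ab: "0 \<le> a" "a \<le> b" "b \<le> t"
  shows "(LBINT s:{a..b}. K (t - s)) = (LBINT y:{0..t - a}. K y) - (LBINT y:{0..t - b}. K y)"
proof -
  have "set_integrable lborel {0..t - a} K" by (rule set_integrable_subset[OF K]) (use ab in auto)
  from set_integral_Icc_split[OF this, of "t - b"] show ?thesis
    using ab by (simp add: set_integral_reflect(1))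
qed

lemma beta_kernel_integral:
  assumes "0 < \<mu>" "0 \<le> t"
  shows "set_integrable lborel {0..t} (beta_kernel \<mu>)"
    and "(LBINT s:{0..t}. beta_kernel \<mu> s) = beta_kernel (\<mu> + 1) t"
proof -
  have p: "set_integrable lborel {0..t} (\<lambda>s. s powr (\<mu> - 1))"
    using assms by (intro set_integrable_powr_0) auto
  have b: "beta_kernel \<mu> = (\<lambda>s. s powr (\<mu> - 1) * (1 / Gamma \<mu>))"
    by (simp add: beta_kernel_def[abs_def])
  show "set_integrable lborel {0..t} (beta_kernel \<mu>)"
    unfolding b using p by (intro set_integrable_mult_left)
  have "(LBINT s:{0..t}. s powr (\<mu> - 1)) = integral {0..t} (\<lambda>s. s powr (\<mu> - 1))"
    by (rule set_borel_integral_eq_integral(2)[OF p])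
  also have "\<dots> = t powr \<mu> / \<mu>"
    using has_integral_powr_from_0[of "\<mu> - 1" t] assms by (auto intro: integral_unique)
  finally have i: "(LBINT s:{0..t}. s powr (\<mu> - 1)) = t powr \<mu> / \<mu>" .
  have "Gamma (\<mu> + 1) = \<mu> * Gamma \<mu>"
    using assms by (intro Gamma_plus1) (auto elim!: nonpos_Ints_cases)
  then show "(LBINT s:{0..t}. beta_kernel \<mu> s) = beta_kernel (\<mu> + 1) t"
    unfolding b set_integral_mult_left i by (simp add: beta_kernel_def)
qed

lemma beta_kernel_nonneg: "0 < \<mu> \<Longrightarrow> 0 \<le> beta_kernel \<mu> t"
  by (simp add: beta_kernel_def Gamma_real_pos less_imp_le)

lemma beta_kernel_0: "beta_kernel \<mu> 0 = 0"
  by (simp add: beta_kernel_def)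

text \<open>Both integrations are exact and raise the order of the kernel by one each, which leaves
  a second difference of \<open>beta_kernel (\<mu> + 2)\<close>. On the diagonal the inner integral
  ends at \<open>t\<close>, where the integrated kernel vanishes, and only a first difference
  remains.\<close>

lemma omega_weight_eq:
  assumes \<mu>: "0 < \<mu>" and \<tau>: "0 < \<tau>" and j: "1 \<le> j" "j \<le> n"
  shows "\<tau> * omega_weight \<mu> \<tau> n j =
    (beta_kernel (\<mu> + 2) (real (n - j + 1) * \<tau>) - beta_kernel (\<mu> + 2) (real (n - j) * \<tau>))
    - (if j < n then beta_kernel (\<mu> + 2) (real (n - j) * \<tau>) - beta_kernel (\<mu> + 2) (real (n - 1 - j) * \<tau>) else 0)"
proof -
  let ?B = "beta_kernel (\<mu> + 1)" and ?BB = "beta_kernel (\<mu> + 2)"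
  let ?I = "{real (n - 1) * \<tau>..real n * \<tau>}"
  have n: "real (n - 1) = real n - 1" "real (j - 1) = real j - 1" using j by auto
  have inner: "(LBINT s:{real (j - 1) * \<tau>..min t (real j * \<tau>)}. beta_kernel \<mu> (t - s))
      = ?B (t - real (j - 1) * \<tau>) - ?B (t - min t (real j * \<tau>))" if "t \<in> ?I" for t
  proof -
    have "real (j - 1) * \<tau> \<le> real (n - 1) * \<tau>" using j \<tau> by (intro mult_right_mono) auto
    then have a: "real (j - 1) * \<tau> \<le> t" using that by auto
    have t0: "0 \<le> t" using that \<tau> by (auto intro: order_trans[of 0 "real (n - 1) * \<tau>"])
    have "real (j - 1) * \<tau> \<le> real j * \<tau>" using \<tau> by (intro mult_right_mono) auto
    then have "(LBINT s:{real (j - 1) * \<tau>..min t (real j * \<tau>)}. beta_kernel \<mu> (t - s))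
      = (LBINT y:{0..t - real (j - 1) * \<tau>}. beta_kernel \<mu> y) - (LBINT y:{0..t - min t (real j * \<tau>)}. beta_kernel \<mu> y)"
      using a t0 \<tau> by (intro set_integral_kernel_interval beta_kernel_integral \<mu>) auto
    also have "\<dots> = ?B (t - real (j - 1) * \<tau>) - ?B (t - min t (real j * \<tau>))"
      using a t0 by (simp add: beta_kernel_integral[OF \<mu>])
    finally show ?thesis .
  qed
  have outer: "set_integrable lborel ?I (\<lambda>t. ?B (t - real i * \<tau>)) \<and>
      (LBINT t:?I. ?B (t - real i * \<tau>)) = ?BB (real (n - i) * \<tau>) - ?BB (real (n - 1 - i) * \<tau>)" if i: "i < n" for i
  proof -
    have s: "indicator ?I t *\<^sub>R ?B (t - real i * \<tau>) = (\<lambda>y. indicator {real (n - 1 - i) * \<tau>..real (n - i) * \<tau>} y *\<^sub>R ?B y) (t - real i * \<tau>)" for t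
      using i n by (auto simp: indicator_def of_nat_diff algebra_simps)
    have BI: "set_integrable lborel {0..real (n - i) * \<tau>} ?B" using \<mu> \<tau> by (intro beta_kernel_integral) auto
    have l: "real (n - 1 - i) * \<tau> \<le> real (n - i) * \<tau>" using \<tau> by (intro mult_right_mono) auto
    have si: "set_integrable lborel {real (n - 1 - i) * \<tau>..real (n - i) * \<tau>} ?B"
      by (rule set_integrable_subset[OF BI]) (use \<tau> in auto)
    have "(LBINT y:{real (n - 1 - i) * \<tau>..real (n - i) * \<tau>}. ?B y) = ?BB (real (n - i) * \<tau>) - ?BB (real (n - 1 - i) * \<tau>)"
      using set_integral_Icc_split[OF BI _ l] \<mu> \<tau> by (simp add: beta_kernel_integral ac_simps)
    then show ?thesis
      using si integral_shift[of "\<lambda>y. indicator {real (n - 1 - i) * \<tau>..real (n - i) * \<tau>} y *\<^sub>R ?B y" "real i * \<tau>"]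
        integrable_shift[of "\<lambda>y. indicator {real (n - 1 - i) * \<tau>..real (n - i) * \<tau>} y *\<^sub>R ?B y" "real i * \<tau>"]
      unfolding set_integrable_def set_lebesgue_integral_def s by simp
  qed
  have "\<tau> * omega_weight \<mu> \<tau> n j = (LBINT t:?I. ?B (t - real (j - 1) * \<tau>) - ?B (t - min t (real j * \<tau>)))"
    unfolding omega_weight_def using \<tau> by (simp del: One_nat_def, intro set_lebesgue_integral_cong allI impI inner) simp_all
  also have "\<dots> = (LBINT t:?I. ?B (t - real (j - 1) * \<tau>)) - (if j < n then (LBINT t:?I. ?B (t - real j * \<tau>)) else 0)"
  proof (cases "j < n")
    case True
    have "real j * \<tau> \<le> real (n - 1) * \<tau>" using True \<tau> by (intro mult_right_mono) auto
    then have "(LBINT t:?I. ?B (t - real (j - 1) * \<tau>) - ?B (t - min t (real j * \<tau>)))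
        = (LBINT t:?I. ?B (t - real (j - 1) * \<tau>) - ?B (t - real j * \<tau>))"
      by (intro set_lebesgue_integral_cong) auto
    then show ?thesis using True outer[of "j - 1"] outer[of j] j by (simp add: set_integral_diff(2))
  next
    case False
    then have "(LBINT t:?I. ?B (t - real (j - 1) * \<tau>) - ?B (t - min t (real j * \<tau>)))
        = (LBINT t:?I. ?B (t - real (j - 1) * \<tau>))"
      using j by (intro set_lebesgue_integral_cong) (auto simp: min_def beta_kernel_0)
    then show ?thesis using False by simp
  qed
  finally show ?thesis using outer[of "j - 1"] outer[of j] j by (auto simp: Suc_diff_le)
qed

text \<open>Below the diagonal the weights are the second differences \<open>C * D (n - j)\<close>;
  on the diagonal they are exactly half of \<open>C * D 0\<close>. Hence twice the triangular sum is
  the full symmetric form of \<open>second_difference_psd\<close>.\<close>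

lemma omega_weight_psd:
  fixes V :: "nat \<Rightarrow> 'b::real_inner"
  assumes \<mu>: "0 < \<mu>" "\<mu> < 1" and \<tau>: "0 < \<tau>"
  shows "0 \<le> (\<Sum>n=1..m. \<Sum>j=1..n. \<tau> * omega_weight \<mu> \<tau> n j * inner (V j) (V n))"
proof -
  define p where "p = \<mu> + 1"
  define D where "D x = \<bar>x + 1\<bar> powr p - 2 * \<bar>x\<bar> powr p + \<bar>x - 1\<bar> powr p" for x :: real
  define C where "C = \<tau> powr p / Gamma (p + 1)"
  have C: "0 \<le> C" using \<mu> by (simp add: C_def p_def Gamma_real_pos less_imp_le)
  have BB: "beta_kernel (\<mu> + 2) (real k * \<tau>) = C * real k powr p" for k
    using \<tau> by (simp add: beta_kernel_def C_def p_def powr_mult algebra_simps)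
  have lower: "\<tau> * omega_weight \<mu> \<tau> n j = C * D (real n - real j)" if "1 \<le> j" "j < n" for n j
    using that unfolding omega_weight_eq[OF \<mu>(1) \<tau> that(1) less_imp_le[OF that(2)]] BB
    by (simp add: D_def of_nat_diff algebra_simps)
  have diag: "2 * (\<tau> * omega_weight \<mu> \<tau> n n) = C * D 0" if "1 \<le> n" for n
    using that unfolding omega_weight_eq[OF \<mu>(1) \<tau> that order_refl] BB
    using \<mu> by (simp add: D_def p_def)
  define G where "G n j = C * D (real n - real j) * inner (V j) (V n)" for n j
  have "D (- x) = D x" for x
  proof -
    have "\<bar>- x + 1\<bar> = \<bar>x - 1\<bar>" "\<bar>- x - 1\<bar> = \<bar>x + 1\<bar>" by linarith+
    then show ?thesis by (simp add: D_def)
  qed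
  from this[of "real n - real j" for n j] have sym: "G n j = G j n" for n j
    by (simp add: G_def inner_commute)
  have "(\<Sum>n=1..m. \<Sum>j=1..m. G n j) = 2 * (\<Sum>n=1..m. \<Sum>j=1..n. \<tau> * omega_weight \<mu> \<tau> n j * inner (V j) (V n))"
  proof (induction m)
    case (Suc m)
    have "(\<Sum>n=1..Suc m. \<Sum>j=1..Suc m. G n j) = (\<Sum>n=1..m. \<Sum>j=1..m. G n j) + (\<Sum>n=1..m. G n (Suc m))
        + (\<Sum>j=1..m. G (Suc m) j) + G (Suc m) (Suc m)"
      by (simp add: sum.distrib)
    also have "(\<Sum>n=1..m. G n (Suc m)) = (\<Sum>j=1..m. G (Suc m) j)"
      by (intro sum.cong refl sym)
    also have "(\<Sum>j=1..m. G (Suc m) j) = (\<Sum>j=1..m. \<tau> * omega_weight \<mu> \<tau> (Suc m) j * inner (V j) (V (Suc m)))"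
      by (intro sum.cong refl) (simp add: G_def lower)
    also have "G (Suc m) (Suc m) = 2 * (\<tau> * omega_weight \<mu> \<tau> (Suc m) (Suc m) * inner (V (Suc m)) (V (Suc m)))"
      using diag[of "Suc m"] by (simp add: G_def algebra_simps)
    finally show ?case unfolding Suc.IH by simp
  qed simp
  moreover have "0 \<le> (\<Sum>n=1..m. \<Sum>j=1..m. G n j)"
  proof -
    have "0 \<le> C * (\<Sum>n=1..m. \<Sum>j=1..m. D (real n - real j) * inner (V n) (V j))"
      using second_difference_psd[of p "{1..m}" V] \<mu> C by (intro mult_nonneg_nonneg) (auto simp: Let_def D_def p_def)
    then show ?thesis by (simp add: G_def sum_distrib_left inner_commute mult.assoc)
  qed
  ultimately show ?thesis by simp
qed

text \<open>Summation by parts, as an induction with the stronger claim that the weighted sum is at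
  least \<open>p k\<close> times the plain one. It allows the exponential weight to be applied to
  the diffusion term, whose partial sums are nonnegative but whose terms need not be.\<close>

lemma weighted_partial_sums_nonneg:
  fixes b p :: "nat \<Rightarrow> real"
  assumes "\<And>k. k \<le> m \<Longrightarrow> 0 \<le> (\<Sum>n=1..k. b n)" "\<And>n. 0 \<le> p n" "\<And>n. p (Suc n) \<le> p n"
  shows "0 \<le> (\<Sum>n=1..m. p n * b n)"
proof -
  have "p k * (\<Sum>n=1..k. b n) \<le> (\<Sum>n=1..k. p n * b n)" if "k \<le> m" for k
    using that
  proof (induction k)
    case (Suc k)
    have "p (Suc k) * (\<Sum>n=1..k. b n) \<le> p k * (\<Sum>n=1..k. b n)"
      using assms Suc.prems by (intro mult_right_mono) auto
    then show ?case using Suc by (simp add: distrib_left)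
  qed simp
  from this[OF order_refl] mult_nonneg_nonneg[OF assms(2)[of m] assms(1)[OF order_refl]] show ?thesis by linarith
qed

text \<open>The exponents are distinct and at least one, so the geometric series without its first
  term dominates. It bounds both the rows and the columns of the kernel in the next lemma.\<close>

lemma sum_powers_le:
  fixes q :: real
  assumes "0 \<le> q" "q < 1" "finite J" "inj_on f J" "\<And>j. j \<in> J \<Longrightarrow> 1 \<le> f j"
  shows "(\<Sum>j\<in>J. q ^ f j) \<le> q / (1 - q)"
proof -
  have inj: "inj_on (\<lambda>j. f j - 1) J"
    using assms(4,5) unfolding inj_on_def by (metis le_add_diff_inverse)
  have "(\<Sum>j\<in>J. q ^ f j) = q * (\<Sum>j\<in>J. q ^ (f j - 1))"
    unfolding sum_distrib_left
  proof (intro sum.cong refl)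
    show "q ^ f j = q * q ^ (f j - 1)" if "j \<in> J" for j
      using assms(5)[OF that] by (metis le_add_diff_inverse plus_1_eq_Suc power_Suc)
  qed
  also have "(\<Sum>j\<in>J. q ^ (f j - 1)) = (\<Sum>i\<in>(\<lambda>j. f j - 1) ` J. q ^ i)"
    by (subst sum.reindex[OF inj]) simp
  also have "\<dots> \<le> (\<Sum>i. q ^ i)"
    using assms by (intro sum_le_suminf summable_geometric) auto
  also have "\<dots> = 1 / (1 - q)" using assms by (intro suminf_geometric) auto
  finally show ?thesis using assms(1) by (simp add: mult_left_mono)
qed

text \<open>The Schur test for the kernel \<open>q ^ (n - j)\<close>.\<close>

lemma geometric_kernel_bound:
  fixes q :: real and z :: "nat \<Rightarrow> real"
  assumes q: "0 \<le> q" "q < 1"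
  shows "(\<Sum>n=1..m. \<Sum>j=1..n-1. q ^ (n - j) * (z j * z n)) \<le> q / (1 - q) * (\<Sum>n=1..m. (z n)\<^sup>2)"
proof -
  define c where "c n j = (if j < n then q ^ (n - j) else 0)" for n j :: nat
  have c0: "0 \<le> c n j" for n j using q by (simp add: c_def)
  have R1: "(\<Sum>n=1..m. c n j) \<le> q / (1 - q)" for j
  proof -
    have "(\<Sum>n=1..m. c n j) = (\<Sum>n\<in>{1..m} \<inter> {j<..}. q ^ (n - j))"
      by (rule sum.mono_neutral_cong_right) (auto simp: c_def)
    also have "\<dots> \<le> q / (1 - q)" by (rule sum_powers_le) (use q in \<open>auto simp: inj_on_def\<close>)
    finally show ?thesis .
  qed
  have R2: "(\<Sum>j=1..m. c n j) \<le> q / (1 - q)" for n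
  proof -
    have "(\<Sum>j=1..m. c n j) = (\<Sum>j\<in>{1..m} \<inter> {..<n}. q ^ (n - j))"
      by (rule sum.mono_neutral_cong_right) (auto simp: c_def)
    also have "\<dots> \<le> q / (1 - q)" by (rule sum_powers_le) (use q in \<open>auto simp: inj_on_def\<close>)
    finally show ?thesis .
  qed
  have "(\<Sum>n=1..m. \<Sum>j=1..n-1. q ^ (n - j) * (z j * z n)) = (\<Sum>n=1..m. \<Sum>j=1..m. c n j * (z j * z n))"
  proof (rule sum.cong[OF refl])
    fix n assume n: "n \<in> {1..m}"
    show "(\<Sum>j=1..n-1. q ^ (n - j) * (z j * z n)) = (\<Sum>j=1..m. c n j * (z j * z n))"
      by (rule sum.mono_neutral_cong_left) (use n in \<open>auto simp: c_def\<close>)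
  qed
  also have "\<dots> \<le> (\<Sum>n=1..m. \<Sum>j=1..m. c n j * (z j)\<^sup>2 / 2 + c n j * (z n)\<^sup>2 / 2)"
  proof (intro sum_mono)
    fix n j
    have "z j * z n \<le> ((z j)\<^sup>2 + (z n)\<^sup>2) / 2" using sum_squares_bound[of "z j" "z n"] by simp
    from mult_left_mono[OF this c0[of n j]]
    show "c n j * (z j * z n) \<le> c n j * (z j)\<^sup>2 / 2 + c n j * (z n)\<^sup>2 / 2" by (simp add: distrib_left add_divide_distrib)
  qed
  also have "\<dots> = (\<Sum>j=1..m. (\<Sum>n=1..m. c n j) * (z j)\<^sup>2 / 2) + (\<Sum>n=1..m. (\<Sum>j=1..m. c n j) * (z n)\<^sup>2 / 2)"
    unfolding sum.distrib by (subst sum.swap) (simp add: sum_distrib_right sum_divide_distrib)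
  also have "\<dots> \<le> (\<Sum>j=1..m. q / (1 - q) * (z j)\<^sup>2 / 2) + (\<Sum>n=1..m. q / (1 - q) * (z n)\<^sup>2 / 2)"
    by (intro add_mono sum_mono divide_right_mono mult_right_mono R1 R2) auto
  also have "\<dots> = q / (1 - q) * (\<Sum>n=1..m. (z n)\<^sup>2) / 2 + q / (1 - q) * (\<Sum>n=1..m. (z n)\<^sup>2) / 2"
    by (simp only: sum_distrib_left sum_divide_distrib)
  also have "\<dots> = q / (1 - q) * (\<Sum>n=1..m. (z n)\<^sup>2)" by (rule field_sum_of_halves)
  finally show ?thesis .
qed

section \<open>Stability of the scheme\<close>

text \<open>The weight must damp two perturbations: the current memory term, with factor
  \<open>min 1 (C * \<tau>)\<close>, and the history, whose Schur bound is
  \<open>q / (1 - q)\<close>. The energy provides the damping \<open>(1 - q ^ 2) / 2\<close>; three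
  quarters of it may be spent here. The factor \<open>100\<close> only has to be large enough, and
  the \<open>+ 1\<close> keeps \<open>x\<close> positive and at least \<tau> when
  \<open>C = 0\<close>.\<close>

lemma weight_constants:
  fixes C \<tau> :: real
  assumes C: "0 \<le> C" and \<tau>: "0 < \<tau>"
  defines "x \<equiv> (100 * C + 1) * \<tau>"
  defines "q \<equiv> exp (- x)"
  shows "min 1 (C * \<tau>) * (1 + q)\<^sup>2 / 4 + C * \<tau>\<^sup>2 * (q / (1 - q)) \<le> 3 / 8 * (1 - q\<^sup>2)"
proof -
  define w where "w = min 1 (C * \<tau>)"
  have x: "0 < x" using C \<tau> by (simp add: x_def)
  have ct: "C * \<tau> \<le> x / 100" using \<tau> by (simp add: x_def algebra_simps)
  have w: "0 \<le> w" "w \<le> 1" "w \<le> x / 100" using C \<tau> ct by (auto simp: w_def)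
  have ex: "1 + x + x\<^sup>2 / 2 \<le> exp x" using x by (intro exp_lower_Taylor_quadratic) simp
  have q: "0 < q" "q < 1" using x by (auto simp: q_def)
  have qe: "q = 1 / exp x" by (simp add: q_def exp_minus inverse_eq_divide)
  have qq: "q / (1 - q) = 1 / (exp x - 1)"
    using x unfolding qe by (simp add: divide_simps)
  have tx: "\<tau> \<le> x" using C \<tau> by (simp add: x_def algebra_simps)
  have "C * \<tau>\<^sup>2 \<le> (x / 100) * x"
    using mult_mono[OF ct tx] x \<tau> by (simp add: power2_eq_square)
  then have "C * \<tau>\<^sup>2 * (q / (1 - q)) \<le> (x / 100 * x) * (q / (1 - q))"
    using q by (intro mult_right_mono) auto
  also have "\<dots> \<le> (x / 100 * x) * (1 / (x + x\<^sup>2 / 2))"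
    unfolding qq using x ex by (intro mult_left_mono divide_left_mono mult_pos_pos) (auto simp: add_pos_pos)
  also have "\<dots> = x / 100 / (1 + x / 2)"
  proof -
    have "x + x\<^sup>2 / 2 = x * (1 + x / 2)" by (simp add: power2_eq_square distrib_left)
    then show ?thesis using x by simp
  qed
  finally have c3: "C * \<tau>\<^sup>2 * (q / (1 - q)) \<le> x / 100 / (1 + x / 2)" .
  \<comment> \<open>For \<open>x \<le> 3\<close> both sides are compared linearly in
    \<open>x\<close>, using \<open>1 - q \<ge> x / 4\<close>. Beyond that
    \<open>q \<le> 1 / 8\<close>, the right side is nearly \<open>3 / 8\<close>, and the cap
    \<open>1\<close> in the minimum keeps the left side bounded.\<close>
  show ?thesis
    unfolding w_def[symmetric]
  proof (cases "x \<le> 3")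
    case True
    have "x / 100 / (1 + x / 2) \<le> x / 100" using x by (simp add: divide_le_eq)
    then have c3': "C * \<tau>\<^sup>2 * (q / (1 - q)) \<le> x / 100" using c3 by linarith
    have "(1 + q)\<^sup>2 \<le> 2\<^sup>2" using q by (intro power_mono) auto
    then have "w * (1 + q)\<^sup>2 \<le> w * 4" using w by (intro mult_left_mono) auto
    then have c1: "w * (1 + q)\<^sup>2 / 4 \<le> x / 100" using w by simp
    have "1 + x \<le> exp x" by (rule exp_ge_add_one_self)
    then have "q \<le> 1 / (1 + x)" unfolding qe using x by (intro divide_left_mono) auto
    moreover have "1 / (1 + x) \<le> 1 - x / 4"
    proof -
      have "x * x \<le> x * 3" using x True by (intro mult_left_mono) auto
      then have "1 \<le> (1 - x / 4) * (1 + x)" by (simp add: algebra_simps)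
      then show ?thesis using x by (subst pos_divide_le_eq) auto
    qed
    ultimately have "x / 4 \<le> 1 - q" by simp
    also have "\<dots> \<le> 1 - q\<^sup>2" using q by (simp add: power2_eq_square mult_left_le)
    finally have "3 / 8 * (x / 4) \<le> 3 / 8 * (1 - q\<^sup>2)" by (rule mult_left_mono) simp
    moreover have "x / 100 + x / 100 \<le> 3 / 8 * (x / 4)" using x by simp
    ultimately show "w * (1 + q)\<^sup>2 / 4 + C * \<tau>\<^sup>2 * (q / (1 - q)) \<le> 3 / 8 * (1 - q\<^sup>2)"
      using add_mono[OF c1 c3'] by (meson order_trans)
  next
    case False
    have "x / 100 / (1 + x / 2) \<le> 1 / 50" using x by (simp add: divide_le_eq)
    then have c3': "C * \<tau>\<^sup>2 * (q / (1 - q)) \<le> 1 / 50" using c3 by linarith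
    have "9 \<le> x\<^sup>2" using power_mono[of 3 x 2] False by simp
    then have "8 \<le> exp x" using ex False by linarith
    then have q8: "q \<le> 1 / 8" unfolding qe by (intro divide_left_mono) auto
    have "(1 + q)\<^sup>2 \<le> (9/8)\<^sup>2" using q q8 by (intro power_mono) auto
    then have "w * (1 + q)\<^sup>2 \<le> 1 * (9/8)\<^sup>2" using w by (intro mult_mono) auto
    then have c1: "w * (1 + q)\<^sup>2 / 4 \<le> 81 / 256" by (simp add: power2_eq_square)
    have "q\<^sup>2 \<le> (1/8)\<^sup>2" using q q8 by (intro power_mono) auto
    then have "63 / 64 \<le> 1 - q\<^sup>2" by (simp add: power2_eq_square)
    then have "3 / 8 * (63 / 64) \<le> 3 / 8 * (1 - q\<^sup>2)" by (rule mult_left_mono) simp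
    moreover have "81 / 256 + 1 / 50 \<le> 3 / 8 * (63 / 64 :: real)" by simp
    ultimately show "w * (1 + q)\<^sup>2 / 4 + C * \<tau>\<^sup>2 * (q / (1 - q)) \<le> 3 / 8 * (1 - q\<^sup>2)"
      using add_mono[OF c1 c3'] by (meson order_trans)
  qed
qed

text \<open>
  The scheme is tested with \<open>V n\<close> and the exponential weight \<open>q ^ (2 * n)\<close>. The weight replaces the
  discrete Gronwall lemma, which would be restricted to small step sizes.
\<close>

lemma scheme_stability:
  fixes \<theta> V :: "nat \<Rightarrow> 'b::real_inner" and w a r :: "nat \<Rightarrow> real"
  assumes C: "0 \<le> C" and \<tau>: "0 < \<tau>" and NT: "real N * \<tau> \<le> T" and \<theta>0: "\<theta> 0 = 0"
    and V: "\<And>n. V n = (if n = 1 then \<theta> 1 else midval \<theta> n)"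
    and w0: "- 1 \<le> w 0" "\<bar>w 0\<bar> \<le> C * \<tau>" and w: "\<And>k. 1 \<le> k \<Longrightarrow> k < N \<Longrightarrow> \<bar>w (k - 1) - w k\<bar> \<le> C * \<tau>\<^sup>2"
    and a: "\<And>m. m \<le> N \<Longrightarrow> 0 \<le> (\<Sum>n=1..m. a n)"
    and r: "\<And>n. 0 \<le> r n"
    and scheme: "\<And>n. 1 \<le> n \<Longrightarrow> n \<le> N \<Longrightarrow> inner (\<theta> n - \<theta> (n - 1)) (V n)
      + (w 0 * inner (midval \<theta> n) (V n) - (\<Sum>k=1..n-1. (w (k - 1) - w k) * inner (midval \<theta> (n - k)) (V n)))
      + a n \<le> r n * norm (V n)"
    and m: "m \<le> N"
  shows "norm (\<theta> m) \<le> 8 * exp ((100 * C + 1) * T) * (\<Sum>n=1..N. r n)"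
proof -
  define l where "l = 100 * C + 1"
  define q where "q = exp (- (l * \<tau>))"
  have l: "0 < l" using C by (simp add: l_def)
  have q: "0 < q" "q < 1" using l \<tau> by (auto simp: q_def)
  \<comment> \<open>Merges the two lower bounds for \<open>w 0\<close>; the value \<open>1\<close>
    takes over when \<tau> is large.\<close>
  define \<omega> where "\<omega> = min 1 (C * \<tau>)"
  have \<omega>: "0 \<le> \<omega>" "\<omega> \<le> 1" "- \<omega> \<le> w 0" using C \<tau> w0 by (auto simp: \<omega>_def min_def)
  have const: "\<omega> * (1 + q)\<^sup>2 / 4 + C * \<tau>\<^sup>2 * (q / (1 - q)) \<le> 3 / 8 * (1 - q\<^sup>2)"
    using weight_constants[OF C \<tau>] by (simp add: \<omega>_def q_def l_def)
  define y where "y n = q ^ n * norm (\<theta> n)" for n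
  define z where "z n = q ^ n * norm (midval \<theta> n)" for n
  have y0: "y 0 = 0" and ynn: "0 \<le> y n" and znn: "0 \<le> z n" for n
    using q \<theta>0 by (auto simp: y_def z_def)
  have zy: "z n \<le> (y n + q * y (n - 1)) / 2" if "1 \<le> n" for n
  proof -
    have "norm (midval \<theta> n) \<le> (norm (\<theta> n) + norm (\<theta> (n - 1))) / 2"
      using norm_triangle_ineq[of "\<theta> n" "\<theta> (n - 1)"] by (simp add: midval_def)
    then have "z n \<le> q ^ n * ((norm (\<theta> n) + norm (\<theta> (n - 1))) / 2)"
      unfolding z_def using q by (intro mult_left_mono) auto
    also have "q ^ n = q * q ^ (n - 1)" using that by (cases n) auto
    then have "q ^ n * ((norm (\<theta> n) + norm (\<theta> (n - 1))) / 2) = (y n + q * y (n - 1)) / 2"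
      by (simp add: y_def algebra_simps)
    finally show ?thesis .
  qed
  \<comment> \<open>The weighted square is expanded exactly and only
    \<open>q * (y n - y (n - 1)) ^ 2 / 4\<close> is dropped. Summation then yields the factor
    \<open>(1 + q) ^ 2 / 4\<close> that occurs in \<open>const\<close>.\<close>
  have z2: "(z n)\<^sup>2 \<le> (1 + q) * ((y n)\<^sup>2 + q * (y (n - 1))\<^sup>2) / 4" if "1 \<le> n" for n
  proof -
    have "(z n)\<^sup>2 \<le> ((y n + q * y (n - 1)) / 2)\<^sup>2"
      using zy[OF that] znn by (intro power_mono) auto
    also have "\<dots> = (1 + q) * ((y n)\<^sup>2 + q * (y (n - 1))\<^sup>2) / 4 - q * (y n - y (n - 1))\<^sup>2 / 4"
      by (simp add: power2_eq_square field_simps)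
    also have "\<dots> \<le> (1 + q) * ((y n)\<^sup>2 + q * (y (n - 1))\<^sup>2) / 4" using q by simp
    finally show ?thesis .
  qed
  \<comment> \<open>The bound is quadratic on the left and linear in \<open>M\<close> on the right.
    At the end \<open>M\<close> is the maximum of \<open>y\<close>, attained at \<open>k\<close>,
    and one factor \<open>M\<close> is divided out.\<close>
  have key: "1 / 8 * (y k)\<^sup>2 \<le> M * (\<Sum>n=1..N. r n)" if k: "k \<le> N" and M: "\<And>n. n \<le> N \<Longrightarrow> y n \<le> M" for k M
  proof -
    define Y where "Y = (\<Sum>n=1..k. (y n)\<^sup>2)"
    have M0: "0 \<le> M" using M[of 0] y0 by simp
    have E: "q ^ (2 * n) * a n + ((y n)\<^sup>2 - q\<^sup>2 * (y (n - 1))\<^sup>2) / 2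
        - \<omega> * ((1 + q) * ((y n)\<^sup>2 + q * (y (n - 1))\<^sup>2) / 4)
        - C * \<tau>\<^sup>2 * (\<Sum>j=1..n-1. q ^ (n - j) * (z j * z n)) \<le> M * r n" if n: "1 \<le> n" "n \<le> k" for n
    proof -
      have n': "n \<le> N" using n k by simp
      have q2: "q ^ (2 * n) = q ^ n * q ^ n" by (simp add: power_add mult_2)
      have qn: "q ^ n = q * q ^ (n - 1)" using n by (cases n) auto
      have yn: "q ^ (2 * n) * (norm (\<theta> n))\<^sup>2 = (y n)\<^sup>2" "q ^ (2 * n) * (norm (\<theta> (n - 1)))\<^sup>2 = q\<^sup>2 * (y (n - 1))\<^sup>2"
        unfolding q2 y_def power_mult_distrib by (simp_all add: power2_eq_square) (simp add: qn)
      have zn: "q ^ (2 * n) * (norm (midval \<theta> n))\<^sup>2 = (z n)\<^sup>2"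
        unfolding q2 z_def power_mult_distrib by (simp add: power2_eq_square)
      have A: "((y n)\<^sup>2 - q\<^sup>2 * (y (n - 1))\<^sup>2) / 2 - \<omega> * ((1 + q) * ((y n)\<^sup>2 + q * (y (n - 1))\<^sup>2) / 4)
          \<le> q ^ (2 * n) * (inner (\<theta> n - \<theta> (n - 1)) (V n) + w 0 * inner (midval \<theta> n) (V n))"
      proof (cases "n = 1")
        case True
        \<comment> \<open>At the first step the test element is \<open>\<theta> 1\<close> itself and
          the average is half of it, as \<open>\<theta> 0 = 0\<close>. The factor
          \<open>1 + w 0 / 2\<close> is at least \<open>1 / 2\<close> because
          \<open>w 0 \<ge> - 1\<close>.\<close>
        have "inner (\<theta> n - \<theta> (n - 1)) (V n) + w 0 * inner (midval \<theta> n) (V n) = (1 + w 0 / 2) * (norm (\<theta> 1))\<^sup>2"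
          using True \<theta>0 by (simp add: V midval_def power2_norm_eq_inner algebra_simps)
        then have "q ^ (2 * n) * (inner (\<theta> n - \<theta> (n - 1)) (V n) + w 0 * inner (midval \<theta> n) (V n)) = (1 + w 0 / 2) * (y n)\<^sup>2"
          using yn(1) True by (simp add: algebra_simps)
        also have "\<dots> \<ge> (1 / 2) * (y n)\<^sup>2" using w0(1) by (intro mult_right_mono) auto
        moreover have "0 \<le> \<omega> * ((1 + q) * ((y n)\<^sup>2 + q * (y (n - 1))\<^sup>2) / 4)" using \<omega> q by simp
        ultimately show ?thesis using True y0 by simp
      next
        case False
        have e1: "inner (\<theta> n - \<theta> (n - 1)) (V n) = ((norm (\<theta> n))\<^sup>2 - (norm (\<theta> (n - 1)))\<^sup>2) / 2"
          using False by (simp add: V midval_def power2_norm_eq_inner inner_diff_left inner_diff_right inner_add_left inner_add_right inner_commute)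
        have e2: "inner (midval \<theta> n) (V n) = (norm (midval \<theta> n))\<^sup>2"
          using False by (simp add: V power2_norm_eq_inner)
        have "q ^ (2 * n) * (inner (\<theta> n - \<theta> (n - 1)) (V n) + w 0 * inner (midval \<theta> n) (V n))
            = (q ^ (2 * n) * (norm (\<theta> n))\<^sup>2 - q ^ (2 * n) * (norm (\<theta> (n - 1)))\<^sup>2) / 2
              + w 0 * (q ^ (2 * n) * (norm (midval \<theta> n))\<^sup>2)"
          unfolding e1 e2 by (simp add: algebra_simps diff_divide_distrib)
        also have "\<dots> = ((y n)\<^sup>2 - q\<^sup>2 * (y (n - 1))\<^sup>2) / 2 + w 0 * (z n)\<^sup>2" unfolding yn zn ..
        also have "\<dots> \<ge> ((y n)\<^sup>2 - q\<^sup>2 * (y (n - 1))\<^sup>2) / 2 - \<omega> * (z n)\<^sup>2"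
          using mult_right_mono[OF \<omega>(3), of "(z n)\<^sup>2"] by simp
        moreover have "\<omega> * (z n)\<^sup>2 \<le> \<omega> * ((1 + q) * ((y n)\<^sup>2 + q * (y (n - 1))\<^sup>2) / 4)"
          using z2[OF n(1)] \<omega> by (intro mult_left_mono) auto
        ultimately show ?thesis by linarith
      qed
      \<comment> \<open>Writing \<open>q ^ (2 * n)\<close> as
        \<open>q ^ n * (q ^ k * q ^ (n - k))\<close> attaches a weight to each of the two averages
        and leaves \<open>q ^ k\<close>, the kernel of the Schur test.\<close>
      have B: "q ^ (2 * n) * (\<Sum>k=1..n-1. (w (k - 1) - w k) * inner (midval \<theta> (n - k)) (V n))
          \<le> C * \<tau>\<^sup>2 * (\<Sum>j=1..n-1. q ^ (n - j) * (z j * z n))"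
      proof -
        have "q ^ (2 * n) * (\<Sum>k=1..n-1. (w (k - 1) - w k) * inner (midval \<theta> (n - k)) (V n))
            = (\<Sum>k=1..n-1. q ^ (2 * n) * ((w (k - 1) - w k) * inner (midval \<theta> (n - k)) (V n)))"
          by (rule sum_distrib_left)
        also have "\<dots> \<le> (\<Sum>k=1..n-1. C * \<tau>\<^sup>2 * (q ^ k * (z (n - k) * z n)))"
        proof (rule sum_mono)
          fix k assume k: "k \<in> {1..n-1}"
          then have kn: "k \<le> n" by auto
          have "(w (k - 1) - w k) * inner (midval \<theta> (n - k)) (V n) \<le> \<bar>w (k - 1) - w k\<bar> * \<bar>inner (midval \<theta> (n - k)) (V n)\<bar>"
            using abs_ge_self by (simp flip: abs_mult)
          also have "\<dots> \<le> C * \<tau>\<^sup>2 * (norm (midval \<theta> (n - k)) * norm (V n))"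
            using k n' w[of k] C by (intro mult_mono Cauchy_Schwarz_ineq2) auto
          finally have "q ^ (2 * n) * ((w (k - 1) - w k) * inner (midval \<theta> (n - k)) (V n))
              \<le> q ^ (2 * n) * (C * \<tau>\<^sup>2 * (norm (midval \<theta> (n - k)) * norm (V n)))"
            using q by (intro mult_left_mono) auto
          also have "q ^ (2 * n) * (C * \<tau>\<^sup>2 * (norm (midval \<theta> (n - k)) * norm (V n))) = C * \<tau>\<^sup>2 * (q ^ k * (z (n - k) * z n))"
          proof -
            have "V n = midval \<theta> n" using k by (auto simp: V)
            moreover have "q ^ (2 * n) = q ^ n * (q ^ k * q ^ (n - k))"
              unfolding q2 power_add[symmetric] using kn by simp
            ultimately show ?thesis by (simp add: z_def mult_ac)
          qed
          finally show "q ^ (2 * n) * ((w (k - 1) - w k) * inner (midval \<theta> (n - k)) (V n)) \<le> C * \<tau>\<^sup>2 * (q ^ k * (z (n - k) * z n))" .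
        qed
        also have "\<dots> = (\<Sum>j=1..n-1. C * \<tau>\<^sup>2 * (q ^ (n - j) * (z j * z n)))"
          by (rule sum.reindex_bij_witness[of _ "\<lambda>j. n - j" "\<lambda>j. n - j"]) auto
        finally show ?thesis by (simp only: sum_distrib_left)
      qed
      have "q ^ n * norm (V n) \<le> M"
      proof (cases "n = 1")
        case True
        then show ?thesis using M[OF n'] by (simp add: V y_def)
      next
        case False
        have "q * y (n - 1) \<le> 1 * M" using q M[of "n - 1"] n' ynn by (intro mult_mono) auto
        then show ?thesis using False zy[OF n(1)] M[OF n'] by (simp add: V z_def)
      qed
      moreover have "q ^ n \<le> 1" using q by (simp add: power_le_one)
      ultimately have "q ^ n * (q ^ n * norm (V n)) \<le> 1 * M" using q M0 by (intro mult_mono) auto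
      then have "q ^ (2 * n) * norm (V n) \<le> M" by (simp add: q2 mult.assoc)
      then have R: "q ^ (2 * n) * (r n * norm (V n)) \<le> M * r n"
        using mult_right_mono[OF _ r[of n]] by (metis mult.assoc mult.commute)
      have "q ^ (2 * n) * (inner (\<theta> n - \<theta> (n - 1)) (V n)
          + (w 0 * inner (midval \<theta> n) (V n) - (\<Sum>k=1..n-1. (w (k - 1) - w k) * inner (midval \<theta> (n - k)) (V n)))
          + a n) \<le> q ^ (2 * n) * (r n * norm (V n))"
        using scheme[OF n(1) n'] q by (intro mult_left_mono) auto
      then have "q ^ (2 * n) * (inner (\<theta> n - \<theta> (n - 1)) (V n) + w 0 * inner (midval \<theta> n) (V n))
          - q ^ (2 * n) * (\<Sum>k=1..n-1. (w (k - 1) - w k) * inner (midval \<theta> (n - k)) (V n))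
          + q ^ (2 * n) * a n \<le> q ^ (2 * n) * (r n * norm (V n))"
        by (simp add: distrib_left right_diff_distrib)
      then show ?thesis using A B R by linarith
    qed
    have gen: "(\<Sum>n=1..k. A n + B n - \<omega> * ((1 + q) * H n / 4) - D * K n)
        = (\<Sum>n=1..k. A n) + (\<Sum>n=1..k. B n) - \<omega> * (1 + q) / 4 * (\<Sum>n=1..k. H n) - D * (\<Sum>n=1..k. K n)"
      for A B H K :: "nat \<Rightarrow> real" and D
      by (simp add: sum.distrib sum_subtractf sum_distrib_left mult.assoc)
    have "(\<Sum>n=1..k. q ^ (2 * n) * a n + ((y n)\<^sup>2 - q\<^sup>2 * (y (n - 1))\<^sup>2) / 2
        - \<omega> * ((1 + q) * ((y n)\<^sup>2 + q * (y (n - 1))\<^sup>2) / 4)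
        - C * \<tau>\<^sup>2 * (\<Sum>j=1..n-1. q ^ (n - j) * (z j * z n))) \<le> (\<Sum>n=1..k. M * r n)"
      using E by (intro sum_mono) auto
    then have sumE: "(\<Sum>n=1..k. q ^ (2 * n) * a n) + (\<Sum>n=1..k. ((y n)\<^sup>2 - q\<^sup>2 * (y (n - 1))\<^sup>2) / 2)
        - \<omega> * (1 + q) / 4 * (\<Sum>n=1..k. (y n)\<^sup>2 + q * (y (n - 1))\<^sup>2)
        - C * \<tau>\<^sup>2 * (\<Sum>n=1..k. \<Sum>j=1..n-1. q ^ (n - j) * (z j * z n)) \<le> M * (\<Sum>n=1..k. r n)"
      unfolding gen sum_distrib_left[symmetric, of M] .
    have wa: "0 \<le> (\<Sum>n=1..k. q ^ (2 * n) * a n)"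
    proof (rule weighted_partial_sums_nonneg)
      show "q ^ (2 * Suc n) \<le> q ^ (2 * n)" for n using q by (intro power_decreasing) auto
    qed (use a k q in auto)
    have prev: "(\<Sum>n=1..k. (y (n - 1))\<^sup>2) = Y - (y k)\<^sup>2"
      unfolding Y_def
    proof (induction k)
      case (Suc k)
      then show ?case by (simp add: y0)
    qed (simp add: y0)
    \<comment> \<open>The energy difference does not telescope completely under the weight: the
      defect \<open>(1 - q ^ 2) / 2 * Y\<close> is the damping that pays for the memory
      terms.\<close>
    have S1: "(\<Sum>n=1..k. ((y n)\<^sup>2 - q\<^sup>2 * (y (n - 1))\<^sup>2) / 2) = q\<^sup>2 / 2 * (y k)\<^sup>2 + (1 - q\<^sup>2) / 2 * Y"
    proof -
      have "(\<Sum>n=1..k. ((y n)\<^sup>2 - q\<^sup>2 * (y (n - 1))\<^sup>2) / 2) = (Y - q\<^sup>2 * (\<Sum>n=1..k. (y (n - 1))\<^sup>2)) / 2"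
        by (simp add: Y_def sum_subtractf sum_distrib_left flip: sum_divide_distrib)
      then show ?thesis unfolding prev by (simp add: algebra_simps diff_divide_distrib add_divide_distrib)
    qed
    have S2: "(\<Sum>n=1..k. (y n)\<^sup>2 + q * (y (n - 1))\<^sup>2) \<le> (1 + q) * Y"
    proof -
      have "(\<Sum>n=1..k. (y n)\<^sup>2 + q * (y (n - 1))\<^sup>2) = Y + q * (\<Sum>n=1..k. (y (n - 1))\<^sup>2)"
        by (simp add: Y_def sum.distrib sum_distrib_left)
      also have "\<dots> = (1 + q) * Y - q * (y k)\<^sup>2" unfolding prev by (simp add: algebra_simps)
      also have "\<dots> \<le> (1 + q) * Y" using q by simp
      finally show ?thesis .
    qed
    have "(\<Sum>n=1..k. (z n)\<^sup>2) \<le> (\<Sum>n=1..k. (1 + q) / 4 * ((y n)\<^sup>2 + q * (y (n - 1))\<^sup>2))"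
      using z2 by (intro sum_mono) auto
    also have "\<dots> \<le> (1 + q) / 4 * ((1 + q) * Y)"
      unfolding sum_distrib_left[symmetric] using S2 q by (intro mult_left_mono) auto
    also have "\<dots> \<le> Y"
    proof -
      have "(1 + q) * (1 + q) \<le> 2 * 2" using q by (intro mult_mono) auto
      moreover have "0 \<le> Y" by (simp add: Y_def sum_nonneg)
      ultimately have "((1 + q) * (1 + q)) * Y \<le> 4 * Y" by (intro mult_right_mono) auto
      then show ?thesis by (simp add: mult_ac)
    qed
    finally have zY: "(\<Sum>n=1..k. (z n)\<^sup>2) \<le> Y" .
    have "(\<Sum>n=1..k. \<Sum>j=1..n-1. q ^ (n - j) * (z j * z n)) \<le> q / (1 - q) * (\<Sum>n=1..k. (z n)\<^sup>2)"
      using q by (intro geometric_kernel_bound) auto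
    also have "\<dots> \<le> q / (1 - q) * Y" using zY q by (intro mult_left_mono) auto
    finally have "C * \<tau>\<^sup>2 * (\<Sum>n=1..k. \<Sum>j=1..n-1. q ^ (n - j) * (z j * z n)) \<le> C * \<tau>\<^sup>2 * (q / (1 - q) * Y)"
      using C by (intro mult_left_mono) auto
    moreover have "\<omega> * (1 + q) / 4 * (\<Sum>n=1..k. (y n)\<^sup>2 + q * (y (n - 1))\<^sup>2) \<le> \<omega> * (1 + q) / 4 * ((1 + q) * Y)"
      using S2 \<omega> q by (intro mult_left_mono) auto
    ultimately have f: "q\<^sup>2 / 2 * (y k)\<^sup>2 + (1 - q\<^sup>2) / 2 * Y - \<omega> * (1 + q) / 4 * ((1 + q) * Y) - C * \<tau>\<^sup>2 * (q / (1 - q) * Y)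
        \<le> M * (\<Sum>n=1..k. r n)"
      using sumE wa unfolding S1 by linarith
    have "(\<omega> * (1 + q)\<^sup>2 / 4 + C * \<tau>\<^sup>2 * (q / (1 - q))) * Y \<le> 3 / 8 * (1 - q\<^sup>2) * Y"
      using const by (intro mult_right_mono) (auto simp: Y_def sum_nonneg)
    then have f2: "\<omega> * (1 + q) / 4 * ((1 + q) * Y) + C * \<tau>\<^sup>2 * (q / (1 - q) * Y) \<le> 3 / 8 * (1 - q\<^sup>2) * Y"
      by (simp add: power2_eq_square distrib_right mult.assoc)
    have f3: "u / 2 * Y = 3 / 8 * u * Y + u / 8 * Y" for u
      by (simp add: field_simps)
    have arith: "x1 + e - a - b \<le> R \<Longrightarrow> a + b \<le> c \<Longrightarrow> e = c + d \<Longrightarrow> x1 + d \<le> R" for x1 e a b c d R :: real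
      by linarith
    have "q\<^sup>2 / 2 * (y k)\<^sup>2 + (1 - q\<^sup>2) / 8 * Y \<le> M * (\<Sum>n=1..k. r n)"
      by (rule arith[OF f f2 f3])
    \<comment> \<open>The unspent damping \<open>(1 - q ^ 2) / 8\<close> compensates the factor
      \<open>q ^ 2\<close> in front of the last term when \<open>q\<close> is small.\<close>
    moreover have "1 / 8 * (y k)\<^sup>2 \<le> q\<^sup>2 / 2 * (y k)\<^sup>2 + (1 - q\<^sup>2) / 8 * Y"
    proof -
      have "(y k)\<^sup>2 \<le> Y"
        unfolding Y_def using y0 by (cases "k = 0") (auto intro!: member_le_sum)
      moreover have "0 \<le> (1 - q\<^sup>2) / 8" using q by (simp add: power_le_one)
      ultimately have "(1 - q\<^sup>2) / 8 * (y k)\<^sup>2 \<le> (1 - q\<^sup>2) / 8 * Y" by (rule mult_left_mono)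
      moreover have "q\<^sup>2 / 2 * (y k)\<^sup>2 + (1 - q\<^sup>2) / 8 * (y k)\<^sup>2 = 1 / 8 * (y k)\<^sup>2 + 3 / 8 * (q * y k)\<^sup>2"
        by (simp add: power2_eq_square field_simps)
      moreover have "0 \<le> 3 / 8 * (q * y k)\<^sup>2" by simp
      ultimately show ?thesis by linarith
    qed
    moreover have "M * (\<Sum>n=1..k. r n) \<le> M * (\<Sum>n=1..N. r n)"
      using M0 k r by (intro mult_left_mono sum_mono2) auto
    ultimately show ?thesis by linarith
  qed
  define M where "M = Max (y ` {..N})"
  have M: "y n \<le> M" if "n \<le> N" for n using that by (auto simp: M_def)
  have "M \<in> y ` {..N}" unfolding M_def by (intro Max_in) auto
  then obtain k where k: "k \<le> N" "M = y k" by auto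
  have "1 / 8 * M\<^sup>2 \<le> M * (\<Sum>n=1..N. r n)" using key[OF k(1) M] k(2) by simp
  moreover have "0 \<le> M" using k(2) ynn by simp
  ultimately have M8: "M \<le> 8 * (\<Sum>n=1..N. r n)"
    using r by (cases "M = 0") (auto simp: power2_eq_square sum_nonneg)
  have "norm (\<theta> m) = exp (l * (real m * \<tau>)) * y m"
    by (simp add: y_def q_def flip: exp_of_nat_mult exp_add)
  also have "\<dots> \<le> exp (l * T) * (8 * (\<Sum>n=1..N. r n))"
  proof (intro mult_mono)
    have "real m * \<tau> \<le> real N * \<tau>" using m \<tau> by (intro mult_right_mono) auto
    then show "exp (l * (real m * \<tau>)) \<le> exp (l * T)" using l NT by simp
    show "y m \<le> 8 * (\<Sum>n=1..N. r n)" using M[OF m] M8 by simp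
  qed (use ynn in auto)
  finally show ?thesis by (simp add: l_def)
qed

section \<open>Quadrature errors\<close>

text \<open>The step function equal to \<open>c j\<close> on the cell from
  \<open>(j - 1) * \<tau>\<close> to \<open>j * \<tau>\<close>, open on the left. Only at
  \<open>s = 0\<close> does it pick up \<open>c 0\<close>.\<close>

definition pconst :: "real \<Rightarrow> (nat \<Rightarrow> 'b) \<Rightarrow> real \<Rightarrow> 'b"
  where "pconst \<tau> c s = c (nat \<lceil>s / \<tau>\<rceil>)"

lemma pconst_eq:
  assumes "0 < \<tau>" "1 \<le> j" "(real j - 1) * \<tau> < s" "s \<le> real j * \<tau>"
  shows "pconst \<tau> c s = c j"
proof -
  have "\<lceil>s / \<tau>\<rceil> = int j"
    using assms by (intro ceiling_unique) (auto simp: pos_less_divide_eq pos_divide_le_eq)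
  then show ?thesis by (simp add: pconst_def)
qed

lemma pconst_measurable[measurable]:
  fixes c :: "nat \<Rightarrow> 'b::topological_space"
  shows "pconst \<tau> c \<in> borel_measurable borel"
proof -
  have "(\<lambda>s::real. nat \<lceil>s / \<tau>\<rceil>) \<in> measurable borel (count_space UNIV)" by measurable
  from measurable_compose[OF this, of c borel] show ?thesis
    unfolding pconst_def[abs_def] by simp
qed

lemma pconst_bounded:
  fixes c :: "nat \<Rightarrow> 'b::real_normed_vector"
  assumes \<tau>: "0 < \<tau>" and s: "s \<in> {0..real N * \<tau>}"
  shows "norm (pconst \<tau> c s) \<le> (\<Sum>j\<le>N. norm (c j))"
proof -
  have "s / \<tau> \<le> real N" using s \<tau> by (simp add: pos_divide_le_eq)
  then have "nat \<lceil>s / \<tau>\<rceil> \<le> N" by (simp add: ceiling_le_iff nat_le_iff)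
  then show ?thesis unfolding pconst_def by (intro member_le_sum) auto
qed

lemma set_integrable_continuous:
  fixes f :: "real \<Rightarrow> 'b::{banach, second_countable_topology}"
  assumes "continuous_on {a..b} f"
  shows "set_integrable lborel {a..b} f"
  unfolding set_integrable_def by (rule borel_integrable_compact) (use assms in auto)

lemma norm_sub_half_sum_le:
  fixes x y z :: "'b::real_normed_vector"
  shows "norm (x - (1 / 2) *\<^sub>R (y + z)) \<le> norm x + (norm y + norm z) / 2"
proof -
  have "norm (x - (1 / 2) *\<^sub>R (y + z)) \<le> norm x + norm (y + z) / 2"
    using norm_triangle_ineq4[of x "(1 / 2) *\<^sub>R (y + z)"] by simp
  also have "\<dots> \<le> norm x + (norm y + norm z) / 2"
    by (intro add_left_mono divide_right_mono norm_triangle_ineq) simp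
  finally show ?thesis .
qed

lemma set_integral_scaleR_const:
  fixes f :: "'a \<Rightarrow> real" and c :: "'b::{banach, second_countable_topology}"
  assumes "set_integrable M A f"
  shows "(LINT t:A|M. f t *\<^sub>R c) = (LINT t:A|M. f t) *\<^sub>R c"
  using assms integral_scaleR_left[of c M "\<lambda>t. indicator A t * f t"]
  by (simp add: set_lebesgue_integral_def set_integrable_def)

text \<open>Separates the averaging error of an affine function, a multiple of its slope
  \<open>G\<close>, from that of the remainders \<open>x\<close>, \<open>y\<close>,
  \<open>z\<close>; the constant part \<open>A\<close> is reproduced.\<close>

lemma midpoint_expansion:
  fixes A G x y z :: "'b::real_vector"
  shows "(x + A + a *\<^sub>R G) - (1 / 2) *\<^sub>R ((y + A + b *\<^sub>R G) + (z + A + c *\<^sub>R G))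
    = (a - (b + c) / 2) *\<^sub>R G + (x - (1 / 2) *\<^sub>R (y + z))"
proof -
  have "(1 / 2) *\<^sub>R ((y + A + b *\<^sub>R G) + (z + A + c *\<^sub>R G))
      = (1 / 2) *\<^sub>R (y + z) + (1 / 2) *\<^sub>R (A + A) + ((b + c) / 2) *\<^sub>R G"
    by (simp add: scaleR_add_right scaleR_add_left add_divide_distrib add_ac)
  also have "(1 / 2) *\<^sub>R (A + A) = A" by (rule scaleR_half_double)
  finally show ?thesis by (simp add: algebra_simps)
qed

lemma set_integrable_bounded_measurable:
  fixes f :: "real \<Rightarrow> 'b::{banach, second_countable_topology}"
  assumes "set_borel_measurable lborel {a..b} f" "\<And>s. s \<in> {a..b} \<Longrightarrow> norm (f s) \<le> M"
  shows "set_integrable lborel {a..b} f"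
proof (rule set_integrable_bound[where f = "\<lambda>_. M"])
  show "set_integrable lborel {a..b} (\<lambda>_. M)"
    by (intro set_integrable_continuous continuous_on_const)
  show "AE s in lborel. s \<in> {a..b} \<longrightarrow> norm (f s) \<le> norm M"
    using assms(2) abs_ge_self[of M] by (intro AE_I2 impI) (metis order_trans real_norm_def)
qed (rule assms(1))

lemma set_integrable_pconst:
  fixes c :: "nat \<Rightarrow> 'b::{banach, second_countable_topology}"
  assumes "0 < \<tau>"
  shows "set_integrable lborel {0..real N * \<tau>} (pconst \<tau> c)"
  by (rule set_integrable_bounded_measurable[OF _ pconst_bounded[OF assms, where N = N]]) (simp_all add: set_borel_measurable_def)

lemma set_integral_pconst_piece:
  fixes c :: "nat \<Rightarrow> 'b::{banach, second_countable_topology}"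
  assumes \<tau>: "0 < \<tau>" and j: "1 \<le> j" and K: "set_integrable lborel {(real j - 1) * \<tau>..real j * \<tau>} K"
  shows "(LBINT s:{(real j - 1) * \<tau>..real j * \<tau>}. K s *\<^sub>R pconst \<tau> c s) = (LBINT s:{(real j - 1) * \<tau>..real j * \<tau>}. K s) *\<^sub>R c j"
    and "set_integrable lborel {(real j - 1) * \<tau>..real j * \<tau>} (\<lambda>s. K s *\<^sub>R pconst \<tau> c s)"
proof -
  let ?I = "{(real j - 1) * \<tau>..real j * \<tau>}"
  define K' where "K' = (\<lambda>s. indicator ?I s *\<^sub>R K s)"
  have K'i: "integrable lborel K'" using K by (simp add: K'_def set_integrable_def)
  note [measurable] = borel_measurable_integrable[OF K'i, simplified]
  have AE: "AE s in lborel. K' s *\<^sub>R pconst \<tau> c s = K' s *\<^sub>R c j"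
    using AE_lborel_singleton[of "(real j - 1) * \<tau>"]
  proof eventually_elim
    case (elim s)
    show ?case
    proof (cases "s \<in> ?I")
      case True
      then have "(real j - 1) * \<tau> < s" "s \<le> real j * \<tau>" using elim by auto
      then show ?thesis by (simp add: pconst_eq[OF \<tau> j])
    qed (simp add: K'_def)
  qed
  have eq: "indicator ?I s *\<^sub>R K s *\<^sub>R pconst \<tau> c s = K' s *\<^sub>R pconst \<tau> c s" for s by (simp add: K'_def)
  have i: "integrable lborel (\<lambda>s. K' s *\<^sub>R c j)" using K'i by simp
  have AE': "AE s in lborel. K' s *\<^sub>R c j = K' s *\<^sub>R pconst \<tau> c s"
    using AE by (rule eventually_mono) (erule sym)
  show "set_integrable lborel ?I (\<lambda>s. K s *\<^sub>R pconst \<tau> c s)"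
    unfolding set_integrable_def eq by (rule integrable_cong_AE_imp[OF i _ AE']) simp
  have "(LBINT s. K' s *\<^sub>R pconst \<tau> c s) = (LBINT s. K' s *\<^sub>R c j)"
    by (rule integral_cong_AE[OF _ _ AE]) simp_all
  also have "\<dots> = (LBINT s. K' s) *\<^sub>R c j" using K'i by simp
  finally show "(LBINT s:?I. K s *\<^sub>R pconst \<tau> c s) = (LBINT s:?I. K s) *\<^sub>R c j"
    unfolding set_lebesgue_integral_def eq by (simp add: K'_def)
qed

text \<open>At a grid point the kernel enters only through its integrals over whole cells. These are
  the weights of the scheme, which is why the scheme is an exact convolution with a step
  function.\<close>

lemma conv_pconst:
  fixes c :: "nat \<Rightarrow> 'b::{banach, second_countable_topology}"
  assumes \<tau>: "0 < \<tau>" and K: "set_integrable lborel {0..real n * \<tau>} K"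
  shows "conv K (pconst \<tau> c) (real n * \<tau>)
    = (\<Sum>j=1..n. ((LBINT s:{0..real (n - j + 1) * \<tau>}. K s) - (LBINT s:{0..real (n - j) * \<tau>}. K s)) *\<^sub>R c j)"
proof -
  let ?t = "real n * \<tau>"
  let ?f = "\<lambda>s. K (?t - s) *\<^sub>R pconst \<tau> c s"
  have fi: "set_integrable lborel {0..?t} ?f"
    by (rule conv_integrand_bounded_right[OF K set_integrable_pconst[OF \<tau>] pconst_bounded[OF \<tau>]])
  have "(LBINT s:{0..real m * \<tau>}. ?f s)
      = (\<Sum>j=1..m. ((LBINT s:{0..real (n - j + 1) * \<tau>}. K s) - (LBINT s:{0..real (n - j) * \<tau>}. K s)) *\<^sub>R c j)"
    if "m \<le> n" for m
    using that
  proof (induction m)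
    case 0
    have "AE s in lborel. s \<notin> {0..0::real}"
      using AE_lborel_singleton[of 0] by eventually_elim auto
    then have "(LBINT s:{0..0}. ?f s) = 0"
      unfolding set_lebesgue_integral_def by (intro integral_eq_zero_AE) (auto elim: eventually_mono)
    then show ?case by simp
  next
    case (Suc m)
    let ?I = "{(real (Suc m) - 1) * \<tau>..real (Suc m) * \<tau>}"
    have le: "real m * \<tau> \<le> real (Suc m) * \<tau>" "real (Suc m) * \<tau> \<le> ?t" "0 \<le> real m * \<tau>"
      using \<tau> Suc.prems by (auto intro!: mult_right_mono simp del: of_nat_Suc)
    have Isub: "?I = {real m * \<tau>..real (Suc m) * \<tau>}" by simp
    have Ki: "set_integrable lborel ?I (\<lambda>s. K (?t - s))"
      unfolding set_integral_reflect(2) by (rule set_integrable_subset[OF K]) (use le in \<open>auto simp: algebra_simps\<close>)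
    have "(LBINT s:{0..real (Suc m) * \<tau>}. ?f s) = (LBINT s:{0..real m * \<tau>}. ?f s) + (LBINT s:{real m * \<tau>..real (Suc m) * \<tau>}. ?f s)"
      by (rule set_integral_Icc_split) (use le set_integrable_subset[OF fi] in auto)
    also have "(LBINT s:{real m * \<tau>..real (Suc m) * \<tau>}. ?f s) = (LBINT s:{real m * \<tau>..real (Suc m) * \<tau>}. K (?t - s)) *\<^sub>R c (Suc m)"
      using set_integral_pconst_piece(1)[OF \<tau> _ Ki, of c] unfolding Isub by simp
    also have "(LBINT s:{real m * \<tau>..real (Suc m) * \<tau>}. K (?t - s))
        = (LBINT s:{0..?t - real m * \<tau>}. K s) - (LBINT s:{0..?t - real (Suc m) * \<tau>}. K s)"
      by (rule set_integral_kernel_interval[OF K]) (use le in auto)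
    finally have step: "(LBINT s:{0..real (Suc m) * \<tau>}. ?f s) = (LBINT s:{0..real m * \<tau>}. ?f s)
        + ((LBINT s:{0..?t - real m * \<tau>}. K s) - (LBINT s:{0..?t - real (Suc m) * \<tau>}. K s)) *\<^sub>R c (Suc m)" .
    have "?t - real m * \<tau> = real (n - Suc m + 1) * \<tau>" "?t - real (Suc m) * \<tau> = real (n - Suc m) * \<tau>"
      using Suc.prems by (simp_all add: of_nat_diff algebra_simps)
    then show ?case using Suc step by simp
  qed
  from this[OF order_refl] show ?thesis by (simp add: conv_def)
qed

lemma norm_set_integral_Icc_le:
  fixes f :: "real \<Rightarrow> 'b::{banach, second_countable_topology}"
  assumes f: "set_integrable lborel {a..b} f" and ab: "a \<le> b" and M: "\<And>s. a < s \<Longrightarrow> s \<le> b \<Longrightarrow> norm (f s) \<le> M"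
  shows "norm (LBINT s:{a..b}. f s) \<le> M * (b - a)"
proof -
  have "norm (LBINT s:{a..b}. f s) \<le> (LBINT s:{a..b}. norm (f s))"
    by (rule set_integral_norm_bound[OF f])
  also have "\<dots> \<le> (LBINT s:{a..b}. M)"
  proof (rule set_integral_mono_AE)
    show "set_integrable lborel {a..b} (\<lambda>s. norm (f s))" by (rule set_integrable_norm[OF f])
    show "set_integrable lborel {a..b} (\<lambda>s. M)" by (intro set_integrable_continuous continuous_on_const)
    show "AE s\<in>{a..b} in lborel. norm (f s) \<le> M"
      using AE_lborel_singleton[of a] by eventually_elim (use M in auto)
  qed
  also have "\<dots> = M * (b - a)" using ab by (simp add: set_lebesgue_integral_def)
  finally show ?thesis .
qed

text \<open>Common setting for the solution, averaged on every cell, and for minus its Laplacian,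
  with the end point value on the first cell; hence the alternative in \<open>c1\<close>. The scalar
  \<open>\<Phi>\<close> controls the first order Taylor remainder, so a singular second derivative
  enters only through the finite increment \<open>\<Phi> T - \<Phi> 0\<close>.\<close>

locale quadrature =
  fixes T \<tau> C :: real and N :: nat and v v' :: "real \<Rightarrow> 'b::{banach, second_countable_topology}"
    and \<Phi> :: "real \<Rightarrow> real" and c :: "nat \<Rightarrow> 'b"
  assumes \<tau>: "0 < \<tau>" and NT: "real N * \<tau> = T"
    and lip: "\<And>s t. 0 \<le> s \<Longrightarrow> s \<le> t \<Longrightarrow> t \<le> T \<Longrightarrow> norm (v t - v s) \<le> C * (t - s)"
    and taylor: "\<And>s t. 0 \<le> s \<Longrightarrow> s \<le> t \<Longrightarrow> t \<le> T \<Longrightarrow> norm (v t - v s - (t - s) *\<^sub>R v' s) \<le> (t - s) * (\<Phi> t - \<Phi> s)"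
    and \<Phi>_mono: "\<And>s t. 0 \<le> s \<Longrightarrow> s \<le> t \<Longrightarrow> t \<le> T \<Longrightarrow> \<Phi> s \<le> \<Phi> t"
    and c1: "c 1 = v \<tau> \<or> c 1 = (1 / 2) *\<^sub>R (v \<tau> + v 0)"
    and cj: "\<And>j. 2 \<le> j \<Longrightarrow> j \<le> N \<Longrightarrow> c j = (1 / 2) *\<^sub>R (v (real j * \<tau>) + v ((real j - 1) * \<tau>))"
    and C_nonneg: "0 \<le> C"
begin

definition err :: "real \<Rightarrow> 'b" where "err s = v s - pconst \<tau> c s"

definition Err :: "real \<Rightarrow> 'b" where "Err x = (LBINT s:{0..x}. err s)"

lemma continuous_v: "continuous_on {0..T} v"
  unfolding continuous_on_iff
proof (intro ballI allI impI)
  fix x e :: real assume x: "x \<in> {0..T}" and e: "0 < e"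
  have "dist (v y) (v x) \<le> C * dist y x" if "y \<in> {0..T}" for y
    using lip[of x y] lip[of y x] x that by (cases "x \<le> y") (auto simp: dist_norm norm_minus_commute)
  moreover have sm: "C * dist y x < e" if "dist y x < e / (C + 1)" for y
  proof -
    have "C * dist y x \<le> (C + 1) * dist y x" by (simp add: mult_right_mono)
    also have "\<dots> < e" using that C_nonneg by (simp add: pos_less_divide_eq mult.commute)
    finally show ?thesis .
  qed
  ultimately show "\<exists>d>0. \<forall>y\<in>{0..T}. dist y x < d \<longrightarrow> dist (v y) (v x) < e"
    using e C_nonneg by (intro exI[of _ "e / (C + 1)"]) (meson add_nonneg_pos divide_pos_pos le_less_trans zero_less_one)
qed

lemma err_integrable: "set_integrable lborel {0..T} err"
  unfolding err_def[abs_def]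
  using set_integral_diff(1)[OF set_integrable_continuous[OF continuous_v], of "pconst \<tau> c"] set_integrable_pconst[OF \<tau>, of N c] NT
  by simp

lemma err_integrable_sub: "0 \<le> a \<Longrightarrow> b \<le> T \<Longrightarrow> set_integrable lborel {a..b} err"
  by (rule set_integrable_subset[OF err_integrable]) auto

lemma norm_err: 
  assumes s: "0 < s" "s \<le> T"
  shows "norm (err s) \<le> C * \<tau>"
proof -
  define j where "j = nat \<lceil>s / \<tau>\<rceil>"
  have p: "0 < s / \<tau>" using s \<tau> by simp
  have "0 < \<lceil>s / \<tau>\<rceil>" using p by (simp add: zero_less_ceiling)
  then have j1: "1 \<le> j" unfolding j_def by linarith
  have jr: "real j = of_int \<lceil>s / \<tau>\<rceil>" using p by (simp add: j_def)
  have "real j - 1 < s / \<tau>" "s / \<tau> \<le> real j" unfolding jr by linarith+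
  then have js: "(real j - 1) * \<tau> < s" "s \<le> real j * \<tau>" using \<tau> by (simp_all add: pos_less_divide_eq pos_divide_le_eq)
  have "s / \<tau> \<le> real N" using s \<tau> NT by (simp add: pos_divide_le_eq)
  then have jN: "j \<le> N" by (simp add: j_def ceiling_le_iff nat_le_iff)
  then have jT: "real j * \<tau> \<le> T" using \<tau> NT by (metis mult_right_mono of_nat_mono less_imp_le)
  have "err s = v s - c j" using pconst_eq[OF \<tau> j1 js] by (simp add: err_def)
  moreover have l: "norm (v s - v (real j * \<tau>)) \<le> C * \<tau>"
  proof -
    have "norm (v (real j * \<tau>) - v s) \<le> C * (real j * \<tau> - s)" using lip[of s "real j * \<tau>"] s js jT by simp
    also have "\<dots> \<le> C * \<tau>" using js C_nonneg by (intro mult_left_mono) (auto simp: algebra_simps)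
    finally show ?thesis by (simp add: norm_minus_commute)
  qed
  moreover have r: "norm (v s - v ((real j - 1) * \<tau>)) \<le> C * \<tau>"
  proof -
    have "norm (v s - v ((real j - 1) * \<tau>)) \<le> C * (s - (real j - 1) * \<tau>)" using lip[of "(real j - 1) * \<tau>" s] s js j1 \<tau> by simp
    also have "\<dots> \<le> C * \<tau>" using js C_nonneg by (intro mult_left_mono) (auto simp: algebra_simps)
    finally show ?thesis .
  qed
  moreover have mid: "norm (v s - (1 / 2) *\<^sub>R (v (real j * \<tau>) + v ((real j - 1) * \<tau>))) \<le> C * \<tau>"
  proof -
    have "v s - (1 / 2) *\<^sub>R (v (real j * \<tau>) + v ((real j - 1) * \<tau>))
        = (1 / 2) *\<^sub>R ((v s - v (real j * \<tau>)) + (v s - v ((real j - 1) * \<tau>)))"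
      by (simp add: algebra_simps flip: scaleR_add_left)
    then show ?thesis using norm_triangle_mono[OF l r] by simp
  qed
  ultimately show ?thesis
    using c1 cj[of j] jN j1 by (cases "j = 1") auto
qed

text \<open>Convolution shifts the grid by an arbitrary \<open>r\<close>, so \<open>Err\<close> is
  also evaluated at negative arguments, where it has to continue by zero.\<close>

lemma Err_neg: "x \<le> 0 \<Longrightarrow> Err x = 0"
proof -
  assume x: "x \<le> 0"
  have "AE s in lborel. s \<notin> {0..x}"
    using AE_lborel_singleton[of 0] by eventually_elim (use x in auto)
  then show ?thesis
    unfolding Err_def set_lebesgue_integral_def by (intro integral_eq_zero_AE) (auto elim: eventually_mono)
qed

lemma Err_diff:
  assumes "0 \<le> a" "a \<le> b" "b \<le> T"
  shows "Err b - Err a = (LBINT s:{a..b}. err s)"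
  unfolding Err_def using set_integral_Icc_split[of 0 b err a] err_integrable_sub[of 0 b] assms by simp

lemma Err_diff_le:
  assumes "0 \<le> a" "a \<le> b" "b \<le> T"
  shows "norm (Err b - Err a) \<le> C * \<tau> * (b - a)"
  unfolding Err_diff[OF assms]
  by (rule norm_set_integral_Icc_le[OF err_integrable_sub]) (use assms norm_err in auto)

text \<open>
  For an affine function the error is a periodic sawtooth, whose integral over any period vanishes.
\<close>

lemma Err_increment:
  assumes j: "2 \<le> j" and x: "(real j - 1) * \<tau> < x" "x \<le> real j * \<tau>" and xT: "(real j + 1) * \<tau> \<le> T"
  shows "norm (Err (x + \<tau>) - Err x) \<le> 4 * \<tau>\<^sup>2 * (\<Phi> ((real j + 1) * \<tau>) - \<Phi> ((real j - 1) * \<tau>))"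
proof -
  define a where "a = (real j - 1) * \<tau>"
  have a0: "0 \<le> a" using j \<tau> by (simp add: a_def)
  have pts: "real j * \<tau> = a + \<tau>" "(real j + 1) * \<tau> = a + 2 * \<tau>" by (simp_all add: a_def algebra_simps)
  have pts2: "(real (j + 1) - 1) * \<tau> = a + \<tau>" "real (j + 1) * \<tau> = a + 2 * \<tau>" by (simp_all add: a_def algebra_simps)
  define P where "P = \<Phi> (a + 2 * \<tau>) - \<Phi> a"
  define \<rho> where "\<rho> s = v s - v a - (s - a) *\<^sub>R v' a" for s
  have v\<rho>: "v s = \<rho> s + v a + (s - a) *\<^sub>R v' a" for s by (simp add: \<rho>_def)
  have aT: "a + 2 * \<tau> \<le> T" using xT pts by simp
  have \<rho>: "norm (\<rho> s) \<le> 2 * \<tau> * P" if "a \<le> s" "s \<le> a + 2 * \<tau>" for s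
  proof -
    have "norm (\<rho> s) \<le> (s - a) * (\<Phi> s - \<Phi> a)" unfolding \<rho>_def using taylor[of a s] that a0 aT by simp
    also have "\<dots> \<le> 2 * \<tau> * P"
      unfolding P_def using that \<Phi>_mono[of s "a + 2 * \<tau>"] \<Phi>_mono[of a s] a0 aT \<tau> by (intro mult_mono) auto
    finally show ?thesis .
  qed
  have jN: "real j + 1 \<le> real N" using xT NT \<tau> by (metis mult_le_cancel_right_pos)
  then have jN': "j + 1 \<le> N" by simp
  \<comment> \<open>The errors of the affine Taylor part on two neighbouring cells, centred at their
    midpoints. The slope is frozen at \<open>a\<close> for both cells, so that the pieces belong to
    one sawtooth.\<close>
  define s1 where "s1 = (\<lambda>s. (s - a - \<tau> / 2) *\<^sub>R v' a)"
  define s2 where "s2 = (\<lambda>s. (s - a - 3 / 2 * \<tau>) *\<^sub>R v' a)"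
  have e1: "norm (err s - s1 s) \<le> 4 * \<tau> * P" if "a < s" "s \<le> a + \<tau>" for s
  proof -
    have "err s = v s - (1 / 2) *\<^sub>R (v (a + \<tau>) + v a)"
      using pconst_eq[OF \<tau>, of j s c] that cj[of j] j jN' by (simp add: err_def pts flip: a_def)
    also have "\<dots> = s1 s + (\<rho> s - (1 / 2) *\<^sub>R (\<rho> (a + \<tau>) + \<rho> a))"
      unfolding s1_def v\<rho>[of s] v\<rho>[of "a + \<tau>"] using midpoint_expansion[of "\<rho> s" "v a" "s - a" "v' a" "\<rho> (a + \<tau>)" \<tau> "\<rho> a" 0]
      by (simp add: \<rho>_def)
    finally have "norm (err s - s1 s) = norm (\<rho> s - (1 / 2) *\<^sub>R (\<rho> (a + \<tau>) + \<rho> a))" by simp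
    also have "\<dots> \<le> norm (\<rho> s) + (norm (\<rho> (a + \<tau>)) + norm (\<rho> a)) / 2"
      by (rule norm_sub_half_sum_le)
    also have "\<dots> \<le> 2 * \<tau> * P + (2 * \<tau> * P + 2 * \<tau> * P) / 2"
      using that \<tau> by (intro add_mono divide_right_mono \<rho>) auto
    also have "\<dots> = 4 * \<tau> * P" by simp
    finally show ?thesis .
  qed
  have e2: "norm (err s - s2 s) \<le> 4 * \<tau> * P" if "a + \<tau> < s" "s \<le> a + 2 * \<tau>" for s
  proof -
    have "err s = v s - (1 / 2) *\<^sub>R (v (a + 2 * \<tau>) + v (a + \<tau>))"
      using pconst_eq[OF \<tau>, of "j + 1" s c, unfolded pts2] that cj[of "j + 1", unfolded pts2] j jN' by (simp add: err_def)
    also have "\<dots> = s2 s + (\<rho> s - (1 / 2) *\<^sub>R (\<rho> (a + 2 * \<tau>) + \<rho> (a + \<tau>)))"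
      unfolding s2_def v\<rho>[of s] v\<rho>[of "a + \<tau>"] v\<rho>[of "a + 2 * \<tau>"]
      using midpoint_expansion[of "\<rho> s" "v a" "s - a" "v' a" "\<rho> (a + 2 * \<tau>)" "2 * \<tau>" "\<rho> (a + \<tau>)" \<tau>]
      by simp
    finally have "norm (err s - s2 s) = norm (\<rho> s - (1 / 2) *\<^sub>R (\<rho> (a + 2 * \<tau>) + \<rho> (a + \<tau>)))" by simp
    also have "\<dots> \<le> norm (\<rho> s) + (norm (\<rho> (a + 2 * \<tau>)) + norm (\<rho> (a + \<tau>))) / 2"
      by (rule norm_sub_half_sum_le)
    also have "\<dots> \<le> 2 * \<tau> * P + (2 * \<tau> * P + 2 * \<tau> * P) / 2"
      using that \<tau> by (intro add_mono divide_right_mono \<rho>) auto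
    also have "\<dots> = 4 * \<tau> * P" by simp
    finally show ?thesis .
  qed
  have xa: "a < x" "x \<le> a + \<tau>" using x by (simp_all add: a_def pts algebra_simps)
  have lin: "(LBINT s:{l..u}. s - d) = ((u - d)\<^sup>2 - (l - d)\<^sup>2) / 2" if "l \<le> u" for l u d :: real
  proof -
    have "(LBINT s. (s - d) * indicator {l..u} s) = (u - d)\<^sup>2 / 2 - (l - d)\<^sup>2 / 2"
      by (rule integral_FTC_Icc_real[OF that]) (auto intro!: derivative_eq_intros continuous_intros)
    then show ?thesis by (simp add: set_lebesgue_integral_def mult.commute diff_divide_distrib)
  qed
  have ci: "set_integrable lborel {l..u} (\<lambda>s::real. s - d)" for l u d
    by (intro set_integrable_continuous continuous_intros)
  have s1i: "set_integrable lborel {x..a + \<tau>} s1" and s2i: "set_integrable lborel {a + \<tau>..x + \<tau>} s2"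
    unfolding s1_def s2_def by (intro set_integrable_continuous continuous_intros)+
  have I1: "(LBINT s:{x..a + \<tau>}. s1 s) = (((\<tau> / 2)\<^sup>2 - (x - a - \<tau> / 2)\<^sup>2) / 2) *\<^sub>R v' a"
  proof -
    have "(LBINT s:{x..a + \<tau>}. s1 s) = (LBINT s:{x..a + \<tau>}. s - (a + \<tau> / 2)) *\<^sub>R v' a"
      unfolding s1_def diff_diff_eq by (rule set_integral_scaleR_const[OF ci])
    then show ?thesis using lin[of x "a + \<tau>" "a + \<tau> / 2"] xa by (simp add: diff_diff_eq)
  qed
  have I2: "(LBINT s:{a + \<tau>..x + \<tau>}. s2 s) = (((x - a - \<tau> / 2)\<^sup>2 - (\<tau> / 2)\<^sup>2) / 2) *\<^sub>R v' a"
  proof -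
    have q: "x + \<tau> - (a + 3 / 2 * \<tau>) = x - a - \<tau> / 2" "(a + \<tau> - (a + 3 / 2 * \<tau>))\<^sup>2 = (\<tau> / 2)\<^sup>2"
      by (simp_all add: power2_eq_square)
    have l2: "(LBINT s:{a + \<tau>..x + \<tau>}. s - (a + 3 / 2 * \<tau>)) = ((x - a - \<tau> / 2)\<^sup>2 - (\<tau> / 2)\<^sup>2) / 2"
      unfolding q[symmetric] using xa by (intro lin) simp
    have "(LBINT s:{a + \<tau>..x + \<tau>}. s2 s) = (LBINT s:{a + \<tau>..x + \<tau>}. s - (a + 3 / 2 * \<tau>)) *\<^sub>R v' a"
      unfolding s2_def diff_diff_eq by (rule set_integral_scaleR_const[OF ci])
    then show ?thesis unfolding l2 .
  qed
  have ei: "set_integrable lborel {x..a + \<tau>} err" "set_integrable lborel {a + \<tau>..x + \<tau>} err"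
    by (rule err_integrable_sub; use a0 xa aT \<tau> in simp)+
  have ed: "Err (a + \<tau>) - Err x = (LBINT s:{x..a + \<tau>}. err s)" "Err (x + \<tau>) - Err (a + \<tau>) = (LBINT s:{a + \<tau>..x + \<tau>}. err s)"
    by (rule Err_diff; use a0 xa aT \<tau> in simp)+
  have "Err (x + \<tau>) - Err x = (LBINT s:{x..a + \<tau>}. err s) + (LBINT s:{a + \<tau>..x + \<tau>}. err s)"
    unfolding ed[symmetric] by simp
  also have "\<dots> = (LBINT s:{x..a + \<tau>}. err s - s1 s) + (LBINT s:{a + \<tau>..x + \<tau>}. err s - s2 s)
      + ((LBINT s:{x..a + \<tau>}. s1 s) + (LBINT s:{a + \<tau>..x + \<tau>}. s2 s))"
    by (simp add: set_integral_diff(2)[OF ei(1) s1i] set_integral_diff(2)[OF ei(2) s2i])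
  also have "(LBINT s:{x..a + \<tau>}. s1 s) + (LBINT s:{a + \<tau>..x + \<tau>}. s2 s) = 0"
    unfolding I1 I2 by (simp flip: scaleR_add_left add_divide_distrib)
  finally have "norm (Err (x + \<tau>) - Err x) \<le> norm (LBINT s:{x..a + \<tau>}. err s - s1 s) + norm (LBINT s:{a + \<tau>..x + \<tau>}. err s - s2 s)"
    using norm_triangle_ineq by simp
  also have "\<dots> \<le> (4 * \<tau> * P) * (a + \<tau> - x) + (4 * \<tau> * P) * (x + \<tau> - (a + \<tau>))"
    using xa by (intro add_mono norm_set_integral_Icc_le set_integral_diff(1) ei s1i s2i e1 e2) auto
  also have "\<dots> = 4 * \<tau>\<^sup>2 * P" by (simp add: power2_eq_square algebra_simps)
  finally show ?thesis by (simp add: P_def pts a_def[symmetric])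
qed

text \<open>The sawtooth argument needs cells from the second one on. At most two of the shifted
  increments meet the first cell, and each costs \<open>C * \<tau>\<^sup>2\<close> by the Lipschitz
  bound. The remaining ones involve increments of \<open>\<Phi>\<close> over two cells, so each cell
  is counted twice: hence \<open>8 = 2 * 4\<close>.\<close>

lemma Err_variation:
  assumes r: "0 \<le> r" "r \<le> T"
  shows "(\<Sum>n=1..N. norm (Err (real n * \<tau> - r) - Err (real (n - 1) * \<tau> - r))) \<le> 2 * C * \<tau>\<^sup>2 + 8 * \<tau>\<^sup>2 * (\<Phi> T - \<Phi> 0)"
proof -
  define i where "i = nat \<lfloor>r / \<tau>\<rfloor>"
  have "0 \<le> r / \<tau>" using r \<tau> by simp
  then have ir: "real i = of_int \<lfloor>r / \<tau>\<rfloor>" by (simp add: i_def)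
  have "real i \<le> r / \<tau>" "r / \<tau> < real i + 1" unfolding ir by linarith+
  then have i: "real i * \<tau> \<le> r" "r < (real i + 1) * \<tau>" using \<tau> by (simp_all add: pos_le_divide_eq pos_divide_less_eq)
  have grid: "0 \<le> real k * \<tau>" "real k * \<tau> \<le> T" if "k \<le> N" for k
    using that \<tau> NT by (auto intro: mult_right_mono)
  \<comment> \<open>A majorant of the partial sums. Up to \<open>i\<close> all arguments are
    nonpositive; step \<open>i + 1\<close> ends in the first cell; afterwards the increments of
    \<open>\<Phi>\<close> telescope with stride two, and both lower ends are replaced by
    \<open>\<Phi> 0\<close> by monotonicity.\<close>
  define P where "P n = (if n \<le> i then 0 else if n = i + 1 then C * \<tau>\<^sup>2
      else 2 * C * \<tau>\<^sup>2 + 4 * \<tau>\<^sup>2 * (\<Phi> (real (n - i) * \<tau>) + \<Phi> (real (n - i - 1) * \<tau>) - 2 * \<Phi> 0))" for n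
  have C\<tau>: "0 \<le> C * \<tau>\<^sup>2" using C_nonneg by simp
  have \<Phi>0: "\<Phi> 0 \<le> \<Phi> (real k * \<tau>)" if "k \<le> N" for k using \<Phi>_mono[of 0 "real k * \<tau>"] grid[OF that] by simp
  have step: "norm (Err (real (Suc m) * \<tau> - r) - Err (real m * \<tau> - r)) \<le> P (Suc m) - P m" if m: "Suc m \<le> N" for m
  proof -
    have x: "real (Suc m) * \<tau> - r = (real m * \<tau> - r) + \<tau>" by (simp add: algebra_simps)
    have mT: "real m * \<tau> + \<tau> \<le> T" using grid(2)[OF m] by (simp add: algebra_simps)
    consider "Suc m \<le> i" | "m = i" | "m = i + 1" | "i + 2 \<le> m" by linarith
    then show ?thesis
    proof cases
      case 1
      have "real (Suc m) * \<tau> \<le> real i * \<tau>" using 1 \<tau> by (intro mult_right_mono) auto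
      then have "real (Suc m) * \<tau> - r \<le> 0" "real m * \<tau> - r \<le> 0" using i x \<tau> by linarith+
      then show ?thesis using 1 by (simp add: Err_neg P_def)
    next
      case 2
      have "real m * \<tau> - r \<le> 0" using i 2 by simp
      then have "Err (real m * \<tau> - r) = Err 0" by (simp add: Err_neg)
      moreover have "norm (Err (real (Suc m) * \<tau> - r) - Err 0) \<le> C * \<tau>\<^sup>2"
      proof -
        have "(real i + 1) * \<tau> = real m * \<tau> + \<tau>" using 2 by (simp add: algebra_simps)
        then have p: "0 \<le> real (Suc m) * \<tau> - r" "real (Suc m) * \<tau> - r \<le> \<tau>" "real (Suc m) * \<tau> - r \<le> T"
          using i(2) \<open>real m * \<tau> - r \<le> 0\<close> x mT r by linarith+
        have "norm (Err (real (Suc m) * \<tau> - r) - Err 0) \<le> C * \<tau> * (real (Suc m) * \<tau> - r - 0)"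
          by (rule Err_diff_le) (use p in auto)
        also have "\<dots> \<le> C * \<tau> * \<tau>" using p C_nonneg \<tau> by (intro mult_left_mono) auto
        finally show ?thesis by (simp add: power2_eq_square mult.assoc)
      qed
      ultimately show ?thesis using 2 by (simp add: P_def)
    next
      case 3
      have "(real i + 1) * \<tau> = real m * \<tau>" using 3 by (simp add: algebra_simps)
      then have p: "0 \<le> real m * \<tau> - r" "real (Suc m) * \<tau> - r \<le> T" using i(2) x mT r by linarith+
      have "norm (Err (real (Suc m) * \<tau> - r) - Err (real m * \<tau> - r)) \<le> C * \<tau> * (real (Suc m) * \<tau> - r - (real m * \<tau> - r))"
        by (rule Err_diff_le) (use p x \<tau> in auto)
      also have "real (Suc m) * \<tau> - r - (real m * \<tau> - r) = \<tau>" unfolding x by simp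
      also have "C * \<tau> * \<tau> = C * \<tau>\<^sup>2" by (simp add: power2_eq_square)
      also have "\<dots> \<le> P (Suc m) - P m"
      proof -
        have "P (Suc m) - P m = C * \<tau>\<^sup>2 + 4 * \<tau>\<^sup>2 * ((\<Phi> (real 2 * \<tau>) - \<Phi> 0) + (\<Phi> (real 1 * \<tau>) - \<Phi> 0))"
          using 3 by (simp add: P_def)
        moreover have "0 \<le> 4 * \<tau>\<^sup>2 * ((\<Phi> (real 2 * \<tau>) - \<Phi> 0) + (\<Phi> (real 1 * \<tau>) - \<Phi> 0))"
          using \<Phi>0[of 2] \<Phi>0[of 1] m 3 by (intro mult_nonneg_nonneg add_nonneg_nonneg) auto
        ultimately show ?thesis by linarith
      qed
      finally show ?thesis .
    next
      case 4
      define j where "j = m - i"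
      have j: "2 \<le> j" "real j = real m - real i" "j + 1 \<le> N" using 4 m by (auto simp: j_def)
      have jm: "real j * \<tau> = real m * \<tau> - real i * \<tau>" "(real j - 1) * \<tau> = real m * \<tau> - (real i + 1) * \<tau>"
        by (simp_all add: j algebra_simps)
      have jT: "(real j + 1) * \<tau> \<le> T" using grid(2)[OF j(3)] by (simp add: add.commute)
      have x1: "(real j - 1) * \<tau> < real m * \<tau> - r" using i(2) jm(2) by linarith
      have x2: "real m * \<tau> - r \<le> real j * \<tau>" using i(1) jm(1) by linarith
      have "norm (Err (real m * \<tau> - r + \<tau>) - Err (real m * \<tau> - r))
          \<le> 4 * \<tau>\<^sup>2 * (\<Phi> ((real j + 1) * \<tau>) - \<Phi> ((real j - 1) * \<tau>))"
        by (rule Err_increment[OF j(1) x1 x2 jT])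
      also have "\<dots> = P (Suc m) - P m"
      proof -
        have "real (Suc m - i) = real j + 1" "real (Suc m - i - 1) = real j" "real (m - i) = real j" "real (m - i - 1) = real j - 1"
          using 4 by (auto simp: j_def of_nat_diff)
        then show ?thesis using 4 unfolding P_def by (simp add: algebra_simps)
      qed
      finally show ?thesis unfolding x .
    qed
  qed
  have "(\<Sum>n=1..m. norm (Err (real n * \<tau> - r) - Err (real (n - 1) * \<tau> - r))) \<le> P m" if "m \<le> N" for m
    using that
  proof (induction m)
    case (Suc m)
    then show ?case using step[of m] by simp
  qed (simp add: P_def)
  from this[OF order_refl] have "(\<Sum>n=1..N. norm (Err (real n * \<tau> - r) - Err (real (n - 1) * \<tau> - r))) \<le> P N" .
  also have "P N \<le> 2 * C * \<tau>\<^sup>2 + 4 * \<tau>\<^sup>2 * ((\<Phi> T - \<Phi> 0) + (\<Phi> T - \<Phi> 0))"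
  proof -
    have mon: "\<Phi> (real k * \<tau>) \<le> \<Phi> T" if "k \<le> N" for k using \<Phi>_mono[of "real k * \<tau>" T] grid[OF that] by simp
    have T0: "0 \<le> \<Phi> T - \<Phi> 0" using mon[of 0] by simp
    have "4 * \<tau>\<^sup>2 * (\<Phi> (real (N - i) * \<tau>) + \<Phi> (real (N - i - 1) * \<tau>) - 2 * \<Phi> 0) \<le> 4 * \<tau>\<^sup>2 * ((\<Phi> T - \<Phi> 0) + (\<Phi> T - \<Phi> 0))"
      using mon[of "N - i"] mon[of "N - i - 1"] by (intro mult_left_mono) auto
    moreover have "0 \<le> 4 * \<tau>\<^sup>2 * ((\<Phi> T - \<Phi> 0) + (\<Phi> T - \<Phi> 0))" using T0 by (intro mult_nonneg_nonneg) auto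
    ultimately show ?thesis unfolding P_def using C\<tau> by auto
  qed
  also have "\<dots> = 2 * C * \<tau>\<^sup>2 + 8 * \<tau>\<^sup>2 * (\<Phi> T - \<Phi> 0)" by (simp add: algebra_simps)
  finally show ?thesis .
qed

lemma Err_eq_conv: "0 \<le> x \<Longrightarrow> Err x = conv (\<lambda>_. 1) err x"
  by (simp add: Err_def conv_def)

text \<open>Moves one integration from the kernel to the error. The gain of an order happens here:
  \<open>Err\<close> has second order variation, while \<open>err\<close> itself is only of first
  order.\<close>

lemma conv_kernel_err:
  assumes K: "set_integrable lborel {0..T} K" and t: "0 \<le> t" "t \<le> T"
  shows "conv (\<lambda>x. LBINT s:{0..x}. K s) err t = conv K Err t"
proof -
  have one: "set_integrable lborel {0..t} (\<lambda>_. 1::real)" by (intro set_integrable_continuous continuous_on_const)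
  have Kt: "set_integrable lborel {0..t} K" by (rule set_integrable_subset[OF K]) (use t in auto)
  have "conv K (\<lambda>_. 1) x = (LBINT s:{0..x}. K s)" for x
    by (simp add: conv_def set_integral_reflect(1))
  then have "conv (\<lambda>x. LBINT s:{0..x}. K s) err t = conv (conv K (\<lambda>_. 1)) err t" by presburger
  also have "\<dots> = conv K (conv (\<lambda>_. 1) err) t"
    by (rule conv_assoc[symmetric, OF Kt one err_integrable_sub[OF order_refl t(2)], of 1]) simp
  also have "\<dots> = conv K Err t"
    unfolding conv_def[of K] by (intro set_lebesgue_integral_cong) (auto simp: Err_eq_conv)
  finally show ?thesis .
qed

text \<open>
  Convolving with an integrable kernel does not increase the variation over the grid, which is of second
  order although the error itself is only of first order.
\<close>

lemma quadrature_error: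
  assumes K: "set_integrable lborel {0..T} K"
  shows "(\<Sum>n=1..N. norm (conv (\<lambda>x. LBINT s:{0..x}. K s) err (real n * \<tau>) - conv (\<lambda>x. LBINT s:{0..x}. K s) err (real (n - 1) * \<tau>)))
    \<le> (LBINT s:{0..T}. \<bar>K s\<bar>) * (2 * C * \<tau>\<^sup>2 + 8 * \<tau>\<^sup>2 * (\<Phi> T - \<Phi> 0))"
proof -
  define B where "B = 2 * C * \<tau>\<^sup>2 + 8 * \<tau>\<^sup>2 * (\<Phi> T - \<Phi> 0)"
  define K' where "K' = (\<lambda>s. indicator {0..T} s * K s)"
  define E' where "E' = (\<lambda>s. indicator {0..T} s *\<^sub>R Err s)"
  have T0: "0 \<le> T" using \<tau> NT by (metis mult_nonneg_nonneg of_nat_0_le_iff less_imp_le)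
  have K'i: "integrable lborel K'" using K by (simp add: K'_def set_integrable_def)
  have "set_integrable lborel {0..T} (conv (\<lambda>_. 1) err)"
    by (intro conv_integrable err_integrable set_integrable_continuous continuous_on_const)
  then have "set_integrable lborel {0..T} Err"
    by (rule set_integrable_cong[THEN iffD1, rotated -1]) (auto simp: Err_eq_conv)
  then have E'i: "integrable lborel E'" by (simp add: E'_def set_integrable_def)
  note [measurable] = borel_measurable_integrable[OF K'i, simplified] borel_measurable_integrable[OF E'i, simplified]
  have E'Err: "E' x = Err x" if "x \<le> T" for x using that Err_neg[of x] by (cases "0 \<le> x") (auto simp: E'_def)
  have E'b: "norm (E' x) \<le> C * \<tau> * T" for x
  proof (cases "x \<in> {0..T}")
    case True
    have "norm (Err x - Err 0) \<le> C * \<tau> * (x - 0)" by (rule Err_diff_le) (use True in auto)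
    also have "\<dots> \<le> C * \<tau> * T" using True C_nonneg \<tau> by (intro mult_left_mono) auto
    finally show ?thesis using True by (simp add: E'_def Err_neg)
  next
    case False
    then show ?thesis using C_nonneg \<tau> T0 by (simp add: E'_def)
  qed
  \<comment> \<open>Reflection puts the dependence on the time into \<open>E'\<close> alone. The
    kernel becomes a fixed weight, and the sum over the grid can be taken under the
    integral.\<close>
  have J: "conv K Err t = (LBINT y. K' y *\<^sub>R E' (t - y))" if "t \<le> T" for t
    unfolding conv_eq_truncated[OF that]
    using integral_reflect_shift[of "\<lambda>y. K' (t - y) *\<^sub>R E' y" t] by (simp add: K'_def E'_def)
  have Ji: "integrable lborel (\<lambda>y. K' y *\<^sub>R E' (t - y))" for t
  proof (rule Bochner_Integration.integrable_bound[where f = "\<lambda>y. K' y * (C * \<tau> * T)"])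
    show "AE y in lborel. norm (K' y *\<^sub>R E' (t - y)) \<le> norm (K' y * (C * \<tau> * T))"
      unfolding norm_scaleR real_norm_def abs_mult[of "K' _"] using E'b abs_ge_self[of "C * \<tau> * T"]
      by (intro AE_I2 mult_left_mono) (auto intro: order_trans)
  qed (use K'i in simp_all)
  have grid: "0 \<le> real k * \<tau>" "real k * \<tau> \<le> T" if "k \<le> N" for k
    using that \<tau> NT by (auto intro: mult_right_mono)
  let ?d = "\<lambda>n y. E' (real n * \<tau> - y) - E' (real (n - 1) * \<tau> - y)"
  have di: "integrable lborel (\<lambda>y. K' y *\<^sub>R ?d n y)" for n
    unfolding scaleR_diff_right by (intro Bochner_Integration.integrable_diff Ji)
  have "(\<Sum>n=1..N. norm (conv (\<lambda>x. LBINT s:{0..x}. K s) err (real n * \<tau>) - conv (\<lambda>x. LBINT s:{0..x}. K s) err (real (n - 1) * \<tau>)))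
      = (\<Sum>n=1..N. norm (LBINT y. K' y *\<^sub>R ?d n y))"
  proof (intro sum.cong refl arg_cong[where f = norm])
    fix n assume "n \<in> {1..N}"
    then have "n \<le> N" "n - 1 \<le> N" by auto
    then show "conv (\<lambda>x. LBINT s:{0..x}. K s) err (real n * \<tau>) - conv (\<lambda>x. LBINT s:{0..x}. K s) err (real (n - 1) * \<tau>)
        = (LBINT y. K' y *\<^sub>R ?d n y)"
      unfolding scaleR_diff_right
      by (simp only: conv_kernel_err[OF K grid] J[OF grid(2)] Bochner_Integration.integral_diff[OF Ji Ji])
  qed
  also have "\<dots> \<le> (\<Sum>n=1..N. LBINT y. norm (K' y *\<^sub>R ?d n y))"
    by (intro sum_mono integral_norm_bound)
  also have "\<dots> = (LBINT y. (\<Sum>n=1..N. norm (K' y *\<^sub>R ?d n y)))"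
    by (rule Bochner_Integration.integral_sum[symmetric]) (intro integrable_norm di)
  also have "\<dots> \<le> (LBINT y. \<bar>K' y\<bar> * B)"
  proof (rule integral_mono)
    show "integrable lborel (\<lambda>y. \<Sum>n=1..N. norm (K' y *\<^sub>R ?d n y))"
      by (intro Bochner_Integration.integrable_sum integrable_norm di)
    show "integrable lborel (\<lambda>y. \<bar>K' y\<bar> * B)" using K'i by simp
    fix y
    show "(\<Sum>n=1..N. norm (K' y *\<^sub>R ?d n y)) \<le> \<bar>K' y\<bar> * B"
    proof (cases "y \<in> {0..T}")
      case True
      have "(\<Sum>n=1..N. norm (?d n y)) = (\<Sum>n=1..N. norm (Err (real n * \<tau> - y) - Err (real (n - 1) * \<tau> - y)))"
      proof (intro sum.cong refl)
        fix n assume "n \<in> {1..N}"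
        then have "n \<le> N" "n - 1 \<le> N" by auto
        from grid(2)[OF this(1)] grid(2)[OF this(2)] True
        show "norm (?d n y) = norm (Err (real n * \<tau> - y) - Err (real (n - 1) * \<tau> - y))"
          by (simp add: E'Err)
      qed
      also have "\<dots> \<le> B" unfolding B_def using True by (intro Err_variation) auto
      finally have "\<bar>K' y\<bar> * (\<Sum>n=1..N. norm (?d n y)) \<le> \<bar>K' y\<bar> * B" by (rule mult_left_mono) simp
      then show ?thesis by (simp add: sum_distrib_left)
    qed (simp add: K'_def)
  qed
  also have "\<dots> = (LBINT s:{0..T}. \<bar>K s\<bar>) * B"
    by (simp add: K'_def set_lebesgue_integral_def abs_mult)
  finally show ?thesis by (simp add: B_def)
qed

end

section \<open>The exact solution\<close>

lemma set_integral_bounded_linear: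
  fixes f :: "'c \<Rightarrow> 'b::{banach, second_countable_topology}" and P :: "'b \<Rightarrow> 'd::{banach, second_countable_topology}"
  assumes P: "bounded_linear P" and f: "set_integrable M A f"
  shows "P (LINT x:A|M. f x) = (LINT x:A|M. P (f x))" and "set_integrable M A (\<lambda>x. P (f x))"
proof -
  have s: "P (indicator A x *\<^sub>R f x) = indicator A x *\<^sub>R P (f x)" for x
    by (rule linear_scale[OF bounded_linear.linear[OF P]])
  show "P (LINT x:A|M. f x) = (LINT x:A|M. P (f x))"
    using integral_bounded_linear[OF P f[unfolded set_integrable_def]] unfolding s set_lebesgue_integral_def by simp
  show "set_integrable M A (\<lambda>x. P (f x))"
    using integrable_bounded_linear[OF P f[unfolded set_integrable_def]] unfolding s set_integrable_def .
qed

lemma set_integrable_Icc_Ioo: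
  fixes f :: "real \<Rightarrow> 'b::{banach, second_countable_topology}"
  assumes "set_integrable lborel {a<..<b} f" "a \<le> b"
  shows "set_integrable lborel {a..b} f"
proof -
  have s: "set_integrable lborel {c} f" for c
  proof -
    have eq: "indicator {c} x *\<^sub>R f x = indicator {c} x *\<^sub>R f c" for x by (cases "x = c") simp_all
    show ?thesis unfolding set_integrable_def eq by simp
  qed
  have "set_integrable lborel (insert a (insert b {a<..<b})) f"
    using set_integrable_Un[OF s[of a] set_integrable_Un[OF s[of b] assms(1)]] by (simp add: insert_commute)
  moreover have "insert a (insert b {a<..<b}) = {a..b}" using assms(2) by auto
  ultimately show ?thesis by simp
qed

text \<open>The weak derivative determines increments only strictly inside the interval. Continuity
  of the primitive, here via the scalar majorant \<open>\<psi>\<close>, carries them to the end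
  points, in particular to the initial values.\<close>

lemma primitive_extend:
  fixes v w :: "real \<Rightarrow> 'b::{banach, second_countable_topology}"
  assumes T: "0 < T" and v: "continuous_on {0..T} v" and w: "set_integrable lborel {0..T} w"
    and \<psi>: "continuous_on {0..T} \<psi>" "\<And>s t. 0 \<le> s \<Longrightarrow> s \<le> t \<Longrightarrow> t \<le> T \<Longrightarrow> norm (LBINT r:{s..t}. w r) \<le> \<psi> t - \<psi> s"
    and prim: "\<And>s t. 0 < s \<Longrightarrow> s < t \<Longrightarrow> t < T \<Longrightarrow> v t - v s = (LBINT r:{s..t}. w r)"
    and t: "0 \<le> s" "s \<le> t" "t \<le> T"
  shows "v t - v s = (LBINT r:{s..t}. w r)"
proof -
  define F where "F t = (LBINT r:{0..t}. w r)" for t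
  have wi: "set_integrable lborel {0..b} w" if "b \<le> T" for b
    by (rule set_integrable_subset[OF w]) (use that in auto)
  have Fd: "F b - F a = (LBINT r:{a..b}. w r)" if "0 \<le> a" "a \<le> b" "b \<le> T" for a b
    unfolding F_def using set_integral_Icc_split[OF wi[of b], of a] that by simp
  have Fle: "dist (F b) (F a) \<le> dist (\<psi> b) (\<psi> a)" if "a \<in> {0..T}" "b \<in> {0..T}" for a b
  proof (cases "a \<le> b")
    case True
    then show ?thesis using \<psi>(2)[of a b] Fd[of a b] that abs_ge_self[of "\<psi> b - \<psi> a"] by (simp add: dist_norm)
  next
    case False
    then show ?thesis using \<psi>(2)[of b a] Fd[of b a] that abs_ge_self[of "\<psi> a - \<psi> b"]
      by (simp add: dist_norm norm_minus_commute abs_minus_commute)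
  qed
  have "continuous_on {0..T} F"
    using \<psi>(1) Fle unfolding continuous_on_iff by (meson le_less_trans)
  then have c: "continuous_on {0..T} (\<lambda>t. v t - F t)" by (intro continuous_on_diff v)
  have cl: "closure {0<..<T} = {0..T}" using T by simp
  have const: "v r - F r = v (T/2) - F (T/2)" if "r \<in> {0..T}" for r
  proof (rule continuous_constant_on_closure[of "{0<..<T}" "\<lambda>t. v t - F t"])
    fix x assume x: "x \<in> {0<..<T}"
    consider "x < T / 2" | "x = T / 2" | "T / 2 < x" by linarith
    then show "v x - F x = v (T/2) - F (T/2)"
    proof cases
      case 1
      then have "v (T/2) - v x = F (T/2) - F x" using prim[of x "T/2"] Fd[of x "T/2"] x T by simp
      then show ?thesis by (simp add: algebra_simps)
    next
      case 3
      then have "v x - v (T/2) = F x - F (T/2)" using prim[of "T/2" x] Fd[of "T/2" x] x T by simp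
      then show ?thesis by (simp add: algebra_simps)
    qed (simp only:)
  qed (use c cl that in auto)
  have "v t - F t = v s - F s" using const[of t] const[of s] t by simp
  then have "v t - v s = F t - F s" by (simp add: algebra_simps)
  then show ?thesis using Fd[OF t] by simp
qed

lemma conv_const_right:
  assumes "set_integrable lborel {0..t} a"
  shows "conv a (\<lambda>_. z) t = (LBINT s:{0..t}. a s) *\<^sub>R z"
proof -
  have "set_integrable lborel {0..t} (\<lambda>s. a (t - s))"
    using set_integral_reflect(2)[of 0 t a t] assms by simp
  then have "conv a (\<lambda>_. z) t = (LBINT s:{0..t}. a (t - s)) *\<^sub>R z"
    unfolding conv_def by (rule set_integral_scaleR_const)
  then show ?thesis by (simp add: set_integral_reflect(1))
qed

lemma conv_cong:
  assumes "\<And>s. s \<in> {0..t} \<Longrightarrow> a s = a' s" "\<And>s. s \<in> {0..t} \<Longrightarrow> b s = b' s"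
  shows "conv a b t = conv a' b' t"
  unfolding conv_def by (rule set_lebesgue_integral_cong) (use assms in auto)

lemma conv_one: "conv (\<lambda>_. 1) b t = (LBINT s:{0..t}. b s)"
  by (simp add: conv_def)

lemma conv_diff_right:
  fixes b c :: "real \<Rightarrow> 'b::{banach, second_countable_topology}"
  assumes a: "continuous_on {0..t} a" and b: "set_integrable lborel {0..t} b" and c: "set_integrable lborel {0..t} c"
  shows "conv a (\<lambda>s. b s - c s) t = conv a b t - conv a c t"
    and "conv a (\<lambda>s. b s + c s) t = conv a b t + conv a c t"
proof -
  obtain M where M: "\<And>x. x \<in> {0..t} \<Longrightarrow> norm (a x) \<le> M"
    using continuous_on_Icc_bounded[OF a] by blast
  then have M': "\<And>x. x \<in> {0..t} \<Longrightarrow> \<bar>a x\<bar> \<le> M" by simp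
  note i = conv_integrand_bounded_left[OF set_integrable_continuous[OF a] b M'] conv_integrand_bounded_left[OF set_integrable_continuous[OF a] c M']
  show "conv a (\<lambda>s. b s - c s) t = conv a b t - conv a c t" "conv a (\<lambda>s. b s + c s) t = conv a b t + conv a c t"
    unfolding conv_def scaleR_diff_right scaleR_add_right
    by (rule set_integral_diff(2) set_integral_add(2), rule i, assumption, rule i, assumption)+
qed

lemma conv_scaleR_right: "conv a (\<lambda>s. r *\<^sub>R b s) t = r *\<^sub>R conv a b t"
  by (simp only: conv_def scaleR_left_commute[of _ r] set_integral_scaleR_right)

lemma conv_assoc_bounded:
  fixes c :: "real \<Rightarrow> 'b::{banach, second_countable_topology}"
  assumes a: "continuous_on {0..t} a" and b: "set_integrable lborel {0..t} b" and c: "set_integrable lborel {0..t} c"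
  shows "conv a (conv b c) t = conv (conv a b) c t"
proof -
  obtain M where "\<And>x. x \<in> {0..t} \<Longrightarrow> norm (a x) \<le> M"
    using continuous_on_Icc_bounded[OF a] by blast
  then show ?thesis
    by (intro conv_assoc[OF set_integrable_continuous[OF a] b c, of M]) simp
qed

lemma continuous_beta_kernel: "1 < \<mu> \<Longrightarrow> continuous_on {0..t} (beta_kernel \<mu>)"
  unfolding beta_kernel_def[abs_def] divide_inverse
  by (intro continuous_intros continuous_on_powr') auto

locale diffusion_wave = dirichlet_problem \<Omega> lam \<phi> + variable_exponent T L \<alpha> \<alpha>1 \<alpha>2 \<alpha>3
  for \<Omega> :: "'a::euclidean_space set" and lam \<phi> T L \<alpha> \<alpha>1 \<alpha>2 \<alpha>3 +
  fixes \<kappa> p Q0 :: real and u0 ub0 :: "'a L2" and f :: "real \<Rightarrow> 'a L2" and du :: "nat \<Rightarrow> real \<Rightarrow> 'a L2"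
  assumes \<kappa>_pos: "0 < \<kappa>"
    and H_check_eq: "H_check \<Omega> lam \<phi> 2 = H2 \<Omega> \<inter> H10 \<Omega>"
    and u0: "u0 \<in> H_check \<Omega> lam \<phi> 2" and ub0: "ub0 \<in> H_check \<Omega> lam \<phi> 2"
    and f_W11: "W11_time (L2_on \<Omega>) T f"
    and solution: "diffusion_wave_solution \<Omega> lam \<phi> T \<kappa> \<alpha> p f u0 ub0 du"
    and du2: "\<And>m t. m \<in> {0, 1} \<Longrightarrow> t \<in> {0<..T} \<Longrightarrow> du 2 t \<in> H_check \<Omega> lam \<phi> (2 * real m) \<and>
      norm_H_check lam \<phi> (2 * real m) (du 2 t) \<le> Q0 * t powr (\<alpha> 0 - 2)"
begin

definition \<mu> :: real where "\<mu> = \<alpha> 0 - 1"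

text \<open>The primitive \<open>Q0 * t powr \<mu> / \<mu>\<close> of the assumed bound
  \<open>Q0 * t powr (\<alpha> 0 - 2)\<close>, written with beta kernels to reuse their
  integrals.\<close>

definition \<Phi> :: "real \<Rightarrow> real" where "\<Phi> t = Q0 * Gamma \<mu> * beta_kernel (\<mu> + 1) t"

lemma \<mu>: "0 < \<mu>" "\<mu> < 1" using \<alpha>0 by (auto simp: \<mu>_def)

lemma L2_on_H_check: "q \<in> H_check \<Omega> lam \<phi> s \<Longrightarrow> q \<in> L2_on \<Omega>"
  by (simp add: H_check_def)

lemma continuous_du: "continuous_on {0..T} (du 0)" "continuous_on {0..T} (du 1)"
  and du_0: "du 0 0 = u0" "du 1 0 = ub0"
  using solution by (auto simp: diffusion_wave_solution_def)

lemma norm_du2: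
  assumes "t \<in> {0<..T}"
  shows "norm (du 2 t) \<le> Q0 * Gamma \<mu> * beta_kernel \<mu> t"
    and "norm (trunc_laplacian k (du 2 t)) \<le> Q0 * Gamma \<mu> * beta_kernel \<mu> t"
proof -
  have eq: "Q0 * t powr (\<alpha> 0 - 2) = Q0 * Gamma \<mu> * beta_kernel \<mu> t"
    using Gamma_real_pos[OF \<mu>(1)] by (simp add: beta_kernel_def \<mu>_def)
  have 0: "du 2 t \<in> H_check \<Omega> lam \<phi> 0" "norm_H_check lam \<phi> 0 (du 2 t) \<le> Q0 * t powr (\<alpha> 0 - 2)"
    using du2[of 0 t] assms by auto
  have 1: "du 2 t \<in> H_check \<Omega> lam \<phi> 2" "norm_H_check lam \<phi> 2 (du 2 t) \<le> Q0 * t powr (\<alpha> 0 - 2)"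
    using du2[of 1 t] assms by auto
  show "norm (du 2 t) \<le> Q0 * Gamma \<mu> * beta_kernel \<mu> t"
    using 0 norm_H_check_0[OF L2_on_H_check[OF 0(1)]] eq by simp
  show "norm (trunc_laplacian k (du 2 t)) \<le> Q0 * Gamma \<mu> * beta_kernel \<mu> t"
    using 1 norm_trunc_laplacian_le[OF 1(1), of k] eq by simp
qed

lemma du2_L2_on: "t \<in> {0<..T} \<Longrightarrow> du 2 t \<in> L2_on \<Omega>"
  using du2[of 0 t] by (auto simp: H_check_def)

lemma Q0_nonneg: "0 \<le> Q0 * Gamma \<mu>"
proof -
  have "0 \<le> Q0 * Gamma \<mu> * beta_kernel \<mu> T" using norm_du2(1)[of T] T_pos by (auto intro: order_trans[OF norm_ge_zero])
  moreover have "0 < beta_kernel \<mu> T" using T_pos \<mu> by (simp add: beta_kernel_def Gamma_real_pos)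
  ultimately show ?thesis by (simp add: zero_le_mult_iff)
qed

lemma beta_integrable: "t \<le> T \<Longrightarrow> 0 < \<nu> \<Longrightarrow> set_integrable lborel {0..t} (beta_kernel \<nu>)"
  by (rule set_integrable_subset[OF beta_kernel_integral(1)[of \<nu> T]]) (use T_pos in auto)

lemma du2_integrable: "set_integrable lborel {0..T} (du 2)"
proof (rule set_integrable_Icc_Ioo)
  have "set_integrable lborel {0<..<T} (\<lambda>t. Q0 * Gamma \<mu> * beta_kernel \<mu> t)"
    by (intro set_integrable_mult_right set_integrable_subset[OF beta_integrable[OF order_refl \<mu>(1)]]) auto
  moreover have "set_borel_measurable lborel {0<..<T} (du 2)"
    using solution by (auto simp: diffusion_wave_solution_def Lp_time_def)
  moreover have "AE t in lborel. t \<in> {0<..<T} \<longrightarrow> norm (du 2 t) \<le> norm (Q0 * Gamma \<mu> * beta_kernel \<mu> t)"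
  proof (intro AE_I2 impI)
    fix t assume "t \<in> {0<..<T}"
    then have "norm (du 2 t) \<le> Q0 * Gamma \<mu> * beta_kernel \<mu> t" by (intro norm_du2) auto
    then show "norm (du 2 t) \<le> norm (Q0 * Gamma \<mu> * beta_kernel \<mu> t)" using abs_ge_self order_trans unfolding real_norm_def by blast
  qed
  ultimately show "set_integrable lborel {0<..<T} (du 2)" by (rule set_integrable_bound)
qed (use T_pos in simp)

lemma \<Phi>_diff:
  assumes "0 \<le> s" "s \<le> t" "t \<le> T"
  shows "(LBINT r:{s..t}. Q0 * Gamma \<mu> * beta_kernel \<mu> r) = \<Phi> t - \<Phi> s" and "\<Phi> s \<le> \<Phi> t"
proof -
  show eq: "(LBINT r:{s..t}. Q0 * Gamma \<mu> * beta_kernel \<mu> r) = \<Phi> t - \<Phi> s"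
    using set_integral_Icc_split[OF beta_integrable[OF assms(3) \<mu>(1)] assms(1,2)] assms
    by (simp add: \<Phi>_def beta_kernel_integral[OF \<mu>(1)] right_diff_distrib flip: distrib_left)
      (simp add: distrib_left)
  have "0 \<le> (LBINT r:{s..t}. Q0 * Gamma \<mu> * beta_kernel \<mu> r)"
    unfolding set_lebesgue_integral_def using Q0_nonneg beta_kernel_nonneg[OF \<mu>(1)]
    by (intro Bochner_Integration.integral_nonneg) simp
  then show "\<Phi> s \<le> \<Phi> t" unfolding eq by simp
qed

lemma continuous_\<Phi>: "continuous_on {0..T} \<Phi>"
  unfolding \<Phi>_def[abs_def] using \<mu> by (intro continuous_intros continuous_beta_kernel) simp

text \<open>One proof for two norms: \<open>P\<close> will be the identity for L2 estimates and each
  \<open>trunc_laplacian k\<close> for estimates of order two.\<close>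

lemma operator_du2_integral:
  assumes P: "bounded_linear P" and b: "\<And>r. r \<in> {0<..T} \<Longrightarrow> norm (P (du 2 r)) \<le> Q0 * Gamma \<mu> * beta_kernel \<mu> r"
    and st: "0 \<le> s" "s \<le> t" "t \<le> T"
  shows "norm (P (LBINT r:{s..t}. du 2 r) :: 'a L2) \<le> \<Phi> t - \<Phi> s"
proof -
  have i: "set_integrable lborel {s..t} (du 2)" by (rule set_integrable_subset[OF du2_integrable]) (use st in auto)
  have j: "set_integrable lborel {s..t} (\<lambda>r. Q0 * Gamma \<mu> * beta_kernel \<mu> r)"
    by (intro set_integrable_mult_right set_integrable_subset[OF beta_integrable[OF st(3) \<mu>(1)]]) (use st in auto)
  note Pi = set_integral_bounded_linear[OF P i]
  have "norm (P (LBINT r:{s..t}. du 2 r)) \<le> (LBINT r:{s..t}. norm (P (du 2 r)))"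
    unfolding Pi(1) by (rule set_integral_norm_bound[OF Pi(2)])
  also have "\<dots> \<le> (LBINT r:{s..t}. Q0 * Gamma \<mu> * beta_kernel \<mu> r)"
  proof (rule set_integral_mono_AE[OF set_integrable_norm[OF Pi(2)] j])
    show "AE r\<in>{s..t} in lborel. norm (P (du 2 r)) \<le> Q0 * Gamma \<mu> * beta_kernel \<mu> r"
      using AE_lborel_singleton[of 0] by eventually_elim (use b st in auto)
  qed
  finally show ?thesis unfolding \<Phi>_diff(1)[OF st] .
qed

lemma du1_increment:
  assumes st: "0 \<le> s" "s \<le> t" "t \<le> T"
  shows "du 1 t - du 1 s = (LBINT r:{s..t}. du 2 r)"
proof (rule primitive_extend[OF T_pos continuous_du(2) du2_integrable continuous_\<Phi> _ _ st])
  show "norm (LBINT r:{s..t}. du 2 r) \<le> \<Phi> t - \<Phi> s" if "0 \<le> s" "s \<le> t" "t \<le> T" for s t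
    by (rule operator_du2_integral[OF bounded_linear_ident norm_du2(1) that])
  show "du 1 t - du 1 s = (LBINT r:{s..t}. du 2 r)" if "0 < s" "s < t" "t < T" for s t
    using solution that continuous_du(2)
    by (intro weak_time_deriv_increment[of T]) (auto simp: diffusion_wave_solution_def)
qed

lemma du1_integrable: "0 \<le> s \<Longrightarrow> t \<le> T \<Longrightarrow> set_integrable lborel {s..t} (du 1)"
  by (rule set_integrable_continuous[OF continuous_on_subset[OF continuous_du(2)]]) auto

lemma du0_increment:
  assumes st: "0 \<le> s" "s \<le> t" "t \<le> T"
  shows "du 0 t - du 0 s = (LBINT r:{s..t}. du 1 r)"
proof -
  obtain M where M: "\<And>x. x \<in> {0..T} \<Longrightarrow> norm (du 1 x) \<le> M"
    using continuous_on_Icc_bounded[OF continuous_du(2)] by blast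
  show ?thesis
  proof (rule primitive_extend[OF T_pos continuous_du(1) du1_integrable[OF order_refl order_refl] _ _ _ st])
    show "norm (LBINT r:{s..t}. du 1 r) \<le> M * t - M * s" if "0 \<le> s" "s \<le> t" "t \<le> T" for s t
      using norm_set_integral_Icc_le[OF du1_integrable that(2), of M] that M by (simp add: right_diff_distrib)
    show "continuous_on {0..T} (\<lambda>t. M * t)" by (intro continuous_intros)
    show "du 0 t - du 0 s = (LBINT r:{s..t}. du 1 r)" if "0 < s" "s < t" "t < T" for s t
      using solution that continuous_du(1)
      by (intro weak_time_deriv_increment[of T]) (auto simp: diffusion_wave_solution_def)
  qed
qed

lemma operator_taylor:
  assumes P: "bounded_linear (P :: 'a L2 \<Rightarrow> 'a L2)" and b: "\<And>r. r \<in> {0<..T} \<Longrightarrow> norm (P (du 2 r)) \<le> Q0 * Gamma \<mu> * beta_kernel \<mu> r"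
    and st: "0 \<le> s" "s \<le> t" "t \<le> T"
  shows "norm (P (du 0 t - du 0 s - (t - s) *\<^sub>R du 1 s)) \<le> (t - s) * (\<Phi> t - \<Phi> s)"
    and "norm (P (du 1 t)) \<le> norm (P ub0) + (\<Phi> T - \<Phi> 0)"
    and "norm (P (du 0 t - du 0 s)) \<le> (norm (P ub0) + (\<Phi> T - \<Phi> 0)) * (t - s)"
proof -
  note d1 = du1_integrable[OF st(1,3)]
  have ci: "set_integrable lborel {s..t} (\<lambda>_. du 1 s)" by (intro set_integrable_continuous continuous_on_const)
  have cint: "(LBINT r:{s..t}. du 1 s) = (t - s) *\<^sub>R du 1 s" using st by (simp add: set_lebesgue_integral_def)
  have P1: "norm (P (du 1 r - du 1 s)) \<le> \<Phi> t - \<Phi> s" if "s < r" "r \<le> t" for r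
    using operator_du2_integral[OF P b, of s r] du1_increment[of s r] \<Phi>_diff(2)[of r t] that st by simp
  note di = set_integral_diff(1)[OF d1 ci]
  have "P (du 0 t - du 0 s - (t - s) *\<^sub>R du 1 s) = (LBINT r:{s..t}. P (du 1 r - du 1 s))"
    unfolding du0_increment[OF st] cint[symmetric] set_integral_diff(2)[OF d1 ci, symmetric]
    by (rule set_integral_bounded_linear(1)[OF P di])
  also have "norm \<dots> \<le> (\<Phi> t - \<Phi> s) * (t - s)"
    by (rule norm_set_integral_Icc_le[OF set_integral_bounded_linear(2)[OF P di] st(2) P1])
  finally show "norm (P (du 0 t - du 0 s - (t - s) *\<^sub>R du 1 s)) \<le> (t - s) * (\<Phi> t - \<Phi> s)" by (simp add: mult.commute)
  have b1: "norm (P (du 1 r)) \<le> norm (P ub0) + (\<Phi> T - \<Phi> 0)" if "0 \<le> r" "r \<le> T" for r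
  proof -
    have "P (du 1 r) = P ub0 + P (du 1 r - du 1 0)"
      using linear_add[OF bounded_linear.linear[OF P], of ub0 "du 1 r - du 1 0"] du_0(2) by simp
    also have "norm \<dots> \<le> norm (P ub0) + (\<Phi> r - \<Phi> 0)"
      using operator_du2_integral[OF P b, of 0 r] du1_increment[of 0 r] that
      by (intro order_trans[OF norm_triangle_ineq]) simp
    also have "\<dots> \<le> norm (P ub0) + (\<Phi> T - \<Phi> 0)" using \<Phi>_diff(2)[of r T] that by simp
    finally show ?thesis .
  qed
  show "norm (P (du 1 t)) \<le> norm (P ub0) + (\<Phi> T - \<Phi> 0)" using b1[of t] st by simp
  show "norm (P (du 0 t - du 0 s)) \<le> (norm (P ub0) + (\<Phi> T - \<Phi> 0)) * (t - s)"
    unfolding du0_increment[OF st] set_integral_bounded_linear(1)[OF P d1]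
    by (rule norm_set_integral_Icc_le[OF set_integral_bounded_linear(2)[OF P d1] st(2)]) (use b1 st in auto)
qed

lemma du_L2_on:
  assumes t: "t \<in> {0..T}"
  shows "du 1 t \<in> L2_on \<Omega>" "du 0 t \<in> L2_on \<Omega>"
proof -
  have 1: "du 1 t \<in> L2_on \<Omega>" if t: "t \<in> {0..T}" for t
  proof -
    have i: "set_integrable lborel {0..t} (du 2)" by (rule set_integrable_subset[OF du2_integrable]) (use t in auto)
    have "AE r in lborel. r \<in> {0..t} \<longrightarrow> du 2 r \<in> L2_on \<Omega>"
      using AE_lborel_singleton[of 0] by eventually_elim (use t du2_L2_on in auto)
    then have "(LBINT r:{0..t}. du 2 r) \<in> L2_on \<Omega>" by (rule L2_on_set_integral[OF open_domain i])
    then have "ub0 + (LBINT r:{0..t}. du 2 r) \<in> L2_on \<Omega>"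
      using L2_on_H_check[OF ub0] subspace_L2_on[OF open_domain] by (intro subspace_add)
    moreover have "du 1 t = ub0 + (LBINT r:{0..t}. du 2 r)" using du1_increment[of 0 t] t du_0(2) by (simp add: algebra_simps)
    ultimately show ?thesis by simp
  qed
  then show "du 1 t \<in> L2_on \<Omega>" using t .
  have i: "set_integrable lborel {0..t} (du 1)" using t by (intro du1_integrable) auto
  have "(LBINT r:{0..t}. du 1 r) \<in> L2_on \<Omega>"
    by (rule L2_on_set_integral[OF open_domain i]) (use 1 t in auto)
  then have "u0 + (LBINT r:{0..t}. du 1 r) \<in> L2_on \<Omega>"
    using L2_on_H_check[OF u0] subspace_L2_on[OF open_domain] by (intro subspace_add)
  moreover have "du 0 t = u0 + (LBINT r:{0..t}. du 1 r)" using du0_increment[of 0 t] t by (simp add: du_0 algebra_simps)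
  ultimately show "du 0 t \<in> L2_on \<Omega>" by simp
qed

text \<open>\<open>C1\<close> will be the Lipschitz constant in time of the solution in the norm of
  order two, and \<open>C0\<close> its bound in that norm.\<close>

definition C1 :: real where "C1 = norm_H_check lam \<phi> 2 ub0 + (\<Phi> T - \<Phi> 0)"
definition C0 :: real where "C0 = norm_H_check lam \<phi> 2 u0 + C1 * T"

lemma C1_nonneg: "0 \<le> C1" and C0_nonneg: "0 \<le> C0"
proof -
  show 1: "0 \<le> C1" using norm_H_check_nonneg[OF ub0] \<Phi>_diff(2)[of 0 T] T_pos by (simp add: C1_def)
  show "0 \<le> C0" using norm_H_check_nonneg[OF u0] 1 T_pos by (simp add: C0_def)
qed

text \<open>The estimates hold for each truncated Laplacian with constants independent of
  \<open>k\<close>, so \<open>H_check_2_iff\<close> turns them into membership. This places the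
  solution and its time derivative in the domain of the Laplacian at every time, end points
  included.\<close>

lemma H_check_bounds:
  assumes st: "0 \<le> s" "s \<le> t" "t \<le> T"
  shows "du 1 t \<in> H_check \<Omega> lam \<phi> 2"
    and "du 0 t - du 0 s \<in> H_check \<Omega> lam \<phi> 2 \<and> norm_H_check lam \<phi> 2 (du 0 t - du 0 s) \<le> C1 * (t - s)"
    and "du 0 t - du 0 s - (t - s) *\<^sub>R du 1 s \<in> H_check \<Omega> lam \<phi> 2 \<and>
      norm_H_check lam \<phi> 2 (du 0 t - du 0 s - (t - s) *\<^sub>R du 1 s) \<le> (t - s) * (\<Phi> t - \<Phi> s)"
    and "du 0 t \<in> H_check \<Omega> lam \<phi> 2 \<and> norm_H_check lam \<phi> 2 (du 0 t) \<le> C0"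
proof -
  have o: "norm (trunc_laplacian k (du 0 t - du 0 s - (t - s) *\<^sub>R du 1 s)) \<le> (t - s) * (\<Phi> t - \<Phi> s)"
      "norm (trunc_laplacian k (du 1 t)) \<le> norm (trunc_laplacian k ub0) + (\<Phi> T - \<Phi> 0)"
      "norm (trunc_laplacian k (du 0 t - du 0 s)) \<le> (norm (trunc_laplacian k ub0) + (\<Phi> T - \<Phi> 0)) * (t - s)"
    if "0 \<le> s" "s \<le> t" "t \<le> T" for s t k
    by (rule operator_taylor[OF bounded_linear_trunc_laplacian norm_du2(2) that], assumption)+
  have L: "du 1 t \<in> L2_on \<Omega>" "du 1 s \<in> L2_on \<Omega>" "du 0 t \<in> L2_on \<Omega>" "du 0 s \<in> L2_on \<Omega>"
    using du_L2_on[of t] du_L2_on[of s] st by auto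
  note sub = subspace_diff[OF subspace_L2_on[OF open_domain]] subspace_scale[OF subspace_L2_on[OF open_domain]]
  have ub: "norm (trunc_laplacian k ub0) + (\<Phi> T - \<Phi> 0) \<le> C1" for k
    using norm_trunc_laplacian_le[OF ub0, of k] by (simp add: C1_def)
  have b1: "norm (trunc_laplacian k (du 1 t)) \<le> C1" for k
    using o(2)[OF st, of k] ub[of k] by simp
  show "du 1 t \<in> H_check \<Omega> lam \<phi> 2"
    using H_check_2_iff[OF C1_nonneg, of "du 1 t"] L b1 by blast
  have lip: "norm (trunc_laplacian k (du 0 t - du 0 s)) \<le> C1 * (t - s)" if "0 \<le> s" "s \<le> t" "t \<le> T" for s t k
    using o(3)[OF that, of k] mult_right_mono[OF ub[of k], of "t - s"] that by simp
  have "0 \<le> C1 * (t - s)" using C1_nonneg st by simp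
  from H_check_2_iff[OF this, of "du 0 t - du 0 s"]
  show "du 0 t - du 0 s \<in> H_check \<Omega> lam \<phi> 2 \<and> norm_H_check lam \<phi> 2 (du 0 t - du 0 s) \<le> C1 * (t - s)"
    using lip[OF st] sub(1)[OF L(3,4)] by blast
  have "0 \<le> (t - s) * (\<Phi> t - \<Phi> s)" using \<Phi>_diff(2)[OF st] st by simp
  from H_check_2_iff[OF this, of "du 0 t - du 0 s - (t - s) *\<^sub>R du 1 s"]
  show "du 0 t - du 0 s - (t - s) *\<^sub>R du 1 s \<in> H_check \<Omega> lam \<phi> 2 \<and>
      norm_H_check lam \<phi> 2 (du 0 t - du 0 s - (t - s) *\<^sub>R du 1 s) \<le> (t - s) * (\<Phi> t - \<Phi> s)"
    using o(1)[OF st] sub(1)[OF sub(1)[OF L(3,4)] sub(2)[OF L(2)]] by blast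
  have "norm (trunc_laplacian k (du 0 t)) \<le> C0" for k
  proof -
    have "trunc_laplacian k (du 0 t) = trunc_laplacian k u0 + trunc_laplacian k (du 0 t - du 0 0)"
      using linear_add[OF bounded_linear.linear[OF bounded_linear_trunc_laplacian], of k u0 "du 0 t - du 0 0"] by (simp add: du_0)
    also have "norm \<dots> \<le> norm_H_check lam \<phi> 2 u0 + C1 * (t - 0)"
      using norm_trunc_laplacian_le[OF u0, of k] lip[of 0 t k] st by (intro norm_triangle_mono) auto
    also have "\<dots> \<le> C0" unfolding C0_def using st C1_nonneg by (intro add_left_mono mult_left_mono) auto
    finally show ?thesis .
  qed
  then show "du 0 t \<in> H_check \<Omega> lam \<phi> 2 \<and> norm_H_check lam \<phi> 2 (du 0 t) \<le> C0"
    using H_check_2_iff[OF C0_nonneg, of "du 0 t"] L by blast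
qed

definition v :: "real \<Rightarrow> 'a L2" where "v t = - laplacian \<Omega> (du 0 t)"
text \<open>It serves as the slope in the Taylor estimate \<open>v_taylor\<close>; no
  differentiability of \<open>v\<close> is claimed.\<close>

definition v' :: "real \<Rightarrow> 'a L2" where "v' t = - laplacian \<Omega> (du 1 t)"

lemma v_taylor:
  assumes st: "0 \<le> s" "s \<le> t" "t \<le> T"
  shows "norm (v t - v s) \<le> C1 * (t - s)"
    and "norm (v t - v s - (t - s) *\<^sub>R v' s) \<le> (t - s) * (\<Phi> t - \<Phi> s)"
proof -
  have H: "du 0 t \<in> H2 \<Omega>" "du 0 s \<in> H2 \<Omega>" "du 1 s \<in> H2 \<Omega>"
    using H_check_bounds(4)[OF st] H_check_bounds(4)[of s s] H_check_bounds(1)[of s s] st unfolding H_check_eq by auto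
  have d: "laplacian \<Omega> (du 0 t - du 0 s) = laplacian \<Omega> (du 0 t) - laplacian \<Omega> (du 0 s)"
    using laplacian_linear_comb[OF H(1,2), of 1 "-1"] by simp
  have "du 0 t - du 0 s \<in> H2 \<Omega>" using H_check_bounds(2)[OF st] unfolding H_check_eq by blast
  from laplacian_linear_comb[OF this H(3), of 1 "- (t - s)"]
  have d2: "laplacian \<Omega> (du 0 t - du 0 s - (t - s) *\<^sub>R du 1 s) = laplacian \<Omega> (du 0 t) - laplacian \<Omega> (du 0 s) - (t - s) *\<^sub>R laplacian \<Omega> (du 1 s)"
    by (simp add: d algebra_simps)
  have "v t - v s = - laplacian \<Omega> (du 0 t - du 0 s)" unfolding d by (simp add: v_def)
  then show "norm (v t - v s) \<le> C1 * (t - s)"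
    using H_check_bounds(2)[OF st] norm_laplacian[of "du 0 t - du 0 s"] unfolding H_check_eq by simp
  have "v t - v s - (t - s) *\<^sub>R v' s = - laplacian \<Omega> (du 0 t - du 0 s - (t - s) *\<^sub>R du 1 s)"
    unfolding d2 by (simp add: v_def v'_def)
  then show "norm (v t - v s - (t - s) *\<^sub>R v' s) \<le> (t - s) * (\<Phi> t - \<Phi> s)"
    using H_check_bounds(3)[OF st] norm_laplacian[of "du 0 t - du 0 s - (t - s) *\<^sub>R du 1 s"] unfolding H_check_eq by simp
qed

end

section \<open>The equation integrated in time\<close>

lemma conv_diff_left:
  fixes b :: "real \<Rightarrow> 'b::{banach, second_countable_topology}"
  assumes a: "continuous_on {0..t} a" and a': "continuous_on {0..t} a'" and b: "set_integrable lborel {0..t} b"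
  shows "conv (\<lambda>s. a s - a' s) b t = conv a b t - conv a' b t"
proof -
  have i: "set_integrable lborel {0..t} (\<lambda>s. A (t - s) *\<^sub>R b s)" if A: "continuous_on {0..t} A" for A
  proof -
    obtain M where "\<And>x. x \<in> {0..t} \<Longrightarrow> norm (A x) \<le> M" using continuous_on_Icc_bounded[OF A] by blast
    then show ?thesis by (intro conv_integrand_bounded_left[where M = M] set_integrable_continuous A b) simp
  qed
  show ?thesis unfolding conv_def scaleR_diff_left by (rule set_integral_diff(2)[OF i[OF a] i[OF a']])
qed

lemma set_integral_FTC:
  fixes F f :: "real \<Rightarrow> real"
  assumes "\<And>x. x \<in> {0..T} \<Longrightarrow> (F has_real_derivative f x) (at x within {0..T})" "continuous_on {0..T} f"
    and t: "0 \<le> t" "t \<le> T"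
  shows "(LBINT s:{0..t}. f s) = F t - F 0"
  unfolding set_lebesgue_integral_def
proof (rule integral_FTC_Icc[OF t(1)])
  fix x assume "0 \<le> x" "x \<le> t"
  then have "(F has_real_derivative f x) (at x within {0..t})"
    using t by (intro DERIV_subset[OF assms(1)]) auto
  then show "(F has_vector_derivative f x) (at x within {0..t})"
    by (simp add: has_real_derivative_iff_has_vector_derivative)
qed (use assms(2) t in \<open>auto intro: continuous_on_subset\<close>)

context diffusion_wave
begin

lemma continuous_on_sub:
  "t \<le> T \<Longrightarrow> continuous_on {0..T} h \<Longrightarrow> continuous_on {0..t} h"
  by (erule continuous_on_subset) auto

lemma set_integrable_sub:
  fixes h :: "real \<Rightarrow> 'b::{banach, second_countable_topology}"
  shows "t \<le> T \<Longrightarrow> set_integrable lborel {0..T} h \<Longrightarrow> set_integrable lborel {0..t} h"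
  using set_integrable_subset[where A = "{0..T}" and B = "{0..t}" and f = h and M = lborel] by auto

lemma g1_primitive: "0 \<le> t \<Longrightarrow> t \<le> T \<Longrightarrow> (LBINT s:{0..t}. g1 s) = g_kernel \<alpha> t - 1"
  using set_integral_FTC[OF g_derivs(1) continuous_g(2)] by (simp add: g_0)

lemma g2_primitive: "0 \<le> t \<Longrightarrow> t \<le> T \<Longrightarrow> (LBINT s:{0..t}. g2 s) = g1 t"
  using set_integral_FTC[OF g_derivs(2) continuous_g(3)] by (simp add: g1_0)

lemma f_integrable: "set_integrable lborel {0..T} f"
proof (rule set_integrable_Icc_Ioo)
  have f: "set_borel_measurable lborel {0<..<T} f" "set_integrable lborel {0<..<T} (\<lambda>t. norm (f t) powr 1)"
    using f_W11 by (auto simp: W11_time_def Lp_time_def)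
  show "set_integrable lborel {0<..<T} f"
    by (rule set_integrable_bound[OF f(2,1)]) simp
qed (use T_pos in simp)

lemma continuous_v: "continuous_on {0..T} v"
proof (rule lipschitz_on_continuous_on)
  show "C1-lipschitz_on {0..T} v"
  proof (rule lipschitz_onI[OF _ C1_nonneg])
    fix x y assume "x \<in> {0..T}" "y \<in> {0..T}"
    then show "dist (v x) (v y) \<le> C1 * dist x y"
      using v_taylor(1)[of x y] v_taylor(1)[of y x]
      by (cases "x \<le> y") (auto simp: dist_norm norm_minus_commute[of "v x"] abs_minus_commute[of x])
  qed
qed

lemma continuous_beta: "continuous_on {0..t} (beta_kernel (\<mu> + 1))"
  using \<mu> by (intro continuous_beta_kernel) simp

text \<open>Neither \<open>beta_kernel \<mu>\<close> nor the kernel \<open>k\<close> is bounded near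
  \<open>0\<close>. The integrated kernel \<open>beta_kernel (\<mu> + 1)\<close> is continuous, so
  that it can be associated freely with the singular factors.\<close>

lemma conv_beta_primitive:
  fixes h :: "real \<Rightarrow> 'b::{banach, second_countable_topology}"
  assumes t: "t \<in> {0..T}" and h: "set_integrable lborel {0..T} h"
  shows "conv (beta_kernel (\<mu> + 1)) h t = (LBINT s:{0..t}. conv (beta_kernel \<mu>) h s)"
proof -
  have "conv (beta_kernel (\<mu> + 1)) h t = conv (conv (\<lambda>_. 1) (beta_kernel \<mu>)) h t"
    by (rule conv_cong) (simp_all add: conv_one beta_kernel_integral[OF \<mu>(1)])
  also have "\<dots> = conv (\<lambda>_. 1) (conv (beta_kernel \<mu>) h) t"
    using t \<mu> by (intro conv_assoc_bounded[symmetric] beta_integrable set_integrable_sub[OF _ h]) auto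
  finally show ?thesis by (simp add: conv_one)
qed

text \<open>The identity \<open>conv_beta_k\<close> fails at \<open>0\<close>, but after integration
  a single point does not matter and all of \<open>{0..T}\<close> is covered.\<close>

lemma conv_beta_k_primitive:
  assumes t: "t \<in> {0..T}"
  shows "conv (beta_kernel (\<mu> + 1)) (k_kernel \<alpha>) t = conv (g_kernel \<alpha>) (\<lambda>_. 1) t"
proof -
  have "conv (beta_kernel (\<mu> + 1)) (k_kernel \<alpha>) t = conv (\<lambda>_. 1) (conv (beta_kernel \<mu>) (k_kernel \<alpha>)) t"
    by (simp only: conv_beta_primitive[OF t k_kernel_integrable] conv_one)
  also have "\<dots> = conv (\<lambda>_. 1) (g_kernel \<alpha>) t"
  proof (rule conv_cong_AE)
    show "AE s in lborel. s \<in> {0..T} \<longrightarrow> conv (beta_kernel \<mu>) (k_kernel \<alpha>) s = g_kernel \<alpha> s"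
      using AE_lborel_singleton[of 0] by eventually_elim (auto simp: conv_beta_k \<mu>_def)
    show "set_integrable lborel {0..T} (conv (beta_kernel \<mu>) (k_kernel \<alpha>))"
      by (intro conv_integrable beta_integrable \<mu> k_kernel_integrable) simp
    show "set_integrable lborel {0..T} (\<lambda>_. 1 :: real)" by (intro set_integrable_continuous continuous_on_const)
  qed (use t continuous_g in \<open>auto intro: set_integrable_continuous\<close>)
  finally show ?thesis by (simp add: conv_commute)
qed

text \<open>Integration by parts in convolution form: \<open>du 0 - u0\<close> is the convolution of
  \<open>1\<close> with \<open>du 1\<close>, and \<open>g - 1\<close> is that of \<open>g1\<close>
  with \<open>1\<close>, so associativity replaces any differentiation of a convolution.\<close>

lemma conv_g_du1:
  assumes t: "t \<in> {0..T}"
  shows "conv (g_kernel \<alpha>) (du 1) t = (du 0 t - u0) + conv g1 (du 0) t - (g_kernel \<alpha> t - 1) *\<^sub>R u0"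
proof -
  have tT: "t \<le> T" using t by simp
  note c = continuous_on_sub[OF tT]
  have "conv g1 (du 0) t - (g_kernel \<alpha> t - 1) *\<^sub>R u0 = conv g1 (\<lambda>s. du 0 s - u0) t"
    using conv_const_right[OF set_integrable_continuous[OF c[OF continuous_g(2)]], of u0] t
    by (subst conv_diff_right(1))
      (auto simp: g1_primitive intro!: set_integrable_continuous c continuous_g continuous_du)
  also have "\<dots> = conv g1 (conv (\<lambda>_. 1) (du 1)) t"
    using t du0_increment[of 0] by (intro conv_cong) (auto simp: conv_one du_0)
  also have "\<dots> = conv (conv g1 (\<lambda>_. 1)) (du 1) t"
    by (intro conv_assoc_bounded c continuous_g set_integrable_continuous continuous_du continuous_on_const)
  also have "\<dots> = conv (\<lambda>s. g_kernel \<alpha> s - 1) (du 1) t"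
    using t by (intro conv_cong) (simp_all add: conv_commute[of g1] conv_one g1_primitive)
  also have "\<dots> = conv (g_kernel \<alpha>) (du 1) t - conv (\<lambda>_. 1) (du 1) t"
    by (intro conv_diff_left c continuous_g set_integrable_continuous continuous_du continuous_on_const)
  also have "conv (\<lambda>_. 1) (du 1) t = du 0 t - u0"
    using du0_increment[of 0 t] t by (simp add: conv_one du_0)
  finally show ?thesis by (simp add: algebra_simps)
qed

lemma f_bar_integrable: "set_integrable lborel {0..T} (f_bar \<alpha> f ub0)"
proof -
  have "set_integrable lborel {0..T} (\<lambda>s. conv (beta_kernel \<mu>) f s + g_kernel \<alpha> s *\<^sub>R ub0)"
    using \<mu> by (intro set_integral_add conv_integrable beta_integrable f_integrable set_integrable_continuous
      continuous_intros continuous_g) auto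
  then show ?thesis by (simp only: f_bar_def[abs_def] conv_def \<mu>_def)
qed

lemma f_bar_integral:
  assumes t: "t \<in> {0..T}"
  shows "(LBINT s:{0..t}. f_bar \<alpha> f ub0 s) = conv (beta_kernel (\<mu> + 1)) f t + (LBINT s:{0..t}. g_kernel \<alpha> s) *\<^sub>R ub0"
proof -
  have tT: "t \<le> T" using t by simp
  have i: "set_integrable lborel {0..t} (g_kernel \<alpha>)"
    by (intro set_integrable_sub[OF tT] set_integrable_continuous continuous_g)
  have "(LBINT s:{0..t}. f_bar \<alpha> f ub0 s) = (LBINT s:{0..t}. conv (beta_kernel \<mu>) f s + g_kernel \<alpha> s *\<^sub>R ub0)"
    by (simp only: f_bar_def[abs_def] conv_def \<mu>_def)
  also have "\<dots> = (LBINT s:{0..t}. conv (beta_kernel \<mu>) f s) + (LBINT s:{0..t}. g_kernel \<alpha> s *\<^sub>R ub0)"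
    using \<mu> by (intro set_integral_add(2) set_integrable_sub[OF tT] conv_integrable beta_integrable f_integrable
      set_integrable_continuous continuous_intros continuous_g) auto
  finally show ?thesis by (simp only: set_integral_scaleR_const[OF i] conv_beta_primitive[OF t f_integrable])
qed

text \<open>The equation holds almost everywhere, which suffices inside a convolution. Then
  \<open>beta_kernel (\<mu> + 1) * k = g * 1\<close> in the sense of convolutions, and the factor
  \<open>1\<close> integrates \<open>du 2\<close> to \<open>du 1 - ub0\<close>.\<close>

lemma exact_equation:
  assumes t: "t \<in> {0..T}"
  shows "du 0 t - g_kernel \<alpha> t *\<^sub>R u0 + conv g1 (du 0) t + \<kappa> *\<^sub>R conv (beta_kernel (\<mu> + 1)) v t
    = (LBINT s:{0..t}. f_bar \<alpha> f ub0 s)"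
proof -
  have tT: "t \<le> T" using t by simp
  note c = continuous_on_sub[OF tT] and i = set_integrable_sub[OF tT]
  have ki: "set_integrable lborel {0..T} (conv (k_kernel \<alpha>) (du 2))"
    by (intro conv_integrable k_kernel_integrable du2_integrable)
  have vi: "set_integrable lborel {0..T} (\<lambda>s. \<kappa> *\<^sub>R v s)"
    by (intro set_integrable_continuous continuous_intros continuous_v)
  have "conv (beta_kernel (\<mu> + 1)) f t = conv (beta_kernel (\<mu> + 1)) (\<lambda>s. conv (k_kernel \<alpha>) (du 2) s + \<kappa> *\<^sub>R v s) t"
  proof (rule conv_cong_AE[OF f_integrable set_integral_add(1)[OF ki vi] beta_integrable[OF order_refl] _ tT])
    have "AE s in lborel. s \<in> {0<..T} \<longrightarrow> (LBINT r:{0..s}. k_kernel \<alpha> (s - r) *\<^sub>R du 2 r) - \<kappa> *\<^sub>R laplacian \<Omega> (du 0 s) = f s"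
      using solution by (simp add: diffusion_wave_solution_def)
    with AE_lborel_singleton[of 0]
    show "AE s in lborel. s \<in> {0..T} \<longrightarrow> f s = conv (k_kernel \<alpha>) (du 2) s + \<kappa> *\<^sub>R v s"
      by eventually_elim (auto simp: conv_def v_def)
  qed (use \<mu> in simp)
  also have "\<dots> = conv (beta_kernel (\<mu> + 1)) (conv (k_kernel \<alpha>) (du 2)) t + \<kappa> *\<^sub>R conv (beta_kernel (\<mu> + 1)) v t"
    unfolding conv_diff_right(2)[OF continuous_beta i[OF ki] i[OF vi]] conv_scaleR_right ..
  also have "conv (beta_kernel (\<mu> + 1)) (conv (k_kernel \<alpha>) (du 2)) t = conv (conv (beta_kernel (\<mu> + 1)) (k_kernel \<alpha>)) (du 2) t"
    by (intro conv_assoc_bounded continuous_beta i k_kernel_integrable du2_integrable)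
  also have "\<dots> = conv (conv (g_kernel \<alpha>) (\<lambda>_. 1)) (du 2) t"
    using t by (intro conv_cong conv_beta_k_primitive) auto
  also have "\<dots> = conv (g_kernel \<alpha>) (conv (\<lambda>_. 1) (du 2)) t"
    by (intro conv_assoc_bounded[symmetric] c continuous_g i du2_integrable set_integrable_continuous continuous_on_const)
  also have "\<dots> = conv (g_kernel \<alpha>) (\<lambda>s. du 1 s - ub0) t"
    using t du1_increment[of 0] du_0(2) by (intro conv_cong) (auto simp: conv_one)
  also have "\<dots> = conv (g_kernel \<alpha>) (du 1) t - (LBINT s:{0..t}. g_kernel \<alpha> s) *\<^sub>R ub0"
    using conv_diff_right(1)[OF c[OF continuous_g(1)] set_integrable_continuous[OF c[OF continuous_du(2)]]
        set_integrable_continuous[OF continuous_on_const]]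
      conv_const_right[OF set_integrable_continuous[OF c[OF continuous_g(1)]], of ub0] by simp
  finally show ?thesis
    unfolding f_bar_integral[OF t] conv_g_du1[OF t] by (simp add: algebra_simps)
qed

end

section \<open>The error of the fully discrete scheme\<close>

text \<open>
  The quadrature rule evaluates its argument at the right end point of the first interval and at
  averages elsewhere. Testing the scheme with the same sequence makes the quadrature term a
  quadratic form.
\<close>

definition head_midval :: "(nat \<Rightarrow> 'b::real_vector) \<Rightarrow> nat \<Rightarrow> 'b"
  where "head_midval X n = (if n = 1 then X 1 else midval X n)"

text \<open>The bracket of the scheme. By \<open>history_conv\<close> it is the increment over one
  step of the convolution of \<open>g1\<close> with the step function of averages, less the
  contribution of the initial value.\<close>

definition history :: "(nat \<Rightarrow> real) \<Rightarrow> (nat \<Rightarrow> 'b::real_vector) \<Rightarrow> nat \<Rightarrow> 'b"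
  where "history w X n = w 0 *\<^sub>R midval X n - (\<Sum>k=1..n-1. (w (k - 1) - w k) *\<^sub>R midval X (n - k)) - w (n - 1) *\<^sub>R X 0"

lemma inner_history:
  "inner (history w X n) \<xi> = w 0 * inner (midval X n) \<xi>
    - (\<Sum>k=1..n-1. (w (k - 1) - w k) * inner (midval X (n - k)) \<xi>) - w (n - 1) * inner (X 0) \<xi>"
  by (simp add: history_def inner_diff_left inner_sum_left)

lemma midval_diff: "midval (\<lambda>j. X j - Y j) n = midval X n - midval Y n"
  by (simp add: midval_def algebra_simps)

lemma head_midval_diff: "head_midval (\<lambda>j. X j - Y j) n = head_midval X n - head_midval Y n"
  by (simp add: head_midval_def midval_diff)

lemma history_diff: "history w (\<lambda>j. X j - Y j) n = history w X n - history w Y n"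
  by (simp add: history_def midval_diff scaleR_diff_right sum_subtractf)

lemma avg_rule_eq:
  assumes "1 \<le> n"
  shows "avg_rule \<mu> \<tau> n X = (\<Sum>j=1..n. omega_weight \<mu> \<tau> n j *\<^sub>R head_midval X j)"
proof -
  have "(\<Sum>j=1..n. omega_weight \<mu> \<tau> n j *\<^sub>R head_midval X j)
    = omega_weight \<mu> \<tau> n 1 *\<^sub>R head_midval X 1 + (\<Sum>j=Suc 1..n. omega_weight \<mu> \<tau> n j *\<^sub>R head_midval X j)"
    by (rule sum.atLeast_Suc_atMost[OF assms])
  also have "(\<Sum>j=Suc 1..n. omega_weight \<mu> \<tau> n j *\<^sub>R head_midval X j) = (\<Sum>j=2..n. omega_weight \<mu> \<tau> n j *\<^sub>R midval X j)"
    by (intro sum.cong) (auto simp: head_midval_def)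
  finally show ?thesis by (simp add: avg_rule_def head_midval_def)
qed

lemma sum_if_less_last:
  fixes F :: "nat \<Rightarrow> 'b::comm_monoid_add"
  assumes "1 \<le> n"
  shows "(\<Sum>j=1..n. if j < n then F j else 0) = (\<Sum>j=1..n-1. F j)"
proof -
  have "(\<Sum>j=1..n-1. F j) = (\<Sum>j=1..n-1. if j < n then F j else 0)" using assms by (intro sum.cong) auto
  also have "\<dots> = (\<Sum>j=1..n. if j < n then F j else 0)" by (rule sum.mono_neutral_left) auto
  finally show ?thesis by simp
qed

text \<open>The product integration rule is exact for step functions: its sum is the increment over
  one step of the convolution with the integrated kernel.\<close>

lemma omega_weight_conv:
  fixes c :: "nat \<Rightarrow> 'b::{banach, second_countable_topology}"
  assumes \<mu>: "0 < \<mu>" and \<tau>: "0 < \<tau>" and n: "1 \<le> n"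
  shows "(\<Sum>j=1..n. (\<tau> * omega_weight \<mu> \<tau> n j) *\<^sub>R c j)
    = conv (beta_kernel (\<mu> + 1)) (pconst \<tau> c) (real n * \<tau>) - conv (beta_kernel (\<mu> + 1)) (pconst \<tau> c) (real (n - 1) * \<tau>)"
proof -
  let ?b = "\<lambda>k. beta_kernel (\<mu> + 2) (real k * \<tau>)"
  have i: "(LBINT s:{0..real k * \<tau>}. beta_kernel (\<mu> + 1) s) = ?b k" "set_integrable lborel {0..real k * \<tau>} (beta_kernel (\<mu> + 1))" for k
    using beta_kernel_integral[of "\<mu> + 1" "real k * \<tau>"] \<mu> \<tau> by (simp_all add: add.assoc)
  have "conv (beta_kernel (\<mu> + 1)) (pconst \<tau> c) (real (n - 1) * \<tau>) = (\<Sum>j=1..n-1. (?b (n - 1 - j + 1) - ?b (n - 1 - j)) *\<^sub>R c j)"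
    unfolding conv_pconst[OF \<tau> i(2)] i(1) ..
  also have "\<dots> = (\<Sum>j=1..n-1. (?b (n - j) - ?b (n - 1 - j)) *\<^sub>R c j)"
  proof (intro sum.cong refl)
    fix j assume "j \<in> {1..n-1}"
    then have "n - 1 - j + 1 = n - j" by auto
    then show "(?b (n - 1 - j + 1) - ?b (n - 1 - j)) *\<^sub>R c j = (?b (n - j) - ?b (n - 1 - j)) *\<^sub>R c j" by (simp only:)
  qed
  also have "\<dots> = (\<Sum>j=1..n. (if j < n then ?b (n - j) - ?b (n - 1 - j) else 0) *\<^sub>R c j)"
    unfolding sum_if_less_last[OF n, symmetric] by (intro sum.cong) auto
  finally have p: "conv (beta_kernel (\<mu> + 1)) (pconst \<tau> c) (real (n - 1) * \<tau>)
    = (\<Sum>j=1..n. (if j < n then ?b (n - j) - ?b (n - 1 - j) else 0) *\<^sub>R c j)" .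
  have "(\<Sum>j=1..n. (\<tau> * omega_weight \<mu> \<tau> n j) *\<^sub>R c j)
    = (\<Sum>j=1..n. ((?b (n - j + 1) - ?b (n - j)) - (if j < n then ?b (n - j) - ?b (n - 1 - j) else 0)) *\<^sub>R c j)"
    by (intro sum.cong refl) (simp only: atLeastAtMost_iff omega_weight_eq[OF \<mu> \<tau>])
  then show ?thesis
    unfolding p unfolding conv_pconst[OF \<tau> i(2)] i(1) scaleR_diff_left[of "_ - _" "if _ then _ else _"] sum_subtractf .
qed

lemma mean_value_within:
  fixes F f :: "real \<Rightarrow> real"
  assumes "\<And>x. x \<in> {0..T} \<Longrightarrow> (F has_real_derivative f x) (at x within {0..T})" "0 \<le> a" "a < b" "b \<le> T"
  obtains \<xi> where "a < \<xi>" "\<xi> < b" "F b - F a = f \<xi> * (b - a)"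
proof -
  have "\<exists>\<xi>\<in>{a<..<b}. F b - F a = f \<xi> * (b - a)"
  proof (rule mvt_simple[OF assms(3)])
    fix x assume "a \<le> x" "x \<le> b"
    then have "(F has_real_derivative f x) (at x within {a..b})"
      using assms(2,4) by (intro DERIV_subset[OF assms(1)]) auto
    then show "(F has_derivative (\<lambda>h. f x * h)) (at x within {a..b})"
      by (simp add: has_field_derivative_def)
  qed
  then show thesis using that by auto
qed

context diffusion_wave
begin

text \<open>By the mean value theorem \<open>w_weight \<alpha> \<tau> k\<close> is \<tau> times a
  value of \<open>g1\<close> in its cell. For neighbouring cells the two points are at most
  \<open>2 * \<tau>\<close> apart and \<open>g2\<close> bounds the slope of \<open>g1\<close>,
  whence the constant \<open>M1 + 2 * M2\<close>.\<close>

lemma weight_bounds: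
  obtains C where "0 \<le> C"
    and "\<And>\<tau> k. 0 < \<tau> \<Longrightarrow> real (k + 1) * \<tau> \<le> T \<Longrightarrow> \<bar>w_weight \<alpha> \<tau> k\<bar> \<le> C * \<tau>"
    and "\<And>\<tau> k. 0 < \<tau> \<Longrightarrow> 1 \<le> k \<Longrightarrow> real (k + 1) * \<tau> \<le> T \<Longrightarrow> \<bar>w_weight \<alpha> \<tau> (k - 1) - w_weight \<alpha> \<tau> k\<bar> \<le> C * \<tau>\<^sup>2"
proof -
  obtain M1 where M1: "\<And>x. x \<in> {0..T} \<Longrightarrow> norm (g1 x) \<le> M1" using continuous_on_Icc_bounded[OF continuous_g(2)] by blast
  obtain M2 where M2: "\<And>x. x \<in> {0..T} \<Longrightarrow> norm (g2 x) \<le> M2" using continuous_on_Icc_bounded[OF continuous_g(3)] by blast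
  have pos: "0 \<le> M1" "0 \<le> M2" using M1[of 0] M2[of 0] T_pos by (auto intro: order_trans[OF abs_ge_zero])
  have mv: "\<exists>\<xi>. real k * \<tau> < \<xi> \<and> \<xi> < real (k + 1) * \<tau> \<and> w_weight \<alpha> \<tau> k = g1 \<xi> * \<tau>"
    if \<tau>: "0 < \<tau>" "real (k + 1) * \<tau> \<le> T" for \<tau> k
  proof -
    have "0 \<le> real k * \<tau>" "real k * \<tau> < real (k + 1) * \<tau>" using \<tau> by (auto simp: algebra_simps)
    from mean_value_within[OF g_derivs(1) this \<tau>(2)] obtain \<xi>
      where \<xi>: "real k * \<tau> < \<xi>" "\<xi> < real (k + 1) * \<tau>"
        "g_kernel \<alpha> (real (k + 1) * \<tau>) - g_kernel \<alpha> (real k * \<tau>) = g1 \<xi> * (real (k + 1) * \<tau> - real k * \<tau>)" by blast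
    have "real (k + 1) * \<tau> - real k * \<tau> = \<tau>" by (simp add: algebra_simps)
    then show ?thesis using \<xi> unfolding w_weight_def by metis
  qed
  have lip: "\<bar>g1 x - g1 y\<bar> \<le> M2 * (y - x)" if "0 \<le> x" "x < y" "y \<le> T" for x y
  proof -
    from mean_value_within[OF g_derivs(2) that] obtain \<xi>
      where \<xi>: "x < \<xi>" "\<xi> < y" "g1 y - g1 x = g2 \<xi> * (y - x)" by blast
    have "\<bar>g1 x - g1 y\<bar> = \<bar>g2 \<xi>\<bar> * (y - x)" using \<xi>(3) that by (simp add: abs_minus_commute[of "g1 x"] abs_mult)
    also have "\<dots> \<le> M2 * (y - x)" using M2[of \<xi>] \<xi> that by (intro mult_right_mono) auto
    finally show ?thesis .
  qed
  show thesis
  proof (rule that[of "M1 + 2 * M2"])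
    show "0 \<le> M1 + 2 * M2" using pos by simp
    fix \<tau> :: real and k assume \<tau>: "0 < \<tau>" "real (k + 1) * \<tau> \<le> T"
    obtain \<xi> where \<xi>: "real k * \<tau> < \<xi>" "\<xi> < real (k + 1) * \<tau>" "w_weight \<alpha> \<tau> k = g1 \<xi> * \<tau>" using mv[OF \<tau>] by blast
    have "0 \<le> real k * \<tau>" using \<tau> by simp
    then have "\<xi> \<in> {0..T}" using \<xi>(1,2) \<tau>(2) by (simp only: atLeastAtMost_iff) linarith
    then have "\<bar>g1 \<xi>\<bar> * \<tau> \<le> (M1 + 2 * M2) * \<tau>" using M1[of \<xi>] pos \<tau> by (intro mult_right_mono) auto
    then show "\<bar>w_weight \<alpha> \<tau> k\<bar> \<le> (M1 + 2 * M2) * \<tau>" using \<xi>(3) \<tau> by (simp add: abs_mult)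
  next
    fix \<tau> :: real and k assume \<tau>: "0 < \<tau>" and k: "1 \<le> k" and kT: "real (k + 1) * \<tau> \<le> T"
    have k1: "k - 1 + 1 = k" using k by simp
    have le: "real k * \<tau> \<le> T" using kT \<tau> by (simp add: algebra_simps)
    obtain \<xi> where \<xi>: "real k * \<tau> < \<xi>" "\<xi> < real (k + 1) * \<tau>" "w_weight \<alpha> \<tau> k = g1 \<xi> * \<tau>" using mv[OF \<tau> kT] by blast
    obtain \<eta> where \<eta>: "real (k - 1) * \<tau> < \<eta>" "\<eta> < real k * \<tau>" "w_weight \<alpha> \<tau> (k - 1) = g1 \<eta> * \<tau>"
      using mv[of \<tau> "k - 1"] \<tau> le unfolding k1 by blast
    have "0 \<le> real (k - 1) * \<tau>" using \<tau> by simp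
    then have "\<bar>g1 \<eta> - g1 \<xi>\<bar> \<le> M2 * (\<xi> - \<eta>)" using \<xi> \<eta> kT by (intro lip) linarith+
    also have "real (k - 1) = real k - 1" using k by simp
    then have "\<xi> - \<eta> \<le> 2 * \<tau>" using \<xi>(2) \<eta>(1) by (simp add: algebra_simps)
    then have "M2 * (\<xi> - \<eta>) \<le> M2 * (2 * \<tau>)" using pos by (intro mult_left_mono)
    also have "\<dots> \<le> (M1 + 2 * M2) * \<tau>" using pos \<tau> by (simp add: algebra_simps)
    finally have "\<bar>g1 \<eta> - g1 \<xi>\<bar> * \<tau> \<le> (M1 + 2 * M2) * \<tau> * \<tau>" using \<tau> by (intro mult_right_mono) auto
    moreover have "w_weight \<alpha> \<tau> (k - 1) - w_weight \<alpha> \<tau> k = (g1 \<eta> - g1 \<xi>) * \<tau>" using \<xi>(3) \<eta>(3) by (simp add: algebra_simps)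
    ultimately show "\<bar>w_weight \<alpha> \<tau> (k - 1) - w_weight \<alpha> \<tau> k\<bar> \<le> (M1 + 2 * M2) * \<tau>\<^sup>2"
      using \<tau> by (simp add: abs_mult power2_eq_square mult.assoc)
  qed
qed

text \<open>At a grid point the convolution is a sum with weights \<open>w (n - j)\<close>.
  Subtracting its value one step earlier and reversing the order of summation produces the
  differences \<open>w (k - 1) - w k\<close> of the scheme.\<close>

lemma history_conv:
  fixes X :: "nat \<Rightarrow> 'b::{banach, second_countable_topology}"
  assumes \<tau>: "0 < \<tau>" and n: "1 \<le> n" "real n * \<tau> \<le> T"
  shows "history (w_weight \<alpha> \<tau>) X n = conv g1 (pconst \<tau> (midval X)) (real n * \<tau>) - conv g1 (pconst \<tau> (midval X)) (real (n - 1) * \<tau>)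
    - (g_kernel \<alpha> (real n * \<tau>) - g_kernel \<alpha> (real (n - 1) * \<tau>)) *\<^sub>R X 0"
proof -
  let ?w = "w_weight \<alpha> \<tau>"
  have c: "conv g1 (pconst \<tau> (midval X)) (real m * \<tau>) = (\<Sum>j=1..m. ?w (m - j) *\<^sub>R midval X j)" if "m \<le> n" for m
  proof -
    have le: "real k * \<tau> \<le> T" if "k \<le> m" for k
    proof -
      have "real k * \<tau> \<le> real n * \<tau>" using that \<open>m \<le> n\<close> \<tau> by (intro mult_right_mono) auto
      then show ?thesis using n by linarith
    qed
    have i: "set_integrable lborel {0..real m * \<tau>} g1"
      by (intro set_integrable_sub[OF le] set_integrable_continuous continuous_g) simp
    have p: "(LBINT s:{0..real k * \<tau>}. g1 s) = g_kernel \<alpha> (real k * \<tau>) - 1" if "k \<le> m" for k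
      using le[OF that] \<tau> by (intro g1_primitive) auto
    show ?thesis unfolding conv_pconst[OF \<tau> i]
    proof (intro sum.cong refl)
      fix j assume "j \<in> {1..m}"
      then have "m - j + 1 \<le> m" "m - j \<le> m" by auto
      then show "((LBINT s:{0..real (m - j + 1) * \<tau>}. g1 s) - (LBINT s:{0..real (m - j) * \<tau>}. g1 s)) *\<^sub>R midval X j = ?w (m - j) *\<^sub>R midval X j"
        by (simp only: p w_weight_def) simp
    qed
  qed
  have w1: "g_kernel \<alpha> (real n * \<tau>) - g_kernel \<alpha> (real (n - 1) * \<tau>) = ?w (n - 1)"
    using n by (simp add: w_weight_def)
  obtain m where m: "n = Suc m" using n by (cases n) auto
  have "(\<Sum>j=1..n. ?w (n - j) *\<^sub>R midval X j) = (\<Sum>j=1..m. ?w (n - j) *\<^sub>R midval X j) + ?w 0 *\<^sub>R midval X n"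
    by (simp add: m)
  moreover have "(\<Sum>k=1..m. (?w (k - 1) - ?w k) *\<^sub>R midval X (n - k)) = (\<Sum>j=1..m. (?w (m - j) - ?w (n - j)) *\<^sub>R midval X j)"
  proof -
    have "(\<Sum>k=1..m. (?w (k - 1) - ?w k) *\<^sub>R midval X (n - k))
      = (\<Sum>j=1..m. (?w (m + 1 - j - 1) - ?w (m + 1 - j)) *\<^sub>R midval X (n - (m + 1 - j)))"
      by (rule sum.atLeastAtMost_rev)
    also have "\<dots> = (\<Sum>j=1..m. (?w (m - j) - ?w (n - j)) *\<^sub>R midval X j)"
      by (intro sum.cong refl) (auto simp: m)
    finally show ?thesis .
  qed
  ultimately show ?thesis
    unfolding history_def w1 c[OF order_refl] c[of "n - 1", OF diff_le_self]
    by (simp add: m sum_subtractf algebra_simps)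
qed

lemma grad_inner_head_midval:
  assumes X: "\<And>j. j \<le> n \<Longrightarrow> X j \<in> H1 \<Omega>"
  shows "(\<Sum>b\<in>Basis. inner (head_midval (\<lambda>j. weak_deriv \<Omega> b (X j)) n) (weak_deriv \<Omega> b \<xi>)) = grad_inner \<Omega> (head_midval X n) \<xi>"
  unfolding grad_inner_def
proof (intro sum.cong refl)
  fix b :: 'a assume b: "b \<in> Basis"
  have "weak_deriv \<Omega> b (midval X n) = midval (\<lambda>j. weak_deriv \<Omega> b (X j)) n"
    using H1_linear_comb(2)[OF X[of n] X[of "n - 1"] b, of "1/2" "1/2"] by (simp add: midval_def scaleR_add_right)
  then show "inner (head_midval (\<lambda>j. weak_deriv \<Omega> b (X j)) n) (weak_deriv \<Omega> b \<xi>) = inner (weak_deriv \<Omega> b (head_midval X n)) (weak_deriv \<Omega> b \<xi>)"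
    by (simp add: head_midval_def)
qed

lemma head_midval_in_subspace: "subspace S \<Longrightarrow> (\<And>j. j \<le> n \<Longrightarrow> X j \<in> S) \<Longrightarrow> head_midval X n \<in> S"
  by (simp add: head_midval_def midval_def subspace_add subspace_scale)

lemma grad_inner_avg_rule:
  assumes X: "\<And>j. j \<le> n \<Longrightarrow> X j \<in> H1 \<Omega>" and n: "1 \<le> n"
  shows "\<tau> * (\<Sum>b\<in>Basis. inner (avg_rule \<mu> \<tau> n (\<lambda>j. weak_deriv \<Omega> b (X j))) (weak_deriv \<Omega> b \<xi>))
    = (\<Sum>j=1..n. \<tau> * omega_weight \<mu> \<tau> n j * grad_inner \<Omega> (head_midval X j) \<xi>)"
proof -
  have "(\<Sum>b\<in>Basis. inner (avg_rule \<mu> \<tau> n (\<lambda>j. weak_deriv \<Omega> b (X j))) (weak_deriv \<Omega> b \<xi>))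
    = (\<Sum>j=1..n. omega_weight \<mu> \<tau> n j * (\<Sum>b\<in>Basis. inner (head_midval (\<lambda>j. weak_deriv \<Omega> b (X j)) j) (weak_deriv \<Omega> b \<xi>)))"
    unfolding avg_rule_eq[OF n] by (simp add: inner_sum_left sum_distrib_left) (rule sum.swap)
  also have "\<dots> = (\<Sum>j=1..n. omega_weight \<mu> \<tau> n j * grad_inner \<Omega> (head_midval X j) \<xi>)"
    using X by (intro sum.cong refl) (simp add: grad_inner_head_midval)
  finally show ?thesis by (simp add: sum_distrib_left mult.assoc)
qed

lemma grad_inner_head_midval_left:
  assumes X: "\<And>j. j \<le> n \<Longrightarrow> X j \<in> H1 \<Omega>"
  shows "grad_inner \<Omega> (head_midval X n) \<xi>
    = (if n = 1 then grad_inner \<Omega> (X 1) \<xi> else (grad_inner \<Omega> (X n) \<xi> + grad_inner \<Omega> (X (n - 1)) \<xi>) / 2)"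
  using grad_inner_linear_comb_left[OF X[of n] X[of "n - 1"], of "1/2" "1/2" \<xi>]
  by (simp add: head_midval_def midval_def scaleR_add_right)

end

section \<open>The error equation and its residuals\<close>

context diffusion_wave
begin

definition nodal :: "real \<Rightarrow> nat \<Rightarrow> 'a L2" where "nodal \<tau> j = du 0 (real j * \<tau>)"

definition nodal_v :: "real \<Rightarrow> nat \<Rightarrow> 'a L2" where "nodal_v \<tau> j = v (real j * \<tau>)"

definition quad1 :: "real \<Rightarrow> nat \<Rightarrow> 'a L2"
  where "quad1 \<tau> n = conv g1 (\<lambda>s. du 0 s - pconst \<tau> (midval (nodal \<tau>)) s) (real n * \<tau>)
    - conv g1 (\<lambda>s. du 0 s - pconst \<tau> (midval (nodal \<tau>)) s) (real (n - 1) * \<tau>)"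

definition quad2 :: "real \<Rightarrow> nat \<Rightarrow> 'a L2"
  where "quad2 \<tau> n = conv (beta_kernel (\<mu> + 1)) (\<lambda>s. v s - pconst \<tau> (head_midval (nodal_v \<tau>)) s) (real n * \<tau>)
    - conv (beta_kernel (\<mu> + 1)) (\<lambda>s. v s - pconst \<tau> (head_midval (nodal_v \<tau>)) s) (real (n - 1) * \<tau>)"

text \<open>The difference of the integrated equation at two neighbouring grid points. Replacing
  functions by step functions leaves only \<open>quad1\<close> and \<open>quad2\<close>, since the
  right side is the exact integral of \<open>f_bar\<close> over the step.\<close>

lemma exact_scheme:
  assumes \<tau>: "0 < \<tau>" and n: "1 \<le> n" "real n * \<tau> \<le> T"
  shows "nodal \<tau> n - nodal \<tau> (n - 1) + history (w_weight \<alpha> \<tau>) (nodal \<tau>) n + quad1 \<tau> n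
    + \<kappa> *\<^sub>R ((\<Sum>j=1..n. (\<tau> * omega_weight \<mu> \<tau> n j) *\<^sub>R head_midval (nodal_v \<tau>) j) + quad2 \<tau> n)
    = (LBINT t:{real (n - 1) * \<tau>..real n * \<tau>}. f_bar \<alpha> f ub0 t)"
proof -
  have le: "real (n - 1) * \<tau> \<le> real n * \<tau>" using \<tau> by (intro mult_right_mono) auto
  have ge: "0 \<le> real (n - 1) * \<tau>" using \<tau> by simp
  have t: "real n * \<tau> \<in> {0..T}" "real (n - 1) * \<tau> \<in> {0..T}" using le ge n by auto
  have q1: "conv g1 (\<lambda>s. du 0 s - pconst \<tau> (midval (nodal \<tau>)) s) (real k * \<tau>)
      = conv g1 (du 0) (real k * \<tau>) - conv g1 (pconst \<tau> (midval (nodal \<tau>))) (real k * \<tau>)" if "real k * \<tau> \<in> {0..T}" for k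
    using that continuous_on_sub[OF _ continuous_g(2), of "real k * \<tau>"] continuous_on_sub[OF _ continuous_du(1), of "real k * \<tau>"]
    by (intro conv_diff_right(1) set_integrable_pconst[OF \<tau>] set_integrable_continuous) auto
  have q2: "conv (beta_kernel (\<mu> + 1)) (\<lambda>s. v s - pconst \<tau> (head_midval (nodal_v \<tau>)) s) (real k * \<tau>)
      = conv (beta_kernel (\<mu> + 1)) v (real k * \<tau>) - conv (beta_kernel (\<mu> + 1)) (pconst \<tau> (head_midval (nodal_v \<tau>))) (real k * \<tau>)"
    if "real k * \<tau> \<in> {0..T}" for k
    using that continuous_on_sub[OF _ continuous_v, of "real k * \<tau>"]
    by (intro conv_diff_right(1) set_integrable_pconst[OF \<tau>] set_integrable_continuous[where f = v] continuous_beta) auto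
  have "nodal \<tau> 0 = u0" using du_0(1) by (simp add: nodal_def)
  note h = history_conv[OF \<tau> n, of "nodal \<tau>", unfolded this]
  have "(LBINT t:{real (n - 1) * \<tau>..real n * \<tau>}. f_bar \<alpha> f ub0 t)
    = (LBINT t:{0..real n * \<tau>}. f_bar \<alpha> f ub0 t) - (LBINT t:{0..real (n - 1) * \<tau>}. f_bar \<alpha> f ub0 t)"
    unfolding set_integral_Icc_split[OF set_integrable_sub[OF n(2) f_bar_integrable] ge le] by simp
  also have "\<dots> = nodal \<tau> n - nodal \<tau> (n - 1) + history (w_weight \<alpha> \<tau>) (nodal \<tau>) n + quad1 \<tau> n
    + \<kappa> *\<^sub>R ((\<Sum>j=1..n. (\<tau> * omega_weight \<mu> \<tau> n j) *\<^sub>R head_midval (nodal_v \<tau>) j) + quad2 \<tau> n)"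
    unfolding exact_equation[OF t(1), symmetric] exact_equation[OF t(2), symmetric] omega_weight_conv[OF \<mu>(1) \<tau> n(1)]
      quad1_def quad2_def q1[OF t(1)] q1[OF t(2)] q2[OF t(1)] q2[OF t(2)] h nodal_def[of _ n] nodal_def[of _ "n - 1"]
    by (simp add: algebra_simps)
  finally show ?thesis by simp
qed

lemma discrete_scheme:
  assumes S: "S \<subseteq> H10 \<Omega>" and \<tau>: "0 < \<tau>" and U: "fully_discrete_solution \<Omega> S \<kappa> \<alpha> f u0h ub0 \<tau> N U" "u0h \<in> S"
    and n: "1 \<le> n" "n \<le> N" and \<xi>: "\<xi> \<in> S"
  shows "inner (U n - U (n - 1)) \<xi> + inner (history (w_weight \<alpha> \<tau>) U n) \<xi>
    + \<kappa> * (\<Sum>j=1..n. \<tau> * omega_weight \<mu> \<tau> n j * grad_inner \<Omega> (head_midval U j) \<xi>)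
    = inner (LBINT t:{real (n - 1) * \<tau>..real n * \<tau>}. f_bar \<alpha> f ub0 t) \<xi>"
proof -
  have "U j \<in> S" if "j \<le> n" for j
    using U that n by (cases "j = 0") (auto simp: fully_discrete_solution_def)
  then have H: "U j \<in> H1 \<Omega>" if "j \<le> n" for j using S H10_H1 that by blast
  have n': "n \<in> {1..N}" using n by simp
  let ?G = "\<Sum>b\<in>Basis. inner (avg_rule \<mu> \<tau> n (\<lambda>j. weak_deriv \<Omega> b (U j))) (weak_deriv \<Omega> b \<xi>)"
  have "inner (bdiff \<tau> U n) \<xi> + 1 / \<tau> * inner (history (w_weight \<alpha> \<tau>) U n) \<xi> + \<kappa> * ?G = inner (F_bar \<alpha> f ub0 \<tau> n) \<xi>"
    using U(1) n' \<xi> unfolding fully_discrete_solution_def inner_history \<mu>_def by blast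
  then have "\<tau> * (1 / \<tau> * inner (U n - U (n - 1)) \<xi> + 1 / \<tau> * inner (history (w_weight \<alpha> \<tau>) U n) \<xi> + \<kappa> * ?G)
    = \<tau> * (1 / \<tau> * inner (LBINT t:{real (n - 1) * \<tau>..real n * \<tau>}. f_bar \<alpha> f ub0 t) \<xi>)"
    unfolding bdiff_def F_bar_def inner_scaleR_left by (simp only:)
  then have "inner (U n - U (n - 1)) \<xi> + inner (history (w_weight \<alpha> \<tau>) U n) \<xi> + \<kappa> * (\<tau> * ?G)
    = inner (LBINT t:{real (n - 1) * \<tau>..real n * \<tau>}. f_bar \<alpha> f ub0 t) \<xi>"
    using \<tau> by (simp add: distrib_left mult.left_commute[of \<tau> \<kappa>])
  moreover have "\<tau> * ?G = (\<Sum>j=1..n. \<tau> * omega_weight \<mu> \<tau> n j * grad_inner \<Omega> (head_midval U j) \<xi>)"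
    by (rule grad_inner_avg_rule[OF H n(1)])
  ultimately show ?thesis by simp
qed

lemma nodal_domain:
  assumes "real j * \<tau> \<le> T" "0 < \<tau>"
  shows "nodal \<tau> j \<in> H2 \<Omega> \<inter> H10 \<Omega>"
  using H_check_bounds(4)[of "real j * \<tau>" "real j * \<tau>"] assms unfolding H_check_eq nodal_def by simp

text \<open>Green's formula followed by the defining property of the Ritz projection: against
  elements of \<open>S\<close>, the Laplacian of the solution acts like the gradient of its
  projection.\<close>

lemma inner_nodal_v:
  assumes R: "ritz_projection \<Omega> S R" and S: "S \<subseteq> H10 \<Omega>" and \<xi>: "\<xi> \<in> S" and j: "real j * \<tau> \<le> T" "0 < \<tau>"
  shows "inner (nodal_v \<tau> j) \<xi> = grad_inner \<Omega> (R (nodal \<tau> j)) \<xi>"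
proof -
  note d = nodal_domain[OF j]
  have "grad_inner \<Omega> (R (nodal \<tau> j)) \<xi> = grad_inner \<Omega> (nodal \<tau> j) \<xi>"
    using d by (intro grad_inner_ritz[OF R S _ \<xi>]) simp
  also have "\<dots> = - inner (laplacian \<Omega> (nodal \<tau> j)) \<xi>"
    using d S \<xi> by (intro grad_inner_laplacian) auto
  finally show ?thesis by (simp add: nodal_v_def v_def nodal_def)
qed

text \<open>By \<open>inner_nodal_v\<close> the projection error \<eta> leaves no trace in the
  diffusion term. It remains only in the time difference and the memory term, where no spatial
  derivatives act on it.\<close>

lemma error_equation:
  assumes R: "ritz_projection \<Omega> S R" and S: "subspace S" "S \<subseteq> H10 \<Omega>" and \<tau>: "0 < \<tau>" "real N * \<tau> = T"
    and U: "fully_discrete_solution \<Omega> S \<kappa> \<alpha> f (R u0) ub0 \<tau> N U"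
    and n: "1 \<le> n" "n \<le> N" and \<xi>: "\<xi> \<in> S"
  defines "\<theta> \<equiv> \<lambda>j. U j - R (nodal \<tau> j)" and "\<eta> \<equiv> \<lambda>j. nodal \<tau> j - R (nodal \<tau> j)"
  shows "inner (\<theta> n - \<theta> (n - 1)) \<xi> + inner (history (w_weight \<alpha> \<tau>) \<theta> n) \<xi>
    + \<kappa> * (\<Sum>j=1..n. \<tau> * omega_weight \<mu> \<tau> n j * grad_inner \<Omega> (head_midval \<theta> j) \<xi>)
    = inner (\<eta> n - \<eta> (n - 1) + history (w_weight \<alpha> \<tau>) \<eta> n + quad1 \<tau> n + \<kappa> *\<^sub>R quad2 \<tau> n) \<xi>"
proof -
  have jT: "real j * \<tau> \<le> T" if "j \<le> n" for j
  proof -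
    have "real j * \<tau> \<le> real N * \<tau>" using that n \<tau> by (intro mult_right_mono) auto
    then show ?thesis using \<tau> by simp
  qed
  have u0S: "R u0 \<in> S" using R u0 H_check_eq by (auto simp: ritz_projection_def)
  have SH: "S \<subseteq> H1 \<Omega>" using S H10_H1 by blast
  have US: "U j \<in> S" if "j \<le> n" for j
    using U u0S that n by (cases "j = 0") (auto simp: fully_discrete_solution_def)
  have RS: "R (nodal \<tau> j) \<in> S" if "j \<le> n" for j
    using R nodal_domain[OF jT[OF that] \<tau>(1)] by (auto simp: ritz_projection_def)
  let ?w = "\<lambda>j. \<tau> * omega_weight \<mu> \<tau> n j" and ?X = "\<lambda>j. R (nodal \<tau> j)"
  let ?G = "\<lambda>X. \<Sum>j=1..n. ?w j * grad_inner \<Omega> (head_midval X j) \<xi>"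
  have cv: "inner (head_midval (nodal_v \<tau>) j) \<xi> = grad_inner \<Omega> (head_midval ?X j) \<xi>" if "j \<le> n" "1 \<le> j" for j
  proof -
    have "grad_inner \<Omega> (head_midval ?X j) \<xi>
      = (if j = 1 then inner (nodal_v \<tau> 1) \<xi> else (inner (nodal_v \<tau> j) \<xi> + inner (nodal_v \<tau> (j - 1)) \<xi>) / 2)"
      using that by (subst grad_inner_head_midval_left) (use SH RS in \<open>auto simp: inner_nodal_v[OF R S(2) \<xi> jT \<tau>(1)]\<close>)
    then show ?thesis by (simp add: head_midval_def midval_def inner_add_left)
  qed
  have G\<theta>: "?G \<theta> = ?G U - ?G ?X"
  proof -
    have "grad_inner \<Omega> (head_midval \<theta> j) \<xi> = grad_inner \<Omega> (head_midval U j) \<xi> - grad_inner \<Omega> (head_midval ?X j) \<xi>" if "j \<in> {1..n}" for j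
    proof -
      have "head_midval U j \<in> S" "head_midval ?X j \<in> S"
        using that by (intro head_midval_in_subspace[OF S(1)] US RS; simp)+
      then have "head_midval U j \<in> H1 \<Omega>" "head_midval ?X j \<in> H1 \<Omega>" using SH by auto
      from grad_inner_linear_comb_left[OF this, of 1 "- 1" \<xi>]
      show ?thesis unfolding \<theta>_def head_midval_diff by simp
    qed
    then show ?thesis
      unfolding sum_subtractf[symmetric] right_diff_distrib[symmetric] by (intro sum.cong refl) simp
  qed
  have "inner (nodal \<tau> n - nodal \<tau> (n - 1)) \<xi> + inner (history (w_weight \<alpha> \<tau>) (nodal \<tau>) n) \<xi> + inner (quad1 \<tau> n) \<xi>
    + \<kappa> * ((\<Sum>j=1..n. ?w j * inner (head_midval (nodal_v \<tau>) j) \<xi>) + inner (quad2 \<tau> n) \<xi>)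
    = inner (LBINT t:{real (n - 1) * \<tau>..real n * \<tau>}. f_bar \<alpha> f ub0 t) \<xi>"
    unfolding exact_scheme[OF \<tau>(1) n(1) jT[OF order_refl], symmetric] by (simp add: inner_add_left inner_sum_left)
  also have "(\<Sum>j=1..n. ?w j * inner (head_midval (nodal_v \<tau>) j) \<xi>) = ?G ?X"
    by (intro sum.cong refl) (simp add: cv)
  finally have "inner (nodal \<tau> n - nodal \<tau> (n - 1)) \<xi> + inner (history (w_weight \<alpha> \<tau>) (nodal \<tau>) n) \<xi> + inner (quad1 \<tau> n) \<xi>
      + \<kappa> * (?G ?X + inner (quad2 \<tau> n) \<xi>)
    = inner (U n - U (n - 1)) \<xi> + inner (history (w_weight \<alpha> \<tau>) U n) \<xi> + \<kappa> * ?G U"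
    unfolding discrete_scheme[OF S(2) \<tau>(1) U u0S n \<xi>] .
  then show ?thesis
    unfolding G\<theta> unfolding \<theta>_def \<eta>_def history_diff by (simp add: inner_diff_left inner_add_left right_diff_distrib distrib_left)
qed

text \<open>\<open>D0\<close> is the Lipschitz constant in time of the solution in L2.
  \<open>K1\<close> and \<open>K2\<close> are the constants of \<open>quadrature_error\<close> for
  \<open>g1\<close> and \<open>beta_kernel (\<mu> + 1)\<close>, whose derivatives are
  \<open>g2\<close> and \<open>beta_kernel \<mu>\<close>.\<close>

definition D0 :: real where "D0 = norm ub0 + (\<Phi> T - \<Phi> 0)"

definition K1 :: real where "K1 = (LBINT s:{0..T}. \<bar>g2 s\<bar>) * (2 * D0 + 8 * (\<Phi> T - \<Phi> 0))"

definition K2 :: real where "K2 = (LBINT s:{0..T}. \<bar>beta_kernel \<mu> s\<bar>) * (2 * C1 + 8 * (\<Phi> T - \<Phi> 0))"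

lemma D0_nonneg: "0 \<le> D0" and K1_nonneg: "0 \<le> K1" and K2_nonneg: "0 \<le> K2"
proof -
  have d: "0 \<le> \<Phi> T - \<Phi> 0" using \<Phi>_diff(2)[of 0 T] T_pos by simp
  then show 1: "0 \<le> D0" by (simp add: D0_def)
  have i: "0 \<le> (LBINT s:{0..T}. \<bar>h s\<bar>)" for h :: "real \<Rightarrow> real"
    unfolding set_lebesgue_integral_def by (intro Bochner_Integration.integral_nonneg) simp
  show "0 \<le> K1" "0 \<le> K2" unfolding K1_def K2_def using i d 1 C1_nonneg by (auto intro!: mult_nonneg_nonneg)
qed

lemma quad_bounds:
  assumes \<tau>: "0 < \<tau>" "real N * \<tau> = T"
  shows "(\<Sum>n=1..N. norm (quad1 \<tau> n)) \<le> K1 * \<tau>\<^sup>2" and "(\<Sum>n=1..N. norm (quad2 \<tau> n)) \<le> K2 * \<tau>\<^sup>2"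
proof -
  have le: "real k * \<tau> \<le> T" if "k \<le> N" for k
  proof -
    have "real k * \<tau> \<le> real N * \<tau>" using that \<tau> by (intro mult_right_mono) auto
    then show ?thesis using \<tau> by simp
  qed
  interpret q: quadrature T \<tau> D0 N "du 0" "du 1" \<Phi> "midval (nodal \<tau>)"
  proof
    show "norm (du 0 t - du 0 s) \<le> D0 * (t - s)" "norm (du 0 t - du 0 s - (t - s) *\<^sub>R du 1 s) \<le> (t - s) * (\<Phi> t - \<Phi> s)"
      if "0 \<le> s" "s \<le> t" "t \<le> T" for s t
      unfolding D0_def by (rule operator_taylor[OF bounded_linear_ident norm_du2(1) that], assumption)+
  qed (use \<tau> \<Phi>_diff(2) D0_nonneg in \<open>auto simp: midval_def nodal_def of_nat_diff\<close>)
  interpret q': quadrature T \<tau> C1 N v v' \<Phi> "head_midval (nodal_v \<tau>)"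
  proof
    show "norm (v t - v s) \<le> C1 * (t - s)" "norm (v t - v s - (t - s) *\<^sub>R v' s) \<le> (t - s) * (\<Phi> t - \<Phi> s)"
      if "0 \<le> s" "s \<le> t" "t \<le> T" for s t
      using v_taylor[OF that] .
  qed (use \<tau> \<Phi>_diff(2) C1_nonneg in \<open>auto simp: head_midval_def midval_def nodal_v_def of_nat_diff\<close>)
  have 1: "conv (\<lambda>x. LBINT s:{0..x}. g2 s) h (real k * \<tau>) = conv g1 h (real k * \<tau>)" if "k \<le> N" for k and h :: "real \<Rightarrow> 'a L2"
    using le[OF that] by (intro conv_cong g2_primitive) auto
  have 2: "conv (\<lambda>x. LBINT s:{0..x}. beta_kernel \<mu> s) h (real k * \<tau>) = conv (beta_kernel (\<mu> + 1)) h (real k * \<tau>)" for k and h :: "real \<Rightarrow> 'a L2"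
    by (intro conv_cong) (simp_all add: beta_kernel_integral[OF \<mu>(1)])
  have "(\<Sum>n=1..N. norm (quad1 \<tau> n)) = (\<Sum>n=1..N. norm (conv (\<lambda>x. LBINT s:{0..x}. g2 s) q.err (real n * \<tau>)
      - conv (\<lambda>x. LBINT s:{0..x}. g2 s) q.err (real (n - 1) * \<tau>)))"
  proof (intro sum.cong refl)
    fix n assume "n \<in> {1..N}"
    then have "n \<le> N" "n - 1 \<le> N" by auto
    then show "norm (quad1 \<tau> n) = norm (conv (\<lambda>x. LBINT s:{0..x}. g2 s) q.err (real n * \<tau>)
      - conv (\<lambda>x. LBINT s:{0..x}. g2 s) q.err (real (n - 1) * \<tau>))"
      by (simp only: 1 quad1_def q.err_def[abs_def])
  qed
  also have "\<dots> \<le> (LBINT s:{0..T}. \<bar>g2 s\<bar>) * (2 * D0 * \<tau>\<^sup>2 + 8 * \<tau>\<^sup>2 * (\<Phi> T - \<Phi> 0))"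
    by (intro q.quadrature_error set_integrable_continuous continuous_g)
  finally show "(\<Sum>n=1..N. norm (quad1 \<tau> n)) \<le> K1 * \<tau>\<^sup>2" by (simp add: K1_def algebra_simps)
  have "(\<Sum>n=1..N. norm (quad2 \<tau> n)) \<le> (LBINT s:{0..T}. \<bar>beta_kernel \<mu> s\<bar>) * (2 * C1 * \<tau>\<^sup>2 + 8 * \<tau>\<^sup>2 * (\<Phi> T - \<Phi> 0))"
    using q'.quadrature_error[OF beta_integrable[OF order_refl \<mu>(1)]] unfolding 2 quad2_def q'.err_def[abs_def] .
  then show "(\<Sum>n=1..N. norm (quad2 \<tau> n)) \<le> K2 * \<tau>\<^sup>2" by (simp add: K2_def algebra_simps)
qed

end

text \<open>The two outer terms have weights of size \<tau>, and fewer than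
  \<open>T / \<tau>\<close> differences of size \<open>\<tau>\<^sup>2\<close> add up to the same
  order. The factor \<tau> is what makes the sum over all steps bounded.\<close>

lemma history_norm_le:
  fixes \<eta> :: "nat \<Rightarrow> 'b::real_normed_vector"
  assumes \<tau>: "0 < \<tau>" and n: "1 \<le> n" "real n * \<tau> \<le> T" and C: "0 \<le> C"
    and w: "\<And>k. k < n \<Longrightarrow> \<bar>w k\<bar> \<le> C * \<tau>" "\<And>k. 1 \<le> k \<Longrightarrow> k < n \<Longrightarrow> \<bar>w (k - 1) - w k\<bar> \<le> C * \<tau>\<^sup>2"
    and \<eta>: "\<And>j. j \<le> n \<Longrightarrow> norm (\<eta> j) \<le> M"
  shows "norm (history w \<eta> n) \<le> C * \<tau> * (2 + T) * M"
proof -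
  have M: "0 \<le> M" using \<eta>[of 0] norm_ge_zero[of "\<eta> 0"] by linarith
  have mid: "norm (midval \<eta> j) \<le> M" if "j \<le> n" for j
  proof -
    have "norm (midval \<eta> j) \<le> (norm (\<eta> j) + norm (\<eta> (j - 1))) / 2"
      unfolding midval_def norm_scaleR using norm_triangle_ineq[of "\<eta> j" "\<eta> (j - 1)"] by simp
    moreover have "norm (\<eta> j) + norm (\<eta> (j - 1)) \<le> M + M"
      using that by (intro add_mono \<eta>) auto
    ultimately show ?thesis by simp
  qed
  have 1: "norm (w 0 *\<^sub>R midval \<eta> n) \<le> C * \<tau> * M"
    unfolding norm_scaleR using w(1)[of 0] mid[of n] n C \<tau> by (intro mult_mono) auto
  have 3: "norm (w (n - 1) *\<^sub>R \<eta> 0) \<le> C * \<tau> * M"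
    unfolding norm_scaleR using w(1)[of "n - 1"] \<eta>[of 0] n C \<tau> by (intro mult_mono) auto
  have "norm (\<Sum>k=1..n-1. (w (k - 1) - w k) *\<^sub>R midval \<eta> (n - k)) \<le> (\<Sum>k=1..n-1. C * \<tau>\<^sup>2 * M)"
  proof (rule sum_norm_le)
    fix k assume k: "k \<in> {1..n-1}"
    then have "1 \<le> k" "k < n" by auto
    then have "\<bar>w (k - 1) - w k\<bar> \<le> C * \<tau>\<^sup>2" "norm (midval \<eta> (n - k)) \<le> M" using w(2) mid by auto
    then show "norm ((w (k - 1) - w k) *\<^sub>R midval \<eta> (n - k)) \<le> C * \<tau>\<^sup>2 * M"
      unfolding norm_scaleR using C by (intro mult_mono) auto
  qed
  also have "\<dots> = real (n - 1) * (C * \<tau>\<^sup>2 * M)" by simp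
  also have "\<dots> = C * \<tau> * M * (real (n - 1) * \<tau>)" by (simp add: power2_eq_square)
  also have "\<dots> \<le> C * \<tau> * M * T"
  proof (rule mult_left_mono)
    have "real (n - 1) * \<tau> \<le> real n * \<tau>" using \<tau> by (intro mult_right_mono) auto
    then show "real (n - 1) * \<tau> \<le> T" using n by linarith
  qed (use C \<tau> M in simp)
  finally have 2: "norm (\<Sum>k=1..n-1. (w (k - 1) - w k) *\<^sub>R midval \<eta> (n - k)) \<le> C * \<tau> * M * T" .
  have "norm (history w \<eta> n) \<le> C * \<tau> * M + C * \<tau> * M * T + C * \<tau> * M"
    unfolding history_def
    by (rule order_trans[OF norm_triangle_ineq4 add_mono[OF order_trans[OF norm_triangle_ineq4 add_mono[OF 1 2]] 3]])
  then show ?thesis by (simp add: algebra_simps)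
qed

section \<open>From the residuals to the error estimate\<close>

context diffusion_wave
begin

text \<open>The form \<open>omega_weight_psd\<close> is applied to each partial derivative
  separately and summed over the coordinate directions.\<close>

lemma energy_nonneg:
  assumes \<tau>: "0 < \<tau>"
  shows "0 \<le> (\<Sum>n=1..m. \<kappa> * (\<Sum>j=1..n. \<tau> * omega_weight \<mu> \<tau> n j * grad_inner \<Omega> (V j) (V n)))"
proof -
  have "(\<Sum>n=1..m. \<kappa> * (\<Sum>j=1..n. \<tau> * omega_weight \<mu> \<tau> n j * grad_inner \<Omega> (V j) (V n)))
    = \<kappa> * (\<Sum>b\<in>Basis. \<Sum>n=1..m. \<Sum>j=1..n. \<tau> * omega_weight \<mu> \<tau> n j * inner (weak_deriv \<Omega> b (V j)) (weak_deriv \<Omega> b (V n)))"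
    unfolding grad_inner_def sum_distrib_left
    by (subst sum.swap, intro sum.cong refl, subst sum.swap, rule refl)
  also have "0 \<le> \<dots>"
    using \<kappa>_pos by (intro mult_nonneg_nonneg sum_nonneg omega_weight_psd \<mu> \<tau>) simp
  finally show ?thesis .
qed

text \<open>Space enters only through the number \<open>E\<close>, later a multiple of the squared
  mesh size, and time only through \<open>N * \<tau> = T\<close>; hence one constant serves all
  meshes and step sizes.\<close>

lemma error_bound:
  obtains A where "0 \<le> A"
    and "\<And>S R E N \<tau> U m. subspace S \<Longrightarrow> S \<subseteq> H10 \<Omega> \<Longrightarrow> ritz_projection \<Omega> S R \<Longrightarrow> 0 \<le> E \<Longrightarrow>
      (\<And>q. q \<in> H2 \<Omega> \<inter> H10 \<Omega> \<Longrightarrow> norm (q - R q) \<le> E * norm_H_check lam \<phi> 2 q) \<Longrightarrow>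
      0 < \<tau> \<Longrightarrow> real N * \<tau> = T \<Longrightarrow> fully_discrete_solution \<Omega> S \<kappa> \<alpha> f (R u0) ub0 \<tau> N U \<Longrightarrow> m \<le> N \<Longrightarrow>
      norm (nodal \<tau> m - U m) \<le> A * (E + \<tau>\<^sup>2)"
proof -
  obtain C where C: "0 \<le> C"
    and w1: "\<And>\<tau> k. 0 < \<tau> \<Longrightarrow> real (k + 1) * \<tau> \<le> T \<Longrightarrow> \<bar>w_weight \<alpha> \<tau> k\<bar> \<le> C * \<tau>"
    and w2: "\<And>\<tau> k. 0 < \<tau> \<Longrightarrow> 1 \<le> k \<Longrightarrow> real (k + 1) * \<tau> \<le> T \<Longrightarrow> \<bar>w_weight \<alpha> \<tau> (k - 1) - w_weight \<alpha> \<tau> k\<bar> \<le> C * \<tau>\<^sup>2"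
    using weight_bounds by blast
  define B where "B = 8 * exp ((100 * C + 1) * T)"
  \<comment> \<open>\<open>C0\<close> stems from the projection error at the final time. Inside the
    bracket, \<open>C1 * T\<close> collects its increments over the steps and the other term its
    memory contributions; \<open>B\<close> is the stability constant.\<close>
  define A1 where "A1 = C0 + B * (C1 * T + C * T * (2 + T) * C0)"
  define A2 where "A2 = B * (K1 + \<kappa> * K2)"
  have B: "0 \<le> B" by (simp add: B_def)
  have A: "0 \<le> A1" "0 \<le> A2"
    unfolding A1_def A2_def using B C C0_nonneg C1_nonneg K1_nonneg K2_nonneg \<kappa>_pos T_pos
    by (intro add_nonneg_nonneg mult_nonneg_nonneg; simp)+
  show thesis
  proof (rule that[of "A1 + A2"])
    show "0 \<le> A1 + A2" using A by simp
    fix S R E N \<tau> U m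
    assume S: "subspace S" "S \<subseteq> H10 \<Omega>" and R: "ritz_projection \<Omega> S R" and E: "0 \<le> E"
      and approx: "\<And>q. q \<in> H2 \<Omega> \<inter> H10 \<Omega> \<Longrightarrow> norm (q - R q) \<le> E * norm_H_check lam \<phi> 2 q"
      and \<tau>: "0 < \<tau>" "real N * \<tau> = T" and U: "fully_discrete_solution \<Omega> S \<kappa> \<alpha> f (R u0) ub0 \<tau> N U" and m: "m \<le> N"
    let ?w = "w_weight \<alpha> \<tau>"
    have jT: "real j * \<tau> \<le> T" if "j \<le> N" for j
    proof -
      have "real j * \<tau> \<le> real N * \<tau>" using that \<tau> by (intro mult_right_mono) auto
      then show ?thesis using \<tau> by simp
    qed
    note dom = nodal_domain[OF jT \<tau>(1)]
    define \<theta> where "\<theta> = (\<lambda>j. U j - R (nodal \<tau> j))"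
    define \<eta> where "\<eta> = (\<lambda>j. nodal \<tau> j - R (nodal \<tau> j))"
    define res where "res n = \<eta> n - \<eta> (n - 1) + history ?w \<eta> n + quad1 \<tau> n + \<kappa> *\<^sub>R quad2 \<tau> n" for n
    have \<eta>: "norm (\<eta> j) \<le> E * C0" if "j \<le> N" for j
    proof -
      have "norm_H_check lam \<phi> 2 (nodal \<tau> j) \<le> C0"
        using H_check_bounds(4)[of "real j * \<tau>" "real j * \<tau>"] jT[OF that] \<tau> by (simp add: nodal_def)
      then show ?thesis using order_trans[OF approx[OF dom[OF that]] mult_left_mono[OF _ E]] by (simp add: \<eta>_def)
    qed
    have d\<eta>: "norm (\<eta> n - \<eta> (n - 1)) \<le> E * (C1 * \<tau>)" if n: "1 \<le> n" "n \<le> N" for n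
    proof -
      have n1: "n - 1 \<le> N" using n by simp
      have le: "real (n - 1) * \<tau> \<le> real n * \<tau>" using \<tau> by (intro mult_right_mono) auto
      have d: "real n * \<tau> - real (n - 1) * \<tau> = \<tau>" using n by (simp add: of_nat_diff algebra_simps)
      have "0 \<le> real (n - 1) * \<tau>" using \<tau> by simp
      from H_check_bounds(2)[OF this le jT[OF n(2)], unfolded d]
      have q: "nodal \<tau> n - nodal \<tau> (n - 1) \<in> H2 \<Omega> \<inter> H10 \<Omega>" "norm_H_check lam \<phi> 2 (nodal \<tau> n - nodal \<tau> (n - 1)) \<le> C1 * \<tau>"
        unfolding H_check_eq nodal_def by blast+
      have "R (nodal \<tau> n - nodal \<tau> (n - 1)) = R (nodal \<tau> n) - R (nodal \<tau> (n - 1))"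
        using dom[OF n(2)] dom[OF n1] by (intro ritz_projection_diff[OF R S]) auto
      then have "\<eta> n - \<eta> (n - 1) = nodal \<tau> n - nodal \<tau> (n - 1) - R (nodal \<tau> n - nodal \<tau> (n - 1))"
        by (simp add: \<eta>_def)
      then show ?thesis using order_trans[OF approx[OF q(1)] mult_left_mono[OF q(2) E]] by simp
    qed
    have kT: "real (k + 1) * \<tau> \<le> T" if "k < N" for k using jT[of "k + 1"] that by simp
    have h\<eta>: "norm (history ?w \<eta> n) \<le> C * \<tau> * (2 + T) * (E * C0)" if n: "1 \<le> n" "n \<le> N" for n
      using n by (intro history_norm_le \<tau> jT C w1 w2 kT \<eta>) auto
    have \<theta>0: "\<theta> 0 = 0"
    proof -
      have "nodal \<tau> 0 = u0" using du_0(1) by (simp add: nodal_def)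
      then show ?thesis using U by (simp add: \<theta>_def fully_discrete_solution_def)
    qed
    have RS: "R (nodal \<tau> j) \<in> S" if "j \<le> N" for j using R dom[OF that] by (auto simp: ritz_projection_def)
    have US: "U j \<in> S" if "j \<le> N" for j
      using U that RS[of 0] \<theta>0 by (cases "j = 0") (auto simp: fully_discrete_solution_def \<theta>_def)
    have \<theta>S: "\<theta> j \<in> S" if "j \<le> N" for j
      unfolding \<theta>_def using that by (intro subspace_diff[OF S(1)] US RS)
    have N: "0 < N" using \<tau> T_pos by (cases "N = 0") auto
    have st: "norm (\<theta> m) \<le> 8 * exp ((100 * C + 1) * T) * (\<Sum>n=1..N. norm (res n))"
    proof (rule scheme_stability[where C = C and \<tau> = \<tau> and N = N and \<theta> = \<theta> and V = "head_midval \<theta>" and w = ?w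
        and a = "\<lambda>n. \<kappa> * (\<Sum>j=1..n. \<tau> * omega_weight \<mu> \<tau> n j * grad_inner \<Omega> (head_midval \<theta> j) (head_midval \<theta> n))"])
      show "real N * \<tau> \<le> T" using \<tau> by simp
      show "head_midval \<theta> n = (if n = 1 then \<theta> 1 else midval \<theta> n)" for n by (rule head_midval_def)
      show "- 1 \<le> ?w 0" using g_nonneg[of \<tau>] g_0 kT[OF N] \<tau> by (auto simp: w_weight_def)
      show "\<bar>?w 0\<bar> \<le> C * \<tau>" by (rule w1[OF \<tau>(1) kT[OF N]])
      show "\<bar>?w (k - 1) - ?w k\<bar> \<le> C * \<tau>\<^sup>2" if "1 \<le> k" "k < N" for k by (rule w2[OF \<tau>(1) that(1) kT[OF that(2)]])
      show "0 \<le> (\<Sum>n=1..m. \<kappa> * (\<Sum>j=1..n. \<tau> * omega_weight \<mu> \<tau> n j * grad_inner \<Omega> (head_midval \<theta> j) (head_midval \<theta> n)))" for m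
        by (rule energy_nonneg[OF \<tau>(1)])
      show "inner (\<theta> n - \<theta> (n - 1)) (head_midval \<theta> n)
        + (?w 0 * inner (midval \<theta> n) (head_midval \<theta> n) - (\<Sum>k=1..n-1. (?w (k - 1) - ?w k) * inner (midval \<theta> (n - k)) (head_midval \<theta> n)))
        + \<kappa> * (\<Sum>j=1..n. \<tau> * omega_weight \<mu> \<tau> n j * grad_inner \<Omega> (head_midval \<theta> j) (head_midval \<theta> n))
        \<le> norm (res n) * norm (head_midval \<theta> n)" if n: "1 \<le> n" "n \<le> N" for n
      proof -
        have V: "head_midval \<theta> n \<in> S" using n by (intro head_midval_in_subspace[OF S(1)] \<theta>S) simp
        have "inner (\<theta> n - \<theta> (n - 1)) \<xi> + inner (history ?w \<theta> n) \<xi>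
          + \<kappa> * (\<Sum>j=1..n. \<tau> * omega_weight \<mu> \<tau> n j * grad_inner \<Omega> (head_midval \<theta> j) \<xi>) = inner (res n) \<xi>" if "\<xi> \<in> S" for \<xi>
          unfolding res_def \<theta>_def \<eta>_def by (rule error_equation[OF R S \<tau> U n that])
        from this[OF V] show ?thesis
          using norm_cauchy_schwarz[of "res n" "head_midval \<theta> n"] unfolding inner_history \<theta>0 inner_zero_left by linarith
      qed
    qed (use C \<tau> \<theta>0 m in auto)
    have "(\<Sum>n=1..N. norm (res n)) \<le> (\<Sum>n=1..N. E * (C1 * \<tau>) + C * \<tau> * (2 + T) * (E * C0) + norm (quad1 \<tau> n) + \<kappa> * norm (quad2 \<tau> n))"
    proof (rule sum_mono)
      fix n assume "n \<in> {1..N}"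
      then have n: "1 \<le> n" "n \<le> N" by auto
      have "norm (\<kappa> *\<^sub>R quad2 \<tau> n) \<le> \<kappa> * norm (quad2 \<tau> n)" using \<kappa>_pos by simp
      then show "norm (res n) \<le> E * (C1 * \<tau>) + C * \<tau> * (2 + T) * (E * C0) + norm (quad1 \<tau> n) + \<kappa> * norm (quad2 \<tau> n)"
        unfolding res_def by (intro norm_triangle_mono d\<eta>[OF n] h\<eta>[OF n] order_refl)
    qed
    also have "\<dots> = real N * (E * (C1 * \<tau>) + C * \<tau> * (2 + T) * (E * C0))
        + (\<Sum>n=1..N. norm (quad1 \<tau> n)) + \<kappa> * (\<Sum>n=1..N. norm (quad2 \<tau> n))"
      by (simp add: sum.distrib sum_distrib_left)
    also have "\<dots> \<le> real N * (E * (C1 * \<tau>) + C * \<tau> * (2 + T) * (E * C0)) + K1 * \<tau>\<^sup>2 + \<kappa> * (K2 * \<tau>\<^sup>2)"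
      using quad_bounds[OF \<tau>] \<kappa>_pos by (intro add_mono order_refl mult_left_mono) auto
    also have "real N * (E * (C1 * \<tau>) + C * \<tau> * (2 + T) * (E * C0)) = (real N * \<tau>) * (E * C1 + C * (2 + T) * (E * C0))"
      by (simp add: algebra_simps)
    finally have res: "(\<Sum>n=1..N. norm (res n)) \<le> T * (E * C1 + C * (2 + T) * (E * C0)) + K1 * \<tau>\<^sup>2 + \<kappa> * (K2 * \<tau>\<^sup>2)"
      unfolding \<tau>(2) .
    have "nodal \<tau> m - U m = \<eta> m - \<theta> m" by (simp add: \<eta>_def \<theta>_def)
    then have "norm (nodal \<tau> m - U m) \<le> norm (\<eta> m) + norm (\<theta> m)" by (simp add: norm_triangle_ineq4)
    also have "\<dots> \<le> E * C0 + B * (T * (E * C1 + C * (2 + T) * (E * C0)) + K1 * \<tau>\<^sup>2 + \<kappa> * (K2 * \<tau>\<^sup>2))"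
      using \<eta>[OF m] order_trans[OF st[folded B_def] mult_left_mono[OF res B]] by (rule add_mono)
    also have "\<dots> = A1 * E + A2 * \<tau>\<^sup>2" by (simp add: A1_def A2_def algebra_simps)
    also have "\<dots> \<le> (A1 + A2) * E + (A1 + A2) * \<tau>\<^sup>2"
      using A E by (intro add_mono mult_right_mono) auto
    finally show "norm (nodal \<tau> m - U m) \<le> (A1 + A2) * (E + \<tau>\<^sup>2)" by (simp only: distrib_left)
  qed
qed

end

theorem theorem8:
  fixes \<Omega> :: "'a::euclidean_space set"
    and T \<kappa> L p Q0 \<sigma> C_reg C_ritz :: real
    and \<alpha> \<alpha>1 \<alpha>2 \<alpha>3 :: "real \<Rightarrow> real"
    and lam :: "nat \<Rightarrow> real" and \<phi> :: "nat \<Rightarrow> 'a L2"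
    and u0 ub0 :: "'a L2" and f :: "real \<Rightarrow> 'a L2" and du :: "nat \<Rightarrow> real \<Rightarrow> 'a L2"
    and \<M> :: "'a set set set" and \<Lambda> :: "'a set set \<Rightarrow> 'a L2 \<Rightarrow> 'a L2"
  assumes "0 < T" and "0 < \<kappa>" and "DIM('a) \<le> 3" and "admissible_domain \<Omega>"
    and "dirichlet_eigensystem \<Omega> lam \<phi>"
    and "H_check \<Omega> lam \<phi> 2 = H2 \<Omega> \<inter> H10 \<Omega>"
    and "\<And>v. v \<in> H2 \<Omega> \<inter> H10 \<Omega> \<Longrightarrow> norm_H2 \<Omega> v \<le> C_reg * norm_H_check lam \<phi> 2 v"
    \<comment> \<open>the variable exponent\<close>
    and "\<And>t. t \<in> {0..T} \<Longrightarrow> 1 < \<alpha> t \<and> \<alpha> t < 2"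
    and "\<And>t. t \<in> {0..T} \<Longrightarrow> (\<alpha> has_real_derivative \<alpha>1 t) (at t within {0..T})"
    and "\<And>t. t \<in> {0..T} \<Longrightarrow> (\<alpha>1 has_real_derivative \<alpha>2 t) (at t within {0..T})"
    and "\<And>t. t \<in> {0..T} \<Longrightarrow> (\<alpha>2 has_real_derivative \<alpha>3 t) (at t within {0..T})"
    and "0 < L" and "\<And>t. t \<in> {0..T} \<Longrightarrow> \<bar>\<alpha>1 t\<bar> + \<bar>\<alpha>2 t\<bar> + \<bar>\<alpha>3 t\<bar> \<le> L"
    and "\<alpha>1 0 = 0" and "\<alpha>2 0 = 0"
    \<comment> \<open>the data, and the solution with its time derivatives\<close>
    and "u0 \<in> H_check \<Omega> lam \<phi> 2" and "ub0 \<in> H_check \<Omega> lam \<phi> 2" and "W11_time (L2_on \<Omega>) T f"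
    and "1 < p" and "p < 1 / (2 - \<alpha> 0)"
    and "diffusion_wave_solution \<Omega> lam \<phi> T \<kappa> \<alpha> p f u0 ub0 du"
    and "has_weak_time_deriv T (du 2) (du 3)"
    and "\<And>n m t. n \<in> {1, 2} \<Longrightarrow> m \<in> {0, 1} \<Longrightarrow> t \<in> {0<..T} \<Longrightarrow>
      du (n + 1) t \<in> H_check \<Omega> lam \<phi> (2 * real m) \<and>
      norm_H_check lam \<phi> (2 * real m) (du (n + 1) t) \<le> Q0 * t powr (\<alpha> 0 - (real n + 1))"
    \<comment> \<open>the family of meshes and their Ritz projections\<close>
    and "0 < \<sigma>"
    and "\<And>\<T>. \<T> \<in> \<M> \<Longrightarrow> partition_of \<Omega> \<T> \<and> quasi_uniform \<sigma> \<T>"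
    and "\<And>\<T>. \<T> \<in> \<M> \<Longrightarrow> ritz_projection \<Omega> (fe_space \<Omega> \<T>) (\<Lambda> \<T>)"
    and "\<And>\<T> v. \<T> \<in> \<M> \<Longrightarrow> v \<in> H2 \<Omega> \<inter> H10 \<Omega> \<Longrightarrow>
      norm (v - \<Lambda> \<T> v) \<le> C_ritz * (mesh_size \<T>)\<^sup>2 * norm_H2 \<Omega> v"
  shows "\<exists>Q>0. \<forall>\<T>\<in>\<M>. \<forall>N>0. \<forall>U.
    fully_discrete_solution \<Omega> (fe_space \<Omega> \<T>) \<kappa> \<alpha> f (\<Lambda> \<T> u0) ub0 (T / real N) N U \<longrightarrow>
    (\<forall>m\<in>{1..N}. norm (du 0 (real m * (T / real N)) - U m) \<le> Q * ((mesh_size \<T>)\<^sup>2 + (T / real N)\<^sup>2))"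
proof -
  interpret diffusion_wave \<Omega> lam \<phi> T L \<alpha> \<alpha>1 \<alpha>2 \<alpha>3 \<kappa> p Q0 u0 ub0 f du
  proof
    fix m :: nat and t assume "m \<in> {0, 1}" "t \<in> {0<..T}"
    with assms(23)[of 1 m t]
    show "du 2 t \<in> H_check \<Omega> lam \<phi> (2 * real m) \<and> norm_H_check lam \<phi> (2 * real m) (du 2 t) \<le> Q0 * t powr (\<alpha> 0 - 2)"
      by (simp add: numeral_2_eq_2)
  qed (use assms in \<open>auto simp: admissible_domain_def\<close>)
  obtain A where A: "0 \<le> A"
    and bound: "\<And>S R E N \<tau> U m. subspace S \<Longrightarrow> S \<subseteq> H10 \<Omega> \<Longrightarrow> ritz_projection \<Omega> S R \<Longrightarrow> 0 \<le> E \<Longrightarrow>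
      (\<And>q. q \<in> H2 \<Omega> \<inter> H10 \<Omega> \<Longrightarrow> norm (q - R q) \<le> E * norm_H_check lam \<phi> 2 q) \<Longrightarrow>
      0 < \<tau> \<Longrightarrow> real N * \<tau> = T \<Longrightarrow> fully_discrete_solution \<Omega> S \<kappa> \<alpha> f (R u0) ub0 \<tau> N U \<Longrightarrow> m \<le> N \<Longrightarrow>
      norm (nodal \<tau> m - U m) \<le> A * (E + \<tau>\<^sup>2)"
    using error_bound by blast
  \<comment> \<open>Combines the approximation constant with that of elliptic regularity, which
    converts the H2 norm into the norm of order two. Absolute values are taken since neither
    constant is assumed to have a sign.\<close>
  define K where "K = \<bar>C_ritz\<bar> * \<bar>C_reg\<bar>"
  have K: "0 \<le> K" by (simp add: K_def)
  show ?thesis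
  \<comment> \<open>The outer \<open>+ 1\<close> keeps the constant positive even if
    \<open>A = 0\<close>; the inner one covers the coefficient of the squared time step.\<close>
  proof (intro exI[of _ "A * (K + 1) + 1"] conjI ballI allI impI)
    show "0 < A * (K + 1) + 1" using A K by (simp add: add_nonneg_pos)
    fix \<T> N U m
    assume \<T>: "\<T> \<in> \<M>" and N: "(0::nat) < N"
      and U: "fully_discrete_solution \<Omega> (fe_space \<Omega> \<T>) \<kappa> \<alpha> f (\<Lambda> \<T> u0) ub0 (T / real N) N U" and m: "m \<in> {1..N}"
    let ?\<tau> = "T / real N" and ?h = "mesh_size \<T>"
    have "norm (nodal ?\<tau> m - U m) \<le> A * (K * ?h\<^sup>2 + ?\<tau>\<^sup>2)"
    proof (rule bound[where S = "fe_space \<Omega> \<T>" and R = "\<Lambda> \<T>"])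
      show "subspace (fe_space \<Omega> \<T>)" using assms(25)[OF \<T>] by (intro subspace_fe_space) simp
      show "fe_space \<Omega> \<T> \<subseteq> H10 \<Omega>" by (auto simp: fe_space_def)
      show "ritz_projection \<Omega> (fe_space \<Omega> \<T>) (\<Lambda> \<T>)" by (rule assms(26)[OF \<T>])
      fix q assume q: "q \<in> H2 \<Omega> \<inter> H10 \<Omega>"
      have H: "0 \<le> norm_H2 \<Omega> q" by (simp add: norm_H2_def sum_nonneg)
      have nn: "0 \<le> norm_H_check lam \<phi> 2 q" using q norm_H_check_nonneg[of q 2] by (simp add: H_check_eq)
      have "norm (q - \<Lambda> \<T> q) \<le> C_ritz * ?h\<^sup>2 * norm_H2 \<Omega> q" by (rule assms(27)[OF \<T> q])
      also have "\<dots> \<le> \<bar>C_ritz\<bar> * ?h\<^sup>2 * norm_H2 \<Omega> q" using H by (intro mult_right_mono) auto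
      also have "\<dots> \<le> \<bar>C_ritz\<bar> * ?h\<^sup>2 * (\<bar>C_reg\<bar> * norm_H_check lam \<phi> 2 q)"
      proof (rule mult_left_mono)
        have "C_reg * norm_H_check lam \<phi> 2 q \<le> \<bar>C_reg\<bar> * norm_H_check lam \<phi> 2 q" using nn by (intro mult_right_mono) auto
        then show "norm_H2 \<Omega> q \<le> \<bar>C_reg\<bar> * norm_H_check lam \<phi> 2 q" using assms(7)[OF q] by linarith
      qed simp
      finally show "norm (q - \<Lambda> \<T> q) \<le> K * ?h\<^sup>2 * norm_H_check lam \<phi> 2 q" by (simp add: K_def mult_ac)
    qed (use K U m N T_pos in auto)
    also have "\<dots> \<le> A * ((K + 1) * (?h\<^sup>2 + ?\<tau>\<^sup>2))"
    proof (intro mult_left_mono A)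
      have "0 \<le> ?h\<^sup>2" "0 \<le> K * ?\<tau>\<^sup>2" using K by simp_all
      then show "K * ?h\<^sup>2 + ?\<tau>\<^sup>2 \<le> (K + 1) * (?h\<^sup>2 + ?\<tau>\<^sup>2)" by (simp only: distrib_left distrib_right mult_1)
    qed
    also have "\<dots> \<le> (A * (K + 1) + 1) * (?h\<^sup>2 + ?\<tau>\<^sup>2)"
      by (simp only: distrib_right[of "A * (K + 1)"] mult.assoc) simp
    finally show "norm (du 0 (real m * ?\<tau>) - U m) \<le> (A * (K + 1) + 1) * (?h\<^sup>2 + ?\<tau>\<^sup>2)"
      by (simp only: nodal_def)
  qed
qed

end
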